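(* Let $\kappa>0$ be a fixed constant independent of $\epsilon$ and of the mesh size. There is a constant $C_2$ (which may depend on $\kappa$ but is independent of $\epsilon$ and of the mesh size) such that the following hold. For any $F\in\mathcal{E}_h^0$ with $h_F\le\kappa\epsilon$, $$(\eta_F^0)^2\le C_2\sum_{T\in\omega_F}\big(\epsilon^{-1}\|\boldsymbol{q}-\boldsymbol{q}_h\|_{0,T}^2+\epsilon\|\nabla(u-u_h)\|_{0,T}^2+\|u-u_h\|_{0,T}^2+osc_h^2(R_h,T)\big).$$ For any $T\in\mathcal{T}_h$ with $h_T\le\kappa\epsilon$, $$\eta_T^2\le C_2\big(\epsilon^{-1}\|\boldsymbol{q}-\boldsymbol{q}_h\|_{0,T}^2+\epsilon\|\nabla(u-u_h)\|_{0,T}^2+\|u-u_h\|_{0,T}^2+osc_h^2(R_h,T)\big).$$ Here $\omega_F$ is the union of the elements of $\mathcal{T}_h$ sharing the common face $F$ (the sum is over these elements), and $osc_h^2(R_h,T):=\alpha_T^2\|R_h-P_WR_h\|_{0,T}^2$ with $P_W$ the $L^2$-orthogonal projection onto $W_h$.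
   Context: Problem. $\Omega\subset\mathbb{R}^d$ ($d=2,3$) is a bounded polyhedral domain, and $u\in H^1(\Omega)$ is the weak solution of $-\epsilon\Delta u+\boldsymbol{\beta}\cdot\nabla u+cu=f$ in $\Omega$, $u=g$ on $\partial\Omega$. Assumptions: (i) $0<\epsilon\le 1$; (ii) $\boldsymbol{\beta}\in W^{1,\infty}(\Omega)^d$, $c\in L^\infty(\Omega)$, $f\in L^2(\Omega)$, $g\in H^{1/2}(\partial\Omega)$; (iii) $c-\frac12\mathrm{div}\,\boldsymbol{\beta}\ge0$; (iv) there are $\psi\in W^{1,\infty}(\Omega)$ and a constant $b_0>0$ with $\boldsymbol{\beta}\cdot\nabla\psi\ge b_0$. Put $\boldsymbol{q}=-\epsilon\nabla u$, so that $\mathrm{div}\,\boldsymbol{q}+\boldsymbol{\beta}\cdot\nabla u+cu=f$. Mesh. $\mathcal{T}_h$ is a conforming, shape-regular simplicial triangulation of $\Omega$; "faces" are edges if $d=2$ and faces if $d=3$. $\mathcal{E}_h$, $\mathcal{E}_h^0$, $\mathcal{E}_h^\partial$ are the sets of all, interior, and boundary faces; $\partial\mathcal{T}_h=\{\partial T:T\in\mathcal{T}_h\}$; $h_T$, $h_F$ are the diameters of $T$, $F$; $\boldsymbol{n}$ is the outward unit normal on $\partial T$. $(\eta,\zeta)_{\mathcal{T}_h}=\sum_{T}\int_T\eta\zeta\,dx$, $\langle\eta,\zeta\rangle_{\partial\mathcal{T}_h}=\sum_T\int_{\partial T}\eta\zeta\,ds$. $\|\cdot\|_{0,D}$ is the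 $L^2(D)$ norm. HDG method. Fix $p\ge1$; $\mathcal{P}_p(S)$ is the space of polynomials of total degree at most $p$ on $S$. $\boldsymbol{V}_h=\{\boldsymbol{v}\in L^2(\Omega)^d:\boldsymbol{v}|_T\in\mathcal{P}_p(T)^d\ \forall T\}$, $W_h=\{w\in L^2(\Omega):w|_T\in\mathcal{P}_p(T)\ \forall T\}$, $M_h=\{\mu\in L^2(\mathcal{E}_h):\mu|_F\in\mathcal{P}_p(F)\ \forall F\in\mathcal{E}_h\}$. $(\boldsymbol{q}_h,u_h,\widehat u_h)\in\boldsymbol{V}_h\times W_h\times M_h$ is the unique solution of, for all $(\boldsymbol{r},w,\mu)\in\boldsymbol{V}_h\times W_h\times M_h$, $(\epsilon^{-1}\boldsymbol{q}_h,\boldsymbol{r})_{\mathcal{T}_h}-(u_h,\mathrm{div}\,\boldsymbol{r})_{\mathcal{T}_h}+\langle\widehat u_h,\boldsymbol{r}\cdot\boldsymbol{n}\rangle_{\partial\mathcal{T}_h}=0$; $-(\boldsymbol{q}_h+\boldsymbol{\beta}u_h,\nabla w)_{\mathcal{T}_h}+((c-\mathrm{div}\,\boldsymbol{\beta})u_h,w)_{\mathcal{T}_h}+\langle(\widehat{\boldsymbol{q}}_h+\widehat{\boldsymbol{\beta}u_h})\cdot\boldsymbol{n},w\rangle_{\partial\mathcal{T}_h}=(f,w)_{\mathcal{T}_h}$; $\langle\widehat u_h,\mu\rangle_{\partial\Omega}=\langle g,\mu\rangle_{\partial\Omega}$; $\langle(\widehat{\boldsymbol{q}}_h+\widehat{\boldsymbol{\beta}u_h})\cdot\boldsymbol{n},\mu\rangle_{\partial\mathcal{T}_h\setminus\partial\Omega}=0$;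 where on $\partial\mathcal{T}_h$, $(\widehat{\boldsymbol{q}}_h+\widehat{\boldsymbol{\beta}u_h})\cdot\boldsymbol{n}=\boldsymbol{q}_h\cdot\boldsymbol{n}+(\boldsymbol{\beta}\cdot\boldsymbol{n})\widehat u_h+\tau(u_h-\widehat u_h)$, and, for $T\in\mathcal{T}_h$ and each face $F$ of $T$, $\tau|_F=\max(\sup_{x\in F}\boldsymbol{\beta}(x)\cdot\boldsymbol{n},0)+\min(\rho_0\epsilon/h_T,1)$ with a fixed $0<\rho_0\le1$. Estimator. $R_h|_T=f-\mathrm{div}\,\boldsymbol{q}_h-\boldsymbol{\beta}\cdot\nabla u_h-cu_h$ for $T\in\mathcal{T}_h$; $\alpha_S=\min\{h_S\epsilon^{-1/2},1\}$ for $S$ an element or a face; for $F\in\mathcal{E}_h$, $$\gamma_F=\min\Big\{\frac{\epsilon}{h_F}+\Big(\frac{h_F}{\epsilon}+\epsilon^{-1/2}\alpha_F\Big)\|\boldsymbol{\beta}\|_{L^\infty(F)}+h_F,\ \frac{\epsilon+\|\boldsymbol{\beta}\|_{L^\infty(F)}}{h_F}+h_F\Big\}.$$ On an interior face $F=\partial T^+\cap\partial T^-$ the jumps are $[[\phi]]=\phi^+-\phi^-$ and $[[\boldsymbol{\sigma}\cdot\boldsymbol{n}]]=\boldsymbol{\sigma}^+\cdot\boldsymbol{n}^++\boldsymbol{\sigma}^-\cdot\boldsymbol{n}^-$. Then $\eta_T^2=\alpha_T^2\|R_h\|_{0,T}^2+\epsilon^{-1}\|\boldsymbol{q}_h+\epsilon\nabla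 u_h\|_{0,T}^2$ for $T\in\mathcal{T}_h$; $(\eta_F^0)^2=\epsilon^{-1/2}\alpha_F\|[[\boldsymbol{q}_h\cdot\boldsymbol{n}]]\|_{0,F}^2+\gamma_F\|[[u_h]]\|_{0,F}^2$ for $F\in\mathcal{E}_h^0$. Constants "independent of $\epsilon$ and the mesh size" may depend only on $d$, $\Omega$, $p$, $\rho_0$, the shape-regularity of the mesh, $\boldsymbol{\beta}$, $c$, $\psi$, $b_0$ (not on $f$, $g$), and here on $\kappa$. *)

theory Defs
  imports "HOL-Analysis.Analysis"
begin

section \<open>Surface measure\<close>

definition hyperplanes :: "(real^'n) set set" where
  "hyperplanes = {{x. a \<bullet> x = b} | a b. a \<noteq> 0}"

text \<open>
  On one hyperplane \<open>H\<close> the \<open>(d-1)\<close>-dimensional Lebesgue measure of \<open>A\<close> is the volume of the part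
  of the slab of thickness 1 around \<open>H\<close> that projects orthogonally into \<open>A\<close>.  Summing over all
  hyperplanes gives a measure that agrees with the surface (Hausdorff) measure on every set covered
  by finitely many hyperplanes, such as a face of a simplex or the boundary of a polyhedron: distinct
  hyperplanes meet in null sets, see the lemma \<open>emeasure_surface_hyperplane\<close> below.
\<close>

definition hyperplane_content :: "(real^'n) set \<Rightarrow> (real^'n) set \<Rightarrow> ennreal" where
  "hyperplane_content H A = emeasure lborel {x. infdist x H \<le> 1/2 \<and> closest_point H x \<in> A}"

definition surface_measure :: "(real^'n) measure" where
  "surface_measure = measure_of UNIV (sets borel)
     (\<lambda>A. \<integral>\<^sup>+ H. hyperplane_content H A \<partial>count_space hyperplanes)"

lemma sets_surface_measure [simp, measurable_cong]: "sets surface_measure = sets borel"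
  unfolding surface_measure_def
  by (metis sets.sets_measure_of_eq space_borel)

lemma space_surface_measure [simp]: "space surface_measure = UNIV"
  unfolding surface_measure_def by simp

lemma hyperplane_basic:
  assumes "H \<in> hyperplanes"
  shows "convex H" "closed H" "H \<noteq> {}"
proof -
  obtain a b where H: "H = {x. a \<bullet> x = b}" and a: "a \<noteq> 0"
    using assms by (auto simp: hyperplanes_def)
  show "convex H" "closed H" unfolding H by (auto simp: convex_hyperplane closed_hyperplane)
  have "(b / (a \<bullet> a)) *\<^sub>R a \<in> H" unfolding H using a by simp
  then show "H \<noteq> {}" by blast
qed

lemma hyperplane_slab_measurable:
  assumes "H \<in> hyperplanes" "A \<in> sets borel"
  shows "{x. infdist x H \<le> 1/2 \<and> closest_point H x \<in> A} \<in> sets borel"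
proof -
  have 1: "closest_point H \<in> borel_measurable borel"
    by (rule borel_measurable_continuous_onI)
       (use hyperplane_basic[OF assms(1)] in \<open>intro continuous_on_closest_point\<close>)
  have 2: "closed {x. infdist x H \<le> 1/2}"
    by (intro closed_Collect_le continuous_intros)
  have "{x. infdist x H \<le> 1/2} \<inter> (closest_point H -` A \<inter> space borel) \<in> sets borel"
    using borel_closed[OF 2] measurable_sets[OF 1 assms(2)] by auto
  moreover have "{x. infdist x H \<le> 1/2 \<and> closest_point H x \<in> A}
      = {x. infdist x H \<le> 1/2} \<inter> (closest_point H -` A \<inter> space borel)" by auto
  ultimately show ?thesis by simp
qed

lemma emeasure_surface_measure:
  assumes "A \<in> sets borel"
  shows "emeasure surface_measure A
    = (\<integral>\<^sup>+ H. hyperplane_content H A \<partial>count_space hyperplanes)"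
proof -
  have "countably_additive (sets borel)
      (\<lambda>A. \<integral>\<^sup>+ H. hyperplane_content H A \<partial>count_space hyperplanes)"
  proof (rule countably_additiveI)
    fix A :: "nat \<Rightarrow> (real^'n) set"
    assume A: "range A \<subseteq> sets borel" "disjoint_family A" "(\<Union>i. A i) \<in> sets borel"
    have "(\<Sum>i. hyperplane_content H (A i)) = hyperplane_content H (\<Union>i. A i)"
      if H: "H \<in> hyperplanes" for H
    proof -
      let ?S = "\<lambda>A. {x. infdist x H \<le> 1/2 \<and> closest_point H x \<in> A}"
      have "range (\<lambda>i. ?S (A i)) \<subseteq> sets lborel"
        using A(1) hyperplane_slab_measurable[OF H] by auto
      moreover have "disjoint_family (\<lambda>i. ?S (A i))"
        using A(2) unfolding disjoint_family_on_def by blast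
      ultimately have "(\<Sum>i. emeasure lborel (?S (A i))) = emeasure lborel (\<Union>i. ?S (A i))"
        by (rule suminf_emeasure)
      also have "(\<Union>i. ?S (A i)) = ?S (\<Union>i. A i)" by auto
      finally show ?thesis unfolding hyperplane_content_def .
    qed
    then have "(\<integral>\<^sup>+ H. hyperplane_content H (\<Union>i. A i) \<partial>count_space hyperplanes)
        = (\<integral>\<^sup>+ H. (\<Sum>i. hyperplane_content H (A i)) \<partial>count_space hyperplanes)"
      by (intro nn_integral_cong) auto
    then show "(\<Sum>i. \<integral>\<^sup>+ H. hyperplane_content H (A i) \<partial>count_space hyperplanes)
        = (\<integral>\<^sup>+ H. hyperplane_content H (\<Union>i. A i) \<partial>count_space hyperplanes)"
      by (simp add: nn_integral_suminf)
  qed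
  moreover have "positive (sets borel)
      (\<lambda>A. \<integral>\<^sup>+ H. hyperplane_content H A \<partial>count_space (hyperplanes :: (real^'n) set set))"
    by (auto simp: positive_def hyperplane_content_def)
  ultimately show ?thesis
    using assms sets.sigma_algebra_axioms[of borel]
    unfolding surface_measure_def
    by (intro emeasure_measure_of_sigma) (auto simp: space_borel)
qed

lemma closest_point_hyperplane:
  fixes a :: "real^'n"
  assumes "a \<noteq> 0"
  shows "closest_point {x. a \<bullet> x = b} x = x - ((a \<bullet> x - b) / (a \<bullet> a)) *\<^sub>R a"
proof -
  let ?H = "{x. a \<bullet> x = b}" and ?p = "x - ((a \<bullet> x - b) / (a \<bullet> a)) *\<^sub>R a"
  have "?H \<in> hyperplanes" using assms by (auto simp: hyperplanes_def)
  note b = hyperplane_basic[OF this]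
  have p: "?p \<in> ?H" using assms by (simp add: inner_diff_right)
  have "dist x ?p \<le> dist x z" if "z \<in> ?H" for z
  proof -
    have az: "a \<bullet> z = b" using that by simp
    have "\<bar>a \<bullet> (x - z)\<bar> \<le> norm a * norm (x - z)" by (rule Cauchy_Schwarz_ineq2)
    then have "\<bar>a \<bullet> x - b\<bar> / norm a \<le> norm (x - z)"
      using assms az by (simp add: inner_diff_right field_simps)
    moreover have "dist x ?p = \<bar>a \<bullet> x - b\<bar> / norm a"
      using assms by (simp add: dist_norm dot_square_norm power2_eq_square)
    ultimately show ?thesis by (simp add: dist_norm)
  qed
  then show ?thesis
    using closest_point_unique[OF b(1,2) p] by auto
qed

lemma hyperplane_content_other:
  assumes "H \<in> hyperplanes" "H' \<in> hyperplanes" "H \<noteq> H'" "A \<subseteq> H'"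
  shows "hyperplane_content H A = 0"
proof -
  obtain a b where H: "H = {x. a \<bullet> x = b}" and a: "a \<noteq> 0"
    using assms by (auto simp: hyperplanes_def)
  obtain a' b' where H': "H' = {x. a' \<bullet> x = b'}" and a': "a' \<noteq> 0"
    using assms by (auto simp: hyperplanes_def)
  define k where "k = (a \<bullet> a') / (a \<bullet> a)"
  let ?S = "{x. infdist x H \<le> 1/2 \<and> closest_point H x \<in> A}"
  have sub: "?S \<subseteq> {x. (a' - k *\<^sub>R a) \<bullet> x = b' - k * b}"
  proof
    fix x assume "x \<in> ?S"
    then have "closest_point H x \<in> H'" using assms(4) by auto
    then have "a' \<bullet> x - ((a \<bullet> x - b) / (a \<bullet> a)) * (a' \<bullet> a) = b'"
      unfolding H closest_point_hyperplane[OF a] H' by (simp add: inner_diff_right)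
    moreover have "((a \<bullet> x - b) / (a \<bullet> a)) * (a' \<bullet> a) = k * (a \<bullet> x - b)"
      by (simp add: k_def inner_commute)
    ultimately have "a' \<bullet> x - k * (a \<bullet> x - b) = b'" by simp
    then show "x \<in> {x. (a' - k *\<^sub>R a) \<bullet> x = b' - k * b}"
      by (simp add: inner_diff_left algebra_simps)
  qed
  have "negligible ?S"
  proof (cases "a' - k *\<^sub>R a = 0")
    case False
    then have "negligible {x. (a' - k *\<^sub>R a) \<bullet> x = b' - k * b}"
      by (intro negligible_hyperplane) auto
    then show ?thesis by (rule negligible_subset) (rule sub)
  next
    case True
    then have ak: "a' = k *\<^sub>R a" and k: "k \<noteq> 0" using a' by auto
    have "?S = {}"
    proof (rule ccontr)
      assume "?S \<noteq> {}"
      then obtain x where "x \<in> ?S" by blast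
      then have "x \<in> {x. (a' - k *\<^sub>R a) \<bullet> x = b' - k * b}" using sub by blast
      then have "b' = k * b" unfolding True by (simp split: if_splits)
      then have "H = H'" using k unfolding H H' ak by auto
      then show False using assms(3) by simp
    qed
    then show ?thesis by (simp only: negligible_empty)
  qed
  then have "?S \<in> null_sets lebesgue" by (simp add: negligible_iff_null_sets)
  then have "emeasure lborel ?S = 0"
    by (cases "?S \<in> sets lborel") (auto dest: null_setsD1 simp: emeasure_notin_sets null_sets_completion_iff)
  then show ?thesis by (simp add: hyperplane_content_def)
qed

lemma emeasure_surface_hyperplane:
  fixes A :: "(real^'n) set"
  assumes H: "H \<in> hyperplanes" and A: "A \<in> sets borel" "A \<subseteq> H"
  shows "emeasure surface_measure A = hyperplane_content H A"
proof -
  have "emeasure surface_measure A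
      = (\<integral>\<^sup>+ H'. hyperplane_content H' A \<partial>count_space hyperplanes)"
    by (rule emeasure_surface_measure[OF A(1)])
  also have "\<dots> = (\<integral>\<^sup>+ H'. hyperplane_content H A * indicator {H} H' \<partial>count_space hyperplanes)"
  proof (rule nn_integral_cong)
    fix H' :: "(real^'n) set" assume "H' \<in> space (count_space hyperplanes)"
    then have "H' \<in> hyperplanes" by simp
    then show "hyperplane_content H' A = hyperplane_content H A * indicator {H} H'"
      using hyperplane_content_other[OF _ H _ A(2), of H'] by (cases "H' = H") auto
  qed
  also have "\<dots> = hyperplane_content H A"
    using H by (subst nn_integral_cmult_indicator) auto
  finally show ?thesis .
qed


section \<open>Function spaces\<close>

definition grad :: "(real^'n \<Rightarrow> real) \<Rightarrow> real^'n \<Rightarrow> real^'n" where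
  "grad f x = (\<chi> i. frechet_derivative f (at x) (axis i 1))"

definition divg :: "(real^'n \<Rightarrow> real^'n) \<Rightarrow> real^'n \<Rightarrow> real" where
  "divg v x = (\<Sum>i\<in>UNIV. frechet_derivative v (at x) (axis i 1) $ i)"

text \<open>\<open>L2_norm M D\<close> is used with \<open>M = lebesgue\<close> on elements and \<open>M = surface_measure\<close> on faces.\<close>

definition L2_norm :: "(real^'n) measure \<Rightarrow> (real^'n) set \<Rightarrow>
    (real^'n \<Rightarrow> 'b::euclidean_space) \<Rightarrow> real" where
  "L2_norm M D f = sqrt (LINT x:D|M. (norm (f x))\<^sup>2)"

definition L2 :: "(real^'n) measure \<Rightarrow> (real^'n) set \<Rightarrow>
    (real^'n \<Rightarrow> 'b::euclidean_space) \<Rightarrow> bool" where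
  "L2 M D f \<longleftrightarrow> set_borel_measurable M D f \<and> set_integrable M D (\<lambda>x. (norm (f x))\<^sup>2)"

definition Linf :: "(real^'n) measure \<Rightarrow> (real^'n) set \<Rightarrow>
    (real^'n \<Rightarrow> 'b::euclidean_space) \<Rightarrow> bool" where
  "Linf M D f \<longleftrightarrow> set_borel_measurable M D f \<and>
     (\<exists>K. AE x in M. x \<in> D \<longrightarrow> norm (f x) \<le> K)"

definition Linf_norm :: "(real^'n) measure \<Rightarrow> (real^'n) set \<Rightarrow>
    (real^'n \<Rightarrow> 'b::euclidean_space) \<Rightarrow> real" where
  "Linf_norm M D f = Inf {K. 0 \<le> K \<and> (AE x in M. x \<in> D \<longrightarrow> norm (f x) \<le> K)}"

text \<open>\<open>C\<^sup>\<infinity>\<close>: here \<open>D [i\<^sub>1, \<dots>, i\<^sub>k]\<close> is the corresponding iterated partial derivative.\<close>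

definition smooth :: "(real^'n \<Rightarrow> real) \<Rightarrow> bool" where
  "smooth f \<longleftrightarrow> (\<exists>D :: 'n list \<Rightarrow> real^'n \<Rightarrow> real. D [] = f \<and>
     (\<forall>is x. (D is has_derivative (\<lambda>h. \<Sum>i\<in>UNIV. h $ i * D (i # is) x)) (at x)))"

definition test_function :: "(real^'n) set \<Rightarrow> (real^'n \<Rightarrow> real) \<Rightarrow> bool" where
  "test_function \<Omega> \<phi> \<longleftrightarrow> smooth \<phi> \<and> (\<exists>K. compact K \<and> K \<subseteq> \<Omega> \<and> (\<forall>x. x \<notin> K \<longrightarrow> \<phi> x = 0))"

definition weak_gradient :: "(real^'n) set \<Rightarrow> (real^'n \<Rightarrow> real) \<Rightarrow> (real^'n \<Rightarrow> real^'n) \<Rightarrow> bool" where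
  "weak_gradient \<Omega> u Du \<longleftrightarrow> (\<forall>\<phi>. test_function \<Omega> \<phi> \<longrightarrow>
     (LINT x:\<Omega>|lebesgue. u x *\<^sub>R grad \<phi> x) = - (LINT x:\<Omega>|lebesgue. \<phi> x *\<^sub>R Du x))"

text \<open>
  The Sobolev spaces are given as relations between a function and its weak gradient, which is unique
  up to null sets: \<open>in_H1 \<Omega> u Du\<close> says that \<open>u \<in> H\<^sup>1(\<Omega>)\<close> and \<open>\<nabla>u = Du\<close>.
\<close>

definition in_H1 :: "(real^'n) set \<Rightarrow> (real^'n \<Rightarrow> real) \<Rightarrow> (real^'n \<Rightarrow> real^'n) \<Rightarrow> bool" where
  "in_H1 \<Omega> u Du \<longleftrightarrow> L2 lebesgue \<Omega> u \<and> L2 lebesgue \<Omega> Du \<and> weak_gradient \<Omega> u Du"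

definition in_W1inf :: "(real^'n) set \<Rightarrow> (real^'n \<Rightarrow> real) \<Rightarrow> (real^'n \<Rightarrow> real^'n) \<Rightarrow> bool" where
  "in_W1inf \<Omega> u Du \<longleftrightarrow> Linf lebesgue \<Omega> u \<and> Linf lebesgue \<Omega> Du \<and> weak_gradient \<Omega> u Du"

text \<open>
  Vector fields, with weak Jacobian \<open>Db\<close> (row \<open>i\<close> is the gradient of component \<open>i\<close>), so that the
  divergence is \<open>trace (Db x)\<close>.  The representative of the field is the one that is continuous up to
  the boundary; this matters because its values on faces are used.
\<close>

definition in_W1inf_vec :: "(real^'n) set \<Rightarrow> (real^'n \<Rightarrow> real^'n) \<Rightarrow> (real^'n \<Rightarrow> real^'n^'n) \<Rightarrow> bool" where
  "in_W1inf_vec \<Omega> b Db \<longleftrightarrow> continuous_on (closure \<Omega>) b \<and>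
     (\<forall>i. in_W1inf \<Omega> (\<lambda>x. b x $ i) (\<lambda>x. Db x $ i))"

definition in_H10 :: "(real^'n) set \<Rightarrow> (real^'n \<Rightarrow> real) \<Rightarrow> (real^'n \<Rightarrow> real^'n) \<Rightarrow> bool" where
  "in_H10 \<Omega> v Dv \<longleftrightarrow> in_H1 \<Omega> v Dv \<and>
     (\<exists>\<phi> :: nat \<Rightarrow> real^'n \<Rightarrow> real. (\<forall>k. test_function \<Omega> (\<phi> k)) \<and>
        (\<lambda>k. L2_norm lebesgue \<Omega> (\<lambda>x. \<phi> k x - v x)) \<longlonglongrightarrow> 0 \<and>
        (\<lambda>k. L2_norm lebesgue \<Omega> (\<lambda>x. grad (\<phi> k) x - Dv x)) \<longlonglongrightarrow> 0)"

text \<open>\<open>H\<^bsup>1/2\<^esup>(\<partial>\<Omega>)\<close> via the Sobolev--Slobodeckij seminorm; \<open>d = (d - 1) + 2 \<cdot> 1/2\<close> is the exponent.\<close>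

definition in_Hhalf :: "(real^'n) set \<Rightarrow> (real^'n \<Rightarrow> real) \<Rightarrow> bool" where
  "in_Hhalf \<Omega> g \<longleftrightarrow> L2 surface_measure (frontier \<Omega>) g \<and>
     (\<integral>\<^sup>+ x. \<integral>\<^sup>+ y. ennreal ((g x - g y)\<^sup>2 / dist x y ^ CARD('n))
        \<partial>restrict_space surface_measure (frontier \<Omega>)
        \<partial>restrict_space surface_measure (frontier \<Omega>)) < \<infinity>"

text \<open>The trace operator is the continuous extension of restriction from smooth functions.\<close>

definition has_trace :: "(real^'n) set \<Rightarrow> (real^'n \<Rightarrow> real) \<Rightarrow> (real^'n \<Rightarrow> real^'n) \<Rightarrow>
    (real^'n \<Rightarrow> real) \<Rightarrow> bool" where
  "has_trace \<Omega> u Du g \<longleftrightarrow> L2 surface_measure (frontier \<Omega>) g \<and>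
     (\<exists>\<phi> :: nat \<Rightarrow> real^'n \<Rightarrow> real. (\<forall>k. smooth (\<phi> k)) \<and>
        (\<lambda>k. L2_norm lebesgue \<Omega> (\<lambda>x. \<phi> k x - u x)) \<longlonglongrightarrow> 0 \<and>
        (\<lambda>k. L2_norm lebesgue \<Omega> (\<lambda>x. grad (\<phi> k) x - Du x)) \<longlonglongrightarrow> 0 \<and>
        (\<lambda>k. L2_norm surface_measure (frontier \<Omega>) (\<lambda>x. \<phi> k x - g x)) \<longlonglongrightarrow> 0)"

definition weak_solution :: "(real^'n) set \<Rightarrow> real \<Rightarrow> (real^'n \<Rightarrow> real^'n) \<Rightarrow> (real^'n \<Rightarrow> real) \<Rightarrow>
    (real^'n \<Rightarrow> real) \<Rightarrow> (real^'n \<Rightarrow> real) \<Rightarrow> (real^'n \<Rightarrow> real) \<Rightarrow> (real^'n \<Rightarrow> real^'n) \<Rightarrow> bool" where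
  "weak_solution \<Omega> \<epsilon> b c f g u Du \<longleftrightarrow> in_H1 \<Omega> u Du \<and> has_trace \<Omega> u Du g \<and>
     (\<forall>v Dv. in_H10 \<Omega> v Dv \<longrightarrow>
        (LINT x:\<Omega>|lebesgue. \<epsilon> * (Du x \<bullet> Dv x) + (b x \<bullet> Du x) * v x + c x * u x * v x)
        = (LINT x:\<Omega>|lebesgue. f x * v x))"


section \<open>Domain and mesh\<close>

text \<open>The condition \<open>interior (closure \<Omega>) = \<Omega>\<close> excludes slits.\<close>

definition polyhedral_domain :: "(real^'n) set \<Rightarrow> bool" where
  "polyhedral_domain \<Omega> \<longleftrightarrow> open \<Omega> \<and> connected \<Omega> \<and> bounded \<Omega> \<and> \<Omega> \<noteq> {} \<and>
     interior (closure \<Omega>) = \<Omega> \<and>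
     (\<exists>\<P>. finite \<P> \<and> (\<forall>K\<in>\<P>. polytope K) \<and> closure \<Omega> = \<Union>\<P>)"

text \<open>Conformity is part of the library notion of a triangulation.\<close>

definition mesh :: "(real^'n) set \<Rightarrow> (real^'n) set set \<Rightarrow> bool" where
  "mesh \<Omega> \<T> \<longleftrightarrow> triangulation \<T> \<and> (\<forall>T\<in>\<T>. int CARD('n) simplex T) \<and> \<Union>\<T> = closure \<Omega>"

definition inball_diameter :: "(real^'n) set \<Rightarrow> real" where
  "inball_diameter T = Sup {2 * r | r. 0 \<le> r \<and> (\<exists>x. cball x r \<subseteq> T)}"

definition shape_regular :: "real \<Rightarrow> (real^'n) set set \<Rightarrow> bool" where
  "shape_regular \<sigma> \<T> \<longleftrightarrow> (\<forall>T\<in>\<T>. diameter T \<le> \<sigma> * inball_diameter T)"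

definition faces :: "(real^'n) set set \<Rightarrow> (real^'n) set set" where
  "faces \<T> = {F. \<exists>T\<in>\<T>. F facet_of T}"

definition interior_faces :: "(real^'n) set set \<Rightarrow> (real^'n) set set" where
  "interior_faces \<T> = {F. \<exists>T\<in>\<T>. \<exists>T'\<in>\<T>. T \<noteq> T' \<and> F facet_of T \<and> F facet_of T'}"

definition boundary_faces :: "(real^'n) set set \<Rightarrow> (real^'n) set set" where
  "boundary_faces \<T> = faces \<T> - interior_faces \<T>"

definition face_patch :: "(real^'n) set set \<Rightarrow> (real^'n) set \<Rightarrow> (real^'n) set set" where
  "face_patch \<T> F = {T\<in>\<T>. F facet_of T}"

definition outer_normal :: "(real^'n) set \<Rightarrow> (real^'n) set \<Rightarrow> real^'n" where
  "outer_normal T F = (THE n. norm n = 1 \<and>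
     (\<exists>a. T \<subseteq> {x. n \<bullet> x \<le> a} \<and> F = T \<inter> {x. n \<bullet> x = a}))"


section \<open>Discrete spaces\<close>

text \<open>Multi-indices are functions \<open>'n \<Rightarrow> nat\<close>.\<close>

definition polys :: "nat \<Rightarrow> (real^'n \<Rightarrow> real) set" where
  "polys p = {f. \<exists>a. f = (\<lambda>x. \<Sum>\<alpha> | (\<Sum>i\<in>UNIV. \<alpha> i) \<le> p. a \<alpha> * (\<Prod>i\<in>UNIV. x $ i ^ \<alpha> i))}"

lemma finite_multi_indices: "finite {\<alpha> :: 'n::finite \<Rightarrow> nat. (\<Sum>i\<in>UNIV. \<alpha> i) \<le> p}"
proof (rule finite_subset)
  show "{\<alpha> :: 'n \<Rightarrow> nat. (\<Sum>i\<in>UNIV. \<alpha> i) \<le> p} \<subseteq> PiE UNIV (\<lambda>_. {..p})"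
  proof
    fix \<alpha> :: "'n \<Rightarrow> nat" assume "\<alpha> \<in> {\<alpha>. (\<Sum>i\<in>UNIV. \<alpha> i) \<le> p}"
    moreover have "\<alpha> i \<le> (\<Sum>i\<in>UNIV. \<alpha> i)" for i by (rule member_le_sum) auto
    ultimately show "\<alpha> \<in> PiE UNIV (\<lambda>_. {..p})" by (auto intro: le_trans)
  qed
qed (intro finite_PiE, auto)

text \<open>
  A function that is polynomial on each element is encoded as a family of polynomials indexed by the
  elements, so that its (generally two-valued) restrictions to faces are available.  Likewise a
  function on the skeleton is a family indexed by the faces.  Only the values of \<open>w T\<close> on \<open>T\<close> and
  of \<open>m F\<close> on \<open>F\<close> are ever used.
\<close>

definition V_h :: "nat \<Rightarrow> (real^'n) set set \<Rightarrow> ((real^'n) set \<Rightarrow> real^'n \<Rightarrow> real^'n) set" where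
  "V_h p \<T> = {v. \<forall>T\<in>\<T>. \<forall>i. (\<lambda>x. v T x $ i) \<in> polys p}"

definition W_h :: "nat \<Rightarrow> (real^'n) set set \<Rightarrow> ((real^'n) set \<Rightarrow> real^'n \<Rightarrow> real) set" where
  "W_h p \<T> = {w. \<forall>T\<in>\<T>. w T \<in> polys p}"

definition M_h :: "nat \<Rightarrow> (real^'n) set set \<Rightarrow> ((real^'n) set \<Rightarrow> real^'n \<Rightarrow> real) set" where
  "M_h p \<T> = {m. \<forall>F\<in>faces \<T>. m F \<in> polys p}"

definition vol_ip :: "(real^'n) set set \<Rightarrow> ((real^'n) set \<Rightarrow> real^'n \<Rightarrow> 'b::euclidean_space) \<Rightarrow>
    ((real^'n) set \<Rightarrow> real^'n \<Rightarrow> 'b) \<Rightarrow> real" where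
  "vol_ip \<T> v w = (\<Sum>T\<in>\<T>. LINT x:T|lebesgue. v T x \<bullet> w T x)"

text \<open>Integrands on the element boundaries depend on the element and on the face.\<close>

definition bdry_ip :: "(real^'n) set set \<Rightarrow> ((real^'n) set \<Rightarrow> (real^'n) set \<Rightarrow> real^'n \<Rightarrow> real) \<Rightarrow>
    ((real^'n) set \<Rightarrow> (real^'n) set \<Rightarrow> real^'n \<Rightarrow> real) \<Rightarrow> real" where
  "bdry_ip \<T> v w =
     (\<Sum>T\<in>\<T>. \<Sum>F | F facet_of T. LINT x:F|surface_measure. v T F x * w T F x)"

definition interior_bdry_ip :: "(real^'n) set set \<Rightarrow>
    ((real^'n) set \<Rightarrow> (real^'n) set \<Rightarrow> real^'n \<Rightarrow> real) \<Rightarrow>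
    ((real^'n) set \<Rightarrow> (real^'n) set \<Rightarrow> real^'n \<Rightarrow> real) \<Rightarrow> real" where
  "interior_bdry_ip \<T> v w =
     (\<Sum>T\<in>\<T>. \<Sum>F | F facet_of T \<and> F \<in> interior_faces \<T>.
        LINT x:F|surface_measure. v T F x * w T F x)"


section \<open>The HDG method\<close>

definition stab :: "real \<Rightarrow> real \<Rightarrow> (real^'n \<Rightarrow> real^'n) \<Rightarrow> (real^'n) set \<Rightarrow> (real^'n) set \<Rightarrow> real" where
  "stab \<rho>0 \<epsilon> b T F =
     max (SUP x\<in>F. b x \<bullet> outer_normal T F) 0 + min (\<rho>0 * \<epsilon> / diameter T) 1"

definition num_flux :: "real \<Rightarrow> real \<Rightarrow> (real^'n \<Rightarrow> real^'n) \<Rightarrow>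
    ((real^'n) set \<Rightarrow> real^'n \<Rightarrow> real^'n) \<Rightarrow> ((real^'n) set \<Rightarrow> real^'n \<Rightarrow> real) \<Rightarrow>
    ((real^'n) set \<Rightarrow> real^'n \<Rightarrow> real) \<Rightarrow> (real^'n) set \<Rightarrow> (real^'n) set \<Rightarrow> real^'n \<Rightarrow> real" where
  "num_flux \<rho>0 \<epsilon> b qh uh uhat T F x =
     qh T x \<bullet> outer_normal T F + (b x \<bullet> outer_normal T F) * uhat F x
     + stab \<rho>0 \<epsilon> b T F * (uh T x - uhat F x)"

definition HDG_solution :: "nat \<Rightarrow> real \<Rightarrow> (real^'n) set set \<Rightarrow> real \<Rightarrow>
    (real^'n \<Rightarrow> real^'n) \<Rightarrow> (real^'n \<Rightarrow> real^'n^'n) \<Rightarrow> (real^'n \<Rightarrow> real) \<Rightarrow>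
    (real^'n \<Rightarrow> real) \<Rightarrow> (real^'n \<Rightarrow> real) \<Rightarrow>
    ((real^'n) set \<Rightarrow> real^'n \<Rightarrow> real^'n) \<Rightarrow> ((real^'n) set \<Rightarrow> real^'n \<Rightarrow> real) \<Rightarrow>
    ((real^'n) set \<Rightarrow> real^'n \<Rightarrow> real) \<Rightarrow> bool" where
  "HDG_solution p \<rho>0 \<T> \<epsilon> b Db c f g qh uh uhat \<longleftrightarrow>
     qh \<in> V_h p \<T> \<and> uh \<in> W_h p \<T> \<and> uhat \<in> M_h p \<T> \<and>
     (\<forall>r\<in>V_h p \<T>.
        vol_ip \<T> (\<lambda>T x. (1 / \<epsilon>) *\<^sub>R qh T x) r
        - vol_ip \<T> uh (\<lambda>T. divg (r T))
        + bdry_ip \<T> (\<lambda>T F. uhat F) (\<lambda>T F x. r T x \<bullet> outer_normal T F) = 0) \<and>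
     (\<forall>w\<in>W_h p \<T>.
        - vol_ip \<T> (\<lambda>T x. qh T x + uh T x *\<^sub>R b x) (\<lambda>T. grad (w T))
        + vol_ip \<T> (\<lambda>T x. (c x - trace (Db x)) * uh T x) w
        + bdry_ip \<T> (num_flux \<rho>0 \<epsilon> b qh uh uhat) (\<lambda>T F. w T)
        = vol_ip \<T> (\<lambda>T. f) w) \<and>
     (\<forall>m\<in>M_h p \<T>.
        (\<Sum>F\<in>boundary_faces \<T>. LINT x:F|surface_measure. uhat F x * m F x)
        = (\<Sum>F\<in>boundary_faces \<T>. LINT x:F|surface_measure. g x * m F x)) \<and>
     (\<forall>m\<in>M_h p \<T>. interior_bdry_ip \<T> (num_flux \<rho>0 \<epsilon> b qh uh uhat) (\<lambda>T F. m F) = 0)"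


section \<open>The error estimator\<close>

definition residual :: "(real^'n \<Rightarrow> real^'n) \<Rightarrow> (real^'n \<Rightarrow> real) \<Rightarrow> (real^'n \<Rightarrow> real) \<Rightarrow>
    ((real^'n) set \<Rightarrow> real^'n \<Rightarrow> real^'n) \<Rightarrow> ((real^'n) set \<Rightarrow> real^'n \<Rightarrow> real) \<Rightarrow>
    (real^'n) set \<Rightarrow> real^'n \<Rightarrow> real" where
  "residual b c f qh uh T x = f x - divg (qh T) x - b x \<bullet> grad (uh T) x - c x * uh T x"

definition alpha :: "real \<Rightarrow> (real^'n) set \<Rightarrow> real" where
  "alpha \<epsilon> S = min (diameter S / sqrt \<epsilon>) 1"

definition gamma_face :: "real \<Rightarrow> (real^'n \<Rightarrow> real^'n) \<Rightarrow> (real^'n) set \<Rightarrow> real" where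
  "gamma_face \<epsilon> b F = (let h = diameter F; B = Linf_norm surface_measure F b in
     min (\<epsilon> / h + (h / \<epsilon> + alpha \<epsilon> F / sqrt \<epsilon>) * B + h) ((\<epsilon> + B) / h + h))"

definition eta_elem_sq :: "real \<Rightarrow> (real^'n \<Rightarrow> real^'n) \<Rightarrow> (real^'n \<Rightarrow> real) \<Rightarrow> (real^'n \<Rightarrow> real) \<Rightarrow>
    ((real^'n) set \<Rightarrow> real^'n \<Rightarrow> real^'n) \<Rightarrow> ((real^'n) set \<Rightarrow> real^'n \<Rightarrow> real) \<Rightarrow>
    (real^'n) set \<Rightarrow> real" where
  "eta_elem_sq \<epsilon> b c f qh uh T =
     (alpha \<epsilon> T)\<^sup>2 * (L2_norm lebesgue T (residual b c f qh uh T))\<^sup>2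
     + 1 / \<epsilon> * (L2_norm lebesgue T (\<lambda>x. qh T x + \<epsilon> *\<^sub>R grad (uh T) x))\<^sup>2"

text \<open>\<open>Tp\<close> and \<open>Tm\<close> are the two elements sharing the interior face \<open>F\<close>.\<close>

definition eta_face_sq :: "real \<Rightarrow> (real^'n \<Rightarrow> real^'n) \<Rightarrow>
    ((real^'n) set \<Rightarrow> real^'n \<Rightarrow> real^'n) \<Rightarrow> ((real^'n) set \<Rightarrow> real^'n \<Rightarrow> real) \<Rightarrow>
    (real^'n) set \<Rightarrow> (real^'n) set \<Rightarrow> (real^'n) set \<Rightarrow> real" where
  "eta_face_sq \<epsilon> b qh uh Tp Tm F =
     alpha \<epsilon> F / sqrt \<epsilon> * (L2_norm surface_measure F
         (\<lambda>x. qh Tp x \<bullet> outer_normal Tp F + qh Tm x \<bullet> outer_normal Tm F))\<^sup>2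
     + gamma_face \<epsilon> b F * (L2_norm surface_measure F (\<lambda>x. uh Tp x - uh Tm x))\<^sup>2"

text \<open>The \<open>L\<^sup>2\<close>-projection onto \<open>W_h\<close>, unique on the elements.\<close>

definition P_W :: "nat \<Rightarrow> (real^'n) set set \<Rightarrow> ((real^'n) set \<Rightarrow> real^'n \<Rightarrow> real) \<Rightarrow>
    (real^'n) set \<Rightarrow> real^'n \<Rightarrow> real" where
  "P_W p \<T> R = (SOME P. P \<in> W_h p \<T> \<and> (\<forall>w\<in>W_h p \<T>. vol_ip \<T> P w = vol_ip \<T> R w))"

definition osc_sq :: "nat \<Rightarrow> (real^'n) set set \<Rightarrow> real \<Rightarrow> ((real^'n) set \<Rightarrow> real^'n \<Rightarrow> real) \<Rightarrow>
    (real^'n) set \<Rightarrow> real" where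
  "osc_sq p \<T> \<epsilon> R T = (alpha \<epsilon> T)\<^sup>2 * (L2_norm lebesgue T (\<lambda>x. R T x - P_W p \<T> R T x))\<^sup>2"

text \<open>The right-hand side on one element, where \<open>q = -\<epsilon>\<nabla>u\<close>.\<close>

definition local_error_sq :: "nat \<Rightarrow> (real^'n) set set \<Rightarrow> real \<Rightarrow>
    (real^'n \<Rightarrow> real^'n) \<Rightarrow> (real^'n \<Rightarrow> real) \<Rightarrow> (real^'n \<Rightarrow> real) \<Rightarrow>
    (real^'n \<Rightarrow> real) \<Rightarrow> (real^'n \<Rightarrow> real^'n) \<Rightarrow>
    ((real^'n) set \<Rightarrow> real^'n \<Rightarrow> real^'n) \<Rightarrow> ((real^'n) set \<Rightarrow> real^'n \<Rightarrow> real) \<Rightarrow>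
    (real^'n) set \<Rightarrow> real" where
  "local_error_sq p \<T> \<epsilon> b c f u Du qh uh T =
     1 / \<epsilon> * (L2_norm lebesgue T (\<lambda>x. - \<epsilon> *\<^sub>R Du x - qh T x))\<^sup>2
     + \<epsilon> * (L2_norm lebesgue T (\<lambda>x. Du x - grad (uh T) x))\<^sup>2
     + (L2_norm lebesgue T (\<lambda>x. u x - uh T x))\<^sup>2
     + osc_sq p \<T> \<epsilon> (residual b c f qh uh) T"

end

theory Submission
  imports Defs
begin

text \<open>
  Each part of the estimator is a residual of a polynomial nature, and a polynomial residual is recovered by
  testing the equation with the residual itself times a bubble.  The classical proof uses polynomial bubbles
  and a reference simplex.  Here the bubble is a smooth function \<open>bump m r\<close> supported in a ball: the ball inscribed
  in an element for the interior residual, a ball around the centre of a face for the jump of the flux.  The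
  product of a polynomial and such a bubble is a test function of the weak formulation, and no reference
  element is needed.  The norm equivalences become statements about polynomials on concentric balls, which follow
  from compactness in the space of coefficients and scale trivially (\<open>coeff_bound\<close>,
  \<open>polys_inverse_estimate\<close>, \<open>bubble_bounds\<close>).  Shape regularity enters only through the ratio between the element and
  the ball.

  \<^emph>\<open>Element residual.\<close>  Let \<open>P\<close> be the projection of \<open>R_h\<close> and \<open>v = P * bump\<close>.  The weak formulation and the divergence
  theorem give \<open>(R_h, v) = (q - q_h, \<nabla>v) + (\<beta>\<cdot>\<nabla>(u - u_h) + c (u - u_h), v)\<close> up to signs, and \<open>\<parallel>\<nabla>v\<parallel>\<close> is at most a multiple of
  \<open>\<parallel>P\<parallel> / h\<close> (\<open>element_residual_estimate\<close>).  The weights fit since \<open>\<alpha>_T / h \<le> 1 / sqrt \<epsilon>\<close>, \<open>\<alpha>_T \<le> 1\<close>, and \<open>h \<le> \<kappa>\<epsilon>\<close> makes \<open>\<alpha>_T \<le> \<kappa> sqrt \<epsilon>\<close>,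
  which pays for the convection term.  The second part of the element estimator is a triangle inequality.

  \<^emph>\<open>Flux jump.\<close>  The same argument on the two elements of a face leaves, after the divergence theorem on each side,
  the integral of the jump times \<open>v\<close> over the face.  The jump is extended off the face by making it constant in
  the normal direction (\<open>face_jump_estimate\<close>).  The divergence theorem is reduced to half-spaces, where the
  difference quotient of the integrand telescopes by translation invariance
  (\<open>half_space_integral_transversal\<close>).

  \<^emph>\<open>Jump of \<open>u_h\<close>.\<close>  Since the numerical trace is single valued, it suffices to bound \<open>u_h - uhat_h\<close> on each side.
  The first equation of the method, integrated by parts over one element, reads
  \<open>\<langle>u_h - uhat_h, \<rho>\<cdot>n\<rangle> = (q_h / \<epsilon> + \<nabla>u_h, \<rho>)\<close> for all polynomial fields \<open>\<rho>\<close> of degree \<open>p\<close>.  There is such a field whose normal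
  component equals \<open>u_h - uhat_h\<close> on the given face and vanishes on all other faces: this is a sum of edge vectors
  \<open>w - v\<close> from the opposite vertex \<open>v\<close>, each multiplied by the barycentric coordinate of \<open>w\<close> and a polynomial of degree
  \<open>p - 1\<close> (\<open>trace_mismatch_estimate\<close>).  So the mismatch is bounded by \<open>\<parallel>q_h + \<epsilon>\<nabla>u_h\<parallel>\<close>, which consists of the errors of \<open>q_h\<close> and \<open>u_h\<close>, and
  for \<open>h \<le> \<kappa>\<epsilon>\<close> the weight \<open>\<gamma>_F\<close> is at most a multiple of \<open>\<epsilon> / h\<close> (\<open>gamma_face_le\<close>).
\<close>

section \<open>Polynomials\<close>

abbreviation midx :: "nat \<Rightarrow> ('n::finite \<Rightarrow> nat) set" where
  "midx p \<equiv> {\<alpha>. (\<Sum>i\<in>UNIV. \<alpha> i) \<le> p}"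

definition monom_fun :: "('n::finite \<Rightarrow> nat) \<Rightarrow> real^'n \<Rightarrow> real" where
  "monom_fun \<alpha> x = (\<Prod>i\<in>UNIV. x $ i ^ \<alpha> i)"

definition poly_of :: "nat \<Rightarrow> (('n::finite \<Rightarrow> nat) \<Rightarrow> real) \<Rightarrow> real^'n \<Rightarrow> real" where
  "poly_of p a x = (\<Sum>\<alpha>\<in>midx p. a \<alpha> * monom_fun \<alpha> x)"

text \<open>
  Multiplication of the monomial with exponent \<open>\<beta>\<close> by the variable \<open>x\<^sub>i\<close>.
\<close>

definition raise :: "'n \<Rightarrow> ('n::finite \<Rightarrow> nat) \<Rightarrow> 'n \<Rightarrow> nat" where
  "raise i \<beta> = \<beta>(i := Suc (\<beta> i))"

lemma polys_eq_range: "polys p = range (poly_of p)"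
  by (auto simp: polys_def poly_of_def[abs_def] monom_fun_def image_iff)

lemma poly_of_in_polys [simp]: "poly_of p a \<in> polys p"
  by (auto simp: polys_eq_range)

lemma polysE: assumes "f \<in> polys p" obtains a where "f = poly_of p a"
  using assms by (auto simp: polys_eq_range)

lemma inj_raise: "inj (raise i)"
proof (rule injI)
  fix \<beta> \<gamma> :: "'a \<Rightarrow> nat" assume eq: "raise i \<beta> = raise i \<gamma>"
  show "\<beta> = \<gamma>"
  proof
    fix j show "\<beta> j = \<gamma> j" using fun_cong[OF eq, of j] by (auto simp: raise_def split: if_splits)
  qed
qed

lemma sum_raise: "(\<Sum>j\<in>UNIV. raise i \<beta> j) = Suc (\<Sum>j\<in>UNIV. \<beta> j)"
proof -
  have "(\<Sum>j\<in>UNIV. raise i \<beta> j) = (\<Sum>j\<in>UNIV. \<beta> j + (if j = i then 1 else 0))"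
    by (rule sum.cong) (auto simp: raise_def)
  then show ?thesis by (simp add: sum.distrib)
qed

lemma raise_surj: assumes "\<alpha> i \<noteq> 0" obtains \<beta> where "\<alpha> = raise i \<beta>"
proof
  show "\<alpha> = raise i (\<alpha>(i := \<alpha> i - 1))" using assms by (auto simp: raise_def)
qed

lemma monom_fun_raise: "monom_fun (raise i \<beta>) x = x $ i * monom_fun \<beta> x"
proof -
  have "monom_fun (raise i \<beta>) x = (\<Prod>j\<in>UNIV. (if j = i then x $ i else 1) * x $ j ^ \<beta> j)"
    unfolding monom_fun_def by (rule prod.cong) (auto simp: raise_def)
  then show ?thesis by (simp add: prod.distrib monom_fun_def)
qed

lemma midx_Suc_image_raise:
  "{\<alpha>\<in>midx (Suc p). \<alpha> i \<noteq> 0} = raise i ` midx p"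
proof
  show "{\<alpha>\<in>midx (Suc p). \<alpha> i \<noteq> 0} \<subseteq> raise i ` midx p"
  proof
    fix \<alpha> assume a: "\<alpha> \<in> {\<alpha>\<in>midx (Suc p). \<alpha> i \<noteq> 0}"
    then obtain \<beta> where "\<alpha> = raise i \<beta>" using raise_surj[of \<alpha> i] by blast
    then show "\<alpha> \<in> raise i ` midx p" using a by (auto simp: sum_raise)
  qed
next
  show "raise i ` midx p \<subseteq> {\<alpha>\<in>midx (Suc p). \<alpha> i \<noteq> 0}"
    by (auto simp: sum_raise) (simp add: raise_def)
qed

lemma sum_over_raise:
  fixes h :: "('n::finite \<Rightarrow> nat) \<Rightarrow> real"
  shows "(\<Sum>\<alpha>\<in>{\<alpha>\<in>midx (Suc p). \<alpha> i \<noteq> 0}. h \<alpha>) = (\<Sum>\<beta>\<in>midx p. h (raise i \<beta>))"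
  unfolding midx_Suc_image_raise
  by (subst sum.reindex) (auto simp: inj_raise inj_on_subset[OF inj_raise])

text \<open>
  Every nonconstant monomial is charged to one variable that occurs in it.  The coefficients charged to \<open>x\<^sub>i\<close>,
  divided by \<open>x\<^sub>i\<close>, form a polynomial of lower degree; this makes polynomials amenable to induction on the degree.
\<close>

definition lower :: "'n \<Rightarrow> (('n::finite \<Rightarrow> nat) \<Rightarrow> real) \<Rightarrow> ('n \<Rightarrow> nat) \<Rightarrow> real" where
  "lower i a \<beta> = (if (SOME j. raise i \<beta> j \<noteq> 0) = i then a (raise i \<beta>) else 0)"

lemma poly_of_Suc:
  "poly_of (Suc p) a x = a (\<lambda>_. 0) + (\<Sum>i\<in>UNIV. x $ i * poly_of p (lower i a) x)"
proof -
  define pick where "pick \<alpha> = (SOME j. \<alpha> j \<noteq> 0)" for \<alpha> :: "'a \<Rightarrow> nat"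
  let ?S = "midx (Suc p) - {\<lambda>_. 0} :: ('a \<Rightarrow> nat) set"
  let ?h = "\<lambda>\<alpha>. a \<alpha> * monom_fun \<alpha> x"
  have pick: "\<alpha> (pick \<alpha>) \<noteq> 0" if "\<alpha> \<noteq> (\<lambda>_. 0)" for \<alpha>
    unfolding pick_def by (rule someI_ex) (use that in auto)
  have fin: "finite (midx (Suc p) :: ('a \<Rightarrow> nat) set)" by (rule finite_multi_indices)
  have "poly_of (Suc p) a x = ?h (\<lambda>_. 0) + (\<Sum>\<alpha>\<in>?S. ?h \<alpha>)"
    unfolding poly_of_def by (rule sum.remove) (use fin in auto)
  moreover have "?h (\<lambda>_. 0) = a (\<lambda>_. 0)" by (simp add: monom_fun_def)
  moreover have "(\<Sum>\<alpha>\<in>?S. ?h \<alpha>) = (\<Sum>i\<in>UNIV. \<Sum>\<alpha>\<in>{\<alpha>\<in>?S. pick \<alpha> = i}. ?h \<alpha>)"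
    by (rule sum.group[symmetric]) (use fin in auto)
  moreover have "(\<Sum>\<alpha>\<in>{\<alpha>\<in>?S. pick \<alpha> = i}. ?h \<alpha>) = x $ i * poly_of p (lower i a) x" for i
  proof -
    have "(\<Sum>\<alpha>\<in>{\<alpha>\<in>?S. pick \<alpha> = i}. ?h \<alpha>)
        = (\<Sum>\<alpha>\<in>{\<alpha>\<in>midx (Suc p). \<alpha> i \<noteq> 0}. if pick \<alpha> = i then ?h \<alpha> else 0)"
      by (rule sum.mono_neutral_cong_left) (use fin pick in auto)
    also have "\<dots> = (\<Sum>\<beta>\<in>midx p. x $ i * (lower i a \<beta> * monom_fun \<beta> x))"
      unfolding sum_over_raise
      by (rule sum.cong) (auto simp: lower_def pick_def monom_fun_raise)
    finally show ?thesis by (simp add: poly_of_def sum_distrib_left)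
  qed
  ultimately show ?thesis by simp
qed

lemma poly_of_0: "poly_of 0 a x = a (\<lambda>_. 0)"
proof -
  have 0: "(midx 0 :: ('a \<Rightarrow> nat) set) = {\<lambda>_. 0}" by (auto simp: fun_eq_iff)
  show ?thesis unfolding poly_of_def 0 by (simp add: monom_fun_def)
qed

lemma polys_add: assumes "f \<in> polys p" "g \<in> polys p" shows "(\<lambda>x. f x + g x) \<in> polys p"
proof -
  obtain a b where "f = poly_of p a" "g = poly_of p b" using assms by (metis polysE)
  then have "(\<lambda>x. f x + g x) = poly_of p (\<lambda>\<alpha>. a \<alpha> + b \<alpha>)"
    by (auto simp: poly_of_def sum.distrib algebra_simps)
  then show ?thesis by simp
qed

lemma polys_cmult: assumes "f \<in> polys p" shows "(\<lambda>x. c * f x) \<in> polys p"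
proof -
  obtain a where "f = poly_of p a" using assms by (metis polysE)
  then have "(\<lambda>x. c * f x) = poly_of p (\<lambda>\<alpha>. c * a \<alpha>)"
    by (auto simp: poly_of_def sum_distrib_left algebra_simps)
  then show ?thesis by simp
qed

lemma polys_mono: assumes "f \<in> polys p" "p \<le> q" shows "f \<in> polys q"
proof -
  obtain a where a: "f = poly_of p a" using assms by (metis polysE)
  have "f = poly_of q (\<lambda>\<alpha>. if \<alpha> \<in> midx p then a \<alpha> else 0)"
    unfolding a poly_of_def[abs_def]
    by (rule ext, rule sum.mono_neutral_cong_left) (use assms(2) in \<open>auto intro: finite_multi_indices\<close>)
  then show ?thesis by simp
qed

lemma polys_const [simp]: "(\<lambda>x. c) \<in> polys p"
proof -
  have "(\<lambda>x. c) = poly_of 0 (\<lambda>_. c)" by (auto simp: poly_of_0)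
  then have "(\<lambda>x. c) \<in> polys 0" by (metis poly_of_in_polys)
  then show ?thesis by (rule polys_mono) simp
qed

lemma polys_sum:
  assumes "\<And>i. i \<in> I \<Longrightarrow> f i \<in> polys p" shows "(\<lambda>x. \<Sum>i\<in>I. f i x) \<in> polys p"
  using assms by (induction I rule: infinite_finite_induct) (auto intro: polys_add)

lemma polys_coord_mult: assumes "f \<in> polys p" shows "(\<lambda>x. x $ i * f x) \<in> polys (Suc p)"
proof -
  obtain a where a: "f = poly_of p a" using assms by (metis polysE)
  let ?b = "\<lambda>\<alpha>. if \<alpha> i \<noteq> 0 then a (\<alpha>(i := \<alpha> i - 1)) else 0"
  have "x $ i * f x = poly_of (Suc p) ?b x" for x
  proof -
    have "poly_of (Suc p) ?b x = (\<Sum>\<alpha>\<in>{\<alpha>\<in>midx (Suc p). \<alpha> i \<noteq> 0}. ?b \<alpha> * monom_fun \<alpha> x)"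
      unfolding poly_of_def by (rule sum.mono_neutral_cong_right) (auto intro: finite_multi_indices)
    also have "\<dots> = (\<Sum>\<beta>\<in>midx p. x $ i * (a \<beta> * monom_fun \<beta> x))"
      unfolding sum_over_raise by (rule sum.cong) (auto simp: monom_fun_raise, auto simp: raise_def)
    finally show ?thesis by (simp add: a poly_of_def sum_distrib_left)
  qed
  then have "(\<lambda>x. x $ i * f x) = poly_of (Suc p) ?b" by auto
  then show ?thesis by simp
qed

lemma polys_0E: assumes "f \<in> polys 0" obtains c where "f = (\<lambda>x. c)"
proof -
  obtain a where a: "f = poly_of 0 a" using assms by (rule polysE)
  show thesis by (rule that[of "a (\<lambda>_. 0)"]) (auto simp: a poly_of_0)
qed

lemma polys_SucE:
  assumes "f \<in> polys (Suc p)"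
  obtains c q where "\<And>i. q i \<in> polys p" "f = (\<lambda>x. c + (\<Sum>i\<in>UNIV. x $ i * q i x))"
proof -
  obtain a where a: "f = poly_of (Suc p) a" using assms by (rule polysE)
  show thesis
    by (rule that[of "\<lambda>i. poly_of p (lower i a)" "a (\<lambda>_. 0)"]) (auto simp: a poly_of_Suc)
qed

lemma polys_induct [consumes 1, case_names const step]:
  assumes "f \<in> polys p"
    and const: "\<And>p c. P p (\<lambda>x. c)"
    and step: "\<And>p c q. (\<And>i. q i \<in> polys p) \<Longrightarrow> (\<And>i. P p (q i))
      \<Longrightarrow> P (Suc p) (\<lambda>x. c + (\<Sum>i\<in>UNIV. x $ i * q i x))"
  shows "P p f"
  using assms(1)
proof (induction p arbitrary: f)
  case 0
  then obtain c where "f = (\<lambda>x. c)" by (rule polys_0E)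
  then show ?case by (simp add: const)
next
  case (Suc p)
  show ?case
  proof (rule polys_SucE[OF Suc.prems])
    fix c q assume q: "\<And>i. q i \<in> polys p" and f: "f = (\<lambda>x. c + (\<Sum>i\<in>UNIV. x $ i * q i x))"
    show "P (Suc p) f" unfolding f by (rule step) (use q Suc.IH in auto)
  qed
qed

lemma polys_coord: "(\<lambda>x. x $ i) \<in> polys (Suc p)"
  using polys_coord_mult[OF polys_const[of 1 p], of i] by simp

lemma polys_affine_mult:
  assumes "f \<in> polys p" shows "(\<lambda>x. (c + v \<bullet> x) * f x) \<in> polys (Suc p)"
proof -
  have "(\<lambda>x. (c + v \<bullet> x) * f x) = (\<lambda>x. c * f x + (\<Sum>i\<in>UNIV. v $ i * (x $ i * f x)))"
    by (auto simp: inner_vec_def algebra_simps sum_distrib_left sum_distrib_right)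
  also have "\<dots> \<in> polys (Suc p)"
    by (intro polys_add polys_sum polys_cmult polys_coord_mult assms)
       (rule polys_mono[OF assms], simp)
  finally show ?thesis .
qed

text \<open>
  Induction on the degree of the first factor: a polynomial is a constant plus a sum of variables times
  polynomials of lower degree.
\<close>

lemma polys_mult: "f \<in> polys p \<Longrightarrow> g \<in> polys q \<Longrightarrow> (\<lambda>x. f x * g x) \<in> polys (p + q)"
proof (induction p f rule: polys_induct)
  case (const p c)
  then show ?case by (auto intro!: polys_cmult intro: polys_mono)
next
  case (step p c r)
  have "(\<lambda>x. (c + (\<Sum>i\<in>UNIV. x $ i * r i x)) * g x)
     = (\<lambda>x. c * g x + (\<Sum>i\<in>UNIV. x $ i * (r i x * g x)))"
    by (auto simp: algebra_simps sum_distrib_left sum_distrib_right)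
  also have "\<dots> \<in> polys (Suc (p + q))"
    using step by (intro polys_add polys_sum polys_cmult polys_coord_mult) (auto intro: polys_mono)
  finally show ?case by simp
qed

lemma polys_affine_subst:
  fixes f :: "real^'n \<Rightarrow> real" and A :: "real^'m \<Rightarrow> real^'n"
  assumes A: "\<And>x i. A x $ i = c i + v i \<bullet> x"
  shows "f \<in> polys p \<Longrightarrow> (\<lambda>x. f (A x)) \<in> polys p"
proof (induction p f rule: polys_induct)
  case (step p c q)
  then show ?case by (auto intro!: polys_add polys_sum polys_affine_mult simp: A)
qed auto

lemma polys_scale_subst:
  assumes "f \<in> polys p" shows "(\<lambda>x. f (x0 + r *\<^sub>R x)) \<in> polys p"
  by (rule polys_affine_subst[OF _ assms, of _ "\<lambda>i. x0 $ i" "\<lambda>i. r *\<^sub>R axis i 1"])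
     (simp add: inner_axis')

lemma polys_differentiable: "f \<in> polys p \<Longrightarrow> f differentiable (at x)"
proof (induction p f rule: polys_induct)
  case (step p c q)
  have "(\<lambda>x. x $ i) differentiable (at x)" for i :: 'a
    by (intro linear_imp_differentiable bounded_linear.linear bounded_linear_vec_nth)
  then show ?case using step
    by (intro differentiable_add differentiable_sum differentiable_mult differentiable_const) auto
qed auto

lemma polys_continuous: "f \<in> polys p \<Longrightarrow> continuous_on S f"
  by (meson continuous_at_imp_continuous_on differentiable_imp_continuous_within polys_differentiable)

lemma polys_borel [measurable]: "f \<in> polys p \<Longrightarrow> f \<in> borel_measurable borel"
  by (intro borel_measurable_continuous_onI polys_continuous)


subsection \<open>Partial derivatives\<close>

lemma has_derivative_grad:
  fixes f :: "real^'n \<Rightarrow> real"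
  assumes "f differentiable (at x)"
  shows "(f has_derivative (\<lambda>h. grad f x \<bullet> h)) (at x)"
proof -
  have d: "(f has_derivative frechet_derivative f (at x)) (at x)"
    using assms frechet_derivative_works by blast
  have lin: "linear (frechet_derivative f (at x))"
    using d has_derivative_linear by blast
  have "frechet_derivative f (at x) h = grad f x \<bullet> h" for h
  proof -
    have "frechet_derivative f (at x) h = frechet_derivative f (at x) (\<Sum>i\<in>UNIV. (h $ i) *\<^sub>R axis i 1)"
      by (simp add: basis_expansion[of h, unfolded scalar_mult_eq_scaleR])
    also have "\<dots> = (\<Sum>i\<in>UNIV. h $ i * grad f x $ i)"
      by (simp add: linear_sum[OF lin] linear_scale[OF lin] grad_def)
    finally show ?thesis by (simp add: inner_vec_def mult.commute)
  qed
  then have "frechet_derivative f (at x) = (\<lambda>h. grad f x \<bullet> h)" by (rule ext)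
  then show ?thesis using d by (simp only:)
qed

lemma grad_unique:
  fixes f :: "real^'n \<Rightarrow> real"
  assumes "(f has_derivative (\<lambda>h. w \<bullet> h)) (at x)"
  shows "grad f x = w"
proof -
  have "frechet_derivative f (at x) = (\<lambda>h. w \<bullet> h)"
    using frechet_derivative_at[OF assms] by simp
  then show ?thesis by (simp add: grad_def vec_eq_iff inner_axis)
qed

lemma DERIV_line:
  fixes f :: "real^'n \<Rightarrow> real"
  assumes "f differentiable (at x)"
  shows "((\<lambda>t. f (x + t *\<^sub>R v)) has_real_derivative (grad f x \<bullet> v)) (at 0)"
proof -
  have "((\<lambda>t. x + t *\<^sub>R v) has_derivative (\<lambda>t. t *\<^sub>R v)) (at 0)"
    by (auto intro!: derivative_eq_intros)
  from has_derivative_compose[OF this, of f "\<lambda>h. grad f x \<bullet> h"] has_derivative_grad[OF assms]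
  have "((\<lambda>t. f (x + t *\<^sub>R v)) has_derivative (\<lambda>t. grad f x \<bullet> (t *\<^sub>R v))) (at 0)"
    by simp
  moreover have "(\<lambda>t. grad f x \<bullet> (t *\<^sub>R v)) = (*) (grad f x \<bullet> v)"
    by (auto simp: fun_eq_iff)
  ultimately show ?thesis by (simp only: has_field_derivative_def)
qed

definition deriv_coeff :: "'n \<Rightarrow> (('n::finite \<Rightarrow> nat) \<Rightarrow> real) \<Rightarrow> ('n \<Rightarrow> nat) \<Rightarrow> real" where
  "deriv_coeff i a \<beta> = real (Suc (\<beta> i)) * a (raise i \<beta>)"

lemma grad_poly_of:
  "grad (poly_of (Suc p) a) x $ i = poly_of p (deriv_coeff i a) x"
proof -
  let ?R = "\<lambda>\<alpha>. (\<Prod>j\<in>UNIV-{i}. x $ j ^ \<alpha> j)"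
  have mono: "monom_fun \<alpha> (x + t *\<^sub>R axis i 1) = (x $ i + t) ^ \<alpha> i * ?R \<alpha>" for \<alpha> t
  proof -
    have "monom_fun \<alpha> (x + t *\<^sub>R axis i 1)
        = (x + t *\<^sub>R axis i 1) $ i ^ \<alpha> i * (\<Prod>j\<in>UNIV-{i}. (x + t *\<^sub>R axis i 1) $ j ^ \<alpha> j)"
      unfolding monom_fun_def by (rule prod.remove) auto
    moreover have "(\<Prod>j\<in>UNIV-{i}. (x + t *\<^sub>R axis i 1) $ j ^ \<alpha> j) = ?R \<alpha>"
      by (rule prod.cong) (auto simp: axis_def)
    ultimately show ?thesis by (simp add: axis_def)
  qed
  have "((\<lambda>t. poly_of (Suc p) a (x + t *\<^sub>R axis i 1)) has_real_derivative
      (\<Sum>\<alpha>\<in>midx (Suc p). a \<alpha> * (real (\<alpha> i) * x $ i ^ (\<alpha> i - 1) * ?R \<alpha>))) (at 0)"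
    unfolding poly_of_def mono
    by (auto intro!: derivative_eq_intros sum.cong simp: algebra_simps)
  moreover have "(\<Sum>\<alpha>\<in>midx (Suc p). a \<alpha> * (real (\<alpha> i) * x $ i ^ (\<alpha> i - 1) * ?R \<alpha>))
      = poly_of p (deriv_coeff i a) x"
  proof -
    have "(\<Sum>\<alpha>\<in>midx (Suc p). a \<alpha> * (real (\<alpha> i) * x $ i ^ (\<alpha> i - 1) * ?R \<alpha>))
       = (\<Sum>\<alpha>\<in>{\<alpha>\<in>midx (Suc p). \<alpha> i \<noteq> 0}. a \<alpha> * (real (\<alpha> i) * x $ i ^ (\<alpha> i - 1) * ?R \<alpha>))"
      by (rule sum.mono_neutral_cong_right) (auto intro: finite_multi_indices)
    also have "\<dots> = (\<Sum>\<beta>\<in>midx p. deriv_coeff i a \<beta> * monom_fun \<beta> x)"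
      unfolding sum_over_raise
    proof (rule sum.cong[OF refl])
      fix \<beta> :: "'a \<Rightarrow> nat"
      have "monom_fun \<beta> x = x $ i ^ \<beta> i * ?R \<beta>"
        unfolding monom_fun_def by (rule prod.remove) auto
      moreover have "?R (raise i \<beta>) = ?R \<beta>" by (rule prod.cong) (auto simp: raise_def)
      ultimately show "a (raise i \<beta>) * (real (raise i \<beta> i) * x $ i ^ (raise i \<beta> i - 1) * ?R (raise i \<beta>))
         = deriv_coeff i a \<beta> * monom_fun \<beta> x"
        by (simp add: deriv_coeff_def raise_def)
    qed
    finally show ?thesis by (simp add: poly_of_def)
  qed
  moreover have "((\<lambda>t. poly_of (Suc p) a (x + t *\<^sub>R axis i 1)) has_real_derivative
      (grad (poly_of (Suc p) a) x \<bullet> axis i 1)) (at 0)"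
    by (rule DERIV_line) (rule polys_differentiable[OF poly_of_in_polys])
  ultimately have "grad (poly_of (Suc p) a) x \<bullet> axis i 1 = poly_of p (deriv_coeff i a) x"
    by (metis DERIV_unique)
  then show ?thesis by (simp add: inner_axis)
qed

lemma grad_const [simp]: "grad (\<lambda>x. c) x = 0"
  by (rule grad_unique) simp

lemma polys_grad: assumes "f \<in> polys p" shows "(\<lambda>x. grad f x $ i) \<in> polys p"
proof (cases p)
  case 0
  then obtain c where "f = (\<lambda>x. c)" using assms polys_0E by blast
  then show ?thesis by simp
next
  case (Suc q)
  then obtain a where "f = poly_of (Suc q) a" using assms polysE by blast
  then have "(\<lambda>x. grad f x $ i) = poly_of q (deriv_coeff i a)" by (simp add: grad_poly_of)
  then show ?thesis by (metis poly_of_in_polys polys_mono Suc le_add2 plus_1_eq_Suc)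
qed


subsection \<open>Coefficients are controlled by the mean square over a ball\<close>

text \<open>
  Each partial derivative vanishes as well, so by induction on the degree all coefficients but the constant one
  are zero.
\<close>

lemma poly_of_zero_imp_coeff_zero:
  assumes "open U" "U \<noteq> {}" "\<And>x. x \<in> U \<Longrightarrow> poly_of p a x = 0" "\<alpha> \<in> midx p"
  shows "a \<alpha> = 0"
  using assms(3,4)
proof (induction p arbitrary: a \<alpha>)
  case 0
  then have "\<alpha> = (\<lambda>_. 0)" by (auto simp: fun_eq_iff)
  then show ?case using 0 assms(2) by (auto simp: poly_of_0)
next
  case (Suc p)
  have z: "a (raise i \<beta>) = 0" if "\<beta> \<in> midx p" for i \<beta>
  proof -
    have "poly_of p (deriv_coeff i a) x = 0" if x: "x \<in> U" for x
    proof -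
      have "((\<lambda>_. 0) has_derivative (\<lambda>h. 0)) (at x)" by simp
      then have "(poly_of (Suc p) a has_derivative (\<lambda>h. 0)) (at x)"
        by (rule has_derivative_transform_within_open[OF _ assms(1) x]) (simp add: Suc.prems)
      then have "(poly_of (Suc p) a has_derivative (\<lambda>h. 0 \<bullet> h)) (at x)" by simp
      from grad_unique[OF this] grad_poly_of[of p a x i] show ?thesis by simp
    qed
    from Suc.IH[OF this that] show ?thesis by (simp add: deriv_coeff_def)
  qed
  show ?case
  proof (cases "\<alpha> = (\<lambda>_. 0)")
    case False
    then obtain i where "\<alpha> i \<noteq> 0" by auto
    then obtain \<beta> where "\<alpha> = raise i \<beta>" by (rule raise_surj)
    then show ?thesis using z Suc.prems(2) by (simp add: sum_raise)
  next
    case True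
    obtain x where x: "x \<in> U" using assms(2) by auto
    have "lower i a \<beta> = 0" if "\<beta> \<in> midx p" for i \<beta> using z[OF that] by (simp add: lower_def)
    then have "poly_of p (lower i a) x = 0" for i by (simp add: poly_of_def)
    then have "poly_of (Suc p) a x = a (\<lambda>_. 0)" by (simp add: poly_of_Suc)
    then show ?thesis using Suc.prems(1)[OF x] True by simp
  qed
qed

text \<open>
  Normalising by \<open>r\<^sup>d\<close>, i.e. by the volume of the ball up to a constant, makes this invariant under dilations.
\<close>

definition mean_sq :: "(real^'n \<Rightarrow> real) \<Rightarrow> real^'n \<Rightarrow> real \<Rightarrow> real" where
  "mean_sq f x0 r = (LINT x:ball x0 r|lborel. (f x)\<^sup>2) / r ^ CARD('n)"

lemma set_integrable_continuous_bounded: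
  fixes f :: "real^'n \<Rightarrow> 'b::euclidean_space"
  assumes "continuous_on UNIV f" "bounded D" "D \<in> sets borel"
  shows "set_integrable lborel D f"
proof -
  obtain K where "compact K" "D \<subseteq> K"
    using assms(2) by (meson bounded_subset_cball compact_cball)
  moreover have "set_integrable lborel K f"
    using borel_integrable_compact[OF \<open>compact K\<close>, of f] assms(1) continuous_on_subset
    by (auto simp: set_integrable_def indicator_scaleR_eq_if)
  ultimately show ?thesis using assms(3) by (auto intro: set_integrable_subset)
qed

lemma integral_lborel_affine:
  fixes g :: "real^'n \<Rightarrow> real"
  assumes [measurable]: "g \<in> borel_measurable borel" and r: "r > 0"
  shows "(\<integral>x. g x \<partial>lborel) = r ^ CARD('n) * (\<integral>y. g (x0 + r *\<^sub>R y) \<partial>lborel)"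
  using r by (subst lborel_affine[of r x0])
    (simp_all add: integral_density integral_distr)

lemma mean_sq_scale:
  fixes f :: "real^'n \<Rightarrow> real"
  assumes [measurable]: "f \<in> borel_measurable borel" and r: "r > 0"
  shows "mean_sq f x0 r = mean_sq (\<lambda>y. f (x0 + r *\<^sub>R y)) 0 1"
proof -
  have "(LINT x:ball x0 r|lborel. (f x)\<^sup>2)
      = r ^ CARD('n) * (\<integral>y. indicator (ball x0 r) (x0 + r *\<^sub>R y) * (f (x0 + r *\<^sub>R y))\<^sup>2 \<partial>lborel)"
    unfolding set_lebesgue_integral_def real_scaleR_def
    by (rule integral_lborel_affine[OF _ r])
      (auto intro!: borel_measurable_times borel_measurable_indicator borel_measurable_power assms)
  also have "(\<lambda>y. indicator (ball x0 r) (x0 + r *\<^sub>R y) :: real) = indicator (ball 0 1)"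
    using r by (auto simp: indicator_def dist_norm fun_eq_iff)
  finally show ?thesis
    using r by (simp add: mean_sq_def set_lebesgue_integral_def fun_eq_iff[symmetric] cong: if_cong)
qed

lemma mean_sq_nonneg: "r > 0 \<Longrightarrow> mean_sq f x0 r \<ge> 0"
  by (auto simp: mean_sq_def set_lebesgue_integral_def intro!: divide_nonneg_pos integral_nonneg_AE)

lemma mean_sq_poly_of:
  "mean_sq (poly_of p a) 0 1
   = (\<Sum>\<alpha>\<in>midx p. \<Sum>\<beta>\<in>midx p. a \<alpha> * a \<beta> * (LINT x:ball 0 1|lborel. monom_fun \<alpha> x * monom_fun \<beta> x))"
proof -
  have c: "continuous_on UNIV (monom_fun \<alpha> :: real^'a \<Rightarrow> real)" for \<alpha>
    unfolding monom_fun_def by (intro continuous_intros)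
  have i: "set_integrable lborel (ball 0 1) (\<lambda>x::real^'a. a \<alpha> * a \<beta> * (monom_fun \<alpha> x * monom_fun \<beta> x))" for \<alpha> \<beta>
    by (rule set_integrable_continuous_bounded) (auto intro!: continuous_intros c)
  have "mean_sq (poly_of p a) 0 1
     = (LINT x:ball 0 1|lborel. (\<Sum>\<alpha>\<in>midx p. \<Sum>\<beta>\<in>midx p. a \<alpha> * a \<beta> * (monom_fun \<alpha> x * monom_fun \<beta> x)))"
    unfolding mean_sq_def poly_of_def power2_eq_square sum_product by (simp add: mult_ac)
  also have "\<dots> = (\<Sum>\<alpha>\<in>midx p. \<Sum>\<beta>\<in>midx p. LINT x:ball 0 1|lborel. a \<alpha> * a \<beta> * (monom_fun \<alpha> x * monom_fun \<beta> x))"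
    using i unfolding set_lebesgue_integral_def set_integrable_def scaleR_sum_right
    by (subst Bochner_Integration.integral_sum; simp)+
  finally show ?thesis by simp
qed

lemma mean_sq_zero_imp_zero:
  fixes f :: "real^'n \<Rightarrow> real"
  assumes c: "continuous_on UNIV f" and z: "mean_sq f 0 1 = 0" and x: "x \<in> ball 0 1"
  shows "f x = 0"
proof (rule ccontr)
  assume nz: "f x \<noteq> 0"
  let ?U = "ball 0 1 \<inter> {x. f x \<noteq> 0}"
  have o: "open ?U"
    by (intro open_Int open_ball open_Collect_neq c continuous_intros)
  have [measurable]: "f \<in> borel_measurable borel" by (rule borel_measurable_continuous_onI[OF c])
  have i: "set_integrable lborel (ball 0 1) (\<lambda>x. (f x)\<^sup>2)"
    by (rule set_integrable_continuous_bounded) (auto intro!: continuous_intros c)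
  have "(\<integral>x. indicator (ball 0 1) x * (f x)\<^sup>2 \<partial>lborel) = 0"
    using z by (simp add: mean_sq_def set_lebesgue_integral_def)
  then have "AE x in lborel. indicator (ball 0 1) x * (f x)\<^sup>2 = 0"
    by (subst (asm) integral_nonneg_eq_0_iff_AE)
       (use i in \<open>auto simp: set_integrable_def\<close>)
  then have "AE x in lborel. x \<notin> ?U" by eventually_elim (auto simp: indicator_def)
  then have "emeasure lborel ?U = 0"
    using o by (subst (asm) AE_iff_measurable[of ?U]) auto
  then have "negligible ?U"
    using o by (auto simp: negligible_iff_null_sets null_sets_def null_sets_completionI)
  then have "?U = {}" using o open_not_negligible by blast
  then show False using nz x by blast
qed

text \<open>
  Equivalence of norms in finite dimension.  For each multi-index \<open>\<alpha>\<close> the coefficient vectors with largest entry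
  \<open>a \<alpha> = 1\<close> form a compact set on which the mean square is continuous and positive, hence bounded below.
\<close>

lemma coeff_bound:
  "\<exists>C>0. \<forall>a. \<forall>\<alpha>\<in>midx p. (a \<alpha>)\<^sup>2 \<le> C * mean_sq (poly_of p a :: real^'n \<Rightarrow> real) 0 1"
proof -
  let ?N = "\<lambda>a. mean_sq (poly_of p a :: real^'n \<Rightarrow> real) 0 1"
  define S where "S = (midx p :: ('n \<Rightarrow> nat) set)"
  \<comment> \<open>all coordinates outside the index set are frozen to 0, so that the product is compact\<close>
  define K where "K \<alpha>0 = PiE UNIV (\<lambda>\<alpha>. if \<alpha> = \<alpha>0 then {1} else if \<alpha> \<in> S then {-1..1::real} else {0})" for \<alpha>0
  have fin: "finite S" unfolding S_def by (rule finite_multi_indices)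
  have contN: "continuous_on UNIV ?N"
    unfolding mean_sq_poly_of by (intro continuous_intros continuous_on_product_coordinates)
  have "\<exists>c>0. \<forall>a\<in>K \<alpha>0. c \<le> ?N a" if \<alpha>0: "\<alpha>0 \<in> S" for \<alpha>0
  proof -
    have "compactin (product_topology (\<lambda>_. euclidean) UNIV) (K \<alpha>0)"
      unfolding K_def by (subst compactin_PiE) auto
    then have comp: "compact (K \<alpha>0)" by (simp add: euclidean_product_topology)
    have "(\<lambda>\<alpha>. if \<alpha> = \<alpha>0 then 1 else 0) \<in> K \<alpha>0" unfolding K_def by (rule PiE_I) auto
    then have ne: "K \<alpha>0 \<noteq> {}" by blast
    obtain a where a: "a \<in> K \<alpha>0" and min: "\<And>b. b \<in> K \<alpha>0 \<Longrightarrow> ?N a \<le> ?N b"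
      using continuous_attains_inf[OF comp ne continuous_on_subset[OF contN]] by auto
    have "?N a \<noteq> 0"
    proof
      assume "?N a = 0"
      then have "poly_of p a x = 0" if "x \<in> ball 0 1" for x :: "real^'n"
        by (rule mean_sq_zero_imp_zero[OF polys_continuous[OF poly_of_in_polys] _ that])
      then have "a \<alpha>0 = 0"
        using poly_of_zero_imp_coeff_zero[of "ball 0 1 :: (real^'n) set" p a \<alpha>0] \<alpha>0[unfolded S_def]
        by auto
      moreover have "a \<alpha>0 = 1" using PiE_mem[OF a[unfolded K_def], of \<alpha>0] by simp
      ultimately show False by simp
    qed
    then have "?N a > 0" using mean_sq_nonneg[of 1 "poly_of p a" 0] by simp
    then show ?thesis using min by blast
  qed
  then obtain c where c: "\<And>\<alpha>0. \<alpha>0 \<in> S \<Longrightarrow> c \<alpha>0 > 0"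
    and cN: "\<And>\<alpha>0 a. \<alpha>0 \<in> S \<Longrightarrow> a \<in> K \<alpha>0 \<Longrightarrow> c \<alpha>0 \<le> ?N a"
    using bchoice[of S "\<lambda>\<alpha>0 c. 0 < c \<and> (\<forall>a\<in>K \<alpha>0. c \<le> ?N a)"] by blast
  have S0: "(\<lambda>_. 0) \<in> S" by (simp add: S_def)
  define C where "C = (\<Sum>\<alpha>\<in>S. 1 / c \<alpha>)"
  have Cge: "1 / c \<alpha> \<le> C" if "\<alpha> \<in> S" for \<alpha>
    unfolding C_def using that by (intro member_le_sum) (auto simp: fin intro: less_imp_le c)
  have "C > 0" using Cge[OF S0] c[OF S0] by (meson less_le_trans zero_less_divide_1_iff)
  moreover have "(a \<alpha>)\<^sup>2 \<le> C * ?N a" if \<alpha>: "\<alpha> \<in> S" for a \<alpha>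
  proof -
    obtain \<beta> where \<beta>: "\<beta> \<in> S" "\<And>\<gamma>. \<gamma> \<in> S \<Longrightarrow> \<bar>a \<gamma>\<bar> \<le> \<bar>a \<beta>\<bar>"
    proof -
      obtain \<beta> where b: "\<beta> \<in> S" "Max ((\<lambda>\<gamma>. \<bar>a \<gamma>\<bar>) ` S) = \<bar>a \<beta>\<bar>"
        by (rule obtains_MAX[OF fin, of "\<lambda>\<gamma>. \<bar>a \<gamma>\<bar>"]) (use S0 in blast)+
      have "\<bar>a \<gamma>\<bar> \<le> \<bar>a \<beta>\<bar>" if "\<gamma> \<in> S" for \<gamma>
        unfolding b(2)[symmetric] by (rule Max_ge) (use fin that in auto)
      then show thesis using b(1) that by blast
    qed
    show ?thesis
    proof (cases "a \<beta> = 0")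
      case True
      then show ?thesis using \<beta>(2)[OF \<alpha>] \<open>C > 0\<close> mean_sq_nonneg[of 1 "poly_of p a" 0] by simp
    next
      case False
      \<comment> \<open>scale so that the largest coefficient becomes 1\<close>
      define b where "b = (\<lambda>\<gamma>. if \<gamma> \<in> S then a \<gamma> / a \<beta> else 0)"
      have "\<bar>b \<gamma>\<bar> \<le> 1" if "\<gamma> \<in> S" for \<gamma>
        using \<beta>(2)[OF that] False that by (simp add: b_def abs_divide)
      then have "b \<gamma> \<in> {-1..1}" if "\<gamma> \<in> S" for \<gamma>
        using that by (simp only: atLeastAtMost_iff abs_le_iff minus_le_iff)
      moreover have "b \<beta> = 1" "\<And>\<gamma>. \<gamma> \<notin> S \<Longrightarrow> b \<gamma> = 0"
        using \<beta>(1) False by (simp_all add: b_def)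
      ultimately have "b \<in> K \<beta>" unfolding K_def by (intro PiE_I) (simp_all split: if_splits)
      then have "c \<beta> \<le> ?N b" using cN \<beta>(1) by blast
      moreover have "?N a = (a \<beta>)\<^sup>2 * ?N b"
      proof -
        have "poly_of p a = (\<lambda>x. a \<beta> * poly_of p b x)"
          using False by (auto simp: poly_of_def b_def S_def[symmetric] sum_distrib_left fun_eq_iff intro!: sum.cong)
        then show ?thesis by (simp add: mean_sq_def power_mult_distrib)
      qed
      ultimately have "(a \<beta>)\<^sup>2 * c \<beta> \<le> ?N a" by (simp add: mult_left_mono)
      then have "(a \<beta>)\<^sup>2 \<le> (1 / c \<beta>) * ?N a" using c[OF \<beta>(1)] by (simp add: field_simps)
      also have "\<dots> \<le> C * ?N a"
        by (intro mult_right_mono Cge \<beta> mean_sq_nonneg) auto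
      finally show ?thesis using \<beta>(2)[OF \<alpha>] by (meson abs_le_square_iff order_trans)
    qed
  qed
  ultimately show ?thesis unfolding S_def by blast
qed

section \<open>Integrals over hyperplanes and the divergence theorem on a half-space\<close>

definition proj :: "real^'n \<Rightarrow> real \<Rightarrow> real^'n \<Rightarrow> real^'n" where
  "proj n a x = x - (n \<bullet> x - a) *\<^sub>R n"

text \<open>
  Integral over the hyperplane \<open>n \<bullet> x = a\<close> for a unit vector \<open>n\<close>, realised like the surface measure as a volume integral over
  a strip of thickness 1 of the function extended constantly along \<open>n\<close>.
\<close>

definition plane_integral :: "real^'n \<Rightarrow> real \<Rightarrow> (real^'n \<Rightarrow> real) \<Rightarrow> real" where
  "plane_integral n a g = (\<integral>x. indicator {x. 0 < n \<bullet> x - a \<and> n \<bullet> x - a \<le> 1} x * g (proj n a x) \<partial>lborel)"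

lemma proj_measurable [measurable]: "proj n a \<in> borel_measurable borel"
  unfolding proj_def by (intro borel_measurable_continuous_onI continuous_intros)

lemma proj_shift: "norm n = 1 \<Longrightarrow> proj n a (x + s *\<^sub>R n) = proj n a x"
  by (simp add: proj_def inner_right_distrib dot_square_norm algebra_simps)

lemma inner_proj: "norm n = 1 \<Longrightarrow> n \<bullet> proj n a x = a"
  by (simp add: proj_def inner_diff_right dot_square_norm)

lemma norm_diff_proj: "norm n = 1 \<Longrightarrow> norm (x - proj n a x) = \<bar>n \<bullet> x - a\<bar>"
  by (simp add: proj_def)

lemma strip_measurable [measurable]: "{x::real^'n. s < n \<bullet> x - a \<and> n \<bullet> x - a \<le> t} \<in> sets borel"
  by measurable

text \<open>
  Monotone solutions of the functional equation of Cauchy are linear: compare with the multiples of \<open>1 / m\<close>.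
\<close>

lemma additive_nonneg_imp_linear:
  fixes \<phi> :: "real \<Rightarrow> real"
  assumes add: "\<And>s t. 0 \<le> s \<Longrightarrow> 0 \<le> t \<Longrightarrow> \<phi> (s + t) = \<phi> s + \<phi> t"
    and nonneg: "\<And>t. 0 \<le> t \<Longrightarrow> 0 \<le> \<phi> t" and t: "0 \<le> t"
  shows "\<phi> t = t * \<phi> 1"
proof -
  have mult: "\<phi> (real k * s) = real k * \<phi> s" if "0 \<le> s" for k s
  proof (induction k)
    case 0
    show ?case using add[of 0 0] by simp
  next
    case (Suc k)
    then show ?case using add[of s "real k * s"] that by (simp add: algebra_simps)
  qed
  have mono: "\<phi> s \<le> \<phi> u" if "0 \<le> s" "s \<le> u" for s u
    using add[of s "u - s"] nonneg[of "u - s"] that by simp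
  have bound: "\<bar>\<phi> t - t * \<phi> 1\<bar> \<le> \<phi> 1 / real (Suc N)" for N
  proof -
    define m where "m = real (Suc N)"
    have m: "m > 0" by (simp add: m_def)
    define k where "k = nat \<lfloor>t * m\<rfloor>"
    have k: "real k \<le> t * m" "t * m < real k + 1"
      using t m by (auto simp: k_def intro!: of_nat_floor)
    have unit: "\<phi> (1 / m) = \<phi> 1 / m"
      using mult[of "1 / m" "Suc N", folded m_def] m by (simp add: field_simps)
    have "real k * (\<phi> 1 / m) \<le> \<phi> t"
      using mono[of "real k * (1 / m)" t] mult[of "1 / m" k] k(1) m unit by (simp add: pos_divide_le_eq)
    then have 1: "real k * \<phi> 1 \<le> \<phi> t * m" using m by (simp add: pos_divide_le_eq)
    have "t \<le> real (Suc k) * (1 / m)" using k(2) m by (simp add: pos_le_divide_eq add.commute)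
    then have "\<phi> t \<le> real (Suc k) * (\<phi> 1 / m)"
      using mono[of t "real (Suc k) * (1 / m)"] mult[of "1 / m" "Suc k"] m t unit by simp
    then have 2: "\<phi> t * m \<le> (real k + 1) * \<phi> 1" using m by (simp add: pos_le_divide_eq add.commute)
    have "real k * \<phi> 1 \<le> t * m * \<phi> 1" "t * m * \<phi> 1 \<le> (real k + 1) * \<phi> 1"
      using k nonneg[of 1] by (intro mult_right_mono; simp)+
    with 1 2 have "\<bar>\<phi> t * m - t * m * \<phi> 1\<bar> \<le> \<phi> 1" unfolding abs_le_iff by (simp add: algebra_simps)
    moreover have "\<phi> t * m - t * m * \<phi> 1 = (\<phi> t - t * \<phi> 1) * m" by (simp add: algebra_simps)
    ultimately show ?thesis unfolding m_def[symmetric] using m by (simp add: abs_mult pos_le_divide_eq)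
  qed
  have "(\<lambda>N. \<phi> 1 / real (Suc N)) \<longlonglongrightarrow> 0"
    by (rule real_tendsto_divide_at_top[OF tendsto_const])
       (intro filterlim_compose[OF filterlim_real_sequentially filterlim_Suc])
  then have "\<bar>\<phi> t - t * \<phi> 1\<bar> \<le> 0"
    by (rule tendsto_lowerbound) (use bound in auto)
  then show ?thesis by simp
qed

lemma integrable_bounded_support:
  fixes f :: "real^'n \<Rightarrow> 'b::{banach, second_countable_topology}"
  assumes [measurable]: "f \<in> borel_measurable borel" and "\<And>x. norm (f x) \<le> M" "\<And>x. f x \<noteq> 0 \<Longrightarrow> norm x \<le> B"
  shows "integrable lborel f"
proof (rule Bochner_Integration.integrable_bound)
  show "integrable lborel (\<lambda>x::real^'n. M * indicator (cball 0 B) x :: real)"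
    using emeasure_bounded_finite[OF bounded_cball[of "0::real^'n" B]]
    by (intro integrable_mult_right) (simp add: integrable_indicator_iff)
  show "AE x in lborel. norm (f x) \<le> norm (M * indicator (cball 0 B) x :: real)"
  proof (rule AE_I2)
    fix x
    show "norm (f x) \<le> norm (M * indicator (cball 0 B) x :: real)"
      using assms(2)[of x] assms(3)[of x] by (cases "f x = 0") (auto simp: indicator_def)
  qed
qed measurable

lemma integral_translate:
  fixes g :: "real^'n \<Rightarrow> real"
  assumes "g \<in> borel_measurable borel"
  shows "(\<integral>x. g x \<partial>lborel) = (\<integral>x. g (x + v) \<partial>lborel)"
  using integral_lborel_affine[OF assms, of 1 v] by (simp add: add.commute)

lemma strip_integrable:
  fixes h :: "real^'n \<Rightarrow> real"
  assumes n: "norm n = 1" and [measurable]: "h \<in> borel_measurable borel"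
    and "\<And>y. \<bar>h y\<bar> \<le> M" "\<And>y. h y \<noteq> 0 \<Longrightarrow> norm y \<le> B"
  shows "integrable lborel (\<lambda>x. indicator {x. s < n \<bullet> x - a \<and> n \<bullet> x - a \<le> t} x * h (proj n a x))"
proof (rule integrable_bounded_support)
  show "norm (indicator {x. s < n \<bullet> x - a \<and> n \<bullet> x - a \<le> t} x * h (proj n a x)) \<le> \<bar>M\<bar>" for x
    using assms(3)[of "proj n a x"] by (auto simp: indicator_def)
  show "norm x \<le> B + \<bar>s\<bar> + \<bar>t\<bar>"
    if "indicator {x. s < n \<bullet> x - a \<and> n \<bullet> x - a \<le> t} x * h (proj n a x) \<noteq> 0" for x
  proof -
    have st: "s < n \<bullet> x - a" "n \<bullet> x - a \<le> t" "norm (proj n a x) \<le> B"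
      using that assms(4) by (auto simp: indicator_def split: if_splits)
    have "norm x \<le> norm (proj n a x) + norm (x - proj n a x)"
      using norm_triangle_ineq[of "proj n a x" "x - proj n a x"] by simp
    then show ?thesis using st norm_diff_proj[OF n, of x a] by linarith
  qed
qed measurable

text \<open>
  By translation invariance the integral over a strip is additive in the thickness of the strip, hence linear.
\<close>

lemma strip_integral_linear:
  fixes h :: "real^'n \<Rightarrow> real"
  assumes n: "norm n = 1" and h [measurable]: "h \<in> borel_measurable borel"
    and M: "\<And>y. \<bar>h y\<bar> \<le> M" and B: "\<And>y. h y \<noteq> 0 \<Longrightarrow> norm y \<le> B" and t: "t \<ge> 0"
  shows "(\<integral>x. indicator {x. s < n \<bullet> x - a \<and> n \<bullet> x - a \<le> s + t} x * h (proj n a x) \<partial>lborel)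
      = t * plane_integral n a h"
proof -
  have transl: "(\<integral>x. indicator {x. s < n \<bullet> x - a \<and> n \<bullet> x - a \<le> s + t} x * h (proj n a x) \<partial>lborel)
      = (\<integral>x. indicator {x. 0 < n \<bullet> x - a \<and> n \<bullet> x - a \<le> t} x * h (proj n a x) \<partial>lborel)"
    if [measurable]: "h \<in> borel_measurable borel" for h :: "real^'n \<Rightarrow> real" and s t
  proof -
    have "indicator {x. s < n \<bullet> x - a \<and> n \<bullet> x - a \<le> s + t} (x + s *\<^sub>R n)
        = (indicator {x. 0 < n \<bullet> x - a \<and> n \<bullet> x - a \<le> t} x :: real)" for x
      using n by (auto simp: indicator_def inner_right_distrib dot_square_norm)
    then show ?thesis
      by (subst integral_translate[of _ "s *\<^sub>R n"]) (simp_all add: proj_shift[OF n])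
  qed
  have nonneg_case: "(\<integral>x. indicator {x. 0 < n \<bullet> x - a \<and> n \<bullet> x - a \<le> t} x * h (proj n a x) \<partial>lborel)
      = t * plane_integral n a h"
    if hm [measurable]: "h \<in> borel_measurable borel" and M: "\<And>y. \<bar>h y\<bar> \<le> M"
      and B: "\<And>y. h y \<noteq> 0 \<Longrightarrow> norm y \<le> B" and nn: "\<And>y. 0 \<le> h y" for h :: "real^'n \<Rightarrow> real"
  proof -
    define \<phi> where "\<phi> t = (\<integral>x. indicator {x. 0 < n \<bullet> x - a \<and> n \<bullet> x - a \<le> t} x * h (proj n a x) \<partial>lborel)" for t
    have int: "integrable lborel (\<lambda>x. indicator {x. s < n \<bullet> x - a \<and> n \<bullet> x - a \<le> t} x * h (proj n a x))" for s t
      by (rule strip_integrable[OF n hm M B])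
    have "\<phi> (s + t) = \<phi> s + \<phi> t" if "0 \<le> s" "0 \<le> t" for s t
    proof -
      have "\<phi> (s + t) = (\<integral>x. indicator {x. 0 < n \<bullet> x - a \<and> n \<bullet> x - a \<le> s} x * h (proj n a x)
          + indicator {x. s < n \<bullet> x - a \<and> n \<bullet> x - a \<le> s + t} x * h (proj n a x) \<partial>lborel)"
        unfolding \<phi>_def using that by (intro Bochner_Integration.integral_cong) (auto simp: indicator_def)
      also have "\<dots> = \<phi> s + \<phi> t"
        unfolding \<phi>_def
        by (subst Bochner_Integration.integral_add[OF int int]) (simp only: transl[OF hm])
      finally show ?thesis .
    qed
    moreover have "0 \<le> \<phi> t" if "0 \<le> t" for t
      unfolding \<phi>_def by (intro integral_nonneg_AE AE_I2) (auto simp: nn)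
    ultimately have "\<phi> t = t * \<phi> 1" using t by (intro additive_nonneg_imp_linear) auto
    then show ?thesis by (simp add: \<phi>_def plane_integral_def)
  qed
  define p where "p y = max (h y) 0" for y
  define q where "q y = max (- h y) 0" for y
  have pm [measurable]: "p \<in> borel_measurable borel" and qm [measurable]: "q \<in> borel_measurable borel"
    unfolding p_def q_def by measurable
  have pq: "h y = p y - q y" "\<bar>p y\<bar> \<le> M" "\<bar>q y\<bar> \<le> M" "0 \<le> p y" "0 \<le> q y"
      "p y \<noteq> 0 \<Longrightarrow> norm y \<le> B" "q y \<noteq> 0 \<Longrightarrow> norm y \<le> B" for y
    using M[of y] B[of y] by (auto simp: p_def q_def max_def split: if_splits)
  have split: "(\<integral>x. indicator {x. 0 < n \<bullet> x - a \<and> n \<bullet> x - a \<le> t} x * h (proj n a x) \<partial>lborel)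
      = (\<integral>x. indicator {x. 0 < n \<bullet> x - a \<and> n \<bullet> x - a \<le> t} x * p (proj n a x) \<partial>lborel)
      - (\<integral>x. indicator {x. 0 < n \<bullet> x - a \<and> n \<bullet> x - a \<le> t} x * q (proj n a x) \<partial>lborel)" for t
    unfolding pq(1) right_diff_distrib
    by (rule Bochner_Integration.integral_diff; rule strip_integrable[OF n]; (rule pq | measurable))
  have "(\<integral>x. indicator {x. 0 < n \<bullet> x - a \<and> n \<bullet> x - a \<le> t} x * h (proj n a x) \<partial>lborel)
     = t * plane_integral n a p - t * plane_integral n a q"
    unfolding split
    by (rule arg_cong2[where f="(-)", OF nonneg_case[OF pm pq(2) pq(6) pq(4)] nonneg_case[OF qm pq(3) pq(7) pq(5)]])
  also have "\<dots> = t * plane_integral n a h"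
    unfolding plane_integral_def split by (simp add: algebra_simps)
  finally show ?thesis using transl[OF h] by simp
qed

text \<open>
  The surface measure restricted to the hyperplane is the image under the orthogonal projection of the volume of
  a symmetric strip of thickness 1, which is then shifted to the strip of \<open>plane_integral\<close>.
\<close>

lemma surface_integral_hyperplane:
  fixes g :: "real^'n \<Rightarrow> real"
  assumes n: "norm n = 1" and F: "F \<in> sets borel" "F \<subseteq> {x. n \<bullet> x = a}" "bounded F"
    and g [measurable]: "g \<in> borel_measurable borel" and M: "\<And>x. x \<in> F \<Longrightarrow> \<bar>g x\<bar> \<le> M"
  shows "(LINT x:F|surface_measure. g x) = plane_integral n a (\<lambda>x. indicator F x * g x)"
proof -
  note [measurable] = F(1)
  let ?H = "{x. n \<bullet> x = a}" and ?S = "{x. \<bar>n \<bullet> x - a\<bar> \<le> 1/2}"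
  have n0: "n \<noteq> 0" using n by auto
  have H: "?H \<in> hyperplanes" using n0 by (auto simp: hyperplanes_def)
  have Hm [measurable]: "?H \<in> sets borel" using hyperplane_basic(2)[OF H] by auto
  have Sm [measurable]: "?S \<in> sets borel" by measurable
  have cp: "closest_point ?H = proj n a"
    using closest_point_hyperplane[OF n0, of a] n by (auto simp: proj_def dot_square_norm)
  have inf: "infdist x ?H = \<bar>n \<bullet> x - a\<bar>" for x
  proof -
    have "infdist x ?H = dist x (closest_point ?H x)"
      using hyperplane_basic[OF H] by (simp add: infdist_eq_setdist setdist_closest_point)
    then show ?thesis unfolding cp by (simp add: dist_norm norm_diff_proj[OF n])
  qed
  have eq: "density surface_measure (\<lambda>x. ennreal (indicator ?H x))
     = distr (density lborel (\<lambda>x. ennreal (indicator ?S x))) borel (proj n a)"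
  proof (rule measure_eqI)
    fix A :: "(real^'n) set" assume "A \<in> sets (density surface_measure (\<lambda>x. ennreal (indicator ?H x)))"
    then have A [measurable]: "A \<in> sets borel" by simp
    have [measurable]: "proj n a -` A \<in> sets borel"
      using measurable_sets[OF proj_measurable[of n a] A] by simp
    have "emeasure (density surface_measure (\<lambda>x. ennreal (indicator ?H x))) A
        = emeasure surface_measure (?H \<inter> A)"
      by (subst emeasure_density)
         (auto simp: ennreal_indicator indicator_inter_arith[symmetric])
    also have "\<dots> = hyperplane_content ?H (?H \<inter> A)"
      by (rule emeasure_surface_hyperplane[OF H]) auto
    also have "\<dots> = emeasure lborel (?S \<inter> proj n a -` A)"
      unfolding hyperplane_content_def cp inf
      by (rule arg_cong[where f="emeasure lborel"]) (auto simp: inner_proj[OF n])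
    also have "\<dots> = emeasure (distr (density lborel (\<lambda>x. ennreal (indicator ?S x))) borel (proj n a)) A"
      by (subst emeasure_distr, simp, simp, subst emeasure_density)
         (auto simp: ennreal_indicator indicator_inter_arith[symmetric])
    finally show "emeasure (density surface_measure (\<lambda>x. ennreal (indicator ?H x))) A
      = emeasure (distr (density lborel (\<lambda>x. ennreal (indicator ?S x))) borel (proj n a)) A" .
  qed simp
  let ?f = "\<lambda>x. indicator F x * g x"
  have "(LINT x:F|surface_measure. g x) = (\<integral>x. indicator ?H x *\<^sub>R ?f x \<partial>surface_measure)"
    unfolding set_lebesgue_integral_def using F(2)
    by (intro Bochner_Integration.integral_cong) (auto simp: indicator_def)
  also have "\<dots> = (\<integral>x. ?f x \<partial>density surface_measure (\<lambda>x. ennreal (indicator ?H x)))"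
    by (rule integral_density[symmetric]) auto
  also have "\<dots> = (\<integral>x. indicator ?S x * ?f (proj n a x) \<partial>lborel)"
    unfolding eq by (subst integral_distr, simp, simp, subst integral_density) auto
  also have "\<dots> = (\<integral>x. indicator {x. -1/2 < n \<bullet> x - a \<and> n \<bullet> x - a \<le> -1/2 + 1} x * ?f (proj n a x) \<partial>lborel)"
  proof (rule integral_cong_AE)
    have "negligible {x. n \<bullet> x = a - 1/2}" by (rule negligible_hyperplane) (use n0 in simp)
    then have "AE x in lebesgue. x \<notin> {x. n \<bullet> x = a - 1/2}"
      unfolding negligible_iff_null_sets by (rule AE_not_in)
    then have "AE x in lborel. x \<notin> {x. n \<bullet> x = a - 1/2}" by (simp add: AE_completion_iff)
    then show "AE x in lborel. indicator ?S x * ?f (proj n a x)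
       = indicator {x. -1/2 < n \<bullet> x - a \<and> n \<bullet> x - a \<le> -1/2 + 1} x * ?f (proj n a x)"
      by eventually_elim (auto simp: indicator_def abs_if split: if_splits)
  qed auto
  also have "\<dots> = 1 * plane_integral n a ?f"
  proof -
    obtain B where "\<And>x. x \<in> F \<Longrightarrow> norm x \<le> B" using F(3) by (auto simp: bounded_iff)
    moreover have "\<bar>g x\<bar> \<le> \<bar>M\<bar>" if "x \<in> F" for x using M[OF that] by linarith
    ultimately show ?thesis
      by (intro strip_integral_linear[OF n, of _ "\<bar>M\<bar>" B]) (auto simp: indicator_def)
  qed
  finally show ?thesis by simp
qed

text \<open>
  The difference quotient of \<open>G\<close> along \<open>e\<close>, integrated over the half-space, telescopes to the integral
  of \<open>G\<close> over a thin strip beyond the bounding plane, divided by the step.  The function \<open>G\<close> may jump, which allows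
  polynomials cut off at the lateral faces of a simplex; the functions \<open>H k\<close> bound the error of replacing \<open>G\<close> on the
  strip by its values on the plane.
\<close>

lemma half_space_integral_transversal:
  fixes G G' :: "real^'n \<Rightarrow> real" and H :: "nat \<Rightarrow> real^'n \<Rightarrow> real"
  assumes n: "norm n = 1" and m: "n \<bullet> e > 0"
    and G [measurable]: "G \<in> borel_measurable borel" and G' [measurable]: "G' \<in> borel_measurable borel"
    and M: "\<And>x. \<bar>G x\<bar> \<le> M" and B: "\<And>x. G x \<noteq> 0 \<Longrightarrow> norm x \<le> B"
    and lip: "\<And>x t. n \<bullet> x \<le> a \<Longrightarrow> 0 < t \<Longrightarrow> t \<le> 1 \<Longrightarrow> \<bar>G (x + t *\<^sub>R e) - G x\<bar> \<le> L * t"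
    and lim: "AE x in lborel. n \<bullet> x \<le> a \<longrightarrow>
      (\<lambda>k. (G (x + (1 / real (Suc k)) *\<^sub>R e) - G x) * real (Suc k)) \<longlonglongrightarrow> G' x"
    and H [measurable]: "\<And>k. H k \<in> borel_measurable borel"
    and HM: "\<And>k y. \<bar>H k y\<bar> \<le> M'" and HB: "\<And>k y. H k y \<noteq> 0 \<Longrightarrow> norm y \<le> B"
    and Hlim: "AE x in lborel. (\<lambda>k. H k (proj n a x)) \<longlonglongrightarrow> 0"
    and close: "\<And>x k. 0 < n \<bullet> x - a \<Longrightarrow> n \<bullet> x - a \<le> (n \<bullet> e) / real (Suc k) \<Longrightarrow>
      \<bar>G x - G (proj n a x)\<bar> \<le> H k (proj n a x)"
  shows "(\<integral>x. indicator {x. n \<bullet> x \<le> a} x * G' x \<partial>lborel) = (n \<bullet> e) * plane_integral n a G"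
proof -
  define m where "m = n \<bullet> e"
  have m0: "m > 0" using m by (simp add: m_def)
  define t where "t k = 1 / real (Suc k)" for k
  have t: "0 < t k" "t k \<le> 1" "real (Suc k) * t k = 1" for k by (auto simp: t_def)
  have cancel: "(t k * m) * X * real (Suc k) = m * X" for X k
  proof -
    have "(t k * m) * X * real (Suc k) = m * X * (real (Suc k) * t k)" by (simp only: mult_ac)
    then show ?thesis by (simp only: t(3) mult_1_right)
  qed
  have tm: "0 \<le> t k * m" for k using mult_pos_pos[OF t(1)[of k] m0] by simp
  have L0: "L \<ge> 0" using lip[of "(a - 1) *\<^sub>R n" 1] n by (auto simp: dot_square_norm)
  have [measurable]: "{x::real^'n. n \<bullet> x \<le> a} \<in> sets borel" by measurable
  let ?I = "indicator {x. n \<bullet> x \<le> a} :: real^'n \<Rightarrow> real"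
  let ?S = "\<lambda>k. indicator {x. 0 < n \<bullet> x - a \<and> n \<bullet> x - a \<le> t k * m} :: real^'n \<Rightarrow> real"
  define D where "D k = (\<integral>x. ?I x * ((G (x + t k *\<^sub>R e) - G x) * real (Suc k)) \<partial>lborel)" for k
  have "D \<longlonglongrightarrow> (\<integral>x. ?I x * G' x \<partial>lborel)"
    unfolding D_def
  proof (rule integral_dominated_convergence)
    show "integrable lborel (\<lambda>x::real^'n. L * indicator (cball 0 (B + norm e)) x :: real)"
      by (rule integrable_bounded_support[where M=L and B="B + norm e"])
         (use L0 in \<open>auto simp: indicator_def split: if_splits\<close>)
    show "AE x in lborel. (\<lambda>k. ?I x * ((G (x + t k *\<^sub>R e) - G x) * real (Suc k))) \<longlonglongrightarrow> ?I x * G' x"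
      using lim by eventually_elim (auto simp: indicator_def t_def)
    show "AE x in lborel. norm (?I x * ((G (x + t k *\<^sub>R e) - G x) * real (Suc k)))
        \<le> L * indicator (cball 0 (B + norm e)) x" for k
    proof (rule AE_I2)
      fix x
      have "\<bar>G (x + t k *\<^sub>R e) - G x\<bar> * real (Suc k) \<le> L * t k * real (Suc k)" if "n \<bullet> x \<le> a"
        using lip[OF that t(1,2)] by (intro mult_right_mono) auto
      moreover have "L * t k * real (Suc k) = L * (real (Suc k) * t k)" by (simp only: mult_ac)
      ultimately have 1: "\<bar>G (x + t k *\<^sub>R e) - G x\<bar> * real (Suc k) \<le> L" if "n \<bullet> x \<le> a"
        using that by (simp only: t(3) mult_1_right)
      have 2: "norm x \<le> B + norm e" if "G (x + t k *\<^sub>R e) - G x \<noteq> 0"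
      proof (cases "G x = 0")
        case False
        then show ?thesis using B[of x] by (simp add: add_increasing2)
      next
        case True
        then have "norm (x + t k *\<^sub>R e) \<le> B" using B that by auto
        moreover have "norm x \<le> norm (x + t k *\<^sub>R e) + norm (t k *\<^sub>R e)"
          using norm_triangle_ineq4[of "x + t k *\<^sub>R e" "t k *\<^sub>R e"] by simp
        moreover have "norm (t k *\<^sub>R e) \<le> norm e" using t[of k] by (simp add: mult_left_le_one_le)
        ultimately show ?thesis by linarith
      qed
      show "norm (?I x * ((G (x + t k *\<^sub>R e) - G x) * real (Suc k))) \<le> L * indicator (cball 0 (B + norm e)) x"
        using 1 2 L0 by (cases "G (x + t k *\<^sub>R e) - G x = 0") (auto simp: indicator_def abs_mult)
    qed
  qed measurable
  moreover have "D \<longlonglongrightarrow> m * plane_integral n a G"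
  proof -
    have Deq: "D k = (\<integral>x. ?S k x * G x \<partial>lborel) * real (Suc k)" for k
    proof -
      have i: "integrable lborel (\<lambda>x. indicator {x. n \<bullet> x \<le> c} x * G x)" for c
      proof (rule integrable_bounded_support[where M="\<bar>M\<bar>" and B=B])
        show "norm (indicator {x. n \<bullet> x \<le> c} x * G x) \<le> \<bar>M\<bar>" for x
          using M[of x] by (auto simp: indicator_def)
        show "norm x \<le> B" if "indicator {x. n \<bullet> x \<le> c} x * G x \<noteq> 0" for x
          using that B by auto
      qed measurable
      have shift: "indicator {x. n \<bullet> x \<le> a + t k * m} (x + t k *\<^sub>R e) = ?I x" for x
        by (auto simp: indicator_def inner_right_distrib m_def)
      have int1: "integrable lborel (\<lambda>x. ?I x * G (x + t k *\<^sub>R e))"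
      proof (rule integrable_bounded_support[where M="\<bar>M\<bar>" and B="B + norm (t k *\<^sub>R e)"])
        show "norm (?I x * G (x + t k *\<^sub>R e)) \<le> \<bar>M\<bar>" for x
          using M[of "x + t k *\<^sub>R e"] by (auto simp: indicator_def)
        show "norm x \<le> B + norm (t k *\<^sub>R e)" if "?I x * G (x + t k *\<^sub>R e) \<noteq> 0" for x
          using that B[of "x + t k *\<^sub>R e"] norm_triangle_ineq4[of "x + t k *\<^sub>R e" "t k *\<^sub>R e"] by auto
      qed measurable
      have "D k = ((\<integral>x. ?I x * G (x + t k *\<^sub>R e) \<partial>lborel) - (\<integral>x. ?I x * G x \<partial>lborel)) * real (Suc k)"
        unfolding D_def Bochner_Integration.integral_diff[OF int1 i, symmetric] integral_mult_left_zero[symmetric]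
        by (simp only: right_diff_distrib left_diff_distrib mult.assoc)
      also have "(\<integral>x. ?I x * G (x + t k *\<^sub>R e) \<partial>lborel) = (\<integral>x. indicator {x. n \<bullet> x \<le> a + t k * m} x * G x \<partial>lborel)"
        by (subst (2) integral_translate[of _ "t k *\<^sub>R e"]) (simp_all add: shift)
      also have "\<dots> - (\<integral>x. ?I x * G x \<partial>lborel) = (\<integral>x. ?S k x * G x \<partial>lborel)"
        using mult_pos_pos[OF t(1)[of k] m0]
        by (subst Bochner_Integration.integral_diff[OF i i, symmetric])
           (auto simp: indicator_def intro!: Bochner_Integration.integral_cong)
      finally show ?thesis .
    qed
    have iS: "integrable lborel (\<lambda>x. ?S k x * G x)" for k
    proof (rule integrable_bounded_support[where M="\<bar>M\<bar>" and B=B])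
      show "norm (?S k x * G x) \<le> \<bar>M\<bar>" for x
        using M[of x] by (auto simp: indicator_def)
      show "norm x \<le> B" if "?S k x * G x \<noteq> 0" for x
        using that B by auto
    qed measurable
    have main: "(\<integral>x. ?S k x * G (proj n a x) \<partial>lborel) * real (Suc k) = m * plane_integral n a G" for k
    proof -
      have "(\<integral>x. ?S k x * G (proj n a x) \<partial>lborel) = (t k * m) * plane_integral n a G"
        using strip_integral_linear[OF n G M B, of "t k * m" 0 a] t(1)[of k] m0 by simp
      then show ?thesis by (simp only: cancel)
    qed
    have err: "\<bar>D k - m * plane_integral n a G\<bar> \<le> m * plane_integral n a (H k)" for k
    proof -
      have "D k - m * plane_integral n a G = (\<integral>x. ?S k x * G x - ?S k x * G (proj n a x) \<partial>lborel) * real (Suc k)"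
        unfolding main[symmetric, of k] Deq
        using strip_integrable[OF n G M B, of 0 a "t k * m"] iS[of k]
        by (subst Bochner_Integration.integral_diff) (auto simp: algebra_simps)
      then have "\<bar>D k - m * plane_integral n a G\<bar> = \<bar>\<integral>x. ?S k x * G x - ?S k x * G (proj n a x) \<partial>lborel\<bar> * real (Suc k)"
        by (simp only: abs_mult abs_of_nat)
      moreover have "\<bar>\<integral>x. ?S k x * G x - ?S k x * G (proj n a x) \<partial>lborel\<bar> \<le> (\<integral>x. ?S k x * H k (proj n a x) \<partial>lborel)"
      proof (rule integral_abs_bound_integral)
        show "integrable lborel (\<lambda>x. ?S k x * G x - ?S k x * G (proj n a x))"
          using strip_integrable[OF n G M B, of 0 a "t k * m"] iS[of k] by (intro Bochner_Integration.integrable_diff) auto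
        show "integrable lborel (\<lambda>x. ?S k x * H k (proj n a x))"
          using strip_integrable[OF n H HM[where k=k] HB[where k=k], of 0 a "t k * m"] by simp
        show "\<bar>?S k x * G x - ?S k x * G (proj n a x)\<bar> \<le> ?S k x * H k (proj n a x)" for x
          using close[of x k] by (auto simp: indicator_def t_def m_def)
      qed
      then have "\<bar>\<integral>x. ?S k x * G x - ?S k x * G (proj n a x) \<partial>lborel\<bar> * real (Suc k)
          \<le> (\<integral>x. ?S k x * H k (proj n a x) \<partial>lborel) * real (Suc k)" by (rule mult_right_mono) simp
      moreover have "(\<integral>x. ?S k x * H k (proj n a x) \<partial>lborel) * real (Suc k) = m * plane_integral n a (H k)"
      proof -
        have "(\<integral>x. ?S k x * H k (proj n a x) \<partial>lborel) = (t k * m) * plane_integral n a (H k)"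
          using strip_integral_linear[OF n H HM[where k=k] HB[where k=k] tm[of k], of 0 a] by simp
        then show ?thesis by (simp only: cancel)
      qed
      ultimately show ?thesis by (simp only:)
    qed
    have "(\<lambda>k. plane_integral n a (H k)) \<longlonglongrightarrow> (\<integral>x. 0 \<partial>(lborel :: (real^'n) measure))"
      unfolding plane_integral_def
    proof (rule integral_dominated_convergence)
      let ?w = "\<lambda>y::real^'n. \<bar>M'\<bar> * indicator (cball 0 B) y :: real"
      show "integrable lborel (\<lambda>x. indicator {x. 0 < n \<bullet> x - a \<and> n \<bullet> x - a \<le> 1} x * ?w (proj n a x))"
        by (rule strip_integrable[OF n, where M="\<bar>M'\<bar>" and B=B]) (auto simp: indicator_def split: if_splits)
      show "AE x in lborel. (\<lambda>k. indicator {x. 0 < n \<bullet> x - a \<and> n \<bullet> x - a \<le> 1} x * H k (proj n a x)) \<longlonglongrightarrow> 0"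
        using Hlim by eventually_elim (auto intro: tendsto_eq_intros)
      show "AE x in lborel. norm (indicator {x. 0 < n \<bullet> x - a \<and> n \<bullet> x - a \<le> 1} x * H k (proj n a x))
         \<le> indicator {x. 0 < n \<bullet> x - a \<and> n \<bullet> x - a \<le> 1} x * ?w (proj n a x)" for k
      proof (rule AE_I2)
        fix x
        have "\<bar>H k (proj n a x)\<bar> \<le> ?w (proj n a x)"
          using HM[of k "proj n a x"] HB[of k "proj n a x"]
          by (cases "H k (proj n a x) = 0") (auto simp: indicator_def)
        then show "norm (indicator {x. 0 < n \<bullet> x - a \<and> n \<bullet> x - a \<le> 1} x * H k (proj n a x))
         \<le> indicator {x. 0 < n \<bullet> x - a \<and> n \<bullet> x - a \<le> 1} x * ?w (proj n a x)"
          by (auto simp: indicator_def)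
      qed
    qed measurable
    then have "(\<lambda>k. m * plane_integral n a (H k)) \<longlonglongrightarrow> 0" by (auto intro: tendsto_mult_right_zero)
    then have "(\<lambda>k. D k - m * plane_integral n a G) \<longlonglongrightarrow> 0"
      by (rule Lim_null_comparison[rotated]) (use err in simp)
    then show ?thesis by (simp add: LIM_zero_iff)
  qed
  ultimately show ?thesis unfolding m_def by (rule LIMSEQ_unique)
qed

lemma abs_poly_of_le:
  assumes a: "\<And>\<alpha>. \<alpha> \<in> midx p \<Longrightarrow> \<bar>a \<alpha>\<bar> \<le> A" and x: "norm (x::real^'n) \<le> K" and K: "K \<ge> 1"
  shows "\<bar>poly_of p a x\<bar> \<le> real (card (midx p :: ('n \<Rightarrow> nat) set)) * (K ^ p * A)"
proof -
  have "\<bar>a \<alpha> * monom_fun \<alpha> x\<bar> \<le> K ^ p * A" if \<alpha>: "\<alpha> \<in> midx p" for \<alpha>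
  proof -
    have "\<bar>monom_fun \<alpha> x\<bar> = (\<Prod>i\<in>UNIV. \<bar>x $ i\<bar> ^ \<alpha> i)"
      by (simp add: monom_fun_def abs_prod power_abs)
    also have "\<dots> \<le> (\<Prod>i\<in>UNIV. K ^ \<alpha> i)"
      using x component_le_norm_cart[of x] by (intro prod_mono conjI power_mono) (auto intro: order_trans)
    also have "\<dots> = K ^ (\<Sum>i\<in>UNIV. \<alpha> i)" by (simp add: power_sum)
    also have "\<dots> \<le> K ^ p" using \<alpha> K by (intro power_increasing) auto
    finally have "\<bar>monom_fun \<alpha> x\<bar> \<le> K ^ p" .
    from mult_mono[OF a[OF \<alpha>] this] a[OF \<alpha>] show ?thesis by (simp add: abs_mult mult.commute)
  qed
  then have "\<bar>poly_of p a x\<bar> \<le> (\<Sum>\<alpha>\<in>(midx p :: ('n \<Rightarrow> nat) set). K ^ p * A)"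
    unfolding poly_of_def by (intro order_trans[OF sum_abs] sum_mono) auto
  then show ?thesis by simp
qed

lemma abs_le_of_square_le: "(x::real)\<^sup>2 \<le> y \<Longrightarrow> \<bar>x\<bar> \<le> sqrt y"
  by (metis real_sqrt_abs real_sqrt_le_mono)

text \<open>
  After the dilation that maps the ball to the unit ball the coefficients are controlled by \<open>coeff_bound\<close>.
\<close>

lemma unit_coefficients:
  "\<exists>C>0. \<forall>f\<in>polys p. \<forall>x0 r. r > 0 \<longrightarrow> (\<exists>a. (\<forall>y::real^'n. f (x0 + r *\<^sub>R y) = poly_of p a y)
     \<and> (\<forall>\<alpha>\<in>midx p. \<bar>a \<alpha>\<bar> \<le> sqrt (C * mean_sq f x0 r)))"
proof -
  obtain C where C: "C > 0" "\<And>a \<alpha>. \<alpha> \<in> midx p \<Longrightarrow>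
      (a \<alpha>)\<^sup>2 \<le> C * mean_sq (poly_of p a :: real^'n \<Rightarrow> real) 0 1"
    using coeff_bound by blast
  have "\<exists>a. (\<forall>y::real^'n. f (x0 + r *\<^sub>R y) = poly_of p a y)
     \<and> (\<forall>\<alpha>\<in>midx p. \<bar>a \<alpha>\<bar> \<le> sqrt (C * mean_sq f x0 r))" if f: "f \<in> polys p" and r: "r > 0" for f :: "real^'n \<Rightarrow> real" and x0 r
  proof -
    obtain a where a: "(\<lambda>y. f (x0 + r *\<^sub>R y)) = poly_of p a"
      using polys_scale_subst[OF f] by (rule polysE)
    have "\<bar>a \<alpha>\<bar> \<le> sqrt (C * mean_sq f x0 r)" if "\<alpha> \<in> midx p" for \<alpha>
      unfolding mean_sq_scale[OF polys_borel[OF f] r] a by (rule abs_le_of_square_le) (rule C(2)[OF that])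
    then show ?thesis using a by (auto simp: fun_eq_iff)
  qed
  then show ?thesis using C(1) by blast
qed

lemma grad_scale_subst:
  fixes f :: "real^'n \<Rightarrow> real"
  assumes "f differentiable (at (x0 + r *\<^sub>R y))"
  shows "grad (\<lambda>y. f (x0 + r *\<^sub>R y)) y = r *\<^sub>R grad f (x0 + r *\<^sub>R y)"
proof (rule grad_unique)
  have "((\<lambda>y. x0 + r *\<^sub>R y) has_derivative (\<lambda>h. r *\<^sub>R h)) (at y)"
    by (auto intro!: derivative_eq_intros)
  from has_derivative_compose[OF this has_derivative_grad[OF assms]]
  show "((\<lambda>y. f (x0 + r *\<^sub>R y)) has_derivative (\<lambda>h. (r *\<^sub>R grad f (x0 + r *\<^sub>R y)) \<bullet> h)) (at y)"
    by simp
qed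

lemma norm_le_card_bound:
  fixes v :: "real^'n" assumes "\<And>i. \<bar>v $ i\<bar> \<le> A" shows "norm v \<le> real CARD('n) * A"
proof -
  have "norm v \<le> (\<Sum>i\<in>UNIV. \<bar>v $ i\<bar>)" by (rule norm_le_l1_cart)
  also have "\<dots> \<le> (\<Sum>i\<in>(UNIV::'n set). A)" by (intro sum_mono assms)
  finally show ?thesis by simp
qed

lemma norm_rescaled_le:
  fixes x :: "real^'n" assumes "r > 0" "x \<in> cball x0 (K * r)" shows "norm ((1 / r) *\<^sub>R (x - x0)) \<le> K"
  using assms unfolding norm_scaleR by (simp add: dist_norm norm_minus_commute field_simps)

text \<open>
  Both bounds follow from the coefficients after rescaling; the ball on the left may be larger than the one
  whose mean square appears, since a polynomial is determined by its values on any ball.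
\<close>

lemma polys_inverse_estimate:
  assumes K: "K \<ge> 1"
  shows "\<exists>C>0. \<forall>f\<in>polys p. \<forall>x0 r x. r > 0 \<longrightarrow> (x::real^'n) \<in> cball x0 (K * r) \<longrightarrow>
     (f x)\<^sup>2 \<le> C * mean_sq f x0 r \<and> (r * norm (grad f x))\<^sup>2 \<le> C * mean_sq f x0 r"
proof -
  obtain C where C1: "C > 0" and C2: "\<forall>f\<in>polys (p). \<forall>x0 r. r > 0 \<longrightarrow> (\<exists>a. (\<forall>y::real^'n. f (x0 + r *\<^sub>R y) = poly_of (p) a y)
     \<and> (\<forall>\<alpha>\<in>midx (p). \<bar>a \<alpha>\<bar> \<le> sqrt (C * mean_sq f x0 r)))"
    using unit_coefficients[where 'n='n and p="p"] by (elim exE conjE)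
  define N where "N = real (card (midx p :: ('n \<Rightarrow> nat) set)) * K ^ p"
  define N' where "N' = real CARD('n) * (N * real (Suc p))"
  have N0: "N \<ge> 0" "N' \<ge> 0" using K by (auto simp: N_def N'_def)
  define D where "D = (N\<^sup>2 + N'\<^sup>2 + 1) * C"
  have D: "D > 0" unfolding D_def using C1 by (intro mult_pos_pos) (auto intro: add_nonneg_pos)
  have "(f x)\<^sup>2 \<le> D * mean_sq f x0 r \<and> (r * norm (grad f x))\<^sup>2 \<le> D * mean_sq f x0 r"
    if f: "f \<in> polys p" and r: "r > 0" and x: "x \<in> cball x0 (K * r)" for f x0 r and x :: "real^'n"
  proof -
    define M where "M = mean_sq f x0 r"
    have M0: "M \<ge> 0" unfolding M_def by (rule mean_sq_nonneg[OF r])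
    define A where "A = sqrt (C * M)"
    have A0: "A \<ge> 0" "A\<^sup>2 = C * M" using C1 M0 by (auto simp: A_def)
    obtain a where a': "\<forall>y::real^'n. f (x0 + r *\<^sub>R y) = poly_of p a y" and
      aA': "\<forall>\<alpha>\<in>midx p. \<bar>a \<alpha>\<bar> \<le> sqrt (C * mean_sq f x0 r)"
      using C2[rule_format, OF f r, of x0] by (elim exE conjE)
    have a: "f (x0 + r *\<^sub>R y) = poly_of p a y" for y using a' by (rule spec)
    have aA: "\<bar>a \<alpha>\<bar> \<le> A" if "\<alpha> \<in> midx p" for \<alpha>
      unfolding A_def M_def using aA' that by (rule bspec)
    define y where "y = (1 / r) *\<^sub>R (x - x0)"
    have xy: "x0 + r *\<^sub>R y = x" using r by (simp add: y_def)
    have y: "norm y \<le> K" unfolding y_def by (rule norm_rescaled_le[OF r x])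
    have 1: "\<bar>f x\<bar> \<le> N * A"
      using abs_poly_of_le[OF aA y K] a[of y] by (simp add: xy N_def mult.assoc)
    have 2: "r * norm (grad f x) \<le> N' * A"
    proof -
      have g: "grad (poly_of p a) y = r *\<^sub>R grad f x"
        using grad_scale_subst[OF polys_differentiable[OF f], of x0 r y] unfolding a xy
        by (simp add: fun_eq_iff[symmetric])
      have "norm (grad (poly_of p a) y) \<le> N' * A"
      proof (cases p)
        case 0
        then have "poly_of p a = (\<lambda>_. a (\<lambda>_. 0))" by (auto simp: poly_of_0)
        then show ?thesis using N0 A0 by simp
      next
        case (Suc q)
        have "\<bar>grad (poly_of p a) y $ i\<bar> \<le> N * (real (Suc p) * A)" for i
        proof -
          have "\<bar>deriv_coeff i a \<beta>\<bar> \<le> real (Suc p) * A" if \<beta>: "\<beta> \<in> midx q" for \<beta>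
          proof -
            have "\<beta> i \<le> (\<Sum>j\<in>UNIV. \<beta> j)" by (rule member_le_sum) auto
            then have "real (Suc (\<beta> i)) \<le> real (Suc p)" using \<beta> Suc by simp
            moreover have "\<bar>a (raise i \<beta>)\<bar> \<le> A" using \<beta> Suc by (intro aA) (simp add: sum_raise)
            ultimately show ?thesis unfolding deriv_coeff_def abs_mult
              by (intro mult_mono) auto
          qed
          from abs_poly_of_le[OF this y K]
          have "\<bar>grad (poly_of p a) y $ i\<bar> \<le> real (card (midx q :: ('n \<Rightarrow> nat) set)) * (K ^ q * (real (Suc p) * A))"
            by (simp add: Suc grad_poly_of)
          also have "\<dots> \<le> real (card (midx p :: ('n \<Rightarrow> nat) set)) * (K ^ p * (real (Suc p) * A))"
            using K A0 Suc
            by (intro mult_mono power_increasing of_nat_mono card_mono finite_multi_indices) auto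
          finally show ?thesis by (simp add: N_def mult.assoc)
        qed
        from norm_le_card_bound[OF this] show ?thesis by (simp add: N'_def mult_ac)
      qed
      then show ?thesis using r by (simp add: g)
    qed
    have "(f x)\<^sup>2 \<le> (N * A)\<^sup>2" using 1 by (metis abs_ge_zero power2_abs power_mono)
    moreover have "(r * norm (grad f x))\<^sup>2 \<le> (N' * A)\<^sup>2" using 2 r by (intro power_mono) auto
    moreover have "(N * A)\<^sup>2 \<le> D * M" "(N' * A)\<^sup>2 \<le> D * M"
      using M0 C1 unfolding power_mult_distrib A0(2) D_def by (auto simp: algebra_simps)
    ultimately show ?thesis unfolding M_def by linarith
  qed
  then show ?thesis using D by blast
qed

text \<open>
  Lowering the degree by one with control of the parts: this provides the polynomial factors of degree \<open>p\<close>
  in the test field of \<open>trace_mismatch_estimate\<close>.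
\<close>

lemma polys_decomposition:
  assumes K: "K \<ge> 1"
  shows "\<exists>C>0. \<forall>f\<in>polys (Suc p). \<forall>x0 r. r > 0 \<longrightarrow> (\<exists>c q. (\<forall>i. q i \<in> polys p) \<and>
     (\<forall>x::real^'n. f x = c + (\<Sum>i\<in>UNIV. (x - x0) $ i / r * q i x)) \<and> \<bar>c\<bar> \<le> C * sqrt (mean_sq f x0 r) \<and>
     (\<forall>i. \<forall>x\<in>cball x0 (K * r). \<bar>q i x\<bar> \<le> C * sqrt (mean_sq f x0 r)))"
proof -
  obtain C where C1: "C > 0" and C2: "\<forall>f\<in>polys (Suc p). \<forall>x0 r. r > 0 \<longrightarrow> (\<exists>a. (\<forall>y::real^'n. f (x0 + r *\<^sub>R y) = poly_of (Suc p) a y)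
     \<and> (\<forall>\<alpha>\<in>midx (Suc p). \<bar>a \<alpha>\<bar> \<le> sqrt (C * mean_sq f x0 r)))"
    using unit_coefficients[where 'n='n and p="Suc p"] by (elim exE conjE)
  define N where "N = real (card (midx p :: ('n \<Rightarrow> nat) set)) * K ^ p"
  have N0: "N \<ge> 0" using K by (auto simp: N_def)
  have "\<exists>c q. (\<forall>i. q i \<in> polys p) \<and>
     (\<forall>x::real^'n. f x = c + (\<Sum>i\<in>UNIV. (x - x0) $ i / r * q i x)) \<and> \<bar>c\<bar> \<le> ((N + 1) * sqrt C) * sqrt (mean_sq f x0 r) \<and>
     (\<forall>i. \<forall>x\<in>cball x0 (K * r). \<bar>q i x\<bar> \<le> ((N + 1) * sqrt C) * sqrt (mean_sq f x0 r))"
    if f: "f \<in> polys (Suc p)" and r: "r > 0" for f x0 r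
  proof -
    define A where "A = sqrt (C * mean_sq f x0 r)"
    have A0: "A \<ge> 0" using C1 mean_sq_nonneg[OF r, of f x0] by (simp add: A_def)
    obtain a where a': "\<forall>y::real^'n. f (x0 + r *\<^sub>R y) = poly_of (Suc p) a y" and
      aA': "\<forall>\<alpha>\<in>midx (Suc p). \<bar>a \<alpha>\<bar> \<le> sqrt (C * mean_sq f x0 r)"
      using C2[rule_format, OF f r, of x0] by (elim exE conjE)
    have a: "f (x0 + r *\<^sub>R y) = poly_of (Suc p) a y" for y using a' by (rule spec)
    have aA: "\<bar>a \<alpha>\<bar> \<le> A" if "\<alpha> \<in> midx (Suc p)" for \<alpha>
      unfolding A_def using aA' that by (rule bspec)
    define q where "q = (\<lambda>i x. poly_of p (lower i a) ((- (1 / r)) *\<^sub>R x0 + (1 / r) *\<^sub>R x))"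
    have arg: "(- (1 / r)) *\<^sub>R x0 + (1 / r) *\<^sub>R x = (1 / r) *\<^sub>R (x - x0)" for x
      by (simp add: scaleR_right_diff_distrib)
    have d1: "q i \<in> polys p" for i unfolding q_def by (rule polys_scale_subst) simp
    have d2: "f x = a (\<lambda>_. 0) + (\<Sum>i\<in>UNIV. (x - x0) $ i / r * q i x)" for x
    proof -
      have "f x = poly_of (Suc p) a ((1 / r) *\<^sub>R (x - x0))"
        using a[of "(1 / r) *\<^sub>R (x - x0)"] r by simp
      then show ?thesis unfolding q_def arg by (simp add: poly_of_Suc)
    qed
    have d3: "\<bar>a (\<lambda>_. 0)\<bar> \<le> (N + 1) * A"
    proof -
      have "\<bar>a (\<lambda>_. 0)\<bar> \<le> 1 * A" using aA[of "\<lambda>_. 0"] by simp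
      also have "\<dots> \<le> (N + 1) * A" using N0 A0 by (intro mult_right_mono) auto
      finally show ?thesis .
    qed
    have d4: "\<bar>q i x\<bar> \<le> (N + 1) * A" if x: "x \<in> cball x0 (K * r)" for i x
    proof -
      have n: "norm ((1 / r) *\<^sub>R (x - x0)) \<le> K"
        by (rule norm_rescaled_le[OF r x])
      have low: "\<bar>lower i a \<beta>\<bar> \<le> A" if "\<beta> \<in> midx p" for \<beta>
        using that A0 aA[of "raise i \<beta>"] by (simp add: lower_def sum_raise)
      have "\<bar>q i x\<bar> \<le> N * A"
        unfolding q_def arg N_def mult.assoc by (rule abs_poly_of_le[OF low n K])
      also have "\<dots> \<le> (N + 1) * A" using A0 by (intro mult_right_mono) auto
      finally show ?thesis .
    qed
    have eqA: "(N + 1) * A = ((N + 1) * sqrt C) * sqrt (mean_sq f x0 r)"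
      by (simp add: A_def real_sqrt_mult)
    show ?thesis
      by (intro exI[of _ "a (\<lambda>_. 0)"] exI[of _ q] conjI allI ballI d1 d2 d3[unfolded eqA] d4[unfolded eqA])
  qed
  moreover have "(N + 1) * sqrt C > 0" using N0 C1 by (intro mult_pos_pos) auto
  ultimately show ?thesis by blast
qed

text \<open>
  Functions to which the divergence theorem is applied: products of polynomials and bubbles.
\<close>

definition C1_compact :: "(real^'n \<Rightarrow> real) \<Rightarrow> bool" where
  "C1_compact G \<longleftrightarrow> (\<forall>x. G differentiable (at x)) \<and> continuous_on UNIV (grad G) \<and> (\<exists>B. \<forall>x. G x \<noteq> 0 \<longrightarrow> norm x \<le> B)"

lemma grad_zero_outside:
  fixes G :: "real^'n \<Rightarrow> real"
  assumes "\<And>x. G x \<noteq> 0 \<Longrightarrow> x \<in> S" "closed S" "x \<notin> S"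
  shows "grad G x = 0"
proof (rule grad_unique)
  have op: "open (- S)" using assms(2) by auto
  have d0: "((\<lambda>_. 0::real) has_derivative (\<lambda>h. 0)) (at x)" by simp
  have "(G has_derivative (\<lambda>h. 0)) (at x)"
    by (rule has_derivative_transform_within_open[OF d0 op]) (use assms in auto)
  then show "(G has_derivative (\<lambda>h. 0 \<bullet> h)) (at x)" by simp
qed

lemma lipschitz_of_grad_bound:
  fixes G :: "real^'n \<Rightarrow> real"
  assumes d: "\<And>z. z \<in> closed_segment x y \<Longrightarrow> G differentiable (at z)"
    and L: "\<And>z. z \<in> closed_segment x y \<Longrightarrow> norm (grad G z) \<le> L"
  shows "\<bar>G y - G x\<bar> \<le> L * norm (y - x)"
proof -
  have "norm (G y - G x) \<le> L * norm (y - x)"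
  proof (rule differentiable_bound[of "closed_segment x y" G "\<lambda>z h. grad G z \<bullet> h"])
    fix z assume z: "z \<in> closed_segment x y"
    show "(G has_derivative (\<bullet>) (grad G z)) (at z within closed_segment x y)"
      using has_derivative_grad[OF d[OF z]] by (rule has_derivative_at_withinI)
    show "onorm ((\<bullet>) (grad G z)) \<le> L"
    proof (rule onorm_le)
      fix h
      have "\<bar>grad G z \<bullet> h\<bar> \<le> norm (grad G z) * norm h" by (rule Cauchy_Schwarz_ineq2)
      also have "\<dots> \<le> L * norm h" by (intro mult_right_mono L z) simp
      finally show "norm (grad G z \<bullet> h) \<le> L * norm h" by simp
    qed
  qed auto
  then show ?thesis by simp
qed

lemma C1_compact_bounds:
  fixes G :: "real^'n \<Rightarrow> real"
  assumes "C1_compact G"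
  obtains M L B where "\<And>x. \<bar>G x\<bar> \<le> M" "\<And>x. norm (grad G x) \<le> L" "\<And>x. G x \<noteq> 0 \<Longrightarrow> norm x \<le> B"
    "\<And>x. grad G x \<noteq> 0 \<Longrightarrow> norm x \<le> B" "B \<ge> 0" "L \<ge> 0"
proof -
  obtain B0 where B0: "\<And>x. G x \<noteq> 0 \<Longrightarrow> norm x \<le> B0" using assms by (auto simp: C1_compact_def)
  define B where "B = \<bar>B0\<bar>"
  have B: "G x \<noteq> 0 \<Longrightarrow> norm x \<le> B" for x using B0[of x] by (simp add: B_def)
  have gB: "grad G x \<noteq> 0 \<Longrightarrow> norm x \<le> B" for x
    using grad_zero_outside[of G "cball 0 B" x] B by auto
  have cG: "continuous_on UNIV G"
    using assms by (auto simp: C1_compact_def continuous_on_eq_continuous_at intro!: differentiable_imp_continuous_within)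
  have cg: "continuous_on UNIV (grad G)" using assms by (simp add: C1_compact_def)
  have "compact (G ` cball 0 B)" "compact (grad G ` cball 0 B)"
    by (rule compact_continuous_image[OF continuous_on_subset[OF cG] compact_cball], simp)
       (rule compact_continuous_image[OF continuous_on_subset[OF cg] compact_cball], simp)
  then have "bounded (G ` cball 0 B)" "bounded (grad G ` cball 0 B)"
    by (auto intro: compact_imp_bounded)
  then obtain M L where bnd: "\<forall>y\<in>G ` cball 0 B. norm y \<le> M" "\<forall>y\<in>grad G ` cball 0 B. norm y \<le> L"
    unfolding bounded_iff by (elim exE)
  have M: "norm (G x) \<le> M" and L: "norm (grad G x) \<le> L" if "x \<in> cball 0 B" for x
    using bnd that by blast+
  have "\<bar>G x\<bar> \<le> \<bar>M\<bar>" for x using M[of x] B[of x] by (cases "G x = 0") auto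
  moreover have "norm (grad G x) \<le> \<bar>L\<bar>" for x using L[of x] gB[of x] by (cases "grad G x = 0") auto
  ultimately show thesis using B gB that[of "\<bar>M\<bar>" "\<bar>L\<bar>" B] by (auto simp: B_def)
qed

lemma C1_compact_measurable:
  fixes G :: "real^'n \<Rightarrow> real"
  assumes "C1_compact G"
  shows "G \<in> borel_measurable borel" "(\<lambda>x. grad G x \<bullet> e) \<in> borel_measurable borel"
proof -
  have "continuous_on UNIV G" "continuous_on UNIV (grad G)"
    using assms by (auto simp: C1_compact_def continuous_on_eq_continuous_at intro!: differentiable_imp_continuous_within)
  then show "G \<in> borel_measurable borel" "(\<lambda>x. grad G x \<bullet> e) \<in> borel_measurable borel"
    by (auto intro!: borel_measurable_continuous_onI continuous_intros)
qed

lemma C1_compact_grad_integrable: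
  fixes G :: "real^'n \<Rightarrow> real"
  assumes G: "C1_compact G" and [measurable]: "D \<in> sets borel"
  shows "integrable lborel (\<lambda>x. indicator D x * (grad G x \<bullet> e))"
proof -
  obtain M L B where b: "\<And>x. \<bar>G x\<bar> \<le> M" "\<And>x. norm (grad G x) \<le> L" "\<And>x. G x \<noteq> 0 \<Longrightarrow> norm x \<le> B"
    "\<And>x. grad G x \<noteq> 0 \<Longrightarrow> norm x \<le> B" "B \<ge> 0" "L \<ge> 0"
    using C1_compact_bounds[OF G] by metis
  note [measurable] = C1_compact_measurable[OF G]
  show ?thesis
  proof (rule integrable_bounded_support[where M="L * norm e" and B=B])
    fix x
    have "\<bar>grad G x \<bullet> e\<bar> \<le> norm (grad G x) * norm e" by (rule Cauchy_Schwarz_ineq2)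
    also have "\<dots> \<le> L * norm e" by (intro mult_right_mono b) auto
    finally show "norm (indicator D x * (grad G x \<bullet> e)) \<le> L * norm e"
      using b(6) by (auto simp: indicator_def)
    show "indicator D x * (grad G x \<bullet> e) \<noteq> 0 \<Longrightarrow> norm x \<le> B"
      using b(4)[of x] by (cases "grad G x = 0") auto
  qed measurable
qed

text \<open>
  Here \<open>G\<close> is Lipschitz, so that its values on the strip differ from those on the plane by at most a multiple of
  the thickness.
\<close>

lemma half_space_integral_C1_transversal:
  fixes G :: "real^'n \<Rightarrow> real"
  assumes n: "norm n = 1" and G: "C1_compact G" and m: "n \<bullet> e > 0"
  shows "(\<integral>x. indicator {x. n \<bullet> x \<le> a} x * (grad G x \<bullet> e) \<partial>lborel) = (n \<bullet> e) * plane_integral n a G"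
proof -
  obtain M L B where b: "\<And>x. \<bar>G x\<bar> \<le> M" "\<And>x. norm (grad G x) \<le> L" "\<And>x. G x \<noteq> 0 \<Longrightarrow> norm x \<le> B"
    "\<And>x. grad G x \<noteq> 0 \<Longrightarrow> norm x \<le> B" "B \<ge> 0" "L \<ge> 0"
    using C1_compact_bounds[OF G] by metis
  have d: "G differentiable (at x)" for x using G by (simp add: C1_compact_def)
  have lip: "\<bar>G y - G x\<bar> \<le> L * norm (y - x)" for x y
    by (rule lipschitz_of_grad_bound) (auto intro: d b)
  define m where "m = n \<bullet> e"
  have m0: "m > 0" using m by (simp add: m_def)
  define H where "H k y = (L * m / real (Suc k)) * indicator (cball 0 (B + m)) y" for k and y :: "real^'n"
  have Suc1: "m / real (Suc k) \<le> m" for k using m0 by (simp add: field_simps)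
  show ?thesis
  proof (rule half_space_integral_transversal[OF n m C1_compact_measurable[OF G] b(1), where B="B + m" and H=H and L="L * norm e" and M'="L * m"])
    show "norm x \<le> B + m" if "G x \<noteq> 0" for x using b(3)[OF that] m0 by simp
    show "\<bar>G (x + t *\<^sub>R e) - G x\<bar> \<le> L * norm e * t" if "0 < t" for x t
      using lip[of "x + t *\<^sub>R e" x] that by (simp add: mult_ac)
    show "AE x in lborel. n \<bullet> x \<le> a \<longrightarrow>
      (\<lambda>k. (G (x + (1 / real (Suc k)) *\<^sub>R e) - G x) * real (Suc k)) \<longlonglongrightarrow> grad G x \<bullet> e"
    proof (intro AE_I2 impI)
      fix x
      have "((\<lambda>t. (G (x + t *\<^sub>R e) - G x) / t) \<longlongrightarrow> grad G x \<bullet> e) (at 0)"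
        using DERIV_line[OF d, of x e] by (simp add: DERIV_def)
      moreover have "filterlim (\<lambda>k. 1 / real (Suc k)) (at 0) sequentially"
        unfolding filterlim_at using LIMSEQ_inverse_real_of_nat by (auto simp: inverse_eq_divide)
      ultimately have "(\<lambda>k. (G (x + (1 / real (Suc k)) *\<^sub>R e) - G x) / (1 / real (Suc k))) \<longlonglongrightarrow> grad G x \<bullet> e"
        by (rule filterlim_compose)
      then show "(\<lambda>k. (G (x + (1 / real (Suc k)) *\<^sub>R e) - G x) * real (Suc k)) \<longlonglongrightarrow> grad G x \<bullet> e"
        by simp
    qed
    show "H k \<in> borel_measurable borel" for k unfolding H_def
      by (intro borel_measurable_times borel_measurable_const borel_measurable_indicator) simp
    show "\<bar>H k y\<bar> \<le> L * m" for k y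
    proof -
      have "L * (m / real (Suc k)) \<le> L * m" by (intro mult_left_mono Suc1 b)
      then show ?thesis using m0 b(6) unfolding H_def by (auto simp: indicator_def)
    qed
    show "norm y \<le> B + m" if "H k y \<noteq> 0" for k y
      using that by (auto simp: H_def indicator_def split: if_splits)
    show "AE x in lborel. (\<lambda>k. H k (proj n a x)) \<longlonglongrightarrow> 0"
    proof (rule AE_I2)
      fix x
      have "(\<lambda>k. L * m * inverse (real (Suc k)) * indicator (cball 0 (B + m)) (proj n a x)) \<longlonglongrightarrow> L * m * 0 * indicator (cball 0 (B + m)) (proj n a x)"
        by (intro tendsto_intros LIMSEQ_inverse_real_of_nat)
      then show "(\<lambda>k. H k (proj n a x)) \<longlonglongrightarrow> 0" by (simp add: H_def divide_inverse)
    qed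
    show "\<bar>G x - G (proj n a x)\<bar> \<le> H k (proj n a x)" if "0 < n \<bullet> x - a" "n \<bullet> x - a \<le> (n \<bullet> e) / real (Suc k)" for x k
    proof (cases "G x = 0 \<and> G (proj n a x) = 0")
      case True
      then show ?thesis using m0 b(6) by (simp add: H_def)
    next
      case False
      have dist: "norm (x - proj n a x) \<le> m / real (Suc k)"
        using that norm_diff_proj[OF n, of x a] by (simp add: m_def)
      have "norm (proj n a x) \<le> B + m"
      proof (cases "G x = 0")
        case True
        then show ?thesis using False b(3)[of "proj n a x"] m0 by simp
      next
        case F: False
        have "norm (proj n a x) \<le> norm x + norm (x - proj n a x)"
          using norm_triangle_ineq4[of x "x - proj n a x"] by simp
        then show ?thesis using b(3)[OF F] dist Suc1[of k] by linarith
      qed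
      moreover have "\<bar>G x - G (proj n a x)\<bar> \<le> L * (m / real (Suc k))"
        using lip[of x "proj n a x"] mult_left_mono[OF dist b(6)] by linarith
      ultimately show ?thesis by (simp add: H_def)
    qed
  qed
qed

text \<open>
  An arbitrary direction is the difference of two directions that point out of the half-space.
\<close>

theorem half_space_integral_C1:
  fixes G :: "real^'n \<Rightarrow> real"
  assumes n: "norm n = 1" and G: "C1_compact G"
  shows "(\<integral>x. indicator {x. n \<bullet> x \<le> a} x * (grad G x \<bullet> e) \<partial>lborel) = (n \<bullet> e) * plane_integral n a G"
proof -
  define c where "c = \<bar>n \<bullet> e\<bar> + 1"
  have nn: "n \<bullet> n = 1" using n by (simp add: dot_square_norm)
  have [measurable]: "{x::real^'n. n \<bullet> x \<le> a} \<in> sets borel" by measurable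
  have 1: "n \<bullet> (e + c *\<^sub>R n) > 0" "n \<bullet> (c *\<^sub>R n) > 0" by (auto simp: inner_right_distrib nn c_def)
  have "(\<integral>x. indicator {x. n \<bullet> x \<le> a} x * (grad G x \<bullet> e) \<partial>lborel)
     = (\<integral>x. indicator {x. n \<bullet> x \<le> a} x * (grad G x \<bullet> (e + c *\<^sub>R n))
          - indicator {x. n \<bullet> x \<le> a} x * (grad G x \<bullet> (c *\<^sub>R n)) \<partial>lborel)"
    by (intro Bochner_Integration.integral_cong) (auto simp: inner_right_distrib algebra_simps)
  also have "\<dots> = (n \<bullet> (e + c *\<^sub>R n)) * plane_integral n a G - (n \<bullet> (c *\<^sub>R n)) * plane_integral n a G"
    by (subst Bochner_Integration.integral_diff)
       (simp_all only: half_space_integral_C1_transversal[OF n G 1(1)] half_space_integral_C1_transversal[OF n G 1(2)]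
         C1_compact_grad_integrable[OF G] strip_measurable sets_lborel \<open>{x. n \<bullet> x \<le> a} \<in> sets borel\<close>)
  finally show ?thesis by (simp add: inner_right_distrib algebra_simps)
qed

text \<open>
  The half-space is chosen so large that the support lies in its interior.
\<close>

corollary integral_grad_zero:
  fixes G :: "real^'n \<Rightarrow> real"
  assumes G: "C1_compact G"
  shows "(\<integral>x. grad G x \<bullet> e \<partial>lborel) = 0"
proof -
  obtain M L B where b: "\<And>x. \<bar>G x\<bar> \<le> M" "\<And>x. norm (grad G x) \<le> L" "\<And>x. G x \<noteq> 0 \<Longrightarrow> norm x \<le> B"
    "\<And>x. grad G x \<noteq> 0 \<Longrightarrow> norm x \<le> B" "B \<ge> 0" "L \<ge> 0"
    using C1_compact_bounds[OF G] by metis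
  obtain n :: "real^'n" where n: "norm n = 1" by (metis norm_axis_1)
  have le: "n \<bullet> x \<le> norm x" for x using norm_cauchy_schwarz[of n x] n by simp
  have "G (proj n (B + 1) x) = 0" for x
    using b(3)[of "proj n (B + 1) x"] le[of "proj n (B + 1) x"] inner_proj[OF n, of "B + 1" x] by fastforce
  then have "plane_integral n (B + 1) G = 0" by (simp add: plane_integral_def)
  then have "(\<integral>x. indicator {x. n \<bullet> x \<le> B + 1} x * (grad G x \<bullet> e) \<partial>lborel) = 0"
    using half_space_integral_C1[OF n G, of "B + 1" e] by simp
  moreover have "indicator {x. n \<bullet> x \<le> B + 1} x * (grad G x \<bullet> e) = grad G x \<bullet> e" for x
    using b(4)[of x] le[of x] by (cases "grad G x = 0") (auto simp: indicator_def)
  ultimately show ?thesis by simp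
qed

section \<open>Smooth bumps and test functions\<close>

text \<open>
  A family of functions that is closed under partial derivatives consists of smooth functions, since the
  iterated derivatives can be chosen within the family.
\<close>

lemma smooth_coinduct:
  assumes "f \<in> \<F>"
    and step: "\<And>g. g \<in> \<F> \<Longrightarrow> \<exists>d. (\<forall>i. d i \<in> \<F>) \<and> (\<forall>x. (g has_derivative (\<lambda>h. \<Sum>i\<in>UNIV. h $ i * d i x)) (at (x::real^'n)))"
  shows "smooth f"
proof -
  have "\<forall>g\<in>\<F>. \<exists>d. (\<forall>i. d i \<in> \<F>) \<and> (\<forall>x. (g has_derivative (\<lambda>h. \<Sum>i\<in>UNIV. h $ i * d i x)) (at (x::real^'n)))"
    using step by (intro ballI)
  then obtain d where d: "\<forall>g\<in>\<F>. (\<forall>i. d g i \<in> \<F>) \<and> (\<forall>x. (g has_derivative (\<lambda>h. \<Sum>i\<in>UNIV. h $ i * d g i x)) (at (x::real^'n)))"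
    by (rule bchoice[THEN exE])
  define D where "D = rec_list f (\<lambda>i _ g. d g i)"
  have D: "D [] = f" "D (i # is) = d (D is) i" for i "is" by (simp_all add: D_def)
  have "D is \<in> \<F>" for "is" by (induction "is") (use assms(1) d D in auto)
  then have "\<forall>is x. (D is has_derivative (\<lambda>h. \<Sum>i\<in>UNIV. h $ i * D (i # is) x)) (at x)"
    using d D(2) by simp
  then show ?thesis unfolding smooth_def using D(1) by blast
qed

text \<open>
  The powers of \<open>1 / s\<close> are those that arise when \<open>exp (- 1 / s)\<close> is differentiated.
\<close>

definition bump_profile :: "nat \<Rightarrow> real \<Rightarrow> real" where
  "bump_profile k s = (if s > 0 then exp (- (1 / s)) / s ^ k else 0)"

lemma bump_profile_nonneg: "0 \<le> bump_profile k s"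
  by (simp add: bump_profile_def)

text \<open>
  From \<open>exp x \<ge> (x / n)\<^sup>n\<close>.
\<close>

lemma bump_profile_le:
  assumes "n > 0" "s > 0" shows "bump_profile k s \<le> (real n * s) ^ n / s ^ k"
proof -
  have "1 / (real n * s) \<le> exp (1 / (real n * s))"
    using exp_ge_add_one_self[of "1 / (real n * s)"] by linarith
  then have "(1 / (real n * s)) ^ n \<le> exp (1 / (real n * s)) ^ n"
    using assms by (intro power_mono) auto
  also have "\<dots> = exp (1 / s)" using assms by (simp flip: exp_of_nat_mult)
  finally have "1 / (real n * s) ^ n \<le> exp (1 / s)" by (simp add: power_divide)
  moreover have "(real n * s) ^ n > 0" using assms by simp
  ultimately have "exp (- (1 / s)) \<le> (real n * s) ^ n"
    by (simp add: exp_minus field_simps)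
  then show ?thesis using assms by (simp add: bump_profile_def divide_right_mono)
qed

lemma bump_profile_le_linear: "bump_profile k s \<le> real (Suc k) ^ Suc k * \<bar>s\<bar>"
proof (cases "s > 0")
  case True
  have "bump_profile k s \<le> (real (Suc k) * s) ^ Suc k / s ^ k" by (rule bump_profile_le) (use True in auto)
  also have "\<dots> = real (Suc k) ^ Suc k * s" using True by (simp only: power_mult_distrib) simp
  finally show ?thesis using True by simp
next
  case False
  then have "bump_profile k s = 0" by (simp add: bump_profile_def)
  then show ?thesis by (simp only:) simp
qed

lemma bump_profile_DERIV:
  "(bump_profile k has_real_derivative (bump_profile (k + 2) s - real k * bump_profile (k + 1) s)) (at s)"
proof -
  consider "s > 0" | "s < 0" | "s = 0" by linarith
  then show ?thesis
  proof cases
    case 1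
    let ?y = "inverse s"
    have "((\<lambda>s. exp (- inverse s) * inverse s ^ k) has_real_derivative
        exp (- ?y) * (?y * ?y) * ?y ^ k + exp (- ?y) * (real k * ?y ^ (k - 1) * - (?y * ?y))) (at s)"
      using 1 by (auto intro!: derivative_eq_intros)
    also have "exp (- ?y) * (?y * ?y) * ?y ^ k + exp (- ?y) * (real k * ?y ^ (k - 1) * - (?y * ?y))
       = bump_profile (k + 2) s - real k * bump_profile (k + 1) s"
      using 1 by (cases k) (simp_all add: bump_profile_def divide_inverse power_inverse algebra_simps)
    finally show ?thesis
      by (rule has_field_derivative_transform_within_open[of _ _ _ "{0<..}"])
         (use 1 in \<open>auto simp: bump_profile_def divide_inverse power_inverse\<close>)
  next
    case 2
    have "((\<lambda>s. 0) has_real_derivative 0) (at s)" by simp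
    then have "(bump_profile k has_real_derivative 0) (at s)"
      by (rule has_field_derivative_transform_within_open[of _ _ _ "{..<0}"])
         (use 2 in \<open>auto simp: bump_profile_def\<close>)
    then show ?thesis using 2 by (simp add: bump_profile_def)
  next
    case 3
    have "((\<lambda>h. (bump_profile k (0 + h) - bump_profile k 0) / h) \<longlongrightarrow> 0) (at 0)"
    proof (rule Lim_null_comparison)
      show "\<forall>\<^sub>F h in at 0. norm ((bump_profile k (0 + h) - bump_profile k 0) / h) \<le> real (Suc (Suc k)) ^ Suc (Suc k) * \<bar>h\<bar>"
      proof (rule always_eventually, rule allI)
        fix h :: real
        have "norm ((bump_profile k (0 + h) - bump_profile k 0) / h) = bump_profile (Suc k) h"
          by (auto simp: bump_profile_def)
        then show "norm ((bump_profile k (0 + h) - bump_profile k 0) / h) \<le> real (Suc (Suc k)) ^ Suc (Suc k) * \<bar>h\<bar>"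
          using bump_profile_le_linear[of "Suc k" h] by linarith
      qed
      show "((\<lambda>h. real (Suc (Suc k)) ^ Suc (Suc k) * \<bar>h\<bar>) \<longlongrightarrow> 0) (at 0)"
        by (auto intro!: tendsto_eq_intros)
    qed
    then have "(bump_profile k has_real_derivative 0) (at 0)" by (simp only: DERIV_def)
    then show ?thesis using 3 by (simp add: bump_profile_def)
  qed
qed

text \<open>
  Closed under partial derivatives when \<open>s\<close> is a polynomial; it contains the bubbles.
\<close>

inductive_set bump_family :: "(real^'n \<Rightarrow> real) \<Rightarrow> (real^'n \<Rightarrow> real) set" for s where
  base: "P \<in> polys p \<Longrightarrow> (\<lambda>x. P x * bump_profile k (s x)) \<in> bump_family s"
| add: "f \<in> bump_family s \<Longrightarrow> g \<in> bump_family s \<Longrightarrow> (\<lambda>x. f x + g x) \<in> bump_family s"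

lemma has_derivative_bump_profile_comp:
  fixes s :: "real^'n \<Rightarrow> real"
  assumes "s differentiable (at x)"
  shows "((\<lambda>x. bump_profile k (s x)) has_derivative
    (\<lambda>h. (bump_profile (k + 2) (s x) - real k * bump_profile (k + 1) (s x)) * (grad s x \<bullet> h))) (at x)"
  using has_derivative_compose[OF has_derivative_grad[OF assms] bump_profile_DERIV[unfolded has_field_derivative_def]]
  by simp

lemma smooth_bump_family:
  assumes s: "s \<in> polys q" and f: "f \<in> bump_family s"
  shows "smooth f"
proof (rule smooth_coinduct[OF f])
  fix g assume "g \<in> bump_family s"
  then show "\<exists>d. (\<forall>i. d i \<in> bump_family s) \<and> (\<forall>x. (g has_derivative (\<lambda>h. \<Sum>i\<in>UNIV. h $ i * d i x)) (at x))"
  proof induction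
    case (base P p k)
    define d where "d i x = (grad P x $ i * bump_profile k (s x) + (P x * grad s x $ i) * bump_profile (k + 2) (s x))
        + (- real k * (P x * grad s x $ i)) * bump_profile (k + 1) (s x)" for i x
    have "d i \<in> bump_family s" for i
      unfolding d_def
      by (intro bump_family.add bump_family.base[OF polys_grad[OF base]]
          bump_family.base[OF polys_mult[OF base polys_grad[OF s]]]
          bump_family.base[OF polys_cmult[OF polys_mult[OF base polys_grad[OF s]]]])
    moreover have "((\<lambda>x. P x * bump_profile k (s x)) has_derivative (\<lambda>h. \<Sum>i\<in>UNIV. h $ i * d i x)) (at x)" for x
    proof -
      have "((\<lambda>x. P x * bump_profile k (s x)) has_derivative
         (\<lambda>h. P x * ((bump_profile (k + 2) (s x) - real k * bump_profile (k + 1) (s x)) * (grad s x \<bullet> h))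
            + (grad P x \<bullet> h) * bump_profile k (s x))) (at x)"
        by (rule has_derivative_mult[OF has_derivative_grad[OF polys_differentiable[OF base]]
            has_derivative_bump_profile_comp[OF polys_differentiable[OF s]]])
      moreover have "P x * ((bump_profile (k + 2) (s x) - real k * bump_profile (k + 1) (s x)) * (grad s x \<bullet> h))
            + (grad P x \<bullet> h) * bump_profile k (s x) = (\<Sum>i\<in>UNIV. h $ i * d i x)" for h
        unfolding d_def inner_vec_def inner_real_def sum_distrib_left sum_distrib_right sum.distrib[symmetric]
        by (rule sum.cong) (auto simp: algebra_simps)
      ultimately show ?thesis by (simp only:)
    qed
    ultimately show ?case by blast
  next
    case (add f g)
    then obtain d d' where "\<forall>i. d i \<in> bump_family s" "\<forall>i. d' i \<in> bump_family s"
      "\<forall>x. (f has_derivative (\<lambda>h. \<Sum>i\<in>UNIV. h $ i * d i x)) (at x)"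
      "\<forall>x. (g has_derivative (\<lambda>h. \<Sum>i\<in>UNIV. h $ i * d' i x)) (at x)" by blast
    then have "(\<forall>i. (\<lambda>x. d i x + d' i x) \<in> bump_family s) \<and>
      (\<forall>x. ((\<lambda>x. f x + g x) has_derivative (\<lambda>h. \<Sum>i\<in>UNIV. h $ i * (d i x + d' i x))) (at x))"
      by (auto intro: bump_family.add simp: distrib_left sum.distrib intro!: has_derivative_add)
    then show ?case by (intro exI[of _ "\<lambda>i x. d i x + d' i x"])
  qed
qed

definition bump :: "real^'n \<Rightarrow> real \<Rightarrow> real^'n \<Rightarrow> real" where
  "bump m r x = bump_profile 0 (1 - (norm (x - m))\<^sup>2 / r\<^sup>2)"

lemma bump_poly: "(\<lambda>x::real^'n. 1 - (norm (x - m))\<^sup>2 / r\<^sup>2) \<in> polys 2"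
proof -
  have "(\<lambda>x::real^'n. x $ i + - m $ i) \<in> polys 1" for i
    using polys_add[OF polys_coord[of i 0] polys_const[of "- m $ i" "Suc 0"]] by simp
  from polys_mult[OF this this]
  have "(\<lambda>x::real^'n. 1 + (- 1 / r\<^sup>2) * (\<Sum>i\<in>UNIV. (x $ i + - m $ i) * (x $ i + - m $ i))) \<in> polys (1 + 1)"
    by (intro polys_add polys_const polys_cmult polys_sum)
  moreover have "1 + (- 1 / r\<^sup>2) * (\<Sum>i\<in>UNIV. (x $ i + - m $ i) * (x $ i + - m $ i)) = 1 - (norm (x - m))\<^sup>2 / r\<^sup>2" for x
    by (simp add: power2_norm_eq_inner inner_vec_def)
  ultimately show ?thesis by (simp only: one_add_one)
qed

lemma has_derivative_bump:
  fixes m :: "real^'n"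
  shows "(bump m r has_derivative
     (\<lambda>h. ((- 2 / r\<^sup>2 * bump_profile 2 (1 - (norm (x - m))\<^sup>2 / r\<^sup>2)) *\<^sub>R (x - m)) \<bullet> h)) (at x)"
proof -
  have "((\<lambda>x. 1 - (norm (x - m))\<^sup>2 / r\<^sup>2) has_derivative (\<lambda>h. ((- 2 / r\<^sup>2) *\<^sub>R (x - m)) \<bullet> h)) (at x)"
    unfolding power2_norm_eq_inner divide_inverse
    by (auto intro!: derivative_eq_intros simp: inner_commute algebra_simps)
  then have g: "grad (\<lambda>x. 1 - (norm (x - m))\<^sup>2 / r\<^sup>2) x = (- 2 / r\<^sup>2) *\<^sub>R (x - m)" by (rule grad_unique)
  show ?thesis
    using has_derivative_bump_profile_comp[OF polys_differentiable[OF bump_poly[of m r]], of 0 x]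
    unfolding bump_def[abs_def] g by (simp add: mult_ac numeral_2_eq_2)
qed

lemma bump_nonneg: "0 \<le> bump m r x" by (simp add: bump_def bump_profile_nonneg)

lemma bump_le_1: "bump m r x \<le> 1" by (simp add: bump_def bump_profile_def)

lemma bump_outside: assumes "r > 0" "x \<notin> ball m r" shows "bump m r x = 0"
proof -
  have "r\<^sup>2 \<le> (norm (x - m))\<^sup>2" using assms by (intro power_mono) (auto simp: dist_norm norm_minus_commute)
  from divide_right_mono[OF this zero_le_power2[of r]] have "r\<^sup>2 / r\<^sup>2 \<le> (norm (x - m))\<^sup>2 / r\<^sup>2" .
  moreover have "r\<^sup>2 / r\<^sup>2 = 1" using assms(1) by simp
  ultimately have "\<not> 0 < 1 - (norm (x - m))\<^sup>2 / r\<^sup>2" by linarith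
  then show ?thesis by (simp add: bump_def bump_profile_def)
qed

lemma bump_lower: assumes "r > 0" "x \<in> ball m (r / 2)" shows "exp (- 2) \<le> bump m r x"
proof -
  have "(norm (x - m))\<^sup>2 \<le> (r / 2)\<^sup>2" using assms by (intro power_mono) (auto simp: dist_norm norm_minus_commute)
  from divide_right_mono[OF this zero_le_power2[of r]]
  have "(norm (x - m))\<^sup>2 / r\<^sup>2 \<le> 1 / 4" using assms(1) by (simp add: power_divide)
  then have s: "1 / 2 \<le> 1 - (norm (x - m))\<^sup>2 / r\<^sup>2" by linarith
  have "exp (- 2) \<le> bump_profile 0 s" if "1 / 2 \<le> s" for s
    using that by (simp add: bump_profile_def field_simps)
  then show ?thesis unfolding bump_def using s by blast
qed

text \<open>
  The scaling \<open>1 / r\<close> is what matters; the factor 8 is twice the bound 4 for \<open>exp (- 1 / s) / s\<^sup>2\<close>.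
\<close>

lemma grad_bump_le: assumes "r > 0" shows "norm (grad (bump m r) x) \<le> 8 / r"
proof -
  let ?s = "1 - (norm (x - m))\<^sup>2 / r\<^sup>2"
  have g: "grad (bump m r) x = (- 2 / r\<^sup>2 * bump_profile 2 ?s) *\<^sub>R (x - m)"
    by (rule grad_unique[OF has_derivative_bump])
  show ?thesis
  proof (cases "?s > 0")
    case False
    then show ?thesis using assms by (simp add: g bump_profile_def)
  next
    case True
    have "bump_profile 2 ?s \<le> (real 2 * ?s) ^ 2 / ?s ^ 2" by (rule bump_profile_le) (use True in auto)
    also have "\<dots> = 4"
    proof -
      have "(real 2 * s) ^ 2 / s ^ 2 = 4" if "s > 0" for s :: real using that by (simp add: power_mult_distrib)
      then show ?thesis using True by blast
    qed
    finally have 4: "bump_profile 2 ?s \<le> 4" .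
    have "(norm (x - m))\<^sup>2 < r\<^sup>2" using True assms by (simp add: field_simps)
    then have nr: "norm (x - m) \<le> r" using assms by (simp add: power2_less_imp_less less_imp_le)
    have "norm (grad (bump m r) x) = 2 / r\<^sup>2 * (bump_profile 2 ?s * norm (x - m))"
      unfolding g by (simp add: abs_mult bump_profile_nonneg)
    also have "\<dots> \<le> 2 / r\<^sup>2 * (4 * r)"
      using nr 4 assms by (intro mult_left_mono mult_mono) (auto simp: bump_profile_nonneg)
    also have "\<dots> = 8 / r" using assms by (simp add: power2_eq_square)
    finally show ?thesis .
  qed
qed

lemma smooth_poly_bump: assumes "P \<in> polys p" shows "smooth (\<lambda>x. P x * bump m r x)"
  unfolding bump_def by (rule smooth_bump_family[OF bump_poly]) (rule bump_family.base[OF assms])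

lemma test_function_poly_bump:
  assumes "P \<in> polys p" "r > 0" "cball m r \<subseteq> \<Omega>"
  shows "test_function \<Omega> (\<lambda>x. P x * bump m r x)"
  unfolding test_function_def using smooth_poly_bump[OF assms(1)] bump_outside[OF assms(2), of _ m] assms(3)
  by (intro conjI exI[of _ "cball m r"]) auto

lemma grad_mult:
  fixes f g :: "real^'n \<Rightarrow> real"
  assumes "f differentiable (at x)" "g differentiable (at x)"
  shows "grad (\<lambda>x. f x * g x) x = f x *\<^sub>R grad g x + g x *\<^sub>R grad f x"
  by (rule grad_unique)
     (use has_derivative_mult[OF has_derivative_grad[OF assms(1)] has_derivative_grad[OF assms(2)]]
      in \<open>simp add: inner_add_left mult.commute\<close>)

lemma bump_differentiable: "bump m r differentiable (at x)"
  using has_derivative_bump by (rule differentiableI)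

lemma smooth_imp:
  fixes f :: "real^'n \<Rightarrow> real"
  assumes "smooth f" shows "f differentiable (at x)" "continuous_on UNIV (grad f)"
proof -
  obtain D where D: "D [] = f" "\<And>is x. (D is has_derivative (\<lambda>h. \<Sum>i\<in>UNIV. h $ i * D (i # is) x)) (at x)"
    using assms unfolding smooth_def by blast
  show "f differentiable (at x)" using D(2)[of "[]"] D(1) by (auto intro: differentiableI)
  have c: "continuous_on UNIV (D is)" for "is"
    using has_derivative_continuous[OF D(2)] by (simp add: continuous_on_eq_continuous_at)
  have "grad f x = (\<chi> i. D [i] x)" for x
  proof (rule grad_unique)
    show "(f has_derivative (\<lambda>h. (\<chi> i. D [i] x) \<bullet> h)) (at x)"
      using D(2)[of "[]" x] unfolding D(1) by (simp add: inner_vec_def mult.commute)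
  qed
  then have "grad f = (\<lambda>x. \<chi> i. D [i] x)" by auto
  then show "continuous_on UNIV (grad f)" by (simp add: c continuous_on_vec_lambda)
qed

lemma test_function_C1_compact: assumes "test_function \<Omega> \<phi>" shows "C1_compact \<phi>"
proof -
  obtain K where K: "compact K" "\<And>x. x \<notin> K \<Longrightarrow> \<phi> x = 0" and s: "smooth \<phi>"
    using assms by (auto simp: test_function_def)
  obtain B where "\<And>x. x \<in> K \<Longrightarrow> norm x \<le> B" using compact_imp_bounded[OF K(1)] by (auto simp: bounded_iff)
  then show ?thesis using smooth_imp[OF s] K(2) unfolding C1_compact_def by blast
qed

lemma C1_compact_mult:
  fixes f g :: "real^'n \<Rightarrow> real"
  assumes f: "\<And>x. f differentiable (at x)" "continuous_on UNIV (grad f)" and g: "C1_compact g"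
  shows "C1_compact (\<lambda>x. f x * g x)"
proof -
  have g': "\<And>x. g differentiable (at x)" "continuous_on UNIV (grad g)" using g by (auto simp: C1_compact_def)
  have c: "continuous_on UNIV f" "continuous_on UNIV g"
    using f(1) g'(1) by (auto simp: continuous_on_eq_continuous_at intro!: differentiable_imp_continuous_within)
  have "grad (\<lambda>x. f x * g x) = (\<lambda>x. f x *\<^sub>R grad g x + g x *\<^sub>R grad f x)"
    using grad_mult[OF f(1) g'(1)] by auto
  moreover have "continuous_on UNIV (\<lambda>x. f x *\<^sub>R grad g x + g x *\<^sub>R grad f x)"
    by (intro continuous_intros c f g')
  ultimately show ?thesis using f(1) g'(1) g unfolding C1_compact_def
    by (auto intro: differentiable_mult)
qed

lemma set_integrable_lebesgue:
  fixes f :: "real^'n \<Rightarrow> 'b::euclidean_space"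
  assumes "continuous_on UNIV f" "bounded D" "D \<in> sets borel"
  shows "set_integrable lebesgue D f"
proof -
  have [measurable]: "f \<in> borel_measurable borel" using assms(1) by (rule borel_measurable_continuous_onI)
  have "(\<lambda>x. indicator D x *\<^sub>R f x) \<in> borel_measurable lborel" using assms(3) by measurable
  then show ?thesis using set_integrable_continuous_bounded[OF assms]
    by (simp add: set_integrable_def integrable_completion)
qed

lemma L2_continuous:
  fixes f :: "real^'n \<Rightarrow> 'b::euclidean_space"
  assumes "continuous_on UNIV f" "bounded D" "D \<in> sets borel"
  shows "L2 lebesgue D f"
  unfolding L2_def
proof
  show "set_borel_measurable lebesgue D f"
    using set_integrable_lebesgue[OF assms] by (auto simp: set_integrable_def set_borel_measurable_def)
  show "set_integrable lebesgue D (\<lambda>x. (norm (f x))\<^sup>2)"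
    by (rule set_integrable_lebesgue) (use assms in \<open>auto intro!: continuous_intros\<close>)
qed

text \<open>
  The constant sequence approximates \<open>v\<close>.  That \<open>grad v\<close> is the weak gradient is integration by parts, i.e.
  \<open>integral_grad_zero\<close> for the product with another test function.
\<close>

lemma test_function_in_H10:
  fixes v :: "real^'n \<Rightarrow> real"
  assumes v: "test_function \<Omega> v" and O: "open \<Omega>" "bounded \<Omega>"
  shows "in_H10 \<Omega> v (grad v)"
proof -
  have C: "C1_compact v" by (rule test_function_C1_compact[OF v])
  have c: "continuous_on UNIV v" "continuous_on UNIV (grad v)" and dv: "\<And>x. v differentiable (at x)"
    using C by (auto simp: C1_compact_def continuous_on_eq_continuous_at intro!: differentiable_imp_continuous_within)
  have "weak_gradient \<Omega> v (grad v)"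
    unfolding weak_gradient_def
  proof (intro allI impI)
    fix \<phi> :: "real^'n \<Rightarrow> real" assume phi: "test_function \<Omega> \<phi>"
    have C': "C1_compact \<phi>" by (rule test_function_C1_compact[OF phi])
    have c': "continuous_on UNIV \<phi>" "continuous_on UNIV (grad \<phi>)" and d': "\<And>x. \<phi> differentiable (at x)"
      using C' by (auto simp: C1_compact_def continuous_on_eq_continuous_at intro!: differentiable_imp_continuous_within)
    obtain K where K: "compact K" "K \<subseteq> \<Omega>" "\<And>x. x \<notin> K \<Longrightarrow> \<phi> x = 0" using phi by (auto simp: test_function_def)
    have gK: "grad \<phi> x = 0" if "x \<notin> K" for x
      by (rule grad_zero_outside[of \<phi> K]) (use K that compact_imp_closed in auto)
    have out: "\<phi> x = 0" "grad \<phi> x = 0" if "x \<notin> \<Omega>" for x using K(2,3) gK that by auto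
    have Gg: "grad (\<lambda>x. v x * \<phi> x) x = v x *\<^sub>R grad \<phi> x + \<phi> x *\<^sub>R grad v x" for x
      by (rule grad_mult[OF dv d'])
    have i: "set_integrable lebesgue \<Omega> (\<lambda>x. v x *\<^sub>R grad \<phi> x)" "set_integrable lebesgue \<Omega> (\<lambda>x. \<phi> x *\<^sub>R grad v x)"
      by (rule set_integrable_lebesgue; use O in \<open>auto intro!: continuous_intros c c'\<close>)+
    have "(LINT x:\<Omega>|lebesgue. v x *\<^sub>R grad \<phi> x) + (LINT x:\<Omega>|lebesgue. \<phi> x *\<^sub>R grad v x)
       = (LINT x:\<Omega>|lebesgue. v x *\<^sub>R grad \<phi> x + \<phi> x *\<^sub>R grad v x)"
      by (rule set_integral_add(2)[OF i, symmetric])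
    also have "\<dots> = (\<integral>x. grad (\<lambda>x. v x * \<phi> x) x \<partial>lebesgue)"
      unfolding set_lebesgue_integral_def Gg
      by (rule Bochner_Integration.integral_cong) (use out in \<open>auto simp: indicator_def\<close>)
    also have "\<dots> = (\<integral>x. grad (\<lambda>x. v x * \<phi> x) x \<partial>lborel)"
      unfolding Gg
      by (rule integral_completion) (auto intro!: borel_measurable_continuous_onI continuous_intros c c')
    also have "\<dots> = 0"
    proof -
      have CG: "C1_compact (\<lambda>x. v x * \<phi> x)" by (rule C1_compact_mult[OF dv c(2) C'])
      have int: "integrable lborel (grad (\<lambda>x. v x * \<phi> x))"
      proof -
        obtain B where B: "\<And>x. v x * \<phi> x \<noteq> 0 \<Longrightarrow> norm x \<le> B" "\<And>x. grad (\<lambda>x. v x * \<phi> x) x \<noteq> 0 \<Longrightarrow> norm x \<le> B"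
          using C1_compact_bounds[OF CG] by metis
        have "set_integrable lborel (cball 0 B) (grad (\<lambda>x. v x * \<phi> x))"
          by (rule set_integrable_continuous_bounded) (use CG in \<open>auto simp: C1_compact_def\<close>)
        moreover have "indicator (cball 0 B) x *\<^sub>R grad (\<lambda>x. v x * \<phi> x) x = grad (\<lambda>x. v x * \<phi> x) x" for x
          using B(2)[of x] by (auto simp: indicator_def)
        ultimately show ?thesis by (simp add: set_integrable_def)
      qed
      have "(\<integral>x. grad (\<lambda>x. v x * \<phi> x) x \<partial>lborel) \<bullet> e = 0" for e
        using integral_grad_zero[OF CG, of e] int by simp
      then show ?thesis by (metis inner_eq_zero_iff)
    qed
    finally show "(LINT x:\<Omega>|lebesgue. v x *\<^sub>R grad \<phi> x) = - (LINT x:\<Omega>|lebesgue. \<phi> x *\<^sub>R grad v x)"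
      by (simp add: eq_neg_iff_add_eq_0)
  qed
  moreover have "L2 lebesgue \<Omega> v" "L2 lebesgue \<Omega> (grad v)"
    by (rule L2_continuous; use O c in auto)+
  ultimately have "in_H1 \<Omega> v (grad v)" by (simp add: in_H1_def)
  then show ?thesis unfolding in_H10_def using v
    by (intro conjI exI[of _ "\<lambda>_. v"]) (auto simp: L2_norm_def set_lebesgue_integral_def)
qed

section \<open>Barycentric coordinates of a simplex\<close>

text \<open>
  A nondegenerate simplex with vertex set \<open>V\<close> given with its barycentric coordinates \<open>x \<mapsto> c v + g v \<bullet> x\<close>.
\<close>

locale bary_simplex =
  fixes V :: "(real^'n) set" and c :: "real^'n \<Rightarrow> real" and g :: "real^'n \<Rightarrow> real^'n" and T :: "(real^'n) set"
  assumes indep: "\<not> affine_dependent V" and card_V: "card V = Suc CARD('n)" and T: "T = convex hull V"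
    and sum_lam: "\<And>x. (\<Sum>v\<in>V. c v + g v \<bullet> x) = 1"
    and repr: "\<And>x. (\<Sum>v\<in>V. (c v + g v \<bullet> x) *\<^sub>R v) = x"
    and delta: "\<And>v w. v \<in> V \<Longrightarrow> w \<in> V \<Longrightarrow> c v + g v \<bullet> w = (if v = w then 1 else 0)"

text \<open>
  The edge vectors from one vertex form a basis; the coordinates with respect to it are the barycentric
  coordinates of the other vertices.
\<close>

lemma bary_simplex_exists:
  fixes T :: "(real^'n) set"
  assumes "int CARD('n) simplex T"
  obtains V c g where "bary_simplex V c g T"
proof -
  obtain V where indep: "\<not> affine_dependent V" and "int (card V) = int CARD('n) + 1" and T: "T = convex hull V"
    using assms by (auto simp: simplex_def)
  then have card_V: "card V = Suc CARD('n)" by simp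
  then obtain v0 where v0: "v0 \<in> V" by fastforce
  have fin: "finite V" using card_V by (metis card.infinite nat.distinct(1))
  define U where "U = V - {v0}"
  define B where "B = (\<lambda>x. - v0 + x) ` U"
  have finU: "finite U" using fin by (simp add: U_def)
  have cU: "card U = CARD('n)" using card_V v0 fin by (simp add: U_def)
  have injU: "inj_on (\<lambda>x. - v0 + x) U" by (auto simp: inj_on_def)
  have iB: "independent B" using indep affine_dependent_iff_dependent2[OF v0] by (simp add: B_def U_def)
  have cB: "card B = CARD('n)" using cU card_image[OF injU] by (simp add: B_def)
  have finB: "finite B" using finU by (simp add: B_def)
  have sp: "span B = UNIV"
    using card_ge_dim_independent[of B UNIV] iB cB by auto
  define l where "l v y = representation B y (- v0 + v)" for v y
  have lin: "linear (l v)" for v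
    by (rule linearI) (simp_all add: l_def representation_add[OF iB] representation_scale[OF iB] sp)
  define gg where "gg v = adjoint (l v) 1" for v
  have lg: "l v y = gg v \<bullet> y" for v y
    using adjoint_works[OF lin, of y v 1] by (simp add: gg_def inner_commute)
  have ldelta: "l v (w - v0) = (if v = w then 1 else 0)" if "v \<in> U" "w \<in> U" for v w
  proof -
    have "- v0 + w \<in> B" using that by (auto simp: B_def)
    then show ?thesis using representation_basis[OF iB, of "- v0 + w"] by (auto simp: l_def)
  qed
  have lrepr: "(\<Sum>v\<in>U. l v y *\<^sub>R (v - v0)) = y" for y
  proof -
    have "(\<Sum>v\<in>U. l v y *\<^sub>R (v - v0)) = (\<Sum>b\<in>B. representation B y b *\<^sub>R b)"
      by (rule sum.reindex_cong[OF injU B_def, symmetric]) (simp add: l_def)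
    also have "\<dots> = y"
      by (rule sum_representation_eq[OF iB]) (use sp finB in auto)
    finally show ?thesis .
  qed
  define c where "c v = (if v = v0 then 1 + (\<Sum>u\<in>U. gg u \<bullet> v0) else - (gg v \<bullet> v0))" for v
  define g where "g v = (if v = v0 then - (\<Sum>u\<in>U. gg u) else gg v)" for v
  have lamU: "c v + g v \<bullet> x = l v (x - v0)" if "v \<in> U" for v x
    using that by (auto simp: c_def g_def lg inner_diff_right U_def)
  have lam0: "c v0 + g v0 \<bullet> x = 1 - (\<Sum>u\<in>U. l u (x - v0))" for x
    by (simp add: c_def g_def lg inner_diff_right sum_subtractf inner_sum_left)
  have V_eq: "V = insert v0 U" "v0 \<notin> U" using v0 by (auto simp: U_def)
  have "bary_simplex V c g T"
  proof
    show "(\<Sum>v\<in>V. c v + g v \<bullet> x) = 1" for x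
      using finU V_eq(2) unfolding V_eq(1) by (simp add: lam0 lamU)
    show "(\<Sum>v\<in>V. (c v + g v \<bullet> x) *\<^sub>R v) = x" for x
    proof -
      have "(\<Sum>v\<in>V. (c v + g v \<bullet> x) *\<^sub>R v) = v0 + (\<Sum>v\<in>U. l v (x - v0) *\<^sub>R (v - v0))"
        using finU V_eq(2) unfolding V_eq(1)
        by (simp add: lam0 lamU scaleR_left_diff_distrib scaleR_right_diff_distrib sum_subtractf scaleR_sum_left)
      then show ?thesis by (simp add: lrepr)
    qed
    show "c v + g v \<bullet> w = (if v = w then 1 else 0)" if "v \<in> V" "w \<in> V" for v w
    proof (cases "v = v0")
      case True
      show ?thesis
      proof (cases "w = v0")
        case True
        have "l u 0 = 0" for u using lin linear_0 by blast
        then show ?thesis using \<open>v = v0\<close> True by (simp add: lam0)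
      next
        case False
        then have "w \<in> U" using that by (simp add: U_def)
        then have "(\<Sum>u\<in>U. l u (w - v0)) = (\<Sum>u\<in>U. if u = w then 1 else 0)"
          by (intro sum.cong) (auto simp: ldelta)
        then show ?thesis using \<open>v = v0\<close> False \<open>w \<in> U\<close> finU by (simp add: lam0)
      qed
    next
      case False
      then have vU: "v \<in> U" using that by (simp add: U_def)
      have "l v 0 = 0" using lin linear_0 by blast
      then show ?thesis using False that vU ldelta[OF vU, of w] by (cases "w = v0") (auto simp: lamU U_def)
    qed
  qed (use indep card_V T in auto)
  then show thesis by (rule that)
qed

context bary_simplex
begin

definition lam :: "real^'n \<Rightarrow> real^'n \<Rightarrow> real" where "lam v x = c v + g v \<bullet> x"

text \<open>
  Outer unit normal and offset of the facet opposite to \<open>v\<close>: the coordinate \<open>lam v\<close> decreases outwards.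
\<close>

definition nrm :: "real^'n \<Rightarrow> real^'n" where "nrm v = (- 1 / norm (g v)) *\<^sub>R g v"

definition off :: "real^'n \<Rightarrow> real" where "off v = c v / norm (g v)"

definition facet :: "real^'n \<Rightarrow> (real^'n) set" where "facet v = {x\<in>T. lam v x = 0}"

lemma fin_V: "finite V" using card_V by (metis card.infinite nat.distinct(1))

lemma sum_lam': "(\<Sum>v\<in>V. lam v x) = 1" using sum_lam by (simp add: lam_def)
lemma repr': "(\<Sum>v\<in>V. lam v x *\<^sub>R v) = x" using repr by (simp add: lam_def)
lemma delta': "v \<in> V \<Longrightarrow> w \<in> V \<Longrightarrow> lam v w = (if v = w then 1 else 0)" using delta by (simp add: lam_def)

lemma lam_add: "lam v (x + y) = lam v x + g v \<bullet> y" by (simp add: lam_def inner_right_distrib)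

lemma lam_diff: "lam v x - lam v y = g v \<bullet> (x - y)" by (simp add: lam_def inner_diff_right)

lemma g_inner_edge: "u \<in> V \<Longrightarrow> v \<in> V \<Longrightarrow> w \<in> V \<Longrightarrow> g u \<bullet> (w - v) = (if u = w then 1 else 0) - (if u = v then 1 else 0)"
  using lam_diff[of u w v] by (simp add: delta')

lemma continuous_lam: "continuous_on S (lam v)" unfolding lam_def by (intro continuous_intros)

lemma lam_polys: "q \<in> polys p \<Longrightarrow> (\<lambda>x. lam v x * q x) \<in> polys (Suc p)"
  unfolding lam_def by (rule polys_affine_mult)

lemma lam_combination:
  assumes "v \<in> V" "(\<Sum>w\<in>V. u w) = 1"
  shows "lam v (\<Sum>w\<in>V. u w *\<^sub>R w) = u v"
proof -
  have "lam v (\<Sum>w\<in>V. u w *\<^sub>R w) = c v * (\<Sum>w\<in>V. u w) + (\<Sum>w\<in>V. u w * (g v \<bullet> w))"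
    by (simp add: lam_def inner_sum_right assms(2))
  also have "\<dots> = (\<Sum>w\<in>V. u w * lam v w)"
    by (simp add: lam_def sum_distrib_left sum.distrib distrib_left mult.commute)
  also have "\<dots> = (\<Sum>w\<in>V. if w = v then u w else 0)"
    by (rule sum.cong) (use assms in \<open>auto simp: delta'\<close>)
  finally show ?thesis using assms fin_V by simp
qed

lemma T_iff: "x \<in> T \<longleftrightarrow> (\<forall>v\<in>V. 0 \<le> lam v x)"
proof
  assume "x \<in> T"
  then obtain u where "\<forall>w\<in>V. 0 \<le> u w" "(\<Sum>w\<in>V. u w) = 1" "(\<Sum>w\<in>V. u w *\<^sub>R w) = x"
    unfolding T convex_hull_finite[OF fin_V] by auto
  then show "\<forall>v\<in>V. 0 \<le> lam v x" using lam_combination by auto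
next
  assume "\<forall>v\<in>V. 0 \<le> lam v x"
  then show "x \<in> T" unfolding T convex_hull_finite[OF fin_V]
    using sum_lam'[of x] repr'[of x] by auto
qed

lemma lam_le_1: assumes "x \<in> T" "v \<in> V" shows "lam v x \<le> 1"
proof -
  have "lam v x \<le> (\<Sum>v\<in>V. lam v x)" using assms T_iff fin_V by (intro member_le_sum) auto
  then show ?thesis by (simp add: sum_lam')
qed

lemma V_sub_T: "V \<subseteq> T" unfolding T by (rule hull_subset)

lemma compact_T: "compact T" unfolding T using fin_V by (simp add: finite_imp_compact compact_convex_hull)

lemma convex_T: "convex T" unfolding T by simp

lemma T_borel [measurable]: "T \<in> sets borel" 
  using compact_imp_closed[OF compact_T] by (rule borel_closed)

lemma facet_eq_hull: assumes "v \<in> V" shows "facet v = convex hull (V - {v})"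
proof
  have fv: "finite (V - {v})" using fin_V by simp
  show "facet v \<subseteq> convex hull (V - {v})"
  proof
    fix x assume x: "x \<in> facet v"
    then have l: "lam v x = 0" "\<And>w. w \<in> V \<Longrightarrow> 0 \<le> lam w x" by (auto simp: facet_def T_iff)
    have "(\<Sum>w\<in>V - {v}. lam w x) = 1" "(\<Sum>w\<in>V - {v}. lam w x *\<^sub>R w) = x"
      using sum_lam'[of x] repr'[of x] l(1) assms fin_V by (simp_all add: sum_diff1)
    then show "x \<in> convex hull (V - {v})"
      unfolding convex_hull_finite[OF fv] using l(2) by (auto intro!: exI[of _ "\<lambda>w. lam w x"])
  qed
  show "convex hull (V - {v}) \<subseteq> facet v"
  proof
    fix x assume x: "x \<in> convex hull (V - {v})"
    then obtain u where u: "\<forall>w\<in>V - {v}. 0 \<le> u w" "(\<Sum>w\<in>V - {v}. u w) = 1" "(\<Sum>w\<in>V - {v}. u w *\<^sub>R w) = x"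
      unfolding convex_hull_finite[OF fv] by auto
    define u' where "u' = u(v := 0)"
    have "(\<Sum>w\<in>V. u' w) = (\<Sum>w\<in>V - {v}. u w)" "(\<Sum>w\<in>V. u' w *\<^sub>R w) = (\<Sum>w\<in>V - {v}. u w *\<^sub>R w)"
      using assms fin_V by (auto simp: u'_def sum.remove[of V v] intro!: sum.cong)
    then have "lam v x = 0" using lam_combination[OF assms, of u'] u by (simp add: u'_def)
    moreover have "x \<in> T" using x hull_mono[of "V - {v}" V] unfolding T by auto
    ultimately show "x \<in> facet v" by (simp add: facet_def)
  qed
qed

lemma vertex_in_facet: "v \<in> V \<Longrightarrow> w \<in> V \<Longrightarrow> w \<noteq> v \<Longrightarrow> w \<in> facet v"
  using V_sub_T by (auto simp: facet_def delta')

lemma other_vertex: assumes "v \<in> V" obtains w where "w \<in> V" "w \<noteq> v"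
proof -
  have "card (V - {v}) = CARD('n)" using assms card_V fin_V by simp
  then have "V - {v} \<noteq> {}" by (metis card.empty zero_less_card_finite less_irrefl)
  then show thesis using that by blast
qed

lemma facet_of_iff: "F facet_of T \<longleftrightarrow> (\<exists>v\<in>V. F = facet v)"
proof -
  have "facet v \<noteq> {}" if "v \<in> V" for v
    using other_vertex[OF that] vertex_in_facet[OF that] by (metis empty_iff)
  moreover have "F facet_of T \<longleftrightarrow> F \<noteq> {} \<and> (\<exists>u. u \<in> V \<and> F = convex hull (V - {u}))"
    unfolding T by (rule facet_of_convex_hull_affine_independent[OF indep])
  ultimately show ?thesis using facet_eq_hull by metis
qed

lemma inj_facet: "inj_on facet V"
proof (rule inj_onI, rule ccontr)
  fix v w assume "v \<in> V" "w \<in> V" "facet v = facet w" "v \<noteq> w"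
  then have "w \<in> facet w" using vertex_in_facet by metis
  then show False using \<open>w \<in> V\<close> by (simp add: facet_def delta')
qed

lemma facets_eq: "{F. F facet_of T} = facet ` V" using facet_of_iff by auto

lemma g_nonzero: assumes "v \<in> V" shows "g v \<noteq> 0"
proof
  assume "g v = 0"
  obtain w where "w \<in> V" "w \<noteq> v" using other_vertex[OF assms] .
  then show False using g_inner_edge[OF assms assms, of w] \<open>g v = 0\<close> by auto
qed

lemma norm_nrm: "v \<in> V \<Longrightarrow> norm (nrm v) = 1" using g_nonzero by (simp add: nrm_def)

lemma nrm_inner: "v \<in> V \<Longrightarrow> nrm v \<bullet> x - off v = - lam v x / norm (g v)"
  using g_nonzero by (simp add: nrm_def off_def lam_def field_simps)

lemma half_space_iff: "v \<in> V \<Longrightarrow> nrm v \<bullet> x \<le> off v \<longleftrightarrow> 0 \<le> lam v x"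
  using nrm_inner[of v x] g_nonzero[of v] by (smt (verit) divide_nonneg_pos divide_pos_pos zero_less_norm_iff minus_divide_left)

lemma plane_iff: "v \<in> V \<Longrightarrow> nrm v \<bullet> x = off v \<longleftrightarrow> lam v x = 0"
  using nrm_inner[of v x] g_nonzero[of v] by auto

lemma nrm_edge: assumes "v \<in> V" "w \<in> V" "w \<noteq> v" shows "nrm v \<bullet> (w - v) = 1 / norm (g v)"
  using g_inner_edge[OF assms(1,1,2)] assms(3) by (simp add: nrm_def)

lemma nrm_tangent: assumes "u \<in> V" "v \<in> V" "w \<in> V" "u \<noteq> v" "u \<noteq> w" shows "nrm u \<bullet> (w - v) = 0"
  using g_inner_edge[OF assms(1-3)] assms(4,5) by (simp add: nrm_def)

lemma facet_plane: "v \<in> V \<Longrightarrow> facet v \<subseteq> {x. nrm v \<bullet> x = off v}"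
  by (auto simp: facet_def plane_iff)

lemma compact_facet: "compact (facet v)"
proof -
  have "facet v = T \<inter> (lam v -` {0})" by (auto simp: facet_def)
  moreover have "closed (lam v -` {0})"
    using continuous_closed_vimage[OF closed_singleton, of "lam v"] continuous_lam[of UNIV v]
    by (simp add: continuous_on_eq_continuous_at)
  ultimately show ?thesis using compact_T by (simp add: compact_Int_closed)
qed

lemma facet_borel [measurable]: "facet v \<in> sets borel" 
  using compact_imp_closed[OF compact_facet] by (rule borel_closed)

text \<open>
  A facet of a \<open>d\<close>-simplex spans its hyperplane, so that the normal is unique up to the sign, which the simplex
  decides.
\<close>

lemma outer_normal_facet:
  assumes v: "v \<in> V" shows "outer_normal T (facet v) = nrm v"
  unfolding outer_normal_def
proof (rule the_equality)
  show "norm (nrm v) = 1 \<and> (\<exists>a. T \<subseteq> {x. nrm v \<bullet> x \<le> a} \<and> facet v = T \<inter> {x. nrm v \<bullet> x = a})"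
    using v by (intro conjI exI[of _ "off v"]) (auto simp: norm_nrm half_space_iff plane_iff facet_def T_iff)
next
  fix n assume "norm n = 1 \<and> (\<exists>a. T \<subseteq> {x. n \<bullet> x \<le> a} \<and> facet v = T \<inter> {x. n \<bullet> x = a})"
  then obtain a where n: "norm n = 1" and le: "\<And>x. x \<in> T \<Longrightarrow> n \<bullet> x \<le> a" and eq: "facet v = T \<inter> {x. n \<bullet> x = a}"
    by auto
  define t where "t = a - n \<bullet> v"
  have "v \<notin> facet v" using v by (simp add: facet_def delta')
  then have t: "t > 0" using le[of v] eq V_sub_T v by (fastforce simp: t_def)
  have onV: "a - n \<bullet> w = t * lam v w" if "w \<in> V" for w
  proof (cases "w = v")
    case False
    then have "n \<bullet> w = a" using vertex_in_facet[OF v that] eq by auto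
    then show ?thesis using False v that by (simp add: delta')
  qed (use v in \<open>simp add: t_def delta'\<close>)
  have "n \<bullet> x = a - t * lam v x" for x
  proof -
    have "n \<bullet> x = (\<Sum>w\<in>V. lam w x * (n \<bullet> w))"
      using repr'[of x] by (metis (no_types, lifting) inner_scaleR_right inner_sum_right sum.cong)
    also have "\<dots> = (\<Sum>w\<in>V. lam w x * (a - t * lam v w))"
      using onV by (intro sum.cong) (auto simp: algebra_simps)
    also have "\<dots> = a * (\<Sum>w\<in>V. lam w x) - t * (\<Sum>w\<in>V. if w = v then lam w x else 0)"
      unfolding sum_distrib_left sum_subtractf[symmetric]
      by (rule sum.cong) (use v in \<open>auto simp: delta' algebra_simps\<close>)
    finally show ?thesis using v fin_V by (simp add: sum_lam')
  qed
  then have "n \<bullet> x = a - t * c v + (- t *\<^sub>R g v) \<bullet> x" for x by (simp add: lam_def algebra_simps)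
  from this[of 0] this have "n \<bullet> x = (- t *\<^sub>R g v) \<bullet> x" for x by simp
  then have ng: "n = - t *\<^sub>R g v" by (metis vector_eq_rdot)
  then have "t * norm (g v) = 1" using n t by (metis norm_minus_cancel norm_scaleR abs_of_pos scaleR_minus_left)
  then have "t = 1 / norm (g v)" using g_nonzero[OF v] by (simp add: field_simps)
  then show "n = nrm v" using ng by (simp add: nrm_def)
qed

text \<open>
  Along the diameter of the ball in the direction of the gradient the coordinate increases by
  \<open>2 r * norm (g v)\<close>, while it stays between 0 and 1.
\<close>

lemma grad_bound_by_inball:
  assumes v: "v \<in> V" and r: "r > 0" and ball: "cball x r \<subseteq> T"
  shows "norm (g v) * (2 * r) \<le> 1"
proof -
  define e where "e = (r / norm (g v)) *\<^sub>R g v"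
  have ne: "norm e = r" using g_nonzero[OF v] r by (simp add: e_def)
  then have "x + e \<in> cball x r" "x - e \<in> cball x r" by (simp_all add: dist_norm)
  then have in_T: "x + e \<in> T" "x - e \<in> T" using ball by blast+
  have "lam v (x + e) - lam v (x - e) = g v \<bullet> (2 *\<^sub>R e)" unfolding lam_diff by (simp add: algebra_simps scaleR_2)
  also have "\<dots> = 2 * r * norm (g v)" using g_nonzero[OF v] by (simp add: e_def dot_square_norm power2_eq_square)
  finally have "2 * r * norm (g v) \<le> 1"
    using lam_le_1[OF in_T(1) v] in_T(2) v T_iff by fastforce
  then show ?thesis by (simp add: mult_ac)
qed

text \<open>
  For \<open>d \<ge> 2\<close> the ball has a diameter \<open>2 e\<close> parallel to the facet.  Its end points have the same coordinate at \<open>v\<close>, so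
  \<open>2 e\<close> is a combination of edges of the facet with coefficients of total mass at most 2.
\<close>

lemma inball_le_diameter_facet:
  assumes d: "CARD('n) \<ge> 2" and v: "v \<in> V" and r: "r > 0" and ball: "cball x r \<subseteq> T"
  shows "r \<le> diameter (facet v)"
proof -
  obtain y where y: "y \<noteq> 0" "orthogonal (g v) y"
    using orthogonal_to_vector_exists[of "g v"] d by (auto simp: orthogonal_def inner_commute)
  define e where "e = (r / norm y) *\<^sub>R y"
  have ne: "norm e = r" using y(1) r by (simp add: e_def)
  have ge: "g v \<bullet> e = 0" using y(2) by (simp add: e_def orthogonal_def)
  have "x + e \<in> cball x r" "x - e \<in> cball x r" using ne by (simp_all add: dist_norm)
  then have in_T: "x + e \<in> T" "x - e \<in> T" using ball by blast+
  obtain w0 where w0: "w0 \<in> V" "w0 \<noteq> v" using other_vertex[OF v] .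
  have bd: "bounded (facet v)" using compact_facet by (rule compact_imp_bounded)
  define \<mu> where "\<mu> w = lam w (x + e) - lam w (x - e)" for w
  have mu0: "\<mu> v = 0" using ge by (simp add: \<mu>_def lam_def inner_add_right inner_diff_right)
  have mu_sum: "(\<Sum>w\<in>V. \<mu> w) = 0" by (simp add: \<mu>_def sum_subtractf sum_lam')
  have mu_le: "(\<Sum>w\<in>V. \<bar>\<mu> w\<bar>) \<le> 2"
  proof -
    have "(\<Sum>w\<in>V. \<bar>\<mu> w\<bar>) \<le> (\<Sum>w\<in>V. lam w (x + e) + lam w (x - e))"
      using in_T T_iff by (intro sum_mono) (fastforce simp: \<mu>_def)
    then show ?thesis by (simp add: sum.distrib sum_lam')
  qed
  have "2 *\<^sub>R e = (\<Sum>w\<in>V. lam w (x + e) *\<^sub>R w) - (\<Sum>w\<in>V. lam w (x - e) *\<^sub>R w)"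
    by (simp add: repr' scaleR_2)
  also have "\<dots> = (\<Sum>w\<in>V. \<mu> w *\<^sub>R w) - (\<Sum>w\<in>V. \<mu> w) *\<^sub>R w0"
    by (simp add: \<mu>_def sum_subtractf[symmetric] scaleR_left_diff_distrib mu_sum[unfolded \<mu>_def])
  also have "\<dots> = (\<Sum>w\<in>V. \<mu> w *\<^sub>R (w - w0))"
    by (simp add: scaleR_sum_left sum_subtractf[symmetric] scaleR_right_diff_distrib)
  finally have eq: "2 *\<^sub>R e = (\<Sum>w\<in>V. \<mu> w *\<^sub>R (w - w0))" .
  have "2 * r = norm (2 *\<^sub>R e)" using ne by simp
  also have "\<dots> \<le> (\<Sum>w\<in>V. \<bar>\<mu> w\<bar> * diameter (facet v))"
    unfolding eq
  proof (intro order_trans[OF norm_sum] sum_mono)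
    fix w assume w: "w \<in> V"
    show "norm (\<mu> w *\<^sub>R (w - w0)) \<le> \<bar>\<mu> w\<bar> * diameter (facet v)"
    proof (cases "w = v")
      case False
      have "dist w w0 \<le> diameter (facet v)"
        by (rule diameter_bounded_bound[OF bd vertex_in_facet[OF v w False] vertex_in_facet[OF v w0]])
      then show ?thesis by (simp add: dist_norm mult_left_mono)
    qed (simp add: mu0)
  qed
  also have "\<dots> \<le> 2 * diameter (facet v)"
    unfolding sum_distrib_right[symmetric]
    by (intro mult_right_mono mu_le diameter_ge_0 bd)
  finally show ?thesis by simp
qed

definition centre :: "real^'n \<Rightarrow> real^'n" where
  "centre v = (1 / real CARD('n)) *\<^sub>R (\<Sum>w\<in>V - {v}. w)"

lemma lam_centre:
  assumes "v \<in> V" "w \<in> V"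
  shows "lam w (centre v) = (if w = v then 0 else 1 / real CARD('n))"
proof -
  define u where "u z = (if z = v then 0 else 1 / real CARD('n))" for z
  have "(\<Sum>z\<in>V. u z) = (\<Sum>z\<in>V - {v}. 1 / real CARD('n))"
    using assms fin_V by (intro sum.mono_neutral_cong_right) (auto simp: u_def)
  also have "\<dots> = 1" using assms card_V fin_V by simp
  finally have 1: "(\<Sum>z\<in>V. u z) = 1" .
  have "(\<Sum>z\<in>V. u z *\<^sub>R z) = (\<Sum>z\<in>V - {v}. (1 / real CARD('n)) *\<^sub>R z)"
    using assms fin_V by (intro sum.mono_neutral_cong_right) (auto simp: u_def)
  also have "\<dots> = centre v" by (simp add: centre_def scaleR_sum_right)
  finally have "centre v = (\<Sum>z\<in>V. u z *\<^sub>R z)" ..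
  then show ?thesis using lam_combination[OF assms(2) 1] by (simp add: u_def)
qed

lemma centre_in_facet: "v \<in> V \<Longrightarrow> centre v \<in> facet v"
  by (auto simp: facet_def T_iff lam_centre)

text \<open>
  At the centre of the facet the other coordinates equal \<open>1 / d\<close>, and they change by at most \<open>1 / (2 d)\<close> over the
  distance \<open>r / d\<close> because of the bound on their gradients.
\<close>

lemma half_ball_sub_T:
  assumes v: "v \<in> V" and r: "r > 0" and ball: "cball x r \<subseteq> T"
    and y: "dist (centre v) y \<le> r / real CARD('n)" and side: "0 \<le> lam v y"
  shows "y \<in> T"
  unfolding T_iff
proof
  fix w assume w: "w \<in> V"
  show "0 \<le> lam w y"
  proof (cases "w = v")
    case False
    have "\<bar>g w \<bullet> (y - centre v)\<bar> \<le> norm (g w) * norm (y - centre v)" by (rule Cauchy_Schwarz_ineq2)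
    also have "\<dots> \<le> norm (g w) * (r / real CARD('n))"
      using y by (intro mult_left_mono) (auto simp: dist_norm norm_minus_commute)
    also have "\<dots> = norm (g w) * r / real CARD('n)" by simp
    also have "\<dots> \<le> 1 / real CARD('n)"
    proof (rule divide_right_mono)
      have "0 \<le> norm (g w) * r" using r by simp
      then show "norm (g w) * r \<le> 1" using grad_bound_by_inball[OF w r ball] by linarith
    qed simp
    finally have "\<bar>g w \<bullet> (y - centre v)\<bar> \<le> 1 / real CARD('n)" .
    then show ?thesis using lam_diff[of w y "centre v"] lam_centre[OF v w] False by simp
  qed (use side in simp)
qed

lemma lam_negligible:
  assumes "v \<in> V" shows "AE x in lborel. lam v x \<noteq> 0"
proof -
  have "negligible {x. g v \<bullet> x = - c v}" using g_nonzero[OF assms] by (intro negligible_hyperplane) auto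
  then have "AE x in lebesgue. x \<notin> {x. g v \<bullet> x = - c v}"
    unfolding negligible_iff_null_sets by (rule AE_not_in)
  then have "AE x in lborel. x \<notin> {x. g v \<bullet> x = - c v}" by (simp add: AE_completion_iff)
  then show ?thesis by eventually_elim (auto simp: lam_def)
qed

text \<open>
  For \<open>d \<ge> 2\<close> the other coordinates are not constant on the hyperplane of a facet.
\<close>

lemma lam_proj_negligible:
  assumes d: "CARD('n) \<ge> 2" and v: "v \<in> V" and u: "u \<in> V" "u \<noteq> v"
  shows "AE x in lborel. lam u (proj (nrm v) (off v) x) \<noteq> 0"
proof -
  define \<beta> where "\<beta> = g u - (g u \<bullet> nrm v) *\<^sub>R nrm v"
  define \<alpha> where "\<alpha> = c u + off v * (g u \<bullet> nrm v)"
  have eq: "lam u (proj (nrm v) (off v) x) = \<alpha> + \<beta> \<bullet> x" for x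
    by (simp add: lam_def proj_def \<alpha>_def \<beta>_def inner_diff_right inner_diff_left algebra_simps)
  have "card (V - {v, u}) = card V - 2" using v u fin_V by (simp add: card_Diff_subset)
  then have "card (V - {v, u}) \<noteq> 0" using card_V d by simp
  then obtain w where w: "w \<in> V" "w \<noteq> v" "w \<noteq> u" using fin_V by (metis card.empty Diff_iff ex_in_conv insertCI)
  have "\<beta> \<bullet> (u - w) = 1"
    using nrm_tangent[OF v w(1) u(1)] w u g_inner_edge[OF u(1) w(1) u(1)]
    by (simp add: \<beta>_def inner_diff_left)
  then have "\<beta> \<noteq> 0" by auto
  then have "negligible {x. \<beta> \<bullet> x = - \<alpha>}" by (intro negligible_hyperplane) auto
  then have "AE x in lebesgue. x \<notin> {x. \<beta> \<bullet> x = - \<alpha>}"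
    unfolding negligible_iff_null_sets by (rule AE_not_in)
  then have "AE x in lborel. x \<notin> {x. \<beta> \<bullet> x = - \<alpha>}" by (simp add: AE_completion_iff)
  then show ?thesis unfolding eq by eventually_elim auto
qed

text \<open>
  The field is a polynomial multiple of the edge direction \<open>w - v\<close>, and the polynomial vanishes on the facet
  opposite to \<open>w\<close>; so among all facets only the one opposite to \<open>v\<close> contributes.  For the proof the simplex is
  prolonged beyond that facet, and \<open>half_space_integral_transversal\<close> is applied to the polynomial cut off outside the
  prolonged simplex: a step in the direction \<open>w - v\<close> changes only the coordinates of \<open>v\<close> and \<open>w\<close>, so it crosses no
  lateral face but the one where the polynomial vanishes.
\<close>

lemma simplex_edge_divergence:
  assumes d: "CARD('n) \<ge> 2" and v: "v \<in> V" and w: "w \<in> V" "w \<noteq> v" and s: "s \<in> polys p"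
  defines "f \<equiv> (\<lambda>x. lam w x * s x)"
  shows "(LINT x:T|lborel. grad f x \<bullet> (w - v)) = (nrm v \<bullet> (w - v)) * (LINT x:facet v|surface_measure. f x)"
proof -
  define e where "e = w - v"
  define n where "n = nrm v"
  define a where "a = off v"
  define m where "m = n \<bullet> e"
  have n1: "norm n = 1" using norm_nrm[OF v] by (simp add: n_def)
  have m_eq: "m = 1 / norm (g v)" using nrm_edge[OF v w] by (simp add: m_def n_def e_def)
  have gv: "norm (g v) > 0" using g_nonzero[OF v] by simp
  have m0: "m > 0" using gv by (simp add: m_eq)
  have half: "n \<bullet> x \<le> a \<longleftrightarrow> 0 \<le> lam v x" for x unfolding n_def a_def by (rule half_space_iff[OF v])
  have lam_n: "lam v x = - (n \<bullet> x - a) / m" for x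
    using nrm_inner[OF v, of x] gv unfolding n_def[symmetric] a_def[symmetric] m_eq by (simp add: field_simps)
  have lam_e: "lam u (x + t *\<^sub>R e) = lam u x + t * ((if u = w then 1 else 0) - (if u = v then 1 else 0))"
    if "u \<in> V" for u x t
    using g_inner_edge[OF that v w(1)] by (simp add: lam_add e_def)
  \<comment> \<open>the simplex prolonged beyond the facet by one unit of the coordinate at the opposite vertex\<close>
  define P where "P = {x. (\<forall>u\<in>V - {v}. 0 \<le> lam u x) \<and> -1 \<le> lam v x}"
  have P_D: "0 \<le> lam u z" if "z \<in> P" "u \<in> V" "u \<noteq> v" for z u using that by (auto simp: P_def)
  have P_meas [measurable]: "P \<in> sets borel"
  proof -
    have "P = (\<Inter>u\<in>V - {v}. {x. 0 \<le> lam u x}) \<inter> {x. -1 \<le> lam v x}" by (auto simp: P_def)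
    moreover have "closed \<dots>" by (intro closed_Int closed_INT ballI closed_Collect_le continuous_intros continuous_lam)
    ultimately show ?thesis by (metis borel_closed)
  qed
  define B where "B = 2 * (\<Sum>u\<in>V. norm u)"
  have PB: "norm x \<le> B" if x: "x \<in> P" for x
  proof -
    have le2: "\<bar>lam u x\<bar> \<le> 2" if u: "u \<in> V" for u
    proof -
      have s1: "lam v x + (\<Sum>u\<in>V - {v}. lam u x) = 1"
        using sum_lam'[of x] v fin_V by (simp add: sum.remove)
      have pos: "0 \<le> (\<Sum>u\<in>V - {v}. lam u x)" using x by (intro sum_nonneg) (auto simp: P_def)
      show ?thesis
      proof (cases "u = v")
        case True
        then show ?thesis using s1 pos x by (auto simp: P_def)
      next
        case False
        then have "lam u x \<le> (\<Sum>u\<in>V - {v}. lam u x)"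
          using u fin_V x by (intro member_le_sum) (auto simp: P_def)
        then show ?thesis using s1 x u False by (auto simp: P_def)
      qed
    qed
    have "norm x = norm (\<Sum>u\<in>V. lam u x *\<^sub>R u)" by (simp add: repr')
    also have "\<dots> \<le> (\<Sum>u\<in>V. 2 * norm u)"
      by (rule order_trans[OF norm_sum], rule sum_mono) (use le2 in \<open>auto intro: mult_right_mono\<close>)
    finally show ?thesis by (simp add: B_def sum_distrib_left)
  qed
  have B0: "B \<ge> 0" by (simp add: B_def sum_nonneg)
  define B' where "B' = B + m"
  have f: "f \<in> polys (Suc p)" unfolding f_def by (rule lam_polys[OF s])
  have fd: "f differentiable (at x)" for x by (rule polys_differentiable[OF f])
  have fm [measurable]: "f \<in> borel_measurable borel" by (rule polys_borel[OF f])
  have gm [measurable]: "(\<lambda>x. grad f x \<bullet> e) \<in> borel_measurable borel"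
    unfolding inner_vec_def by (intro borel_measurable_sum borel_measurable_inner polys_borel[OF polys_grad[OF f]] borel_measurable_const)
  have bnd: "\<exists>K. \<forall>x\<in>cball 0 B'. norm (h x) \<le> K" if "continuous_on UNIV h" for h :: "real^'n \<Rightarrow> real"
  proof -
    have "compact (h ` cball 0 B')" by (rule compact_continuous_image[OF continuous_on_subset[OF that] compact_cball]) simp
    from compact_imp_bounded[OF this] show ?thesis by (auto simp: bounded_iff)
  qed
  obtain M0 where M0: "\<forall>x\<in>cball 0 B'. norm (f x) \<le> M0" using bnd[OF polys_continuous[OF f]] by blast
  obtain S0 where S0: "\<forall>x\<in>cball 0 B'. norm (s x) \<le> S0" using bnd[OF polys_continuous[OF s]] by blast
  have "continuous_on UNIV (\<lambda>x. norm (grad f x))"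
    unfolding norm_vec_def L2_set_def by (intro continuous_intros polys_continuous[OF polys_grad[OF f]])
  then obtain L0 where L0: "\<forall>x\<in>cball 0 B'. norm (norm (grad f x)) \<le> L0" using bnd by blast
  define M where "M = \<bar>M0\<bar>" define S where "S = \<bar>S0\<bar>" define L where "L = \<bar>L0\<bar>"
  have M: "\<bar>f x\<bar> \<le> M" and S: "\<bar>s x\<bar> \<le> S" and L: "norm (grad f x) \<le> L" if "norm x \<le> B'" for x
    using M0 S0 L0 that by (force simp: M_def S_def L_def)+
  have MSL: "M \<ge> 0" "S \<ge> 0" "L \<ge> 0" by (auto simp: M_def S_def L_def)
  have BB': "norm x \<le> B'" if "norm x \<le> B" for x :: "real^'n" using that m0 by (simp add: B'_def)
  have lip: "\<bar>f y - f x\<bar> \<le> L * norm (y - x)" if "norm x \<le> B'" "norm y \<le> B'" for x y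
  proof (rule lipschitz_of_grad_bound[OF fd L])
    fix z assume "z \<in> closed_segment x y"
    moreover have "closed_segment x y \<subseteq> cball 0 B'" using that by (intro closed_segment_subset convex_cball) auto
    ultimately show "norm z \<le> B'" by auto
  qed
  define G where "G x = indicator P x * f x" for x
  define G' where "G' x = indicator T x * (grad f x \<bullet> e)" for x
  define K where "K = (\<Sum>u\<in>V. norm (g u))"
  have K: "norm (g u) \<le> K" if "u \<in> V" for u unfolding K_def using that fin_V by (intro member_le_sum) auto
  \<comment> \<open>near the lateral faces a point of the strip and its projection may lie on different sides of them\<close>
  define Z where "Z k = {y. \<exists>u\<in>V - {v}. \<bar>lam u y\<bar> \<le> K * m / real (Suc k)}" for k
  have Z_meas [measurable]: "Z k \<in> sets borel" for k
  proof -
    have "Z k = (\<Union>u\<in>V - {v}. {y. \<bar>lam u y\<bar> \<le> K * m / real (Suc k)})" by (auto simp: Z_def)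
    moreover have "closed \<dots>" using fin_V by (intro closed_UN ballI closed_Collect_le continuous_intros continuous_lam) auto
    ultimately show ?thesis by (metis borel_closed)
  qed
  define H where "H k y = (L * m / real (Suc k)) * indicator (cball 0 B') y + 2 * M * indicator (cball 0 B' \<inter> Z k) y" for k y
  have mk: "m / real (Suc k) \<le> m" "0 \<le> m / real (Suc k)" for k using m0 by (auto simp: field_simps)
  have "(\<integral>x. indicator {x. n \<bullet> x \<le> a} x * G' x \<partial>lborel) = (n \<bullet> e) * plane_integral n a G"
  proof (rule half_space_integral_transversal[where M=M and B=B' and H=H and M'="L * m + 2 * M" and L="L * norm e + S"])
    show "norm n = 1" by (rule n1)
    show "0 < n \<bullet> e" using m0 by (simp add: m_def)
    show "G \<in> borel_measurable borel" unfolding G_def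
      by (intro borel_measurable_times borel_measurable_indicator P_meas fm)
    show "G' \<in> borel_measurable borel" unfolding G'_def
      by (intro borel_measurable_times borel_measurable_indicator T_borel gm)
    show "\<bar>G x\<bar> \<le> M" for x
      using M[OF BB'[OF PB]] MSL by (cases "x \<in> P") (auto simp: G_def)
    show "norm x \<le> B'" if "G x \<noteq> 0" for x
      using that by (intro BB' PB) (auto simp: G_def indicator_def split: if_splits)
    show "\<bar>G (x + t *\<^sub>R e) - G x\<bar> \<le> (L * norm e + S) * t" if "n \<bullet> x \<le> a" "0 < t" "t \<le> 1" for x t
    proof -
      let ?y = "x + t *\<^sub>R e"
      have lv: "0 \<le> lam v x" using that half by simp
      have rhs: "0 \<le> L * norm e * t" "0 \<le> S * t" using MSL that by auto
      have ly: "lam v ?y = lam v x - t" "lam w ?y = lam w x + t" "\<And>u. u \<in> V \<Longrightarrow> u \<noteq> v \<Longrightarrow> u \<noteq> w \<Longrightarrow> lam u ?y = lam u x"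
        using lam_e v w by auto
      show ?thesis
      proof (cases "?y \<in> P")
        case False
        have "-1 \<le> lam v ?y" using ly(1) lv that by simp
        then obtain u where u: "u \<in> V" "u \<noteq> v" "lam u ?y < 0" using False by (auto simp: P_def not_le)
        then have "lam u x < 0" using ly(2) ly(3)[of u] that by (cases "u = w") auto
        then have "x \<notin> P" using P_D[of x u] u by fastforce
        then show ?thesis using False rhs unfolding distrib_right G_def by simp
      next
        case True
        show ?thesis
        proof (cases "x \<in> P")
          case xP: True
          have "\<bar>f ?y - f x\<bar> \<le> L * norm (?y - x)" by (rule lip[OF BB'[OF PB[OF xP]] BB'[OF PB[OF True]]])
          then have "\<bar>f ?y - f x\<bar> \<le> L * norm e * t" using that by (simp add: mult_ac)
          then show ?thesis using True xP rhs unfolding distrib_right G_def by simp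
        next
          case False
          have "-1 \<le> lam v x" using lv by simp
          then obtain u where u: "u \<in> V" "u \<noteq> v" "lam u x < 0" using False by (auto simp: P_def not_le)
          have "u = w"
          proof (rule ccontr)
            assume "u \<noteq> w"
            then have "lam u ?y < 0" using ly(3)[of u] u by simp
            then show False using P_D[OF True u(1,2)] by simp
          qed
          then have "lam w x < 0" using u by simp
          moreover have "0 \<le> lam w ?y" using True w by (simp add: P_def)
          ultimately have "\<bar>lam w ?y\<bar> \<le> t" using ly by simp
          then have "\<bar>f ?y\<bar> \<le> t * S"
            unfolding f_def abs_mult using S[OF BB'[OF PB[OF True]]] that by (intro mult_mono) auto
          then have "\<bar>f ?y\<bar> \<le> S * t" by (simp add: mult.commute)
          then show ?thesis using True False rhs unfolding distrib_right G_def by simp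
        qed
      qed
    qed
    show "AE x in lborel. n \<bullet> x \<le> a \<longrightarrow>
      (\<lambda>k. (G (x + (1 / real (Suc k)) *\<^sub>R e) - G x) * real (Suc k)) \<longlonglongrightarrow> G' x"
    proof -
      have "AE x in lborel. \<forall>u\<in>V. lam u x \<noteq> 0"
        using fin_V lam_negligible by (subst AE_finite_all) auto
      then show ?thesis
      proof (eventually_elim, intro impI)
        fix x assume nz: "\<forall>u\<in>V. lam u x \<noteq> 0" and nx: "n \<bullet> x \<le> a"
        have lv: "0 < lam v x" using nx half nz v by (metis less_eq_real_def)
        have t0: "filterlim (\<lambda>k. 1 / real (Suc k)) (at 0) sequentially"
          unfolding filterlim_at using LIMSEQ_inverse_real_of_nat by (auto simp: inverse_eq_divide)
        have xt: "((\<lambda>t. x + t *\<^sub>R e) \<longlongrightarrow> x) (at 0)" by (auto intro!: tendsto_eq_intros)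
        have lt: "((\<lambda>t. lam u (x + t *\<^sub>R e)) \<longlongrightarrow> lam u x) (at 0)" for u
          using tendsto_compose[OF _ xt, of "lam u"] continuous_lam[of UNIV u]
          by (simp add: continuous_on_eq_continuous_at isCont_def)
        have "((\<lambda>t. (G (x + t *\<^sub>R e) - G x) / t) \<longlongrightarrow> G' x) (at 0)"
        proof (cases "x \<in> T")
          case True
          then have pos: "lam u x > 0" if "u \<in> V" for u using nz that T_iff by (metis less_eq_real_def)
          have "\<forall>\<^sub>F t in at 0. \<forall>u\<in>V. 0 < lam u (x + t *\<^sub>R e)"
            using fin_V pos order_tendstoD(1)[OF lt] by (simp add: eventually_ball_finite)
          then have ev: "\<forall>\<^sub>F t in at 0. (f (x + t *\<^sub>R e) - f x) / t = (G (x + t *\<^sub>R e) - G x) / t"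
          proof eventually_elim
            case (elim t)
            have "x + t *\<^sub>R e \<in> P" using elim v by (force simp: P_def intro: less_imp_le)
            moreover have "x \<in> P" using pos[of v] pos v by (force simp: P_def intro: less_imp_le)
            ultimately show ?case by (simp add: G_def)
          qed
          have "((\<lambda>t. (f (x + t *\<^sub>R e) - f x) / t) \<longlongrightarrow> grad f x \<bullet> e) (at 0)"
            using DERIV_line[OF fd, of x e] by (simp add: DERIV_def)
          then show ?thesis using tendsto_cong[OF ev] True by (simp add: G'_def)
        next
          case False
          then obtain u where u: "u \<in> V" "lam u x < 0" using T_iff by (meson not_le)
          have uv: "u \<noteq> v" using u lv by auto
          have "\<forall>\<^sub>F t in at 0. lam u (x + t *\<^sub>R e) < 0" by (rule order_tendstoD(2)[OF lt u(2)])
          then have ev: "\<forall>\<^sub>F t in at 0. 0 = (G (x + t *\<^sub>R e) - G x) / t"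
          proof eventually_elim
            case (elim t)
            have "x + t *\<^sub>R e \<notin> P" "x \<notin> P" using P_D[of x u] P_D[of "x + t *\<^sub>R e" u] elim u uv by auto
            then show ?case by (simp add: G_def)
          qed
          show ?thesis using tendsto_cong[OF ev, of 0] False by (simp add: G'_def)
        qed
        from filterlim_compose[OF this t0]
        show "(\<lambda>k. (G (x + (1 / real (Suc k)) *\<^sub>R e) - G x) * real (Suc k)) \<longlonglongrightarrow> G' x" by simp
      qed
    qed
    show "H k \<in> borel_measurable borel" for k unfolding H_def
      by (intro borel_measurable_add borel_measurable_times borel_measurable_const borel_measurable_indicator sets.Int Z_meas) simp_all
    show "\<bar>H k y\<bar> \<le> L * m + 2 * M" for k y
    proof -
      have "L * (m / real (Suc k)) \<le> L * m" "0 \<le> L * (m / real (Suc k))"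
        by (rule mult_left_mono[OF mk(1) MSL(3)]) (rule mult_nonneg_nonneg[OF MSL(3) mk(2)])
      then show ?thesis using MSL unfolding H_def by (auto simp: indicator_def)
    qed
    show "norm y \<le> B'" if "H k y \<noteq> 0" for k y
      using that by (cases "norm y \<le> B'") (auto simp: H_def)
    show "AE x in lborel. (\<lambda>k. H k (proj n a x)) \<longlonglongrightarrow> 0"
    proof -
      have "AE x in lborel. \<forall>u\<in>V - {v}. lam u (proj n a x) \<noteq> 0"
        unfolding n_def a_def using fin_V lam_proj_negligible[OF d v] by (subst AE_finite_all) auto
      then show ?thesis
      proof eventually_elim
        fix x assume nz: "\<forall>u\<in>V - {v}. lam u (proj n a x) \<noteq> 0"
        let ?y = "proj n a x"
        have lim0: "(\<lambda>k. C / real (Suc k)) \<longlonglongrightarrow> 0" for C :: real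
          using tendsto_mult_left[OF LIMSEQ_inverse_real_of_nat, of C] by (simp add: divide_inverse)
        have "\<forall>\<^sub>F k in sequentially. K * m / real (Suc k) < \<bar>lam u ?y\<bar>" if "u \<in> V - {v}" for u
          by (rule order_tendstoD(2)[OF lim0]) (use nz that in auto)
        then have "\<forall>\<^sub>F k in sequentially. \<forall>u\<in>V - {v}. K * m / real (Suc k) < \<bar>lam u ?y\<bar>"
          using fin_V by (simp add: eventually_ball_finite)
        then have ev: "\<forall>\<^sub>F k in sequentially. (L * m / real (Suc k)) * indicator (cball 0 B') ?y = H k ?y"
          by eventually_elim (auto simp: H_def Z_def indicator_def not_le)
        have "(\<lambda>k. (L * m / real (Suc k)) * indicator (cball 0 B') ?y) \<longlonglongrightarrow> 0 * indicator (cball 0 B') ?y"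
          by (intro tendsto_mult lim0 tendsto_const)
        then show "(\<lambda>k. H k ?y) \<longlonglongrightarrow> 0" using tendsto_cong[OF ev] by simp
      qed
    qed
    show "\<bar>G x - G (proj n a x)\<bar> \<le> H k (proj n a x)"
      if x: "0 < n \<bullet> x - a" "n \<bullet> x - a \<le> (n \<bullet> e) / real (Suc k)" for x k
    proof -
      let ?y = "proj n a x"
      have dist: "norm (x - ?y) \<le> m / real (Suc k)"
        using x norm_diff_proj[OF n1, of x a] by (simp add: m_def)
      have lvx: "-1 \<le> lam v x"
      proof -
        have "(n \<bullet> x - a) / m \<le> (m / real (Suc k)) / m" using x m0 by (intro divide_right_mono) (auto simp: m_def)
        also have "\<dots> \<le> 1" using m0 by simp
        finally have "(n \<bullet> x - a) / m \<le> 1" .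
        moreover have "lam v x = - ((n \<bullet> x - a) / m)" unfolding lam_n by (rule minus_divide_left[symmetric])
        ultimately show ?thesis by linarith
      qed
      have lvy: "lam v ?y = 0" using lam_n[of ?y] inner_proj[OF n1, of a x] by simp
      have ny: "norm ?y \<le> B'" if "norm x \<le> B \<or> norm ?y \<le> B"
        using that
      proof
        assume "norm x \<le> B"
        moreover have "norm ?y \<le> norm x + norm (x - ?y)" using norm_triangle_ineq4[of x "x - ?y"] by simp
        ultimately show ?thesis using dist mk[of k] by (simp add: B'_def)
      qed (rule BB')
      show ?thesis
      proof (cases "x \<in> P \<or> ?y \<in> P")
        case False
        then show ?thesis using MSL mk[of k] by (auto simp: G_def H_def)
      next
        case True
        then have yB: "norm ?y \<le> B'" using ny PB by blast
        show ?thesis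
        proof (cases "?y \<in> Z k")
          case True
          have "\<bar>G x\<bar> \<le> M" "\<bar>G ?y\<bar> \<le> M"
            using M[OF BB'[OF PB, of x]] M[OF BB'[OF PB, of ?y]] MSL by (auto simp: G_def indicator_def)
          then have "\<bar>G x - G ?y\<bar> \<le> 2 * M" by linarith
          moreover have "0 \<le> L * (m / real (Suc k))" by (rule mult_nonneg_nonneg[OF MSL(3) mk(2)])
          ultimately show ?thesis using True yB by (simp add: H_def)
        next
          case False
          have "0 \<le> lam u x \<longleftrightarrow> 0 \<le> lam u ?y" if u: "u \<in> V - {v}" for u
          proof -
            have "\<bar>lam u x - lam u ?y\<bar> \<le> norm (g u) * norm (x - ?y)"
              unfolding lam_diff by (rule Cauchy_Schwarz_ineq2)
            also have "\<dots> \<le> K * (m / real (Suc k))"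
              using u K dist mk by (intro mult_mono) (auto intro: order_trans[OF norm_ge_zero])
            finally have "\<bar>lam u x - lam u ?y\<bar> \<le> K * m / real (Suc k)" by simp
            moreover have "\<not> \<bar>lam u ?y\<bar> \<le> K * m / real (Suc k)" using False u unfolding Z_def by blast
            ultimately have "\<bar>lam u x - lam u ?y\<bar> < \<bar>lam u ?y\<bar>" by linarith
            then show ?thesis by linarith
          qed
          then have both: "x \<in> P" "?y \<in> P" using True lvx lvy by (auto simp: P_def)
          have "\<bar>f x - f ?y\<bar> \<le> L * norm (x - ?y)"
            by (rule lip) (use both yB BB' PB in auto)
          also have "\<dots> \<le> L * (m / real (Suc k))" by (intro mult_left_mono dist MSL)
          finally show ?thesis using both yB False by (simp add: G_def H_def)
        qed
      qed
    qed
  qed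
  moreover have "(\<integral>x. indicator {x. n \<bullet> x \<le> a} x * G' x \<partial>lborel) = (LINT x:T|lborel. grad f x \<bullet> e)"
    unfolding set_lebesgue_integral_def G'_def
    by (intro Bochner_Integration.integral_cong) (use v in \<open>auto simp: indicator_def half T_iff\<close>)
  moreover have "plane_integral n a G = (LINT x:facet v|surface_measure. f x)"
  proof -
    have "(LINT x:facet v|surface_measure. f x) = plane_integral n a (\<lambda>x. indicator (facet v) x * f x)"
    proof (rule surface_integral_hyperplane[OF n1])
      show "facet v \<subseteq> {x. n \<bullet> x = a}" unfolding n_def a_def by (rule facet_plane[OF v])
      show "bounded (facet v)" using compact_facet by (rule compact_imp_bounded)
      show "\<bar>f x\<bar> \<le> M" if "x \<in> facet v" for x
        using that by (intro M BB' PB) (auto simp: facet_def T_iff P_def)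
    qed (use fm in auto)
    also have "\<dots> = plane_integral n a G"
    proof -
      have "indicator (facet v) (proj n a x) = (indicator P (proj n a x) :: real)" for x
      proof -
        have "lam v (proj n a x) = 0" using lam_n[of "proj n a x"] inner_proj[OF n1, of a x] by simp
        then have "proj n a x \<in> facet v \<longleftrightarrow> proj n a x \<in> P" using v by (auto simp: facet_def T_iff P_def)
        then show ?thesis by (simp add: indicator_def)
      qed
      then show ?thesis by (simp add: plane_integral_def G_def)
    qed
    finally show ?thesis ..
  qed
  ultimately show ?thesis by (simp add: e_def n_def)
qed

end

section \<open>The $L^2$ norm on a set\<close>

lemma L2_imp_measurable: "L2 M D f \<Longrightarrow> (\<lambda>x. indicator D x *\<^sub>R f x) \<in> borel_measurable M"
  by (simp add: L2_def set_borel_measurable_def)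

lemma L2_norm_sq: "(L2_norm M D f)\<^sup>2 = (LINT x:D|M. (norm (f x))\<^sup>2)"
  unfolding L2_norm_def by (intro real_sqrt_pow2) (simp add: set_lebesgue_integral_def integral_nonneg_AE)

lemma L2_norm_nonneg: "0 \<le> L2_norm M D f"
  unfolding L2_norm_def by (simp add: set_lebesgue_integral_def integral_nonneg_AE)

lemma indicator_norm_sq: "indicator D x *\<^sub>R (norm (f x))\<^sup>2 = (norm (indicator D x *\<^sub>R f x))\<^sup>2"
  by (auto simp: indicator_def)

lemma L2_inner_integrable:
  fixes f g :: "real^'n \<Rightarrow> 'b::euclidean_space"
  assumes f: "L2 M D f" and g: "L2 M D g"
  shows "set_integrable M D (\<lambda>x. f x \<bullet> g x)"
  unfolding set_integrable_def
proof (rule Bochner_Integration.integrable_bound)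
  show "integrable M (\<lambda>x. indicator D x *\<^sub>R (norm (f x))\<^sup>2 + indicator D x *\<^sub>R (norm (g x))\<^sup>2)"
    using f g by (auto simp: L2_def set_integrable_def)
  have "(\<lambda>x. (indicator D x *\<^sub>R f x) \<bullet> (indicator D x *\<^sub>R g x)) \<in> borel_measurable M"
    by (rule borel_measurable_inner[OF L2_imp_measurable[OF f] L2_imp_measurable[OF g]])
  moreover have "(indicator D x *\<^sub>R f x) \<bullet> (indicator D x *\<^sub>R g x) = indicator D x *\<^sub>R (f x \<bullet> g x)" for x
    by (auto simp: indicator_def)
  ultimately show "(\<lambda>x. indicator D x *\<^sub>R (f x \<bullet> g x)) \<in> borel_measurable M" by (simp only:)
  show "AE x in M. norm (indicator D x *\<^sub>R (f x \<bullet> g x)) \<le> norm (indicator D x *\<^sub>R (norm (f x))\<^sup>2 + indicator D x *\<^sub>R (norm (g x))\<^sup>2)"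
  proof (rule AE_I2)
    fix x
    have "\<bar>f x \<bullet> g x\<bar> \<le> norm (f x) * norm (g x)" by (rule Cauchy_Schwarz_ineq2)
    also have "\<dots> \<le> (norm (f x))\<^sup>2 + (norm (g x))\<^sup>2"
      using sum_squares_bound[of "norm (f x)" "norm (g x)"] mult_nonneg_nonneg[OF norm_ge_zero[of "f x"] norm_ge_zero[of "g x"]]
      by linarith
    finally have "\<bar>f x \<bullet> g x\<bar> \<le> \<bar>(norm (f x))\<^sup>2 + (norm (g x))\<^sup>2\<bar>" by (rule order_trans[OF _ abs_ge_self])
    then show "norm (indicator D x *\<^sub>R (f x \<bullet> g x)) \<le> norm (indicator D x *\<^sub>R (norm (f x))\<^sup>2 + indicator D x *\<^sub>R (norm (g x))\<^sup>2)"
      by (cases "x \<in> D") simp_all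
  qed
qed

lemma L2_add:
  fixes f g :: "real^'n \<Rightarrow> 'b::euclidean_space"
  assumes f: "L2 M D f" and g: "L2 M D g"
  shows "L2 M D (\<lambda>x. f x + g x)"
  unfolding L2_def
proof
  have "(\<lambda>x. indicator D x *\<^sub>R f x + indicator D x *\<^sub>R g x) \<in> borel_measurable M"
    by (rule borel_measurable_add[OF L2_imp_measurable[OF f] L2_imp_measurable[OF g]])
  then show "set_borel_measurable M D (\<lambda>x. f x + g x)"
    by (simp add: set_borel_measurable_def scaleR_add_right)
  have "(\<lambda>x. (norm (f x + g x))\<^sup>2) = (\<lambda>x. (norm (f x))\<^sup>2 + ((norm (g x))\<^sup>2 + 2 * (f x \<bullet> g x)))"
    by (auto simp: power2_norm_eq_inner inner_add_left inner_add_right inner_commute)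
  then show "set_integrable M D (\<lambda>x. (norm (f x + g x))\<^sup>2)"
    using f g L2_inner_integrable[OF f g] by (auto simp: L2_def intro!: set_integral_add)
qed

lemma L2_scale:
  fixes f :: "real^'n \<Rightarrow> 'b::euclidean_space"
  assumes f: "L2 M D f"
  shows "L2 M D (\<lambda>x. k *\<^sub>R f x)"
  unfolding L2_def
proof
  have "(\<lambda>x. k *\<^sub>R (indicator D x *\<^sub>R f x)) \<in> borel_measurable M"
    by (rule borel_measurable_scaleR[OF borel_measurable_const L2_imp_measurable[OF f]])
  then show "set_borel_measurable M D (\<lambda>x. k *\<^sub>R f x)"
    unfolding set_borel_measurable_def scaleR_left_commute[of _ k] .
  show "set_integrable M D (\<lambda>x. (norm (k *\<^sub>R f x))\<^sup>2)"
    using f by (simp add: L2_def power_mult_distrib)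
qed

lemma L2_diff:
  fixes f g :: "real^'n \<Rightarrow> 'b::euclidean_space"
  assumes "L2 M D f" and "L2 M D g"
  shows "L2 M D (\<lambda>x. f x - g x)"
  using L2_add[OF assms(1) L2_scale[OF assms(2), of "-1"]] by simp

lemma L2_norm_scale:
  "L2_norm M D (\<lambda>x. k *\<^sub>R f x) = \<bar>k\<bar> * L2_norm M D f"
  by (simp add: L2_norm_def power_mult_distrib real_sqrt_mult)

lemma L2_Cauchy_Schwarz:
  fixes f g :: "real^'n \<Rightarrow> 'b::euclidean_space"
  assumes f: "L2 M D f" and g: "L2 M D g"
  shows "\<bar>LINT x:D|M. f x \<bullet> g x\<bar> \<le> L2_norm M D f * L2_norm M D g"
proof -
  define A B C where "A = (LINT x:D|M. (norm (f x))\<^sup>2)" and "B = (LINT x:D|M. f x \<bullet> g x)"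
    and "C = (LINT x:D|M. (norm (g x))\<^sup>2)"
  have AC: "A \<ge> 0" "C \<ge> 0" unfolding A_def C_def by (simp_all flip: L2_norm_sq)
  have quad: "0 \<le> s\<^sup>2 * A + 2 * s * t * B + t\<^sup>2 * C" for s t
  proof -
    have i: "set_integrable M D (\<lambda>x. s\<^sup>2 * (norm (f x))\<^sup>2)" "set_integrable M D (\<lambda>x. 2 * s * t * (f x \<bullet> g x))"
        "set_integrable M D (\<lambda>x. t\<^sup>2 * (norm (g x))\<^sup>2)"
      using f g L2_inner_integrable[OF f g] by (auto simp: L2_def)
    have "0 \<le> (LINT x:D|M. (norm (s *\<^sub>R f x + t *\<^sub>R g x))\<^sup>2)" by (simp flip: L2_norm_sq)
    also have "(\<lambda>x. (norm (s *\<^sub>R f x + t *\<^sub>R g x))\<^sup>2)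
       = (\<lambda>x. (s\<^sup>2 * (norm (f x))\<^sup>2 + 2 * s * t * (f x \<bullet> g x)) + t\<^sup>2 * (norm (g x))\<^sup>2)"
      unfolding power2_norm_eq_inner
      by (auto simp: inner_add_left inner_add_right inner_commute power2_eq_square[of s] power2_eq_square[of t] algebra_simps)
    also have "(LINT x:D|M. (s\<^sup>2 * (norm (f x))\<^sup>2 + 2 * s * t * (f x \<bullet> g x)) + t\<^sup>2 * (norm (g x))\<^sup>2)
       = s\<^sup>2 * A + 2 * s * t * B + t\<^sup>2 * C"
      using i by (simp add: set_integral_add A_def B_def C_def)
    finally show ?thesis .
  qed
  have "B\<^sup>2 \<le> A * C"
  proof (cases "A = 0")
    case True
    have "B = 0"
    proof (rule ccontr)
      assume "B \<noteq> 0"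
      have "0 \<le> 2 * (- (C + 1) / (2 * B)) * 1 * B + 1\<^sup>2 * C"
        using quad[of "- (C + 1) / (2 * B)" 1] True by simp
      also have "\<dots> = - 1" using \<open>B \<noteq> 0\<close> by (simp add: field_simps)
      finally show False by simp
    qed
    then show ?thesis using AC by simp
  next
    case False
    have "0 \<le> B\<^sup>2 * A + 2 * B * (- A) * B + (- A)\<^sup>2 * C" by (rule quad)
    then have "0 \<le> A * (A * C - B\<^sup>2)" by (simp add: algebra_simps power2_eq_square)
    then show ?thesis using False AC(1) by (simp add: zero_le_mult_iff)
  qed
  then have "\<bar>B\<bar> \<le> sqrt (A * C)" by (metis real_sqrt_abs real_sqrt_le_mono)
  then show ?thesis by (simp add: L2_norm_def A_def B_def C_def real_sqrt_mult)
qed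

lemma L2_norm_triangle:
  fixes f g :: "real^'n \<Rightarrow> 'b::euclidean_space"
  assumes f: "L2 M D f" and g: "L2 M D g"
  shows "L2_norm M D (\<lambda>x. f x + g x) \<le> L2_norm M D f + L2_norm M D g"
proof (rule power2_le_imp_le)
  have i: "set_integrable M D (\<lambda>x. (norm (f x))\<^sup>2)" "set_integrable M D (\<lambda>x. 2 * (f x \<bullet> g x))"
      "set_integrable M D (\<lambda>x. (norm (g x))\<^sup>2)"
    using f g L2_inner_integrable[OF f g] by (auto simp: L2_def)
  have eq: "(\<lambda>x. (norm (f x + g x))\<^sup>2) = (\<lambda>x. ((norm (f x))\<^sup>2 + 2 * (f x \<bullet> g x)) + (norm (g x))\<^sup>2)"
    by (auto simp: power2_norm_eq_inner inner_add_left inner_add_right inner_commute)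
  have "(L2_norm M D (\<lambda>x. f x + g x))\<^sup>2 = (L2_norm M D f)\<^sup>2 + 2 * (LINT x:D|M. f x \<bullet> g x) + (L2_norm M D g)\<^sup>2"
    unfolding L2_norm_sq eq using i by (simp add: set_integral_add)
  also have "\<dots> \<le> (L2_norm M D f + L2_norm M D g)\<^sup>2"
    using L2_Cauchy_Schwarz[OF f g] by (simp add: power2_sum)
  finally show "(L2_norm M D (\<lambda>x. f x + g x))\<^sup>2 \<le> (L2_norm M D f + L2_norm M D g)\<^sup>2" .
qed (simp add: L2_norm_nonneg add_nonneg_nonneg)

lemma L2_norm_diff_le:
  fixes f g :: "real^'n \<Rightarrow> 'b::euclidean_space"
  assumes "L2 M D f" and "L2 M D g"
  shows "L2_norm M D (\<lambda>x. f x - g x) \<le> L2_norm M D f + L2_norm M D g"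
  using L2_norm_triangle[OF assms(1) L2_scale[OF assms(2), of "-1"]] L2_norm_scale[of M D "-1" g] by simp

text \<open>
  Used for the products of an \<open>L\<^sup>2\<close> function with the coefficients of the equation.
\<close>

lemma L2_dominated:
  fixes f :: "real^'n \<Rightarrow> 'b::euclidean_space" and q :: "real^'n \<Rightarrow> 'c::euclidean_space"
  assumes f: "L2 M D f" and q: "(\<lambda>x. indicator D x *\<^sub>R q x) \<in> borel_measurable M"
    and bound: "AE x in M. x \<in> D \<longrightarrow> norm (q x) \<le> K * norm (f x)"
  shows "L2 M D q" "K \<ge> 0 \<Longrightarrow> L2_norm M D q \<le> K * L2_norm M D f"
proof -
  have le: "AE x in M. indicator D x *\<^sub>R (norm (q x))\<^sup>2 \<le> K\<^sup>2 * (indicator D x *\<^sub>R (norm (f x))\<^sup>2)"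
    using bound
  proof eventually_elim
    case (elim x)
    show ?case
    proof (cases "x \<in> D")
      case True
      then have "(norm (q x))\<^sup>2 \<le> (K * norm (f x))\<^sup>2" using elim by (intro power_mono) auto
      then show ?thesis using True by (simp add: power_mult_distrib)
    qed simp
  qed
  have i: "integrable M (\<lambda>x. K\<^sup>2 * (indicator D x *\<^sub>R (norm (f x))\<^sup>2))"
    using f by (auto simp: L2_def set_integrable_def)
  have i2: "integrable M (\<lambda>x. indicator D x *\<^sub>R (norm (q x))\<^sup>2)"
  proof (rule Bochner_Integration.integrable_bound[OF i])
    show "(\<lambda>x. indicator D x *\<^sub>R (norm (q x))\<^sup>2) \<in> borel_measurable M"
      unfolding indicator_norm_sq by (rule borel_measurable_power[OF measurable_compose[OF q borel_measurable_norm]])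
    show "AE x in M. norm (indicator D x *\<^sub>R (norm (q x))\<^sup>2) \<le> norm (K\<^sup>2 * (indicator D x *\<^sub>R (norm (f x))\<^sup>2))"
      using le by eventually_elim (auto simp: abs_mult)
  qed
  then show "L2 M D q" using q by (simp add: L2_def set_integrable_def set_borel_measurable_def)
  assume K: "K \<ge> 0"
  have "(L2_norm M D q)\<^sup>2 \<le> K\<^sup>2 * (L2_norm M D f)\<^sup>2"
    unfolding L2_norm_sq set_lebesgue_integral_def
    by (subst integral_mult_right_zero[symmetric]) (rule integral_mono_AE[OF i2 i le])
  then have "(L2_norm M D q)\<^sup>2 \<le> (K * L2_norm M D f)\<^sup>2" by (simp add: power_mult_distrib)
  then show "L2_norm M D q \<le> K * L2_norm M D f"
    by (rule power2_le_imp_le) (simp add: K L2_norm_nonneg)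
qed

lemma L2_norm_sup_bound:
  fixes f :: "real^'n \<Rightarrow> 'b::euclidean_space"
  assumes "L2 lebesgue D f" "D \<in> sets borel" "D \<subseteq> E" "E \<in> sets borel" "bounded E"
    and S: "\<And>x. x \<in> D \<Longrightarrow> (norm (f x))\<^sup>2 \<le> S" "S \<ge> 0"
  shows "(L2_norm lebesgue D f)\<^sup>2 \<le> S * measure lborel E"
proof -
  have Ef: "emeasure lborel E < \<infinity>" by (rule emeasure_bounded_finite[OF assms(5)])
  have "(L2_norm lebesgue D f)\<^sup>2 \<le> (\<integral>x. S * indicator E x \<partial>lebesgue)"
    unfolding L2_norm_sq set_lebesgue_integral_def
  proof (rule integral_mono)
    show "integrable lebesgue (\<lambda>x. indicator D x *\<^sub>R (norm (f x))\<^sup>2)"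
      using assms(1) by (simp add: L2_def set_integrable_def)
    show "integrable lebesgue (\<lambda>x. S * indicator E x)"
      using Ef assms(4) by (intro integrable_mult_right) (simp add: integrable_indicator_iff)
    show "indicator D x *\<^sub>R (norm (f x))\<^sup>2 \<le> S * indicator E x" for x
      using S assms(3) by (auto simp: indicator_def)
  qed
  also have "\<dots> = S * measure lborel E" using assms(4) by simp
  finally show ?thesis .
qed

lemma measure_cball_scale:
  fixes m :: "real^'n" assumes "r \<ge> 0"
  shows "measure lborel (cball m r) = r ^ CARD('n) * unit_ball_vol (real CARD('n))"
  using content_cball[OF assms, of m] by simp


subsection \<open>Existence of the $L^2$ projection\<close>

lemma L2_zero_imp_orthogonal:
  fixes f g :: "real^'n \<Rightarrow> real"
  assumes "L2 M D f" "L2 M D g" "L2_norm M D f = 0"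
  shows "(LINT x:D|M. f x * g x) = 0"
  using L2_Cauchy_Schwarz[OF assms(1,2)] assms(3) by simp

text \<open>
  Gram--Schmidt, one generator at a time.  A generator that depends on the previous ones leaves a remainder of
  norm zero, which is orthogonal to everything and receives the coefficient zero.
\<close>

lemma L2_projection_exists:
  fixes b :: "'i \<Rightarrow> real^'n \<Rightarrow> real"
  assumes "finite I" "\<And>i. i \<in> I \<Longrightarrow> L2 M D (b i)" "L2 M D R"
  shows "\<exists>a. \<forall>i\<in>I. (LINT x:D|M. (R x - (\<Sum>j\<in>I. a j * b j x)) * b i x) = 0"
  using assms
proof (induction I arbitrary: R rule: finite_induct)
  case empty
  then show ?case by simp
next
  case (insert k I)
  have L2b: "L2 M D (b i)" if "i \<in> I" for i using insert that by simp
  have L2sum: "L2 M D (\<lambda>x. \<Sum>j\<in>I. a j * b j x)" for a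
    using insert.hyps(1) L2b
  proof (induction I rule: finite_induct)
    case empty
    show ?case by (simp add: L2_def set_borel_measurable_def set_integrable_def)
  next
    case (insert i J)
    then show ?case using L2_add[OF L2_scale[of M D "b i" "a i"] insert.IH] by simp
  qed
  obtain r where r: "\<And>i. i \<in> I \<Longrightarrow> (LINT x:D|M. (R x - (\<Sum>j\<in>I. r j * b j x)) * b i x) = 0"
    using insert.IH[OF L2b insert.prems(2)] by blast
  obtain s where s: "\<And>i. i \<in> I \<Longrightarrow> (LINT x:D|M. (b k x - (\<Sum>j\<in>I. s j * b j x)) * b i x) = 0"
    using insert.IH[OF L2b insert.prems(1)[of k]] by blast
  define R' where "R' x = R x - (\<Sum>j\<in>I. r j * b j x)" for x
  define b' where "b' x = b k x - (\<Sum>j\<in>I. s j * b j x)" for x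
  have L2R': "L2 M D R'" unfolding R'_def by (rule L2_diff[OF insert.prems(2) L2sum])
  have L2b': "L2 M D b'" unfolding b'_def by (rule L2_diff[OF insert.prems(1) L2sum]) simp
  have int: "set_integrable M D (\<lambda>x. u x * w x)" if "L2 M D u" "L2 M D w" for u w :: "real^'n \<Rightarrow> real"
    using L2_inner_integrable[OF that] by simp
  have R'b: "(LINT x:D|M. R' x * b i x) = 0" if "i \<in> I" for i unfolding R'_def by (rule r[OF that])
  have b'b: "(LINT x:D|M. b' x * b i x) = 0" if "i \<in> I" for i unfolding b'_def by (rule s[OF that])
  define t where "t = (if L2_norm M D b' = 0 then 0 else (LINT x:D|M. R' x * b' x) / (L2_norm M D b')\<^sup>2)"
  have orth': "(LINT x:D|M. (R' x - t * b' x) * b i x) = 0" if "i \<in> I" for i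
  proof -
    have "(LINT x:D|M. (R' x - t * b' x) * b i x) = (LINT x:D|M. R' x * b i x - t * (b' x * b i x))"
      by (simp add: algebra_simps)
    also have "\<dots> = 0"
      using int[OF L2R' L2b[OF that]] int[OF L2b' L2b[OF that]]
      by (simp add: set_integral_diff R'b[OF that] b'b[OF that])
    finally show ?thesis .
  qed
  have L2d: "L2 M D (\<lambda>x. R' x - t * b' x)" using L2_diff[OF L2R' L2_scale[OF L2b', of t]] by simp
  have orthb': "(LINT x:D|M. (R' x - t * b' x) * b' x) = 0"
  proof -
    have "(LINT x:D|M. (R' x - t * b' x) * b' x) = (LINT x:D|M. R' x * b' x - t * (b' x)\<^sup>2)"
      by (simp add: algebra_simps power2_eq_square)
    also have "\<dots> = (LINT x:D|M. R' x * b' x) - t * (L2_norm M D b')\<^sup>2"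
      using int[OF L2R' L2b'] L2b' by (simp add: set_integral_diff L2_norm_sq L2_def)
    also have "\<dots> = 0"
      using L2_zero_imp_orthogonal[OF L2b' L2R'] by (simp add: t_def mult.commute)
    finally show ?thesis .
  qed
  have orthk: "(LINT x:D|M. (R' x - t * b' x) * b k x) = 0"
  proof -
    have "(LINT x:D|M. (R' x - t * b' x) * b k x)
       = (LINT x:D|M. (R' x - t * b' x) * b' x + (\<Sum>j\<in>I. s j * ((R' x - t * b' x) * b j x)))"
    proof -
      have "b k x = b' x + (\<Sum>j\<in>I. s j * b j x)" for x by (simp add: b'_def)
      then have "y * b k x = y * b' x + (\<Sum>j\<in>I. s j * (y * b j x))" for x y
        by (simp add: distrib_left sum_distrib_left mult.left_commute)
      then show ?thesis by (simp only:)
    qed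
    also have "\<dots> = (LINT x:D|M. (R' x - t * b' x) * b' x) + (LINT x:D|M. (\<Sum>j\<in>I. s j * ((R' x - t * b' x) * b j x)))"
    proof (rule set_integral_add(2)[OF int[OF L2d L2b']])
      show "set_integrable M D (\<lambda>x. \<Sum>j\<in>I. s j * ((R' x - t * b' x) * b j x))"
        unfolding set_integrable_def scaleR_sum_right
        by (intro Bochner_Integration.integrable_sum)
           (use int[OF L2d L2b] in \<open>auto simp: set_integrable_def mult.left_commute\<close>)
    qed
    also have "(LINT x:D|M. (\<Sum>j\<in>I. s j * ((R' x - t * b' x) * b j x))) = (\<Sum>j\<in>I. s j * (LINT x:D|M. (R' x - t * b' x) * b j x))"
      using int[OF L2d L2b] unfolding set_lebesgue_integral_def set_integrable_def scaleR_sum_right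
      by (subst Bochner_Integration.integral_sum) (auto simp: mult.left_commute)
    also have "\<dots> = 0" by (simp add: orth')
    finally show ?thesis by (simp add: orthb')
  qed
  define a where "a j = (if j = k then t else r j - t * s j)" for j
  have "R x - (\<Sum>j\<in>insert k I. a j * b j x) = R' x - t * b' x" for x
  proof -
    have "(\<Sum>j\<in>I. a j * b j x) = (\<Sum>j\<in>I. (r j - t * s j) * b j x)"
      using insert.hyps(2) by (intro sum.cong) (auto simp: a_def)
    then show ?thesis using insert.hyps
      by (simp add: R'_def b'_def a_def algebra_simps sum_subtractf sum_distrib_left)
  qed
  then show ?case using orth' orthk by (intro exI[of _ a]) auto
qed

section \<open>Scaled bounds for bubble functions\<close>

lemma mean_sq_ball_integral:
  fixes f :: "real^'n \<Rightarrow> real"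
  assumes "r > 0"
  shows "r ^ CARD('n) * mean_sq f m (r / 2) = 2 ^ CARD('n) * (LINT x:ball m (r / 2)|lborel. (f x)\<^sup>2)"
  using assms by (simp add: mean_sq_def power_divide)

text \<open>
  The bubble is at most 1 and its gradient at most \<open>8 / r\<close>, so all bounds come from the inverse estimate at the scale \<open>r / 2\<close>.
  That scale is used since the bubble is bounded below on the half ball.
\<close>

lemma bubble_bounds:
  assumes K: "K \<ge> 1"
  shows "\<exists>C>0. \<forall>f\<in>polys p. \<forall>(m::real^'n) r D. r > 0 \<longrightarrow> D \<in> sets borel \<longrightarrow> D \<subseteq> cball m (K * r) \<longrightarrow>
     (\<forall>x\<in>cball m (K * r). (f x)\<^sup>2 \<le> C * mean_sq f m (r / 2)) \<and>
     (L2_norm lebesgue D f)\<^sup>2 \<le> C * (r ^ CARD('n) * mean_sq f m (r / 2)) \<and>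
     (L2_norm lebesgue D (\<lambda>x. f x * bump m r x))\<^sup>2 \<le> C * (r ^ CARD('n) * mean_sq f m (r / 2)) \<and>
     (r * L2_norm lebesgue D (grad (\<lambda>x. f x * bump m r x)))\<^sup>2 \<le> C * (r ^ CARD('n) * mean_sq f m (r / 2))"
proof -
  have "2 * K \<ge> 1" using K by simp
  from polys_inverse_estimate[OF this, of p, where 'n='n]
  obtain C where C: "C > 0" and C2: "\<forall>f\<in>polys p. \<forall>x0 r x. r > 0 \<longrightarrow> (x::real^'n) \<in> cball x0 (2 * K * r) \<longrightarrow>
     (f x)\<^sup>2 \<le> C * mean_sq f x0 r \<and> (r * norm (grad f x))\<^sup>2 \<le> C * mean_sq f x0 r" by (elim exE conjE)
  define \<omega> where "\<omega> = K ^ CARD('n) * unit_ball_vol (real CARD('n))"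
  have w0: "\<omega> \<ge> 0" using K unit_ball_vol_nonneg[of "real CARD('n)"] by (simp add: \<omega>_def)
  \<comment> \<open>136 = 2 (4 + 64): (2 + 8)^2 split by 2 (2^2 + 8^2), where 8 is the constant of the bubble gradient and 2 comes from the scale r / 2\<close>
  define C' where "C' = C + 136 * C * \<omega>"
  have C'0: "C' > 0" using C w0 by (simp add: C'_def add_pos_nonneg)
  have "(\<forall>x\<in>cball m (K * r). (f x)\<^sup>2 \<le> C' * mean_sq f m (r / 2)) \<and>
     (L2_norm lebesgue D f)\<^sup>2 \<le> C' * (r ^ CARD('n) * mean_sq f m (r / 2)) \<and>
     (L2_norm lebesgue D (\<lambda>x. f x * bump m r x))\<^sup>2 \<le> C' * (r ^ CARD('n) * mean_sq f m (r / 2)) \<and>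
     (r * L2_norm lebesgue D (grad (\<lambda>x. f x * bump m r x)))\<^sup>2 \<le> C' * (r ^ CARD('n) * mean_sq f m (r / 2))"
    if f: "f \<in> polys p" and r: "r > 0" and D: "D \<in> sets borel" "D \<subseteq> cball m (K * r)" for f and m :: "real^'n" and r D
  proof -
    define M where "M = mean_sq f m (r / 2)"
    have M0: "M \<ge> 0" unfolding M_def using r by (intro mean_sq_nonneg) simp
    have pt: "(f x)\<^sup>2 \<le> C * M" "(r / 2 * norm (grad f x))\<^sup>2 \<le> C * M" if "x \<in> cball m (K * r)" for x
      using C2[rule_format, OF f, of "r / 2" x m] r that by (simp_all add: M_def)
    have bD: "bounded D" using D(2) bounded_cball bounded_subset by blast
    have Kr: "0 \<le> K * r" using K r by simp
    have vol: "measure lborel (cball m (K * r)) = \<omega> * r ^ CARD('n)"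
      using measure_cball_scale[OF Kr, of m] by (simp add: \<omega>_def power_mult_distrib mult_ac)
    have C1: "C1_compact (\<lambda>x. f x * bump m r x)"
      using test_function_C1_compact[OF test_function_poly_bump[OF f r subset_UNIV]] .
    have cont: "continuous_on UNIV (\<lambda>x. f x * bump m r x)" "continuous_on UNIV (grad (\<lambda>x. f x * bump m r x))"
      using C1 by (auto simp: C1_compact_def continuous_on_eq_continuous_at intro!: differentiable_imp_continuous_within)
    have CM: "0 \<le> C * M" using C M0 by simp
    have fin: "S * (\<omega> * r ^ CARD('n)) \<le> C' * (r ^ CARD('n) * M)" if "S \<le> 136 * (C * M)" for S
    proof -
      have "S * (\<omega> * r ^ CARD('n)) \<le> 136 * (C * M) * (\<omega> * r ^ CARD('n))"
        using that w0 r by (intro mult_right_mono) auto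
      also have "\<dots> = (136 * C * \<omega>) * (r ^ CARD('n) * M)" by simp
      also have "\<dots> \<le> C' * (r ^ CARD('n) * M)"
        using C M0 r by (intro mult_right_mono) (auto simp: C'_def)
      finally show ?thesis .
    qed
    have 1: "(f x)\<^sup>2 \<le> C' * M" if "x \<in> cball m (K * r)" for x
    proof -
      have "C * M \<le> C' * M" using w0 C M0 by (intro mult_right_mono) (auto simp: C'_def)
      then show ?thesis using pt(1)[OF that] by simp
    qed
    have 2: "(L2_norm lebesgue D f)\<^sup>2 \<le> (C * M) * measure lborel (cball m (K * r))"
      by (rule L2_norm_sup_bound[OF L2_continuous[OF polys_continuous[OF f] bD D(1)] D])
         (use pt(1) D CM in \<open>auto simp: power2_abs\<close>)
    have 3: "(L2_norm lebesgue D (\<lambda>x. f x * bump m r x))\<^sup>2 \<le> (C * M) * measure lborel (cball m (K * r))"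
    proof (rule L2_norm_sup_bound[OF L2_continuous[OF cont(1) bD D(1)] D])
      fix x assume "x \<in> D"
      have "(norm (f x * bump m r x))\<^sup>2 = (f x)\<^sup>2 * (bump m r x)\<^sup>2" by (simp add: power_mult_distrib)
      also have "\<dots> \<le> (f x)\<^sup>2 * 1"
        by (intro mult_left_mono power_le_one bump_nonneg bump_le_1) simp
      finally show "(norm (f x * bump m r x))\<^sup>2 \<le> C * M" using pt(1)[of x] D \<open>x \<in> D\<close> by auto
    qed (use CM in auto)
    have 4: "(L2_norm lebesgue D (grad (\<lambda>x. f x * bump m r x)))\<^sup>2 \<le> (136 / r\<^sup>2 * (C * M)) * measure lborel (cball m (K * r))"
    proof (rule L2_norm_sup_bound[OF L2_continuous[OF cont(2) bD D(1)] D])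
      fix x assume "x \<in> D"
      then have x: "x \<in> cball m (K * r)" using D by auto
      have g: "grad (\<lambda>x. f x * bump m r x) x = f x *\<^sub>R grad (bump m r) x + bump m r x *\<^sub>R grad f x"
        by (rule grad_mult[OF polys_differentiable[OF f] bump_differentiable])
      define A where "A = \<bar>f x\<bar>" define G where "G = r / 2 * norm (grad f x)"
      have AG: "A\<^sup>2 \<le> C * M" "G\<^sup>2 \<le> C * M" "A \<ge> 0" "G \<ge> 0" using pt[OF x] r by (auto simp: A_def G_def)
      have "norm (f x *\<^sub>R grad (bump m r) x) \<le> A * (8 / r)"
        unfolding norm_scaleR A_def by (rule mult_left_mono[OF grad_bump_le[OF r]]) simp
      moreover have "norm (bump m r x *\<^sub>R grad f x) \<le> 1 * norm (grad f x)"
        unfolding norm_scaleR abs_of_nonneg[OF bump_nonneg] by (rule mult_right_mono[OF bump_le_1]) simp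
      ultimately have "norm (grad (\<lambda>x. f x * bump m r x) x) \<le> A * (8 / r) + 1 * norm (grad f x)"
        unfolding g using norm_triangle_ineq[of "f x *\<^sub>R grad (bump m r) x" "bump m r x *\<^sub>R grad f x"] by linarith
      then have "r * norm (grad (\<lambda>x. f x * bump m r x) x) \<le> r * (A * (8 / r) + 1 * norm (grad f x))"
        using r by (intro mult_left_mono) auto
      also have "\<dots> = 8 * A + 2 * G" using r by (simp add: G_def algebra_simps)
      finally have "(r * norm (grad (\<lambda>x. f x * bump m r x) x))\<^sup>2 \<le> (8 * A + 2 * G)\<^sup>2"
        using r by (intro power_mono) auto
      also have "\<dots> \<le> 2 * (8 * A)\<^sup>2 + 2 * (2 * G)\<^sup>2"
        using sum_squares_bound[of "8 * A" "2 * G"] by (simp add: power2_sum)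
      also have "\<dots> \<le> 136 * (C * M)" using AG by (simp add: power_mult_distrib)
      finally show "(norm (grad (\<lambda>x. f x * bump m r x) x))\<^sup>2 \<le> 136 / r\<^sup>2 * (C * M)"
        using r by (simp add: power_mult_distrib pos_le_divide_eq mult.commute)
    qed (use CM in auto)
    have "(r * L2_norm lebesgue D (grad (\<lambda>x. f x * bump m r x)))\<^sup>2
        \<le> r\<^sup>2 * ((136 / r\<^sup>2 * (C * M)) * measure lborel (cball m (K * r)))"
      unfolding power_mult_distrib by (intro mult_left_mono 4) simp
    also have "\<dots> = 136 * (C * M) * (\<omega> * r ^ CARD('n))" using r by (simp add: vol)
    finally have 5: "(r * L2_norm lebesgue D (grad (\<lambda>x. f x * bump m r x)))\<^sup>2 \<le> C' * (r ^ CARD('n) * M)"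
      using fin[of "136 * (C * M)"] by simp
    show ?thesis using 1 2 3 5 fin[of "C * M"] CM unfolding vol M_def by auto
  qed
  then show ?thesis using C'0 by blast
qed

lemma plane_integral_mono:
  fixes g h :: "real^'n \<Rightarrow> real"
  assumes n: "norm n = 1" and "g \<in> borel_measurable borel" "h \<in> borel_measurable borel"
    and "\<And>y. \<bar>h y\<bar> \<le> M" "\<And>y. h y \<noteq> 0 \<Longrightarrow> norm y \<le> B" and le: "\<And>y. n \<bullet> y = a \<Longrightarrow> 0 \<le> g y \<and> g y \<le> h y"
  shows "plane_integral n a g \<le> plane_integral n a h"
  unfolding plane_integral_def
proof (rule integral_mono')
  show "integrable lborel (\<lambda>x. indicator {x. 0 < n \<bullet> x - a \<and> n \<bullet> x - a \<le> 1} x * h (proj n a x))"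
    by (rule strip_integrable[OF n assms(3,4,5)])
  show "indicator {x. 0 < n \<bullet> x - a \<and> n \<bullet> x - a \<le> 1} x * g (proj n a x)
      \<le> indicator {x. 0 < n \<bullet> x - a \<and> n \<bullet> x - a \<le> 1} x * h (proj n a x)" for x
    using le[of "proj n a x"] inner_proj[OF n] by (auto simp: indicator_def)
  show "0 \<le> indicator {x. 0 < n \<bullet> x - a \<and> n \<bullet> x - a \<le> 1} x * h (proj n a x)" for x
    using le[of "proj n a x"] inner_proj[OF n] by (auto simp: indicator_def)
qed

text \<open>
  A polynomial that is constant in the normal direction: its mean square over a ball around a point of the
  plane is controlled by its mean square over the section of the ball.
\<close>

lemma mean_sq_le_plane_integral:
  fixes G :: "real^'n \<Rightarrow> real"
  assumes n: "norm n = 1" and m: "n \<bullet> m = a" and r: "r > 0" and G: "G \<in> polys p"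
    and inv: "\<And>x. G (proj n a x) = G x"
  shows "r ^ CARD('n) * mean_sq G m (r / 2)
     \<le> 2 ^ CARD('n) * (r * plane_integral n a (\<lambda>x. indicator (ball m (r / 2)) x * (G x)\<^sup>2))"
proof -
  let ?h = "\<lambda>x. indicator (ball m (r / 2)) x * (G x)\<^sup>2"
  have Gm [measurable]: "G \<in> borel_measurable borel" by (rule polys_borel[OF G])
  have hm: "?h \<in> borel_measurable borel"
    by (intro borel_measurable_times borel_measurable_indicator borel_measurable_power Gm) simp
  have "compact ((\<lambda>x. (G x)\<^sup>2) ` cball m (r / 2))"
    by (rule compact_continuous_image[OF _ compact_cball]) (intro continuous_intros polys_continuous[OF G])
  from compact_imp_bounded[OF this] obtain M where M: "\<forall>y\<in>cball m (r / 2). \<bar>(G y)\<^sup>2\<bar> \<le> M"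
    by (auto simp: bounded_iff)
  have hM: "\<bar>?h y\<bar> \<le> \<bar>M\<bar>" for y
  proof (cases "y \<in> ball m (r / 2)")
    case True
    then have "\<bar>(G y)\<^sup>2\<bar> \<le> M" using M ball_subset_cball by blast
    then show ?thesis using True by simp
  qed simp
  have hB: "norm y \<le> norm m + r / 2" if "?h y \<noteq> 0" for y
  proof -
    have "dist m y < r / 2" using that by (auto simp: indicator_def split: if_splits)
    then show ?thesis using norm_triangle_ineq2[of y m] by (simp add: dist_norm norm_minus_commute)
  qed
  have "(LINT x:ball m (r / 2)|lborel. (G x)\<^sup>2)
     \<le> (\<integral>x. indicator {x. - r / 2 < n \<bullet> x - a \<and> n \<bullet> x - a \<le> - r / 2 + r} x * ?h (proj n a x) \<partial>lborel)"
    unfolding set_lebesgue_integral_def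
  proof (rule integral_mono')
    show "integrable lborel (\<lambda>x. indicator {x. - r / 2 < n \<bullet> x - a \<and> n \<bullet> x - a \<le> - r / 2 + r} x * ?h (proj n a x))"
      by (rule strip_integrable[OF n hm hM hB])
    show "0 \<le> indicator {x. - r / 2 < n \<bullet> x - a \<and> n \<bullet> x - a \<le> - r / 2 + r} x * ?h (proj n a x)" for x
      by (auto simp: indicator_def)
    show "indicator (ball m (r / 2)) x *\<^sub>R (G x)\<^sup>2
       \<le> indicator {x. - r / 2 < n \<bullet> x - a \<and> n \<bullet> x - a \<le> - r / 2 + r} x * ?h (proj n a x)" for x
    proof (cases "x \<in> ball m (r / 2)")
      case True
      have "\<bar>n \<bullet> x - a\<bar> < r / 2"
      proof -
        have "\<bar>n \<bullet> (x - m)\<bar> \<le> norm n * norm (x - m)" by (rule Cauchy_Schwarz_ineq2)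
        then show ?thesis using True n m by (simp add: inner_diff_right dist_norm norm_minus_commute)
      qed
      then have "- r / 2 < n \<bullet> x - a \<and> n \<bullet> x - a \<le> - r / 2 + r" unfolding abs_less_iff by linarith
      moreover have "proj n a x \<in> ball m (r / 2)"
      proof -
        have eq: "x - m = (proj n a x - m) + (n \<bullet> x - a) *\<^sub>R n" by (simp add: proj_def)
        have "orthogonal (proj n a x - m) ((n \<bullet> x - a) *\<^sub>R n)"
          using inner_proj[OF n, of a x] m by (simp add: orthogonal_def inner_commute inner_diff_right)
        then have "(norm (x - m))\<^sup>2 = (norm (proj n a x - m))\<^sup>2 + (norm ((n \<bullet> x - a) *\<^sub>R n))\<^sup>2"
          unfolding eq by (rule norm_add_Pythagorean)
        then have "(norm (proj n a x - m))\<^sup>2 \<le> (norm (x - m))\<^sup>2" by simp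
        then have "norm (proj n a x - m) \<le> norm (x - m)" by (rule power2_le_imp_le) simp
        then show ?thesis using True by (simp add: dist_norm norm_minus_commute)
      qed
      ultimately show ?thesis using True by (simp add: inv indicator_def)
    qed (simp add: indicator_def)
  qed
  also have "\<dots> = r * plane_integral n a ?h"
    by (rule strip_integral_linear[OF n hm hM hB]) (use r in auto)
  finally show ?thesis unfolding mean_sq_ball_integral[OF r] by simp
qed

lemma polys_proj:
  assumes "f \<in> polys p" shows "(\<lambda>x. f (proj n a x)) \<in> polys p"
proof (rule polys_affine_subst[OF _ assms, of _ "\<lambda>i. a * n $ i" "\<lambda>i. axis i 1 - (n $ i) *\<^sub>R n"])
  fix x i
  show "proj n a x $ i = a * n $ i + (axis i 1 - n $ i *\<^sub>R n) \<bullet> x"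
    by (simp add: proj_def inner_diff_left inner_axis' algebra_simps)
qed

lemma proj_proj: "norm n = 1 \<Longrightarrow> proj n a (proj n a x) = proj n a x"
  using inner_proj[of n a x] by (simp add: proj_def)

lemma proj_on_plane: "n \<bullet> x = a \<Longrightarrow> proj n a x = x" by (simp add: proj_def)

text \<open>
  The strip of thickness \<open>r\<close> over the section is contained in a ball of radius \<open>(K + 1) r\<close>.
\<close>

lemma plane_section_area:
  fixes F :: "(real^'n) set"
  assumes n: "norm n = 1" and r: "r > 0" and K: "K \<ge> 0" and F: "F \<in> sets borel" "F \<subseteq> cball m (K * r)"
  shows "r * plane_integral n a (indicator F) \<le> (K + 1) ^ CARD('n) * unit_ball_vol (real CARD('n)) * r ^ CARD('n)"
proof -
  have Fm: "(indicator F :: real^'n \<Rightarrow> real) \<in> borel_measurable borel" using F(1) by simp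
  have B: "norm y \<le> norm m + K * r" if "indicator F y \<noteq> (0::real)" for y
  proof -
    have "dist m y \<le> K * r" using that F(2) by (auto simp: indicator_def split: if_splits)
    then show ?thesis using norm_triangle_ineq2[of y m] by (simp add: dist_norm norm_minus_commute)
  qed
  have Kr: "0 \<le> (K + 1) * r" using K r by simp
  have "r * plane_integral n a (indicator F)
     = (\<integral>x. indicator {x. 0 < n \<bullet> x - a \<and> n \<bullet> x - a \<le> 0 + r} x * indicator F (proj n a x) \<partial>lborel)"
    by (rule strip_integral_linear[OF n Fm _ B, where M=1, symmetric]) (use r in \<open>auto simp: indicator_def\<close>)
  also have "\<dots> \<le> (\<integral>x. indicator (cball m ((K + 1) * r)) x \<partial>lborel)"
  proof (rule integral_mono')
    show "integrable lborel (indicator (cball m ((K + 1) * r)) :: real^'n \<Rightarrow> real)"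
      using emeasure_bounded_finite[OF bounded_cball[of m "(K + 1) * r"]] by (simp add: integrable_indicator_iff)
    show "indicator {x. 0 < n \<bullet> x - a \<and> n \<bullet> x - a \<le> 0 + r} x * indicator F (proj n a x)
       \<le> (indicator (cball m ((K + 1) * r)) x :: real)" for x
    proof (cases "0 < n \<bullet> x - a \<and> n \<bullet> x - a \<le> r \<and> proj n a x \<in> F")
      case True
      have "norm (x - m) \<le> norm (x - proj n a x) + norm (proj n a x - m)"
        using norm_triangle_ineq[of "x - proj n a x" "proj n a x - m"] by simp
      also have "norm (proj n a x - m) \<le> K * r" using True F(2) by (auto simp: dist_norm norm_minus_commute)
      finally have "norm (x - m) \<le> (K + 1) * r" using True norm_diff_proj[OF n, of x a] by (simp add: algebra_simps)
      then show ?thesis by (auto simp: indicator_def dist_norm norm_minus_commute)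
    qed (auto simp: indicator_def)
  qed simp
  also have "\<dots> = (K + 1) ^ CARD('n) * unit_ball_vol (real CARD('n)) * r ^ CARD('n)"
    using measure_cball_scale[OF Kr, of m] by (simp add: power_mult_distrib mult_ac)
  finally show ?thesis .
qed

section \<open>Localisation of the weak formulation\<close>

lemma polyhedral_domainD:
  assumes "polyhedral_domain \<Omega>"
  shows "open \<Omega>" "bounded \<Omega>" "interior (closure \<Omega>) = \<Omega>"
  using assms by (auto simp: polyhedral_domain_def)

text \<open>
  Two adjacent elements cover a ball around the centre of their common face.  They are contained in the closure of
  \<open>\<Omega>\<close> only; that the ball lies in \<open>\<Omega>\<close> holds because \<open>\<Omega>\<close> is the interior of its closure.
\<close>

lemma cball_in_domain:
  fixes m :: "real^'n"
  assumes "polyhedral_domain \<Omega>" "cball m r \<subseteq> closure \<Omega>" "s < r"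
  shows "cball m s \<subseteq> \<Omega>"
proof -
  have "ball m r \<subseteq> interior (closure \<Omega>)"
    by (rule interior_maximal) (use assms(2) ball_subset_cball in auto)
  then have "ball m r \<subseteq> \<Omega>" using polyhedral_domainD[OF assms(1)] by simp
  moreover have "cball m s \<subseteq> ball m r" using assms(3) by (auto simp: subset_iff)
  ultimately show ?thesis by blast
qed

lemma measurable_negligible_change:
  fixes f :: "real^'n \<Rightarrow> 'b::euclidean_space"
  assumes f: "(\<lambda>x. indicator D x *\<^sub>R f x) \<in> borel_measurable lebesgue"
    and T: "T \<in> sets borel" and N: "negligible (T - D)"
  shows "(\<lambda>x. indicator T x *\<^sub>R f x) \<in> borel_measurable lebesgue"
    and "AE x in lebesgue. indicator T x *\<^sub>R (indicator D x *\<^sub>R f x) = indicator T x *\<^sub>R f x"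
proof -
  have T': "T \<in> sets lebesgue" using T by simp
  have 1: "(\<lambda>x. indicator T x *\<^sub>R (indicator D x *\<^sub>R f x)) \<in> borel_measurable lebesgue"
    by (rule borel_measurable_scaleR[OF borel_measurable_indicator[OF T'] f])
  have "AE x in lebesgue. x \<notin> T - D" using N unfolding negligible_iff_null_sets by (rule AE_not_in)
  then show 2: "AE x in lebesgue. indicator T x *\<^sub>R (indicator D x *\<^sub>R f x) = indicator T x *\<^sub>R f x"
    by eventually_elim (auto simp: indicator_def)
  show "(\<lambda>x. indicator T x *\<^sub>R f x) \<in> borel_measurable lebesgue"
    by (rule borel_measurable_AE[OF 1 2])
qed

text \<open>
  An element is contained in the closure of the domain, while the data are square integrable on the domain; the part of
  the element on the boundary is a null set.
\<close>

lemma L2_negligible_change: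
  fixes f :: "real^'n \<Rightarrow> 'b::euclidean_space"
  assumes f: "L2 lebesgue D f" and T: "T \<in> sets borel" and N: "negligible (T - D)"
  shows "L2 lebesgue T f"
  unfolding L2_def
proof
  have fm: "(\<lambda>x. indicator D x *\<^sub>R f x) \<in> borel_measurable lebesgue" by (rule L2_imp_measurable[OF f])
  show m: "set_borel_measurable lebesgue T f"
    unfolding set_borel_measurable_def by (rule measurable_negligible_change[OF fm T N])
  have T': "T \<in> sets lebesgue" using T by simp
  have fi: "integrable lebesgue (\<lambda>x. indicator D x *\<^sub>R (norm (f x))\<^sup>2)" using f by (simp add: L2_def set_integrable_def)
  have 1: "integrable lebesgue (\<lambda>x. indicator T x *\<^sub>R (indicator D x *\<^sub>R (norm (f x))\<^sup>2))"
    by (rule integrable_mult_indicator[OF T' fi])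
  have fm2: "(\<lambda>x. indicator D x *\<^sub>R (norm (f x))\<^sup>2) \<in> borel_measurable lebesgue" using fi by (rule borel_measurable_integrable)
  show "set_integrable lebesgue T (\<lambda>x. (norm (f x))\<^sup>2)"
    unfolding set_integrable_def
    by (rule integrable_cong_AE_imp[OF 1 measurable_negligible_change(1)[OF fm2 T N]])
       (use measurable_negligible_change(2)[OF fm2 T N] in \<open>eventually_elim, simp\<close>)
qed

lemma polys_vec_continuous:
  fixes q :: "real^'m \<Rightarrow> real^'n"
  assumes "\<And>i. (\<lambda>x. q x $ i) \<in> polys p" shows "continuous_on S q"
proof -
  have "continuous_on S (\<lambda>x. \<chi> i. q x $ i)" by (intro continuous_on_vec_lambda polys_continuous[OF assms])
  then show ?thesis by simp
qed

lemma polys_continuous_grad: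
  assumes "w \<in> polys p" shows "continuous_on S (grad w)"
  by (rule polys_vec_continuous[OF polys_grad[OF assms]])

lemma divg_polys:
  fixes q :: "real^'n \<Rightarrow> real^'n"
  assumes q: "\<And>i. (\<lambda>x. q x $ i) \<in> polys p"
  shows "divg q x = (\<Sum>i\<in>UNIV. grad (\<lambda>x. q x $ i) x $ i)" "divg q \<in> polys p"
proof -
  have eq: "divg q x = (\<Sum>i\<in>UNIV. grad (\<lambda>x. q x $ i) x $ i)" for x
  proof -
    have "(q has_derivative (\<lambda>h. \<chi> i. grad (\<lambda>x. q x $ i) x \<bullet> h)) (at x)"
      unfolding has_derivative_componentwise_within[of q] Basis_vec_def
      using has_derivative_grad[OF polys_differentiable[OF q]] by (auto simp: inner_axis)
    note e = frechet_derivative_at[OF this]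
    show ?thesis unfolding divg_def e[symmetric] by (simp add: inner_axis)
  qed
  then show "divg q x = (\<Sum>i\<in>UNIV. grad (\<lambda>x. q x $ i) x $ i)" .
  have "divg q = (\<lambda>x. \<Sum>i\<in>UNIV. grad (\<lambda>x. q x $ i) x $ i)" using eq by auto
  then show "divg q \<in> polys p" by (simp add: polys_sum polys_grad[OF q])
qed

text \<open>
  The weak formulation with the data it needs: bounds \<open>B\<close> and \<open>Kc\<close> for the coefficients, and smooth test functions.
\<close>

locale conv_diff =
  fixes \<Omega> :: "(real^'n) set" and \<epsilon> :: real and b :: "real^'n \<Rightarrow> real^'n" and c f u :: "real^'n \<Rightarrow> real"
    and Du :: "real^'n \<Rightarrow> real^'n" and B Kc :: real
  assumes dom: "polyhedral_domain \<Omega>" and eps: "0 < \<epsilon>"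
    and b_cont: "continuous_on (closure \<Omega>) b" and b_bound: "\<And>x. x \<in> closure \<Omega> \<Longrightarrow> norm (b x) \<le> B"
    and c_meas: "set_borel_measurable lebesgue \<Omega> c" and c_bound: "AE x in lebesgue. x \<in> \<Omega> \<longrightarrow> norm (c x) \<le> Kc"
    and nonneg: "0 \<le> B" "0 \<le> Kc"
    and L2_data: "L2 lebesgue \<Omega> f" "L2 lebesgue \<Omega> u" "L2 lebesgue \<Omega> Du"
    and weak: "\<And>v. test_function \<Omega> v \<Longrightarrow>
      (LINT x:\<Omega>|lebesgue. \<epsilon> * (Du x \<bullet> grad v x) + (b x \<bullet> Du x) * v x + c x * u x * v x)
        = (LINT x:\<Omega>|lebesgue. f x * v x)"
begin

definition elem :: "(real^'n) set \<Rightarrow> bool" where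
  "elem T \<longleftrightarrow> compact T \<and> T \<subseteq> closure \<Omega> \<and> negligible (T - \<Omega>)"

lemma elemI: assumes "compact T" "convex T" "T \<subseteq> closure \<Omega>" shows "elem T"
proof -
  have "interior T \<subseteq> \<Omega>" using interior_mono[OF assms(3)] polyhedral_domainD(3)[OF dom] by simp
  then have "T - \<Omega> \<subseteq> frontier T" using closure_subset[of T] by (auto simp: frontier_def)
  then show ?thesis using assms negligible_convex_frontier[OF assms(2)] negligible_subset by (auto simp: elem_def)
qed

context
  fixes D :: "(real^'n) set"
  assumes D: "D \<in> sets borel" "bounded D" "D \<subseteq> closure \<Omega>" "negligible (D - \<Omega>)"
begin

lemma L2_D: "L2 lebesgue D f" "L2 lebesgue D u" "L2 lebesgue D Du"
  using L2_data by (auto intro: L2_negligible_change[OF _ D(1,4)])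

lemma L2_cont: "continuous_on UNIV h \<Longrightarrow> L2 lebesgue D h" for h :: "real^'n \<Rightarrow> 'a::euclidean_space"
  by (rule L2_continuous[OF _ D(2,1)])

lemma L2_b_mult:
  assumes w: "L2 lebesgue D w"
  shows "L2 lebesgue D (\<lambda>x. b x \<bullet> w x)" "L2_norm lebesgue D (\<lambda>x. b x \<bullet> w x) \<le> B * L2_norm lebesgue D w"
proof -
  have bm: "(\<lambda>x. indicator D x *\<^sub>R b x) \<in> borel_measurable lebesgue"
  proof -
    have "(\<lambda>x. indicator D x *\<^sub>R b x) \<in> borel_measurable borel"
      by (rule borel_measurable_continuous_on_indicator[OF D(1) continuous_on_subset[OF b_cont D(3)]])
    then show ?thesis by (intro measurable_completion) simp
  qed
  have m: "(\<lambda>x. indicator D x *\<^sub>R (b x \<bullet> w x)) \<in> borel_measurable lebesgue"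
  proof -
    have "(\<lambda>x. (indicator D x *\<^sub>R b x) \<bullet> (indicator D x *\<^sub>R w x)) \<in> borel_measurable lebesgue"
      by (rule borel_measurable_inner[OF bm L2_imp_measurable[OF w]])
    moreover have "(indicator D x *\<^sub>R b x) \<bullet> (indicator D x *\<^sub>R w x) = indicator D x *\<^sub>R (b x \<bullet> w x)" for x
      by (auto simp: indicator_def)
    ultimately show ?thesis by (simp only:)
  qed
  have bd: "AE x in lebesgue. x \<in> D \<longrightarrow> norm (b x \<bullet> w x) \<le> B * norm (w x)"
  proof (intro AE_I2 impI)
    fix x assume "x \<in> D"
    have "norm (b x \<bullet> w x) \<le> norm (b x) * norm (w x)" using Cauchy_Schwarz_ineq2[of "b x" "w x"] by simp
    also have "\<dots> \<le> B * norm (w x)" using b_bound \<open>x \<in> D\<close> D(3) by (intro mult_right_mono) auto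
    finally show "norm (b x \<bullet> w x) \<le> B * norm (w x)" .
  qed
  show "L2 lebesgue D (\<lambda>x. b x \<bullet> w x)" "L2_norm lebesgue D (\<lambda>x. b x \<bullet> w x) \<le> B * L2_norm lebesgue D w"
    using L2_dominated[OF w m bd] nonneg by auto
qed

lemma L2_c_mult:
  fixes w :: "real^'n \<Rightarrow> real"
  assumes w: "L2 lebesgue D w"
  shows "L2 lebesgue D (\<lambda>x. c x * w x)" "L2_norm lebesgue D (\<lambda>x. c x * w x) \<le> Kc * L2_norm lebesgue D w"
proof -
  have cm: "(\<lambda>x. indicator D x *\<^sub>R c x) \<in> borel_measurable lebesgue"
    by (rule measurable_negligible_change(1)[OF c_meas[unfolded set_borel_measurable_def] D(1,4)])
  have m: "(\<lambda>x. indicator D x *\<^sub>R (c x * w x)) \<in> borel_measurable lebesgue"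
  proof -
    have "(\<lambda>x. (indicator D x *\<^sub>R c x) * (indicator D x *\<^sub>R w x)) \<in> borel_measurable lebesgue"
      by (rule borel_measurable_times[OF cm L2_imp_measurable[OF w]])
    moreover have "(indicator D x *\<^sub>R c x) * (indicator D x *\<^sub>R w x) = indicator D x *\<^sub>R (c x * w x)" for x
      by (auto simp: indicator_def)
    ultimately show ?thesis by (simp only:)
  qed
  have "AE x in lebesgue. x \<notin> D - \<Omega>" using D(4) unfolding negligible_iff_null_sets by (rule AE_not_in)
  with c_bound have bd: "AE x in lebesgue. x \<in> D \<longrightarrow> norm (c x * w x) \<le> Kc * norm (w x)"
    by eventually_elim (auto simp: abs_mult intro: mult_right_mono)
  show "L2 lebesgue D (\<lambda>x. c x * w x)" "L2_norm lebesgue D (\<lambda>x. c x * w x) \<le> Kc * L2_norm lebesgue D w"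
    using L2_dominated[OF w m bd] nonneg by auto
qed

lemma integrable_product: "L2 lebesgue D g \<Longrightarrow> L2 lebesgue D h \<Longrightarrow> set_integrable lebesgue D (\<lambda>x. g x * h x)"
  for g h :: "real^'n \<Rightarrow> real"
  using L2_inner_integrable[of lebesgue D g h] by simp

lemma weak_integrable:
  assumes v: "continuous_on UNIV v" "continuous_on UNIV (grad v)"
  shows "set_integrable lebesgue D (\<lambda>x. f x * v x)"
    "set_integrable lebesgue D (\<lambda>x. \<epsilon> * (Du x \<bullet> grad v x) + (b x \<bullet> Du x) * v x + c x * u x * v x)"
proof -
  show "set_integrable lebesgue D (\<lambda>x. f x * v x)" by (intro integrable_product L2_D L2_cont v)
  have "set_integrable lebesgue D (\<lambda>x. \<epsilon> * (Du x \<bullet> grad v x))"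
    by (intro set_integrable_mult_right L2_inner_integrable L2_D L2_cont v)
  moreover have "set_integrable lebesgue D (\<lambda>x. (b x \<bullet> Du x) * v x)"
    by (intro integrable_product L2_b_mult L2_D L2_cont v)
  moreover have "set_integrable lebesgue D (\<lambda>x. c x * u x * v x)"
    by (intro integrable_product L2_c_mult L2_D L2_cont v)
  ultimately show "set_integrable lebesgue D (\<lambda>x. \<epsilon> * (Du x \<bullet> grad v x) + (b x \<bullet> Du x) * v x + c x * u x * v x)"
    by (intro set_integral_add(1))
qed

text \<open>
  What is left of the weak formulation when the integrals extend only over \<open>D\<close>.
\<close>

definition weak_defect :: "(real^'n \<Rightarrow> real) \<Rightarrow> real" where
  "weak_defect v = (LINT x:D|lebesgue. f x * v x - (\<epsilon> * (Du x \<bullet> grad v x) + (b x \<bullet> Du x) * v x + c x * u x * v x))"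

text \<open>
  The integral of \<open>div (v q)\<close>, i.e. the flux of \<open>v q\<close> through the boundary of \<open>D\<close>.
\<close>

definition flux_defect :: "(real^'n \<Rightarrow> real^'n) \<Rightarrow> (real^'n \<Rightarrow> real) \<Rightarrow> real" where
  "flux_defect q v = (LINT x:D|lebesgue. divg q x * v x + q x \<bullet> grad v x)"

text \<open>
  The residual tested with \<open>v\<close> equals the errors tested with \<open>v\<close>, up to a term that vanishes by the weak
  formulation and a term that the divergence theorem turns into a flux through the boundary.
\<close>

lemma residual_tested:
  assumes q: "\<And>i. (\<lambda>x. qh T x $ i) \<in> polys p" and w: "uh T \<in> polys p"
    and v: "continuous_on UNIV v" "continuous_on UNIV (grad v)"
  shows "L2 lebesgue D (residual b c f qh uh T)"
    "\<bar>(LINT x:D|lebesgue. residual b c f qh uh T x * v x) - weak_defect v + flux_defect (qh T) v\<bar>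
     \<le> L2_norm lebesgue D (\<lambda>x. - \<epsilon> *\<^sub>R Du x - qh T x) * L2_norm lebesgue D (grad v)
      + (B * L2_norm lebesgue D (\<lambda>x. Du x - grad (uh T) x) + Kc * L2_norm lebesgue D (\<lambda>x. u x - uh T x))
        * L2_norm lebesgue D v"
proof -
  have cq: "continuous_on UNIV (qh T)" by (rule polys_vec_continuous[OF q])
  have cw: "continuous_on UNIV (uh T)" "continuous_on UNIV (grad (uh T))"
    by (rule polys_continuous[OF w], rule polys_continuous_grad[OF w])
  have cd: "continuous_on UNIV (divg (qh T))" by (rule polys_continuous[OF divg_polys(2)[OF q]])
  note Lq = L2_cont[OF cq] and Lw = L2_cont[OF cw(1)] and Lgw = L2_cont[OF cw(2)] and Ld = L2_cont[OF cd]
    and Lv = L2_cont[OF v(1)] and Lgv = L2_cont[OF v(2)]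
  have R_eq: "residual b c f qh uh T = (\<lambda>x. ((f x - divg (qh T) x) - b x \<bullet> grad (uh T) x) - c x * uh T x)"
    by (auto simp: residual_def)
  show LR: "L2 lebesgue D (residual b c f qh uh T)"
    unfolding R_eq by (intro L2_diff L2_D Ld L2_b_mult Lgw L2_c_mult Lw)
  have Leq: "L2 lebesgue D (\<lambda>x. - \<epsilon> *\<^sub>R Du x - qh T x)" by (intro L2_diff L2_scale L2_D Lq)
  have Leg: "L2 lebesgue D (\<lambda>x. Du x - grad (uh T) x)" by (intro L2_diff L2_D Lgw)
  have Leu: "L2 lebesgue D (\<lambda>x. u x - uh T x)" by (intro L2_diff L2_D Lw)
  have i1: "set_integrable lebesgue D (\<lambda>x. (- \<epsilon> *\<^sub>R Du x - qh T x) \<bullet> grad v x)"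
    by (rule L2_inner_integrable[OF Leq Lgv])
  have i2: "set_integrable lebesgue D (\<lambda>x. (b x \<bullet> (Du x - grad (uh T) x)) * v x)"
    by (intro integrable_product L2_b_mult Leg Lv)
  have i3: "set_integrable lebesgue D (\<lambda>x. (c x * (u x - uh T x)) * v x)"
    by (intro integrable_product L2_c_mult Leu Lv)
  have iR: "set_integrable lebesgue D (\<lambda>x. residual b c f qh uh T x * v x)" by (rule integrable_product[OF LR Lv])
  have iW: "set_integrable lebesgue D (\<lambda>x. f x * v x - (\<epsilon> * (Du x \<bullet> grad v x) + (b x \<bullet> Du x) * v x + c x * u x * v x))"
    by (intro set_integral_diff(1) weak_integrable v)
  have iD: "set_integrable lebesgue D (\<lambda>x. divg (qh T) x * v x + qh T x \<bullet> grad v x)"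
    by (intro set_integral_add(1) integrable_product Ld Lv L2_inner_integrable Lq Lgv)
  have pt: "residual b c f qh uh T x * v x - (f x * v x - (\<epsilon> * (Du x \<bullet> grad v x) + (b x \<bullet> Du x) * v x + c x * u x * v x))
      + (divg (qh T) x * v x + qh T x \<bullet> grad v x)
     = (b x \<bullet> (Du x - grad (uh T) x)) * v x + (c x * (u x - uh T x)) * v x - (- \<epsilon> *\<^sub>R Du x - qh T x) \<bullet> grad v x" for x
    by (simp add: residual_def inner_diff_right inner_diff_left algebra_simps)
  have "(LINT x:D|lebesgue. residual b c f qh uh T x * v x) - weak_defect v + flux_defect (qh T) v
     = (LINT x:D|lebesgue. residual b c f qh uh T x * v x - (f x * v x - (\<epsilon> * (Du x \<bullet> grad v x) + (b x \<bullet> Du x) * v x + c x * u x * v x))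
      + (divg (qh T) x * v x + qh T x \<bullet> grad v x))"
    unfolding weak_defect_def flux_defect_def
    by (subst set_integral_add(2)[OF set_integral_diff(1)[OF iR iW] iD]) (simp only: set_integral_diff(2)[OF iR iW])
  also have "\<dots> = (LINT x:D|lebesgue. (b x \<bullet> (Du x - grad (uh T) x)) * v x) + (LINT x:D|lebesgue. (c x * (u x - uh T x)) * v x)
      - (LINT x:D|lebesgue. (- \<epsilon> *\<^sub>R Du x - qh T x) \<bullet> grad v x)"
    unfolding pt
    by (subst set_integral_diff(2)[OF set_integral_add(1)[OF i2 i3] i1]) (simp only: set_integral_add(2)[OF i2 i3])
  finally have eq: "(LINT x:D|lebesgue. residual b c f qh uh T x * v x) - weak_defect v + flux_defect (qh T) v
     = (LINT x:D|lebesgue. (b x \<bullet> (Du x - grad (uh T) x)) * v x) + (LINT x:D|lebesgue. (c x * (u x - uh T x)) * v x)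
      - (LINT x:D|lebesgue. (- \<epsilon> *\<^sub>R Du x - qh T x) \<bullet> grad v x)" .
  have b1: "\<bar>LINT x:D|lebesgue. (- \<epsilon> *\<^sub>R Du x - qh T x) \<bullet> grad v x\<bar>
     \<le> L2_norm lebesgue D (\<lambda>x. - \<epsilon> *\<^sub>R Du x - qh T x) * L2_norm lebesgue D (grad v)"
    by (rule L2_Cauchy_Schwarz[OF Leq Lgv])
  have b2: "\<bar>LINT x:D|lebesgue. (b x \<bullet> (Du x - grad (uh T) x)) * v x\<bar>
     \<le> (B * L2_norm lebesgue D (\<lambda>x. Du x - grad (uh T) x)) * L2_norm lebesgue D v"
    using L2_Cauchy_Schwarz[OF L2_b_mult(1)[OF Leg] Lv] mult_right_mono[OF L2_b_mult(2)[OF Leg] L2_norm_nonneg[of lebesgue D v]]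
    by simp
  have b3: "\<bar>LINT x:D|lebesgue. (c x * (u x - uh T x)) * v x\<bar>
     \<le> (Kc * L2_norm lebesgue D (\<lambda>x. u x - uh T x)) * L2_norm lebesgue D v"
    using L2_Cauchy_Schwarz[OF L2_c_mult(1)[OF Leu] Lv] mult_right_mono[OF L2_c_mult(2)[OF Leu] L2_norm_nonneg[of lebesgue D v]]
    by simp
  show "\<bar>(LINT x:D|lebesgue. residual b c f qh uh T x * v x) - weak_defect v + flux_defect (qh T) v\<bar>
     \<le> L2_norm lebesgue D (\<lambda>x. - \<epsilon> *\<^sub>R Du x - qh T x) * L2_norm lebesgue D (grad v)
      + (B * L2_norm lebesgue D (\<lambda>x. Du x - grad (uh T) x) + Kc * L2_norm lebesgue D (\<lambda>x. u x - uh T x))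
        * L2_norm lebesgue D v"
    unfolding eq distrib_right using b1 b2 b3 by linarith
qed

end

end

section \<open>Fluxes of bubble functions\<close>

lemma C1_compact_strip_integrable:
  fixes G :: "real^'n \<Rightarrow> real"
  assumes n: "norm n = 1" and G: "C1_compact G"
  shows "integrable lborel (\<lambda>x. indicator {x. s < n \<bullet> x - a \<and> n \<bullet> x - a \<le> t} x * G (proj n a x))"
proof -
  obtain M L B where b: "\<And>x. \<bar>G x\<bar> \<le> M" "\<And>x. norm (grad G x) \<le> L" "\<And>x. G x \<noteq> 0 \<Longrightarrow> norm x \<le> B"
    "\<And>x. grad G x \<noteq> 0 \<Longrightarrow> norm x \<le> B" "B \<ge> 0" "L \<ge> 0"
    using C1_compact_bounds[OF G] by metis
  show ?thesis by (rule strip_integrable[OF n C1_compact_measurable(1)[OF G] b(1,3)])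
qed

lemma plane_integral_sum:
  fixes G :: "'i \<Rightarrow> real^'n \<Rightarrow> real"
  assumes n: "norm n = 1" and G: "\<And>i. i \<in> I \<Longrightarrow> C1_compact (G i)"
  shows "plane_integral n a (\<lambda>x. \<Sum>i\<in>I. k i * G i x) = (\<Sum>i\<in>I. k i * plane_integral n a (G i))"
proof -
  have "plane_integral n a (\<lambda>x. \<Sum>i\<in>I. k i * G i x)
     = (\<integral>x. (\<Sum>i\<in>I. k i * (indicator {x. 0 < n \<bullet> x - a \<and> n \<bullet> x - a \<le> 1} x * G i (proj n a x))) \<partial>lborel)"
    unfolding plane_integral_def sum_distrib_left by (simp add: mult.left_commute)
  also have "\<dots> = (\<Sum>i\<in>I. \<integral>x. k i * (indicator {x. 0 < n \<bullet> x - a \<and> n \<bullet> x - a \<le> 1} x * G i (proj n a x)) \<partial>lborel)"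
    by (rule Bochner_Integration.integral_sum) (intro integrable_mult_right C1_compact_strip_integrable n G)
  finally show ?thesis by (simp add: plane_integral_def)
qed

lemma plane_integral_uminus:
  fixes g :: "real^'n \<Rightarrow> real"
  assumes n: "norm n = 1" and g [measurable]: "g \<in> borel_measurable borel"
    and M: "\<And>y. \<bar>g y\<bar> \<le> M" and B: "\<And>y. g y \<noteq> 0 \<Longrightarrow> norm y \<le> B"
  shows "plane_integral (- n) (- a) g = plane_integral n a g"
proof -
  have p: "proj (- n) (- a) x = proj n a x" for x by (simp add: proj_def algebra_simps)
  have null: "AE x in lborel. n \<bullet> x \<noteq> k" for k
  proof -
    have "negligible {x. n \<bullet> x = k}" by (rule negligible_hyperplane) (use n in auto)
    then have "AE x in lebesgue. x \<notin> {x. n \<bullet> x = k}" unfolding negligible_iff_null_sets by (rule AE_not_in)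
    then show ?thesis by (simp add: AE_completion_iff)
  qed
  have "plane_integral (- n) (- a) g
     = (\<integral>x. indicator {x. - 1 < n \<bullet> x - a \<and> n \<bullet> x - a \<le> - 1 + 1} x * g (proj n a x) \<partial>lborel)"
    unfolding plane_integral_def p
  proof (rule integral_cong_AE)
    show "AE x in lborel. indicator {x. 0 < - n \<bullet> x - - a \<and> - n \<bullet> x - - a \<le> 1} x * g (proj n a x)
       = indicator {x. - 1 < n \<bullet> x - a \<and> n \<bullet> x - a \<le> - 1 + 1} x * g (proj n a x)"
      using null[of a] null[of "a - 1"] by eventually_elim (auto simp: indicator_def)
  qed measurable
  also have "\<dots> = 1 * plane_integral n a g" by (rule strip_integral_linear[OF n g M B]) simp_all
  finally show ?thesis by simp
qed

lemma polys_C1_mult: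
  assumes "f \<in> polys p" "C1_compact v" shows "C1_compact (\<lambda>x. f x * v x)"
  by (rule C1_compact_mult[OF polys_differentiable[OF assms(1)] polys_continuous_grad[OF assms(1)] assms(2)])

context
  fixes q :: "real^'n \<Rightarrow> real^'n" and p :: nat and v :: "real^'n \<Rightarrow> real" and m :: "real^'n" and r :: real
  assumes q: "\<And>i. (\<lambda>x. q x $ i) \<in> polys p" and v: "C1_compact v" and supp: "\<And>x. x \<notin> cball m r \<Longrightarrow> v x = 0"
begin

lemma divergence_product:
  "divg q x * v x + q x \<bullet> grad v x = (\<Sum>i\<in>UNIV. grad (\<lambda>x. q x $ i * v x) x \<bullet> axis i 1)"
proof -
  have dv: "v differentiable (at x)" using v by (simp add: C1_compact_def)
  have "grad (\<lambda>x. q x $ i * v x) x \<bullet> axis i 1 = q x $ i * grad v x $ i + v x * grad (\<lambda>x. q x $ i) x $ i" for i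
    unfolding grad_mult[OF polys_differentiable[OF q] dv] by (simp add: inner_axis)
  then have "(\<Sum>i\<in>UNIV. grad (\<lambda>x. q x $ i * v x) x \<bullet> axis i 1)
      = (\<Sum>i\<in>UNIV. q x $ i * grad v x $ i) + v x * (\<Sum>i\<in>UNIV. grad (\<lambda>x. q x $ i) x $ i)"
    by (simp only: sum.distrib sum_distrib_left)
  moreover have "q x \<bullet> grad v x = (\<Sum>i\<in>UNIV. q x $ i * grad v x $ i)" by (simp add: inner_vec_def)
  ultimately show ?thesis unfolding divg_polys(1)[OF q] by (simp only: mult.commute add.commute)
qed

lemma flux_defect_as_sum:
  assumes D: "D \<in> sets borel"
  shows "(LINT x:D|lebesgue. divg q x * v x + q x \<bullet> grad v x)
    = (\<Sum>i\<in>UNIV. \<integral>x. indicator D x * (grad (\<lambda>x. q x $ i * v x) x \<bullet> axis i 1) \<partial>lborel)"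
proof -
  have C: "C1_compact (\<lambda>x. q x $ i * v x)" for i by (rule polys_C1_mult[OF q v])
  have m: "(\<lambda>x. indicator D x * (\<Sum>i\<in>UNIV. grad (\<lambda>x. q x $ i * v x) x \<bullet> axis i 1)) \<in> borel_measurable lborel"
    by (rule borel_measurable_times[OF borel_measurable_indicator borel_measurable_sum])
       (use D C1_compact_measurable(2)[OF C] in auto)
  have "(LINT x:D|lebesgue. divg q x * v x + q x \<bullet> grad v x)
    = (\<integral>x. indicator D x * (\<Sum>i\<in>UNIV. grad (\<lambda>x. q x $ i * v x) x \<bullet> axis i 1) \<partial>lebesgue)"
    unfolding set_lebesgue_integral_def divergence_product by simp
  also have "\<dots> = (\<integral>x. indicator D x * (\<Sum>i\<in>UNIV. grad (\<lambda>x. q x $ i * v x) x \<bullet> axis i 1) \<partial>lborel)"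
    by (rule integral_completion[OF m])
  also have "\<dots> = (\<Sum>i\<in>UNIV. \<integral>x. indicator D x * (grad (\<lambda>x. q x $ i * v x) x \<bullet> axis i 1) \<partial>lborel)"
    unfolding sum_distrib_left
    by (rule Bochner_Integration.integral_sum) (rule C1_compact_grad_integrable[OF C D])
  finally show ?thesis .
qed

lemma grad_product_zero: "x \<notin> cball m r \<Longrightarrow> grad (\<lambda>x. q x $ i * v x) x = 0"
  by (rule grad_zero_outside[of _ "cball m r"]) (use supp in auto)

text \<open>
  The support lies inside \<open>D\<close>, where \<open>D\<close> cannot be told apart from the whole space.
\<close>

lemma interior_flux:
  assumes D: "D \<in> sets borel" "cball m r \<subseteq> D"
  shows "(LINT x:D|lebesgue. divg q x * v x + q x \<bullet> grad v x) = 0"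
proof -
  have "(\<integral>x. indicator D x * (grad (\<lambda>x. q x $ i * v x) x \<bullet> axis i 1) \<partial>lborel) = 0" for i
  proof -
    have eq: "indicator D x * (grad (\<lambda>x. q x $ i * v x) x \<bullet> axis i 1) = grad (\<lambda>x. q x $ i * v x) x \<bullet> axis i 1" for x
      using D(2) grad_product_zero[of x i] by (cases "x \<in> cball m r") (auto simp: indicator_def)
    show ?thesis unfolding eq by (rule integral_grad_zero[OF polys_C1_mult[OF q v]])
  qed
  then show ?thesis unfolding flux_defect_as_sum[OF D(1)] by simp
qed

text \<open>
  On the support of \<open>v\<close> the set \<open>D\<close> coincides with a half-space.
\<close>

lemma face_flux:
  assumes n: "norm n = 1" and D: "D \<in> sets borel" "D \<subseteq> {x. n \<bullet> x \<le> a}" "cball m r \<inter> {x. n \<bullet> x \<le> a} \<subseteq> D"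
  shows "(LINT x:D|lebesgue. divg q x * v x + q x \<bullet> grad v x) = plane_integral n a (\<lambda>x. (q x \<bullet> n) * v x)"
proof -
  have C: "C1_compact (\<lambda>x. q x $ i * v x)" for i by (rule polys_C1_mult[OF q v])
  have "(\<integral>x. indicator D x * (grad (\<lambda>x. q x $ i * v x) x \<bullet> axis i 1) \<partial>lborel) = n $ i * plane_integral n a (\<lambda>x. q x $ i * v x)" for i
  proof -
    have eq: "indicator D x * (grad (\<lambda>x. q x $ i * v x) x \<bullet> axis i 1)
       = indicator {x. n \<bullet> x \<le> a} x * (grad (\<lambda>x. q x $ i * v x) x \<bullet> axis i 1)" for x
      using D(2,3) grad_product_zero[of x i] by (cases "x \<in> cball m r") (auto simp: indicator_def)
    show ?thesis unfolding eq half_space_integral_C1[OF n C] by (simp add: inner_axis)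
  qed
  then have "(LINT x:D|lebesgue. divg q x * v x + q x \<bullet> grad v x) = plane_integral n a (\<lambda>x. \<Sum>i\<in>UNIV. n $ i * (q x $ i * v x))"
    unfolding flux_defect_as_sum[OF D(1)] plane_integral_sum[OF n C] by simp
  also have "(\<lambda>x. \<Sum>i\<in>UNIV. n $ i * (q x $ i * v x)) = (\<lambda>x. (q x \<bullet> n) * v x)"
    by (auto simp: inner_vec_def sum_distrib_right intro!: sum.cong)
  finally show ?thesis .
qed

end

section \<open>Residual and flux jump are bounded by the errors\<close>

context conv_diff
begin

lemma domain_ok: "\<Omega> \<in> sets borel" "bounded \<Omega>" "\<Omega> \<subseteq> closure \<Omega>" "negligible (\<Omega> - \<Omega>)"
  using polyhedral_domainD[OF dom] closure_subset by auto

lemma elemD: assumes "elem T" shows "T \<in> sets borel" "bounded T" "T \<subseteq> closure \<Omega>" "negligible (T - \<Omega>)"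
  using assms compact_imp_bounded borel_closed[OF compact_imp_closed] by (auto simp: elem_def)

lemma weak_domain_zero:
  assumes v: "test_function \<Omega> v"
  shows "weak_defect \<Omega> v = 0"
proof -
  have "C1_compact v" by (rule test_function_C1_compact[OF v])
  then have c: "continuous_on UNIV v" "continuous_on UNIV (grad v)"
    by (auto simp: C1_compact_def continuous_on_eq_continuous_at intro!: differentiable_imp_continuous_within)
  show ?thesis unfolding weak_defect_def[OF domain_ok]
    by (subst set_integral_diff(2)[OF weak_integrable[OF domain_ok c]]) (simp add: weak[OF v])
qed

text \<open>
  Test with \<open>v = P * bump\<close>.  The product \<open>P * v\<close> bounds the mean square of \<open>P\<close>, and hence all norms of \<open>P\<close> and \<open>v\<close>: if \<open>A\<^sup>2\<close>
  denotes a multiple of its integral \<open>X\<close>, then \<open>X \<le> A * E\<close> where \<open>E\<close> is the sum of the errors, and so \<open>A\<close> is at most a multiple of \<open>E\<close>.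
  The factor \<open>2\<^sup>d exp 2\<close> comes from \<open>bump \<ge> exp (-2)\<close> on the ball of half the radius.
\<close>

lemma element_residual_estimate:
  fixes qh :: "(real^'n) set \<Rightarrow> real^'n \<Rightarrow> real^'n"
  assumes T: "elem T" and r: "r > 0" and ball: "cball m r \<subseteq> T" "cball m r \<subseteq> \<Omega>" and TK: "T \<subseteq> cball m (K * r)"
    and q: "\<And>i. (\<lambda>x. qh T x $ i) \<in> polys p" and w: "uh T \<in> polys p" and P: "P \<in> polys p"
    and Cb: "C \<ge> 0" "(L2_norm lebesgue T P)\<^sup>2 \<le> C * (r ^ CARD('n) * mean_sq P m (r / 2))"
      "(L2_norm lebesgue T (\<lambda>x. P x * bump m r x))\<^sup>2 \<le> C * (r ^ CARD('n) * mean_sq P m (r / 2))"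
      "(r * L2_norm lebesgue T (grad (\<lambda>x. P x * bump m r x)))\<^sup>2 \<le> C * (r ^ CARD('n) * mean_sq P m (r / 2))"
  shows "L2_norm lebesgue T (residual b c f qh uh T)
    \<le> (C * (2 ^ CARD('n) * exp 2) + 1) * (L2_norm lebesgue T (\<lambda>x. - \<epsilon> *\<^sub>R Du x - qh T x) / r
      + (B * L2_norm lebesgue T (\<lambda>x. Du x - grad (uh T) x) + Kc * L2_norm lebesgue T (\<lambda>x. u x - uh T x))
      + L2_norm lebesgue T (\<lambda>x. residual b c f qh uh T x - P x))"
proof -
  define v where "v x = P x * bump m r x" for x
  define R where "R = residual b c f qh uh T"
  note Tm = elemD[OF T]
  have tv: "test_function \<Omega> v" unfolding v_def by (rule test_function_poly_bump[OF P r ball(2)])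
  have Cv: "C1_compact v" by (rule test_function_C1_compact[OF tv])
  have c: "continuous_on UNIV v" "continuous_on UNIV (grad v)"
    using Cv by (auto simp: C1_compact_def continuous_on_eq_continuous_at intro!: differentiable_imp_continuous_within)
  have supp: "v x = 0" if "x \<notin> cball m r" for x
    using bump_outside[OF r, of x m] that by (simp add: v_def)
  have gsupp: "grad v x = 0" if "x \<notin> cball m r" for x
    by (rule grad_zero_outside[of v "cball m r"]) (use supp that in auto)
  note LR = residual_tested(1)[where D=T and qh=qh and T=T and uh=uh and v=v and p=p, OF Tm q w c, folded R_def]
  have LP: "L2 lebesgue T P" by (rule L2_cont[OF Tm polys_continuous[OF P]])
  have Lv: "L2 lebesgue T v" by (rule L2_cont[OF Tm c(1)])
  have LRP: "L2 lebesgue T (\<lambda>x. R x - P x)" by (rule L2_diff[OF LR LP])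
  define e1 where "e1 = L2_norm lebesgue T (\<lambda>x. - \<epsilon> *\<^sub>R Du x - qh T x)"
  define e2 where "e2 = B * L2_norm lebesgue T (\<lambda>x. Du x - grad (uh T) x) + Kc * L2_norm lebesgue T (\<lambda>x. u x - uh T x)"
  define e3 where "e3 = L2_norm lebesgue T (\<lambda>x. R x - P x)"
  have e: "e1 \<ge> 0" "e2 \<ge> 0" "e3 \<ge> 0" using nonneg by (simp_all add: e1_def e2_def e3_def L2_norm_nonneg)
  define E where "E = e1 / r + e2 + e3"
  have E0: "E \<ge> 0" using e r by (simp add: E_def)
  define X where "X = (LINT x:T|lebesgue. P x * v x)"
  have iX: "set_integrable lebesgue T (\<lambda>x. P x * v x)" by (rule integrable_product[OF Tm LP Lv])
  have Mle: "r ^ CARD('n) * mean_sq P m (r / 2) \<le> 2 ^ CARD('n) * exp 2 * X"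
  proof -
    have cP: "continuous_on UNIV (\<lambda>x. (P x)\<^sup>2)" by (intro continuous_intros polys_continuous[OF P])
    have "(LINT x:ball m (r / 2)|lborel. (P x)\<^sup>2) = (LINT x:ball m (r / 2)|lebesgue. (P x)\<^sup>2)"
      unfolding set_lebesgue_integral_def
      by (rule integral_completion[symmetric]) (use borel_measurable_continuous_onI[OF cP] in \<open>auto intro!: borel_measurable_times borel_measurable_indicator\<close>)
    also have "\<dots> \<le> exp 2 * X"
    proof -
      have "(LINT x:ball m (r / 2)|lebesgue. (P x)\<^sup>2) \<le> (\<integral>x. exp 2 * (indicator T x *\<^sub>R (P x * v x)) \<partial>lebesgue)"
        unfolding set_lebesgue_integral_def
      proof (rule integral_mono)
        show "integrable lebesgue (\<lambda>x. indicator (ball m (r / 2)) x *\<^sub>R (P x)\<^sup>2)"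
          using set_integrable_lebesgue[OF cP bounded_ball, of m "r / 2"] by (simp add: set_integrable_def)
        show "integrable lebesgue (\<lambda>x. exp 2 * (indicator T x *\<^sub>R (P x * v x)))"
          using iX by (simp add: set_integrable_def)
        fix x
        have v0: "0 \<le> P x * v x" using bump_nonneg[of m r x] by (simp add: v_def mult.assoc[symmetric] zero_le_mult_iff)
        show "indicator (ball m (r / 2)) x *\<^sub>R (P x)\<^sup>2 \<le> exp 2 * (indicator T x *\<^sub>R (P x * v x))"
        proof (cases "x \<in> ball m (r / 2)")
          case True
          then have "x \<in> T" using ball(1) r by (auto simp: subset_iff)
          have "exp 2 * exp (- 2) \<le> exp 2 * bump m r x" using bump_lower[OF r True] by (intro mult_left_mono) auto
          then have "1 \<le> exp 2 * bump m r x" by (simp add: exp_minus)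
          then have "(P x)\<^sup>2 * 1 \<le> (P x)\<^sup>2 * (exp 2 * bump m r x)" by (rule mult_left_mono) simp
          then show ?thesis using True \<open>x \<in> T\<close> by (simp add: v_def power2_eq_square mult_ac)
        next
          case False
          then show ?thesis using v0 by (simp add: indicator_def)
        qed
      qed
      then show ?thesis by (simp add: X_def set_lebesgue_integral_def)
    qed
    finally show ?thesis unfolding mean_sq_ball_integral[OF r] by simp
  qed
  define k where "k = C * (2 ^ CARD('n) * exp 2)"
  have k0: "k \<ge> 0" using Cb(1) by (simp add: k_def)
  have CM: "C * (r ^ CARD('n) * mean_sq P m (r / 2)) \<le> k * X"
    using mult_left_mono[OF Mle Cb(1)] by (simp add: k_def mult_ac)
  define A where "A = sqrt (k * X)"
  have kX0: "0 \<le> k * X" using CM Cb(2) by (meson order_trans zero_le_power2)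
  have A0: "A \<ge> 0" "A\<^sup>2 = k * X" using kX0 by (auto simp: A_def)
  have le_A: "y \<le> A" if "y\<^sup>2 \<le> C * (r ^ CARD('n) * mean_sq P m (r / 2))" for y
    by (rule power2_le_imp_le[OF _ A0(1)]) (use that CM A0 in linarith)
  have bP: "L2_norm lebesgue T P \<le> A" by (rule le_A[OF Cb(2)])
  have bv: "L2_norm lebesgue T v \<le> A" unfolding v_def by (rule le_A[OF Cb(3)])
  have bg: "L2_norm lebesgue T (grad v) \<le> A / r"
    using le_A[OF Cb(4)] r unfolding v_def by (simp add: pos_le_divide_eq mult.commute)
  have wd: "weak_defect T v = 0"
  proof -
    have "indicator T x *\<^sub>R (f x * v x - (\<epsilon> * (Du x \<bullet> grad v x) + (b x \<bullet> Du x) * v x + c x * u x * v x))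
      = indicator \<Omega> x *\<^sub>R (f x * v x - (\<epsilon> * (Du x \<bullet> grad v x) + (b x \<bullet> Du x) * v x + c x * u x * v x))" for x
      using ball supp[of x] gsupp[of x] by (cases "x \<in> cball m r") (auto simp: indicator_def)
    then have "weak_defect T v = weak_defect \<Omega> v"
      unfolding weak_defect_def[OF Tm] weak_defect_def[OF domain_ok] set_lebesgue_integral_def by (simp only:)
    then show ?thesis by (simp add: weak_domain_zero[OF tv])
  qed
  have fd: "flux_defect T (qh T) v = 0"
    unfolding flux_defect_def[OF Tm] by (rule interior_flux[OF q Cv supp Tm(1) ball(1)])
  have "(LINT x:T|lebesgue. R x * v x) \<le> e1 * L2_norm lebesgue T (grad v) + e2 * L2_norm lebesgue T v"
    using residual_tested(2)[where D=T and qh=qh and T=T and uh=uh and v=v and p=p, OF Tm q w c] unfolding wd fd R_def e1_def e2_def by simp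
  moreover have "- (LINT x:T|lebesgue. (R x - P x) * v x) \<le> e3 * L2_norm lebesgue T v"
    using L2_Cauchy_Schwarz[OF LRP Lv] unfolding e3_def by simp
  moreover have "X = (LINT x:T|lebesgue. R x * v x) - (LINT x:T|lebesgue. (R x - P x) * v x)"
  proof -
    have "X = (LINT x:T|lebesgue. R x * v x - (R x - P x) * v x)" by (simp add: X_def algebra_simps)
    also have "\<dots> = (LINT x:T|lebesgue. R x * v x) - (LINT x:T|lebesgue. (R x - P x) * v x)"
      by (rule set_integral_diff(2)[OF integrable_product[OF Tm LR Lv] integrable_product[OF Tm LRP Lv]])
    finally show ?thesis .
  qed
  ultimately have "X \<le> e1 * L2_norm lebesgue T (grad v) + e2 * L2_norm lebesgue T v + e3 * L2_norm lebesgue T v" by linarith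
  also have "\<dots> \<le> e1 * (A / r) + e2 * A + e3 * A"
    by (intro add_mono mult_left_mono bv bg e)
  also have "\<dots> = A * E" by (simp add: E_def algebra_simps)
  finally have "X \<le> A * E" .
  then have "k * X \<le> k * (A * E)" using k0 by (rule mult_left_mono)
  then have "A\<^sup>2 \<le> A * (k * E)" unfolding A0(2) by (simp add: mult_ac)
  then have "A \<le> k * E" using A0(1) k0 E0
    by (cases "A = 0") (auto simp: power2_eq_square)
  moreover have "L2_norm lebesgue T R \<le> L2_norm lebesgue T P + e3"
    using L2_norm_triangle[OF LP LRP] by (simp add: e3_def)
  moreover have "e3 \<le> E" using e r by (simp add: E_def)
  ultimately have "L2_norm lebesgue T R \<le> k * E + E" using bP by linarith
  then show ?thesis
    unfolding R_def[symmetric] e1_def[symmetric] e2_def[symmetric] e3_def[symmetric] k_def[symmetric] E_def[symmetric]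
    by (simp add: algebra_simps)
qed

end

lemma C1_compact_bounded:
  fixes G :: "real^'n \<Rightarrow> real"
  assumes "C1_compact G"
  shows "\<exists>M B. (\<forall>x. \<bar>G x\<bar> \<le> M) \<and> (\<forall>x. G x \<noteq> 0 \<longrightarrow> norm x \<le> B)"
proof -
  obtain M L B where "\<And>x. \<bar>G x\<bar> \<le> M" "\<And>x. norm (grad G x) \<le> L" "\<And>x. G x \<noteq> 0 \<Longrightarrow> norm x \<le> B"
    "\<And>x. grad G x \<noteq> 0 \<Longrightarrow> norm x \<le> B" "B \<ge> 0" "L \<ge> 0"
    using C1_compact_bounds[OF assms] by metis
  then show ?thesis by blast
qed

context conv_diff
begin

text \<open>
  The test function is the jump times a bubble around \<open>m\<close>, the jump being continued constantly in the direction of the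
  normal.  The weak formulation on \<open>\<Omega>\<close> splits into the two elements, and the two flux terms add up to the integral of jump
  times test function over the plane.  The residual is kept on the right-hand side; it is estimated separately.
\<close>

lemma face_jump_estimate:
  fixes qh :: "(real^'n) set \<Rightarrow> real^'n \<Rightarrow> real^'n" and F :: "(real^'n) set"
  assumes T: "elem T1" "elem T2" and r: "r > 0" and K: "K \<ge> 0" and n: "norm n = 1" and m: "n \<bullet> m = a"
    and side: "T1 \<subseteq> {x. n \<bullet> x \<le> a}" "T2 \<subseteq> {x. a \<le> n \<bullet> x}"
    and ball: "cball m r \<inter> {x. n \<bullet> x \<le> a} \<subseteq> T1" "cball m r \<inter> {x. a \<le> n \<bullet> x} \<subseteq> T2" "cball m r \<subseteq> \<Omega>"
    and F: "F \<in> sets borel" "F \<subseteq> {x. n \<bullet> x = a}" "F \<subseteq> cball m (K * r)" "cball m r \<inter> {x. n \<bullet> x = a} \<subseteq> F"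
    and q: "\<And>i. (\<lambda>x. qh T1 x $ i) \<in> polys p" "\<And>i. (\<lambda>x. qh T2 x $ i) \<in> polys p"
    and w: "uh T1 \<in> polys p" "uh T2 \<in> polys p"
    and C: "C \<ge> 0" "\<And>f x. f \<in> polys p \<Longrightarrow> x \<in> cball m (K * r) \<Longrightarrow> (f x)\<^sup>2 \<le> C * mean_sq f m (r / 2)"
      "\<And>f T. f \<in> polys p \<Longrightarrow> T = T1 \<or> T = T2 \<Longrightarrow>
        (L2_norm lebesgue T (\<lambda>x. f x * bump m r x))\<^sup>2 \<le> C * (r ^ CARD('n) * mean_sq f m (r / 2))"
      "\<And>f T. f \<in> polys p \<Longrightarrow> T = T1 \<or> T = T2 \<Longrightarrow>
        (r * L2_norm lebesgue T (grad (\<lambda>x. f x * bump m r x)))\<^sup>2 \<le> C * (r ^ CARD('n) * mean_sq f m (r / 2))"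
  defines "E \<equiv> (\<lambda>T. L2_norm lebesgue T (\<lambda>x. - \<epsilon> *\<^sub>R Du x - qh T x) / r
      + (B * L2_norm lebesgue T (\<lambda>x. Du x - grad (uh T) x) + Kc * L2_norm lebesgue T (\<lambda>x. u x - uh T x))
      + L2_norm lebesgue T (residual b c f qh uh T))"
  shows "(L2_norm surface_measure F (\<lambda>x. qh T1 x \<bullet> n + qh T2 x \<bullet> (- n)))\<^sup>2
    \<le> (C * ((K + 1) ^ CARD('n) * unit_ball_vol (real CARD('n))) * (2 ^ CARD('n) * exp 2))
       * (C * (2 ^ CARD('n) * exp 2)) * r * (E T1 + E T2)\<^sup>2"
proof -
  define J where "J x = qh T1 x \<bullet> n + qh T2 x \<bullet> (- n)" for x
  define Jp where "Jp x = J (proj n a x)" for x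
  have Jpol: "J \<in> polys p"
  proof -
    have "J = (\<lambda>x. (\<Sum>i\<in>UNIV. n $ i * qh T1 x $ i) + (\<Sum>i\<in>UNIV. (- n $ i) * qh T2 x $ i))"
      by (auto simp: J_def inner_vec_def mult.commute)
    also have "\<dots> \<in> polys p" by (intro polys_add polys_sum polys_cmult q)
    finally show ?thesis .
  qed
  have Jp: "Jp \<in> polys p" unfolding Jp_def by (rule polys_proj[OF Jpol])
  have Jinv: "Jp (proj n a x) = Jp x" for x by (simp add: Jp_def proj_proj[OF n])
  have Jplane: "Jp x = J x" if "n \<bullet> x = a" for x using proj_on_plane[OF that] by (simp add: Jp_def)
  define v where "v x = Jp x * bump m r x" for x
  note Tm1 = elemD[OF T(1)] and Tm2 = elemD[OF T(2)]
  have tv: "test_function \<Omega> v" unfolding v_def by (rule test_function_poly_bump[OF Jp r ball(3)])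
  have Cv: "C1_compact v" by (rule test_function_C1_compact[OF tv])
  have c: "continuous_on UNIV v" "continuous_on UNIV (grad v)"
    using Cv by (auto simp: C1_compact_def continuous_on_eq_continuous_at intro!: differentiable_imp_continuous_within)
  have supp: "v x = 0" if "x \<notin> cball m r" for x
    using bump_outside[OF r, of x m] that by (simp add: v_def)
  have gsupp: "grad v x = 0" if "x \<notin> cball m r" for x
    by (rule grad_zero_outside[of v "cball m r"]) (use supp that in auto)
  define M where "M = mean_sq Jp m (r / 2)"
  have M0: "M \<ge> 0" unfolding M_def using r by (intro mean_sq_nonneg) simp
  define Y where "Y = plane_integral n a (\<lambda>x. Jp x * v x)"
  have CJv: "C1_compact (\<lambda>x. Jp x * v x)" by (rule polys_C1_mult[OF Jp Cv])
  have Mle: "r ^ CARD('n) * M \<le> 2 ^ CARD('n) * exp 2 * (r * Y)"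
  proof -
    obtain M' B' where b: "\<forall>x. \<bar>Jp x * v x\<bar> \<le> M'" "\<forall>x. Jp x * v x \<noteq> 0 \<longrightarrow> norm x \<le> B'"
      using C1_compact_bounded[OF CJv] by (elim exE conjE)
    have "plane_integral n a (\<lambda>x. indicator (ball m (r / 2)) x * (Jp x)\<^sup>2) \<le> plane_integral n a (\<lambda>x. exp 2 * (Jp x * v x))"
    proof (rule plane_integral_mono[OF n, where M="exp 2 * M'" and B=B'])
      show "(\<lambda>x. indicator (ball m (r / 2)) x * (Jp x)\<^sup>2) \<in> borel_measurable borel"
        by (intro borel_measurable_times borel_measurable_indicator borel_measurable_power polys_borel[OF Jp]) simp
      show "(\<lambda>x. exp 2 * (Jp x * v x)) \<in> borel_measurable borel"
        by (rule borel_measurable_times[OF borel_measurable_const C1_compact_measurable(1)[OF CJv]])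
      show "\<bar>exp 2 * (Jp y * v y)\<bar> \<le> exp 2 * M'" for y unfolding abs_mult[of "exp 2"] using spec[OF b(1), of y] by simp
      show "norm y \<le> B'" if "exp 2 * (Jp y * v y) \<noteq> 0" for y using that spec[OF b(2), of y] by simp
      show "0 \<le> indicator (ball m (r / 2)) y * (Jp y)\<^sup>2 \<and> indicator (ball m (r / 2)) y * (Jp y)\<^sup>2 \<le> exp 2 * (Jp y * v y)" for y
      proof (cases "y \<in> ball m (r / 2)")
        case True
        have "exp 2 * exp (- 2) \<le> exp 2 * bump m r y" using bump_lower[OF r True] by (intro mult_left_mono) auto
        then have "1 \<le> exp 2 * bump m r y" by (simp add: exp_minus)
        then have "(Jp y)\<^sup>2 * 1 \<le> (Jp y)\<^sup>2 * (exp 2 * bump m r y)" by (rule mult_left_mono) simp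
        then show ?thesis using True by (simp add: v_def power2_eq_square mult_ac)
      next
        case False
        have "0 \<le> Jp y * v y" using bump_nonneg[of m r y] by (simp add: v_def mult.assoc[symmetric] zero_le_mult_iff)
        then show ?thesis using False by simp
      qed
    qed
    also have "\<dots> = exp 2 * Y"
      unfolding Y_def plane_integral_def by (simp add: mult.left_commute)
    finally have "r * plane_integral n a (\<lambda>x. indicator (ball m (r / 2)) x * (Jp x)\<^sup>2) \<le> r * (exp 2 * Y)"
      using r by (intro mult_left_mono) auto
    then have "2 ^ CARD('n) * (r * plane_integral n a (\<lambda>x. indicator (ball m (r / 2)) x * (Jp x)\<^sup>2)) \<le> 2 ^ CARD('n) * (r * (exp 2 * Y))"
      by (rule mult_left_mono) simp
    then show ?thesis using mean_sq_le_plane_integral[OF n m r Jp Jinv] unfolding M_def by (simp add: mult_ac)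
  qed
  define k where "k = C * (2 ^ CARD('n) * exp 2)"
  have k0: "k \<ge> 0" using C(1) by (simp add: k_def)
  have CM: "C * (r ^ CARD('n) * M) \<le> k * (r * Y)"
    using mult_left_mono[OF Mle C(1)] by (simp add: k_def mult_ac)
  have CM0: "0 \<le> C * (r ^ CARD('n) * M)" using C(1) M0 r by simp
  define A where "A = sqrt (k * (r * Y))"
  have A0: "A \<ge> 0" "A\<^sup>2 = k * (r * Y)" using CM CM0 by (auto simp: A_def)
  have le_A: "y \<le> A" if "y\<^sup>2 \<le> C * (r ^ CARD('n) * M)" for y
    by (rule power2_le_imp_le[OF _ A0(1)]) (use that CM A0 in linarith)
  have bv: "L2_norm lebesgue T v \<le> A" if "T = T1 \<or> T = T2" for T
    unfolding v_def by (rule le_A[OF C(3)[OF Jp that, folded M_def]])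
  have bg: "L2_norm lebesgue T (grad v) \<le> A / r" if "T = T1 \<or> T = T2" for T
    using le_A[OF C(4)[OF Jp that, folded M_def]] r unfolding v_def by (simp add: pos_le_divide_eq mult.commute)
  have piece: "flux_defect T (qh T) v - weak_defect T v \<le> A * E T"
    if TT: "T = T1 \<or> T = T2" for T
  proof -
    have eT: "elem T" and qT: "\<And>i. (\<lambda>x. qh T x $ i) \<in> polys p" and wT: "uh T \<in> polys p" using TT T q w by auto
    note Tm = elemD[OF eT]
    have Lv: "L2 lebesgue T v" by (rule L2_cont[OF Tm c(1)])
    note LR = residual_tested(1)[where D=T and qh=qh and T=T and uh=uh and v=v and p=p, OF Tm qT wT c]
    define e1 where "e1 = L2_norm lebesgue T (\<lambda>x. - \<epsilon> *\<^sub>R Du x - qh T x)"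
    define e2 where "e2 = B * L2_norm lebesgue T (\<lambda>x. Du x - grad (uh T) x) + Kc * L2_norm lebesgue T (\<lambda>x. u x - uh T x)"
    define e3 where "e3 = L2_norm lebesgue T (residual b c f qh uh T)"
    have e: "e1 \<ge> 0" "e2 \<ge> 0" "e3 \<ge> 0" using nonneg by (simp_all add: e1_def e2_def e3_def L2_norm_nonneg)
    have "flux_defect T (qh T) v - weak_defect T v + (LINT x:T|lebesgue. residual b c f qh uh T x * v x)
       \<le> e1 * L2_norm lebesgue T (grad v) + e2 * L2_norm lebesgue T v"
      using residual_tested(2)[where D=T and qh=qh and T=T and uh=uh and v=v and p=p, OF Tm qT wT c] unfolding e1_def e2_def by linarith
    moreover have "- (LINT x:T|lebesgue. residual b c f qh uh T x * v x) \<le> e3 * L2_norm lebesgue T v"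
      using L2_Cauchy_Schwarz[OF LR Lv] unfolding e3_def by simp
    ultimately have "flux_defect T (qh T) v - weak_defect T v
       \<le> e1 * L2_norm lebesgue T (grad v) + e2 * L2_norm lebesgue T v + e3 * L2_norm lebesgue T v" by linarith
    also have "\<dots> \<le> e1 * (A / r) + e2 * A + e3 * A"
      by (intro add_mono mult_left_mono bv[OF TT] bg[OF TT] e)
    also have "\<dots> = A * E T" unfolding E_def e1_def[symmetric] e2_def[symmetric] e3_def[symmetric] by (simp add: algebra_simps)
    finally show ?thesis .
  qed
  \<comment> \<open>inside the ball the two elements tile the domain up to the plane between them\<close>
  have wd: "weak_defect T1 v + weak_defect T2 v = 0"
  proof -
    let ?h = "\<lambda>x. f x * v x - (\<epsilon> * (Du x \<bullet> grad v x) + (b x \<bullet> Du x) * v x + c x * u x * v x)"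
    have int: "integrable lebesgue (\<lambda>x. indicator T x *\<^sub>R ?h x)" if "elem T" for T
      using set_integral_diff(1)[OF weak_integrable[OF elemD[OF that] c]] by (simp add: set_integrable_def)
    have int\<Omega>: "integrable lebesgue (\<lambda>x. indicator \<Omega> x *\<^sub>R ?h x)"
      using set_integral_diff(1)[OF weak_integrable[OF domain_ok c]] by (simp add: set_integrable_def)
    have "negligible {x. n \<bullet> x = a}" by (rule negligible_hyperplane) (use n in auto)
    then have ae: "AE x in lebesgue. x \<notin> {x. n \<bullet> x = a}" unfolding negligible_iff_null_sets by (rule AE_not_in)
    have "weak_defect T1 v + weak_defect T2 v = (\<integral>x. indicator T1 x *\<^sub>R ?h x + indicator T2 x *\<^sub>R ?h x \<partial>lebesgue)"
      unfolding weak_defect_def[OF Tm1] weak_defect_def[OF Tm2] set_lebesgue_integral_def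
      by (rule Bochner_Integration.integral_add[OF int[OF T(1)] int[OF T(2)], symmetric])
    also have "\<dots> = (\<integral>x. indicator \<Omega> x *\<^sub>R ?h x \<partial>lebesgue)"
    proof (rule integral_cong_AE)
      show "(\<lambda>x. indicator T1 x *\<^sub>R ?h x + indicator T2 x *\<^sub>R ?h x) \<in> borel_measurable lebesgue"
        by (rule borel_measurable_integrable[OF Bochner_Integration.integrable_add[OF int[OF T(1)] int[OF T(2)]]])
      show "(\<lambda>x. indicator \<Omega> x *\<^sub>R ?h x) \<in> borel_measurable lebesgue" by (rule borel_measurable_integrable[OF int\<Omega>])
      show "AE x in lebesgue. indicator T1 x *\<^sub>R ?h x + indicator T2 x *\<^sub>R ?h x = indicator \<Omega> x *\<^sub>R ?h x"
        using ae
      proof eventually_elim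
        fix x assume x: "x \<notin> {x. n \<bullet> x = a}"
        show "indicator T1 x *\<^sub>R ?h x + indicator T2 x *\<^sub>R ?h x = indicator \<Omega> x *\<^sub>R ?h x"
        proof (cases "x \<in> cball m r")
          case False
          then show ?thesis using supp[OF False] gsupp[OF False] by simp
        next
          case True
          then have O: "x \<in> \<Omega>" using ball(3) by blast
          show ?thesis
          proof (cases "n \<bullet> x \<le> a")
            case le: True
            then have "x \<in> T1" "x \<notin> T2" using True ball(1) side(2) x by auto
            then show ?thesis using O by simp
          next
            case False
            then have "x \<notin> T1" "x \<in> T2" using True ball(2) side(1) x by auto
            then show ?thesis using O by simp
          qed
        qed
      qed
    qed
    also have "\<dots> = weak_defect \<Omega> v" unfolding weak_defect_def[OF domain_ok] set_lebesgue_integral_def ..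
    finally show ?thesis by (simp add: weak_domain_zero[OF tv])
  qed
  have fd: "flux_defect T1 (qh T1) v + flux_defect T2 (qh T2) v = Y"
  proof -
    have C1q: "C1_compact (\<lambda>x. (qh T x \<bullet> k) * v x)" if "\<And>i. (\<lambda>x. qh T x $ i) \<in> polys p" for T k
    proof -
      have "(\<lambda>x. qh T x \<bullet> k) = (\<lambda>x. \<Sum>i\<in>UNIV. k $ i * qh T x $ i)" by (auto simp: inner_vec_def mult.commute)
      also have "\<dots> \<in> polys p" by (intro polys_sum polys_cmult that)
      finally show ?thesis by (rule polys_C1_mult[OF _ Cv])
    qed
    have 1: "flux_defect T1 (qh T1) v = plane_integral n a (\<lambda>x. (qh T1 x \<bullet> n) * v x)"
      unfolding flux_defect_def[OF Tm1] by (rule face_flux[OF q(1) Cv supp n Tm1(1) side(1) ball(1)])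
    have "flux_defect T2 (qh T2) v = plane_integral (- n) (- a) (\<lambda>x. (qh T2 x \<bullet> (- n)) * v x)"
      unfolding flux_defect_def[OF Tm2]
      by (rule face_flux[OF q(2) Cv supp _ Tm2(1)]) (use n side(2) ball(2) in auto)
    also have "\<dots> = plane_integral n a (\<lambda>x. (qh T2 x \<bullet> (- n)) * v x)"
    proof -
      have Cq: "C1_compact (\<lambda>x. (qh T2 x \<bullet> (- n)) * v x)" by (rule C1q[OF q(2)])
      obtain M' B' where b: "\<forall>x. \<bar>(qh T2 x \<bullet> (- n)) * v x\<bar> \<le> M'" "\<forall>x. (qh T2 x \<bullet> (- n)) * v x \<noteq> 0 \<longrightarrow> norm x \<le> B'"
        using C1_compact_bounded[OF Cq] by (elim exE conjE)
      show ?thesis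
        by (rule plane_integral_uminus[OF n C1_compact_measurable(1)[OF Cq] spec[OF b(1)] mp[OF spec[OF b(2)]]])
    qed
    finally have 2: "flux_defect T2 (qh T2) v = plane_integral n a (\<lambda>x. (qh T2 x \<bullet> (- n)) * v x)" .
    have "flux_defect T1 (qh T1) v + flux_defect T2 (qh T2) v
       = (\<integral>x. indicator {x. 0 < n \<bullet> x - a \<and> n \<bullet> x - a \<le> 1} x * ((qh T1 (proj n a x) \<bullet> n) * v (proj n a x))
          + indicator {x. 0 < n \<bullet> x - a \<and> n \<bullet> x - a \<le> 1} x * ((qh T2 (proj n a x) \<bullet> (- n)) * v (proj n a x)) \<partial>lborel)"
      unfolding 1 2 plane_integral_def
      by (rule Bochner_Integration.integral_add[symmetric])
         (rule C1_compact_strip_integrable[OF n C1q[OF q(1)]], rule C1_compact_strip_integrable[OF n C1q[OF q(2)]])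
    also have "\<dots> = Y"
    proof -
      have jj: "Jp (proj n a x) = qh T1 (proj n a x) \<bullet> n + qh T2 (proj n a x) \<bullet> (- n)" for x
        unfolding Jinv unfolding Jp_def J_def ..
      show ?thesis unfolding Y_def plane_integral_def
        by (intro Bochner_Integration.integral_cong refl) (simp only: jj distrib_left distrib_right)
    qed
    finally show ?thesis .
  qed
  have E0: "E T1 \<ge> 0" "E T2 \<ge> 0" unfolding E_def using nonneg r by (simp_all add: L2_norm_nonneg)
  define S where "S = E T1 + E T2"
  have S0: "S \<ge> 0" using E0 by (simp add: S_def)
  have "Y \<le> A * S"
    using piece[of T1] piece[of T2] wd fd by (simp add: S_def distrib_left)
  then have "(k * r) * Y \<le> (k * r) * (A * S)" using k0 r by (intro mult_left_mono) auto
  then have "A\<^sup>2 \<le> A * (k * r * S)" unfolding A0(2) by (simp add: mult_ac)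
  then have "A \<le> k * r * S"
    using A0(1) k0 r S0 by (cases "A = 0") (auto simp: power2_eq_square)
  then have Ybound: "Y \<le> k * r * S\<^sup>2"
    using \<open>Y \<le> A * S\<close> mult_right_mono[OF _ S0, of A "k * r * S"] by (simp add: power2_eq_square mult.assoc)
  define \<omega> where "\<omega> = (K + 1) ^ CARD('n) * unit_ball_vol (real CARD('n))"
  have w0: "\<omega> \<ge> 0" using K unit_ball_vol_nonneg[of "real CARD('n)"] by (simp add: \<omega>_def)
  have norm_sq: "(L2_norm surface_measure F J)\<^sup>2 \<le> (C * M) * plane_integral n a (indicator F)"
  proof -
    have bF: "bounded F" using F(3) bounded_cball bounded_subset by blast
    have J2: "(\<lambda>x. (J x)\<^sup>2) \<in> borel_measurable borel" by (rule borel_measurable_power[OF polys_borel[OF Jpol]])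
    have le: "(J x)\<^sup>2 \<le> C * M" if "x \<in> F" for x
    proof -
      have "n \<bullet> x = a" using that F(2) by auto
      then show ?thesis using C(2)[OF Jp, of x] that F(3) Jplane[of x] by (auto simp: M_def)
    qed
    have CMnn: "0 \<le> C * M" using C(1) M0 by simp
    have "(L2_norm surface_measure F J)\<^sup>2 = (LINT x:F|surface_measure. (J x)\<^sup>2)" by (simp add: L2_norm_sq)
    also have "\<dots> = plane_integral n a (\<lambda>x. indicator F x * (J x)\<^sup>2)"
      by (rule surface_integral_hyperplane[OF n F(1,2) bF J2, of "C * M"]) (use le in auto)
    also have "\<dots> \<le> plane_integral n a (\<lambda>x. (C * M) * indicator F x)"
    proof (rule plane_integral_mono[OF n, where M="C * M" and B="norm m + K * r"])
      show "(\<lambda>x. indicator F x * (J x)\<^sup>2) \<in> borel_measurable borel"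
        by (rule borel_measurable_times[OF borel_measurable_indicator[OF F(1)] J2])
      show "(\<lambda>x. C * M * indicator F x) \<in> borel_measurable borel"
        by (rule borel_measurable_times[OF borel_measurable_const borel_measurable_indicator[OF F(1)]])
      show "\<bar>C * M * indicator F y\<bar> \<le> C * M" for y using CMnn by (auto simp: indicator_def)
      show "norm y \<le> norm m + K * r" if "C * M * indicator F y \<noteq> 0" for y
      proof -
        have "y \<in> F" using that by (auto simp: indicator_def split: if_splits)
        then have "dist m y \<le> K * r" using F(3) by auto
        then show ?thesis using norm_triangle_ineq2[of y m] by (simp add: dist_norm norm_minus_commute)
      qed
      show "0 \<le> indicator F y * (J y)\<^sup>2 \<and> indicator F y * (J y)\<^sup>2 \<le> C * M * indicator F y" for y
        using le[of y] by (auto simp: indicator_def)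
    qed
    also have "\<dots> = (C * M) * plane_integral n a (indicator F)"
      unfolding plane_integral_def by (simp add: mult.left_commute)
    finally show ?thesis .
  qed
  have "r * (L2_norm surface_measure F J)\<^sup>2 \<le> (C * M) * (r * plane_integral n a (indicator F))"
    using mult_left_mono[OF norm_sq, of r] r by (simp add: mult_ac)
  also have "\<dots> \<le> (C * M) * (\<omega> * r ^ CARD('n))"
    using plane_section_area[OF n r K F(1,3), of a] C(1) M0 by (intro mult_left_mono) (auto simp: \<omega>_def)
  also have "\<dots> = (C * \<omega>) * (r ^ CARD('n) * M)" by simp
  also have "\<dots> \<le> (C * \<omega>) * (2 ^ CARD('n) * exp 2 * (r * Y))"
    using C(1) w0 by (intro mult_left_mono Mle) simp
  finally have "r * (L2_norm surface_measure F J)\<^sup>2 \<le> r * ((C * \<omega> * (2 ^ CARD('n) * exp 2)) * Y)"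
    by (simp add: mult_ac)
  then have "(L2_norm surface_measure F J)\<^sup>2 \<le> (C * \<omega> * (2 ^ CARD('n) * exp 2)) * Y" using r by simp
  also have "\<dots> \<le> (C * \<omega> * (2 ^ CARD('n) * exp 2)) * (k * r * S\<^sup>2)"
    using C(1) w0 by (intro mult_left_mono Ybound) simp
  finally show ?thesis
    unfolding J_def[symmetric] \<omega>_def[symmetric] k_def[symmetric] S_def[symmetric] by (simp add: mult.assoc)
qed

end

section \<open>The jump of the scalar unknown\<close>

lemma emeasure_surface_finite:
  fixes F :: "(real^'n) set"
  assumes n: "norm n = 1" and F: "F \<in> sets borel" "F \<subseteq> {x. n \<bullet> x = a}" "bounded F"
  shows "emeasure surface_measure F < \<infinity>"
proof -
  let ?H = "{x. n \<bullet> x = a}"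
  have n0: "n \<noteq> 0" using n by auto
  have H: "?H \<in> hyperplanes" using n0 by (auto simp: hyperplanes_def)
  have cp: "closest_point ?H = proj n a"
    using closest_point_hyperplane[OF n0, of a] n by (auto simp: proj_def dot_square_norm)
  obtain M where M: "\<forall>x\<in>F. norm x \<le> M" using F(3) by (auto simp: bounded_iff)
  have "{x. infdist x ?H \<le> 1/2 \<and> closest_point ?H x \<in> F} \<subseteq> cball 0 (M + 1)"
  proof
    fix x assume x: "x \<in> {x. infdist x ?H \<le> 1/2 \<and> closest_point ?H x \<in> F}"
    have "infdist x ?H = dist x (closest_point ?H x)"
      using hyperplane_basic[OF H] by (simp add: infdist_eq_setdist setdist_closest_point)
    then have "norm (x - proj n a x) \<le> 1/2" using x unfolding cp by (simp add: dist_norm)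
    moreover have "norm (proj n a x) \<le> M" using M x unfolding cp by auto
    moreover have "norm x \<le> norm (proj n a x) + norm (x - proj n a x)"
      using norm_triangle_ineq[of "proj n a x" "x - proj n a x"] by simp
    ultimately show "x \<in> cball 0 (M + 1)" by simp
  qed
  then have "bounded {x. infdist x ?H \<le> 1/2 \<and> closest_point ?H x \<in> F}" using bounded_cball bounded_subset by blast
  from emeasure_bounded_finite[OF this] show ?thesis
    unfolding emeasure_surface_hyperplane[OF H F(1,2)] hyperplane_content_def by simp
qed

context bary_simplex
begin

lemma facet_integrable:
  assumes v: "v \<in> V" and f: "continuous_on UNIV f"
  shows "set_integrable surface_measure (facet v) (f :: real^'n \<Rightarrow> real)"
proof -
  have bF: "bounded (facet v)" using compact_facet by (rule compact_imp_bounded)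
  have fin: "emeasure surface_measure (facet v) < \<infinity>"
    by (rule emeasure_surface_finite[OF norm_nrm[OF v] facet_borel facet_plane[OF v] bF])
  have "compact (f ` facet v)" by (rule compact_continuous_image[OF continuous_on_subset[OF f] compact_facet]) simp
  then obtain M where M: "\<forall>y\<in>f ` facet v. norm y \<le> M" using compact_imp_bounded bounded_iff by metis
  have "integrable surface_measure (\<lambda>x. M * indicator (facet v) x :: real)"
    using fin by (intro integrable_mult_right) (simp add: integrable_indicator_iff)
  then show ?thesis unfolding set_integrable_def
  proof (rule Bochner_Integration.integrable_bound)
    have fm: "f \<in> borel_measurable borel" by (rule borel_measurable_continuous_onI[OF f])
    have "(\<lambda>x. indicator (facet v) x *\<^sub>R f x) \<in> borel_measurable borel"
      by (rule borel_measurable_scaleR[OF borel_measurable_indicator[OF facet_borel] fm])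
    then show "(\<lambda>x. indicator (facet v) x *\<^sub>R f x) \<in> borel_measurable surface_measure"
      by (simp cong: measurable_cong_sets)
    show "AE x in surface_measure. norm (indicator (facet v) x *\<^sub>R f x) \<le> norm (M * indicator (facet v) x :: real)"
    proof (rule AE_I2)
      fix x
      show "norm (indicator (facet v) x *\<^sub>R f x) \<le> norm (M * indicator (facet v) x :: real)"
      proof (cases "x \<in> facet v")
        case True
        then have "\<bar>f x\<bar> \<le> M" using M by auto
        then show ?thesis using True by simp
      qed simp
    qed
  qed
qed

lemma grad_sum:
  fixes a :: "'i \<Rightarrow> real^'n \<Rightarrow> real"
  assumes "\<And>i. i \<in> I \<Longrightarrow> a i differentiable (at x)"
  shows "grad (\<lambda>x. \<Sum>i\<in>I. k i * a i x) x = (\<Sum>i\<in>I. k i *\<^sub>R grad (a i) x)"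
proof (rule grad_unique)
  have "((\<lambda>x. \<Sum>i\<in>I. k i * a i x) has_derivative (\<lambda>h. \<Sum>i\<in>I. k i * (grad (a i) x \<bullet> h))) (at x)"
    by (intro has_derivative_sum has_derivative_mult_right has_derivative_grad assms)
  then show "((\<lambda>x. \<Sum>i\<in>I. k i * a i x) has_derivative (\<lambda>h. (\<Sum>i\<in>I. k i *\<^sub>R grad (a i) x) \<bullet> h)) (at x)"
    by (simp add: inner_sum_left)
qed

text \<open>
  The test field is a combination of the edge vectors leaving the vertex opposite to the face, each multiplied
  by a polynomial that vanishes on the facet opposite to the other end of the edge. Its normal component is
  therefore prescribed on one facet and zero on all the others.  On the facet the coordinates of its vertices
  sum to 1 and represent \<open>x - m\<close>; so replacing \<open>x - m\<close> by \<open>w - m\<close> in the decomposition of the mismatch, weighting with the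
  coordinate of \<open>w\<close> and summing over \<open>w\<close> gives back the mismatch.
\<close>

lemma trace_mismatch_estimate:
  fixes qT :: "real^'n \<Rightarrow> real^'n" and uT \<mu> :: "real^'n \<Rightarrow> real" and uhat :: "(real^'n) set \<Rightarrow> real^'n \<Rightarrow> real"
  assumes d: "CARD('n) \<ge> 2" and v: "v \<in> V" and r: "r > 0" and K: "K \<ge> 1" and TK: "T \<subseteq> cball m (K * r)"
    and m: "nrm v \<bullet> m = off v" and ball: "cball m r \<inter> {x. nrm v \<bullet> x = off v} \<subseteq> facet v"
    and gr: "norm (g v) * r \<le> 1"
    and qT: "\<And>i. (\<lambda>x. qT x $ i) \<in> polys (Suc p)" and uT: "uT \<in> polys (Suc p)" and uhat: "\<And>w. w \<in> V \<Longrightarrow> uhat (facet w) \<in> polys (Suc p)"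
    and D: "D \<ge> 0" "\<And>f. f \<in> polys (Suc p) \<Longrightarrow> \<exists>c q. (\<forall>i. q i \<in> polys p) \<and>
       (\<forall>x::real^'n. f x = c + (\<Sum>i\<in>UNIV. (x - m) $ i / (r / 2) * q i x)) \<and> \<bar>c\<bar> \<le> D * sqrt (mean_sq f m (r / 2)) \<and>
       (\<forall>i. \<forall>x\<in>cball m (K * r). \<bar>q i x\<bar> \<le> D * sqrt (mean_sq f m (r / 2)))"
    and eq: "\<And>\<rho>. (\<And>i. (\<lambda>x. \<rho> x $ i) \<in> polys (Suc p)) \<Longrightarrow>
       (LINT x:T|lebesgue. (1 / \<epsilon>) *\<^sub>R qT x \<bullet> \<rho> x) - (LINT x:T|lebesgue. uT x * divg \<rho> x)
       + (\<Sum>F | F facet_of T. LINT x:F|surface_measure. uhat F x * (\<rho> x \<bullet> outer_normal T F)) = 0"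
  shows "(L2_norm surface_measure (facet v) (\<lambda>x. uT x - uhat (facet v) x))\<^sup>2
    \<le> ((real CARD('n) * (D * (1 + real CARD('n) * (2 * K))) * (2 * K))\<^sup>2 * (K ^ CARD('n) * unit_ball_vol (real CARD('n))) * 2 ^ CARD('n))
       * r * (L2_norm lebesgue T (\<lambda>x. (1 / \<epsilon>) *\<^sub>R qT x + grad uT x))\<^sup>2"
proof -
  define n where "n = nrm v"
  define a where "a = off v"
  define F where "F = facet v"
  have n1: "norm n = 1" unfolding n_def by (rule norm_nrm[OF v])
  have gpos: "norm (g v) > 0" using g_nonzero[OF v] by simp
  define \<mu> where "\<mu> x = uT x - uhat F x" for x
  have mu: "\<mu> \<in> polys (Suc p)"
    using polys_add[OF uT polys_cmult[OF uhat[OF v], of "-1"]] by (simp add: \<mu>_def[abs_def] F_def)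
  \<comment> \<open>constant in the normal direction, so that its mean square over a ball is controlled by the face\<close>
  define Gp where "Gp x = \<mu> (proj n a x)" for x
  have Gp: "Gp \<in> polys (Suc p)" unfolding Gp_def by (rule polys_proj[OF mu])
  have Ginv: "Gp (proj n a x) = Gp x" for x by (simp add: Gp_def proj_proj[OF n1])
  have on_plane: "n \<bullet> x = a" if "x \<in> F" for x using that facet_plane[OF v] by (auto simp: F_def n_def a_def)
  have Gface: "Gp x = \<mu> x" if "x \<in> F" for x using proj_on_plane[OF on_plane[OF that]] by (simp add: Gp_def)
  define M where "M = mean_sq Gp m (r / 2)"
  have M0: "M \<ge> 0" unfolding M_def using r by (intro mean_sq_nonneg) simp
  define Y where "Y = (L2_norm surface_measure F \<mu>)\<^sup>2"
  have Ym: "Y = (LINT x:F|surface_measure. (\<mu> x)\<^sup>2)" by (simp add: Y_def L2_norm_sq)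
  have Fb: "bounded F" unfolding F_def using compact_facet by (rule compact_imp_bounded)
  have Fm: "F \<in> sets borel" by (simp add: F_def)
  have Fsub: "F \<subseteq> {x. n \<bullet> x = a}" using on_plane by auto
  have FT: "F \<subseteq> T" by (auto simp: F_def facet_def)
  have Mle: "r ^ CARD('n) * M \<le> 2 ^ CARD('n) * (r * Y)"
  proof -
    have mu2: "(\<lambda>x. (\<mu> x)\<^sup>2) \<in> borel_measurable borel" by (rule borel_measurable_power[OF polys_borel[OF mu]])
    have "compact ((\<lambda>x. (\<mu> x)\<^sup>2) ` F)" unfolding F_def
      by (rule compact_continuous_image[OF _ compact_facet]) (intro continuous_intros polys_continuous[OF mu])
    then obtain M' where M': "\<forall>y\<in>(\<lambda>x. (\<mu> x)\<^sup>2) ` F. norm y \<le> M'" using compact_imp_bounded bounded_iff by metis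
    obtain B' where B': "\<forall>x\<in>F. norm x \<le> B'" using Fb by (auto simp: bounded_iff)
    have Mp: "\<bar>(\<mu> x)\<^sup>2\<bar> \<le> M'" if "x \<in> F" for x using M' that by auto
    have "plane_integral n a (\<lambda>x. indicator (ball m (r / 2)) x * (Gp x)\<^sup>2) \<le> plane_integral n a (\<lambda>x. indicator F x * (\<mu> x)\<^sup>2)"
    proof (rule plane_integral_mono[OF n1, where M="\<bar>M'\<bar>" and B=B'])
      show "(\<lambda>x. indicator (ball m (r / 2)) x * (Gp x)\<^sup>2) \<in> borel_measurable borel"
        by (intro borel_measurable_times borel_measurable_indicator borel_measurable_power polys_borel[OF Gp]) simp
      show "(\<lambda>x. indicator F x * (\<mu> x)\<^sup>2) \<in> borel_measurable borel"
        by (rule borel_measurable_times[OF borel_measurable_indicator[OF Fm] mu2])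
      show "\<bar>indicator F y * (\<mu> y)\<^sup>2\<bar> \<le> \<bar>M'\<bar>" for y
      proof (cases "y \<in> F")
        case True
        then show ?thesis using Mp[OF True] by simp
      qed simp
      show "norm y \<le> B'" if "indicator F y * (\<mu> y)\<^sup>2 \<noteq> 0" for y
        using that B' by (auto simp: indicator_def split: if_splits)
      show "0 \<le> indicator (ball m (r / 2)) y * (Gp y)\<^sup>2 \<and> indicator (ball m (r / 2)) y * (Gp y)\<^sup>2 \<le> indicator F y * (\<mu> y)\<^sup>2"
        if "n \<bullet> y = a" for y
      proof (cases "y \<in> ball m (r / 2)")
        case True
        then have "y \<in> cball m r \<inter> {x. nrm v \<bullet> x = off v}" using that r by (auto simp: n_def a_def)
        then have "y \<in> F" using ball by (auto simp: F_def)
        then show ?thesis using True Gface by simp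
      qed simp
    qed
    also have "\<dots> = Y"
      unfolding Ym by (rule surface_integral_hyperplane[OF n1 Fm Fsub Fb mu2 Mp, symmetric])
    finally have "r * plane_integral n a (\<lambda>x. indicator (ball m (r / 2)) x * (Gp x)\<^sup>2) \<le> r * Y"
      using r by (intro mult_left_mono) auto
    then have "2 ^ CARD('n) * (r * plane_integral n a (\<lambda>x. indicator (ball m (r / 2)) x * (Gp x)\<^sup>2)) \<le> 2 ^ CARD('n) * (r * Y)"
      by (rule mult_left_mono) simp
    then show ?thesis
      using mean_sq_le_plane_integral[OF n1 m[folded n_def a_def] r Gp Ginv] unfolding M_def by linarith
  qed
  obtain c0 qq where qq: "\<forall>i. qq i \<in> polys p"
     and dec: "\<forall>x::real^'n. Gp x = c0 + (\<Sum>i\<in>UNIV. (x - m) $ i / (r / 2) * qq i x)" and c0: "\<bar>c0\<bar> \<le> D * sqrt M"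
     and qqb: "\<forall>i. \<forall>x\<in>cball m (K * r). \<bar>qq i x\<bar> \<le> D * sqrt M"
    using D(2)[OF Gp] unfolding M_def by (elim exE conjE)
  define s where "s w x = c0 + (\<Sum>i\<in>UNIV. ((w - m) $ i / (r / 2)) * qq i x)" for w x
  have s_pol: "s w \<in> polys p" for w
    unfolding s_def by (intro polys_add polys_const polys_sum polys_cmult) (use qq in simp)
  define al where "al w x = lam w x * s w x" for w x
  have al_pol: "al w \<in> polys (Suc p)" for w unfolding al_def by (rule lam_polys[OF s_pol])
  have dal: "al w differentiable (at x)" for w x by (rule polys_differentiable[OF al_pol])
  let ?W = "V - {v}"
  have finW: "finite ?W" using fin_V by simp
  have cardW: "card ?W = CARD('n)" using v card_V fin_V by simp
  have al_sum: "(\<Sum>w\<in>?W. al w x) = \<mu> x" if x: "x \<in> F" for x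
  proof -
    have lv: "lam v x = 0" using x by (simp add: F_def facet_def)
    have s1: "(\<Sum>w\<in>?W. lam w x) = 1" using sum_lam'[of x] lv v fin_V by (simp add: sum_diff1)
    have s2: "(\<Sum>w\<in>?W. lam w x *\<^sub>R w) = x" using repr'[of x] lv v fin_V by (simp add: sum_diff1)
    have "(\<Sum>w\<in>?W. lam w x *\<^sub>R (w - m)) = (\<Sum>w\<in>?W. lam w x *\<^sub>R w) - (\<Sum>w\<in>?W. lam w x) *\<^sub>R m"
      by (simp only: scaleR_right_diff_distrib sum_subtractf scaleR_sum_left)
    then have xm: "(\<Sum>w\<in>?W. lam w x *\<^sub>R (w - m)) = x - m" unfolding s1 s2 by simp
    have coord: "(\<Sum>w\<in>?W. lam w x * (w - m) $ i) = (x - m) $ i" for i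
      unfolding xm[symmetric] sum_component vector_scaleR_component by (simp only: real_scaleR_def)
    have "(\<Sum>w\<in>?W. al w x) = c0 * (\<Sum>w\<in>?W. lam w x) + (\<Sum>w\<in>?W. \<Sum>i\<in>UNIV. (lam w x * (w - m) $ i) * (qq i x / (r / 2)))"
    proof -
      have t: "lam w x * ((w - m) $ i / (r / 2) * qq i x) = (lam w x * (w - m) $ i) * (qq i x / (r / 2))" for w i
        by (simp only: times_divide_eq_left times_divide_eq_right mult_ac)
      show ?thesis unfolding al_def s_def distrib_left sum.distrib sum_distrib_left t by (simp only: mult_ac)
    qed
    also have "(\<Sum>w\<in>?W. \<Sum>i\<in>UNIV. (lam w x * (w - m) $ i) * (qq i x / (r / 2)))
       = (\<Sum>i\<in>UNIV. (\<Sum>w\<in>?W. lam w x * (w - m) $ i) * (qq i x / (r / 2)))"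
      unfolding sum_distrib_right by (rule sum.swap)
    also have "c0 * (\<Sum>w\<in>?W. lam w x) + \<dots> = Gp x"
    proof -
      have t: "(x - m) $ i * (qq i x / (r / 2)) = (x - m) $ i / (r / 2) * qq i x" for i
        by (simp only: times_divide_eq_left times_divide_eq_right mult_ac)
      show ?thesis unfolding coord s1 t dec[rule_format, of x] by (simp only: mult_1_right)
    qed
    finally show ?thesis using Gface[OF x] by simp
  qed
  have edge: "norm (w - m) \<le> K * r" if "w \<in> V" for w
    using that TK V_sub_T by (auto simp: subset_iff dist_norm norm_minus_commute)
  define b where "b = D * (1 + real CARD('n) * (2 * K))"
  have b0: "b \<ge> 0" using D(1) K by (simp add: b_def)
  have s_bound: "\<bar>s w x\<bar> \<le> b * sqrt M" if "w \<in> V" "x \<in> T" for w x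
  proof -
    have x: "x \<in> cball m (K * r)" using that TK by auto
    have "\<bar>((w - m) $ i / (r / 2)) * qq i x\<bar> \<le> (2 * K) * (D * sqrt M)" for i
    proof -
      have "\<bar>(w - m) $ i\<bar> \<le> K * r" using component_le_norm_cart[of "w - m" i] edge[OF that(1)] by linarith
      then have "\<bar>(w - m) $ i / (r / 2)\<bar> \<le> 2 * K" using r by (simp add: field_simps)
      moreover have "\<bar>qq i x\<bar> \<le> D * sqrt M" using qqb x by blast
      ultimately show ?thesis unfolding abs_mult using K by (intro mult_mono) auto
    qed
    then have "\<bar>\<Sum>i\<in>UNIV. ((w - m) $ i / (r / 2)) * qq i x\<bar> \<le> (\<Sum>i\<in>(UNIV :: 'n set). (2 * K) * (D * sqrt M))"
      by (intro order_trans[OF sum_abs] sum_mono)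
    then have "\<bar>s w x\<bar> \<le> D * sqrt M + real CARD('n) * ((2 * K) * (D * sqrt M))"
      unfolding s_def using c0 by simp
    then show ?thesis by (simp add: b_def algebra_simps)
  qed
  define \<rho> where "\<rho> x = (\<Sum>w\<in>?W. al w x *\<^sub>R (norm (g v) *\<^sub>R (w - v)))" for x
  have rho_comp: "\<rho> x $ i = (\<Sum>w\<in>?W. (norm (g v) * (w - v) $ i) * al w x)" for x i
    by (simp add: \<rho>_def sum_component mult_ac)
  have rho_pol: "(\<lambda>x. \<rho> x $ i) \<in> polys (Suc p)" for i
    unfolding rho_comp by (intro polys_sum polys_cmult al_pol)
  define S where "S = real CARD('n) * b * (2 * K)"
  have S0: "S \<ge> 0" using b0 K by (simp add: S_def)
  have rho_bound: "(norm (\<rho> x))\<^sup>2 \<le> S\<^sup>2 * M" if x: "x \<in> T" for x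
  proof -
    have "norm (al w x *\<^sub>R (norm (g v) *\<^sub>R (w - v))) \<le> (b * sqrt M) * (2 * K)" if w: "w \<in> ?W" for w
    proof -
      have "\<bar>al w x\<bar> \<le> 1 * (b * sqrt M)"
        unfolding al_def abs_mult using lam_le_1[OF x, of w] x T_iff s_bound[of w x] w by (intro mult_mono) auto
      moreover have "norm (g v) * norm (w - v) \<le> 2 * K"
      proof -
        have "norm (w - v) \<le> 2 * K * r"
          using norm_triangle_ineq4[of "w - m" "v - m"] edge[of w] edge[OF v] w by simp
        then have "norm (g v) * norm (w - v) \<le> norm (g v) * (2 * K * r)" by (rule mult_left_mono) simp
        also have "\<dots> = 2 * K * (norm (g v) * r)" by simp
        also have "\<dots> \<le> 2 * K * 1" using K by (intro mult_left_mono gr) simp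
        finally show ?thesis by simp
      qed
      ultimately have "\<bar>al w x\<bar> * (norm (g v) * norm (w - v)) \<le> (1 * (b * sqrt M)) * (2 * K)"
        by (rule mult_mono) (use b0 M0 in auto)
      then show ?thesis by (simp add: abs_mult mult.assoc)
    qed
    then have "norm (\<rho> x) \<le> (\<Sum>w\<in>?W. (b * sqrt M) * (2 * K))"
      unfolding \<rho>_def by (intro order_trans[OF norm_sum] sum_mono)
    then have "norm (\<rho> x) \<le> S * sqrt M" by (simp add: cardW S_def mult_ac)
    then have "(norm (\<rho> x))\<^sup>2 \<le> (S * sqrt M)\<^sup>2" by (intro power_mono) auto
    then show ?thesis using M0 by (simp add: power_mult_distrib)
  qed
  define \<omega> where "\<omega> = K ^ CARD('n) * unit_ball_vol (real CARD('n))"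
  have w0: "\<omega> \<ge> 0" using K unit_ball_vol_nonneg[of "real CARD('n)"] by (simp add: \<omega>_def)
  have bT: "bounded T" using compact_T by (rule compact_imp_bounded)
  have Lrho: "L2 lebesgue T \<rho>" by (rule L2_continuous[OF polys_vec_continuous[OF rho_pol] bT T_borel])
  have rho_norm: "(L2_norm lebesgue T \<rho>)\<^sup>2 \<le> (S\<^sup>2 * \<omega> * 2 ^ CARD('n)) * (r * Y)"
  proof -
    have Kr: "0 \<le> K * r" using K r by simp
    have "(L2_norm lebesgue T \<rho>)\<^sup>2 \<le> (S\<^sup>2 * M) * measure lborel (cball m (K * r))"
      by (rule L2_norm_sup_bound[OF Lrho T_borel TK]) (use rho_bound M0 in auto)
    also have "\<dots> = (S\<^sup>2 * \<omega>) * (r ^ CARD('n) * M)"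
      using measure_cball_scale[OF Kr, of m] by (simp add: \<omega>_def power_mult_distrib mult_ac)
    also have "\<dots> \<le> (S\<^sup>2 * \<omega>) * (2 ^ CARD('n) * (r * Y))" using w0 by (intro mult_left_mono Mle) simp
    finally show ?thesis by (simp add: mult_ac)
  qed
  \<comment> \<open>on a facet opposite to another vertex \<open>z\<close> the coordinate of \<open>z\<close> vanishes and the other edge vectors are tangential\<close>
  have bterms: "(\<Sum>F' | F' facet_of T. LINT x:F'|surface_measure. uhat F' x * (\<rho> x \<bullet> outer_normal T F'))
     = (LINT x:F|surface_measure. uhat F x * \<mu> x)"
  proof -
    have "(\<Sum>F' | F' facet_of T. LINT x:F'|surface_measure. uhat F' x * (\<rho> x \<bullet> outer_normal T F'))
       = (\<Sum>w\<in>V. LINT x:facet w|surface_measure. uhat (facet w) x * (\<rho> x \<bullet> nrm w))"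
      unfolding facets_eq by (simp add: sum.reindex[OF inj_facet] outer_normal_facet)
    also have "\<dots> = (\<Sum>w\<in>V. if w = v then LINT x:F|surface_measure. uhat F x * \<mu> x else 0)"
    proof (rule sum.cong[OF refl])
      fix z assume z: "z \<in> V"
      have val: "\<rho> x \<bullet> nrm z = (if z = v then \<mu> x else 0)" if x: "x \<in> facet z" for x
      proof (cases "z = v")
        case True
        have "\<rho> x \<bullet> nrm z = (\<Sum>w\<in>?W. al w x)"
          unfolding \<rho>_def inner_sum_left
        proof (rule sum.cong[OF refl])
          fix w assume w: "w \<in> ?W"
          have "(w - v) \<bullet> nrm z = 1 / norm (g v)" using nrm_edge[OF v, of w] w True by (simp add: inner_commute)
          then show "al w x *\<^sub>R norm (g v) *\<^sub>R (w - v) \<bullet> nrm z = al w x" using gpos by simp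
        qed
        then show ?thesis using al_sum[of x] x True by (simp add: F_def)
      next
        case False
        have "al w x *\<^sub>R norm (g v) *\<^sub>R (w - v) \<bullet> nrm z = 0" if w: "w \<in> ?W" for w
        proof (cases "w = z")
          case True
          then have "al w x = 0" using x by (simp add: al_def facet_def)
          then show ?thesis by simp
        next
          case wz: False
          have "(w - v) \<bullet> nrm z = 0" using nrm_tangent[OF z v, of w] w wz False by (simp add: inner_commute)
          then show ?thesis by simp
        qed
        then have "\<rho> x \<bullet> nrm z = 0" unfolding \<rho>_def inner_sum_left by (rule sum.neutral[OF ballI])
        then show ?thesis using False by simp
      qed
      have "(LINT x:facet z|surface_measure. uhat (facet z) x * (\<rho> x \<bullet> nrm z))
         = (LINT x:facet z|surface_measure. uhat (facet z) x * (if z = v then \<mu> x else 0))"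
        unfolding set_lebesgue_integral_def
        by (rule Bochner_Integration.integral_cong) (use val in \<open>auto simp: indicator_def\<close>)
      then show "(LINT x:facet z|surface_measure. uhat (facet z) x * (\<rho> x \<bullet> nrm z))
         = (if z = v then LINT x:F|surface_measure. uhat F x * \<mu> x else 0)"
        by (simp add: F_def)
    qed
    also have "\<dots> = (LINT x:F|surface_measure. uhat F x * \<mu> x)" using v fin_V by simp
    finally show ?thesis .
  qed
  have cuT: "continuous_on UNIV uT" "continuous_on UNIV (grad uT)"
    by (rule polys_continuous[OF uT], rule polys_continuous_grad[OF uT])
  have crho: "continuous_on UNIV \<rho>" by (rule polys_vec_continuous[OF rho_pol])
  have cdiv: "continuous_on UNIV (divg \<rho>)" by (rule polys_continuous[OF divg_polys(2)[OF rho_pol]])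
  have cqT: "continuous_on UNIV qT" by (rule polys_vec_continuous[OF qT])
  have cmu: "continuous_on UNIV \<mu>" by (rule polys_continuous[OF mu])
  have cal: "continuous_on UNIV (al w)" for w by (rule polys_continuous[OF al_pol])
  have cuh: "continuous_on UNIV (uhat F)" unfolding F_def by (rule polys_continuous[OF uhat[OF v]])
  have parts: "(LINT x:T|lebesgue. uT x * divg \<rho> x + grad uT x \<bullet> \<rho> x) = (LINT x:F|surface_measure. uT x * \<mu> x)"
  proof -
    define fw where "fw w x = lam w x * (s w x * uT x)" for w x
    have fw_pol: "fw w \<in> polys (Suc (p + Suc p))" for w
      unfolding fw_def by (rule lam_polys[OF polys_mult[OF s_pol uT]])
    have gfw: "grad (fw w) x = al w x *\<^sub>R grad uT x + uT x *\<^sub>R grad (al w) x" for w x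
    proof -
      have "fw w = (\<lambda>x. al w x * uT x)" by (auto simp: fw_def al_def)
      then show ?thesis using grad_mult[OF dal polys_differentiable[OF uT]] by simp
    qed
    have cgfw: "continuous_on UNIV (grad (fw w))" for w by (rule polys_continuous_grad[OF fw_pol])
    have div_eq: "divg \<rho> x = (\<Sum>w\<in>?W. norm (g v) * (grad (al w) x \<bullet> (w - v)))" for x
    proof -
      have "grad (\<lambda>x. \<rho> x $ i) x $ i = (\<Sum>w\<in>?W. norm (g v) * (grad (al w) x $ i * (w - v) $ i))" for i
        unfolding rho_comp by (subst grad_sum[OF dal]) (simp add: sum_component mult_ac)
      then have "divg \<rho> x = (\<Sum>i\<in>UNIV. \<Sum>w\<in>?W. norm (g v) * (grad (al w) x $ i * (w - v) $ i))"
        unfolding divg_polys(1)[OF rho_pol] by simp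
      also have "\<dots> = (\<Sum>w\<in>?W. \<Sum>i\<in>UNIV. norm (g v) * (grad (al w) x $ i * (w - v) $ i))" by (rule sum.swap)
      finally show ?thesis by (simp add: inner_vec_def sum_distrib_left)
    qed
    have pt: "uT x * divg \<rho> x + grad uT x \<bullet> \<rho> x = (\<Sum>w\<in>?W. norm (g v) * (grad (fw w) x \<bullet> (w - v)))" for x
      unfolding div_eq gfw \<rho>_def inner_sum_right sum_distrib_left sum.distrib[symmetric]
      by (rule sum.cong) (simp_all add: inner_add_left algebra_simps)
    have intg: "set_integrable lebesgue T (\<lambda>x. norm (g v) * (grad (fw w) x \<bullet> (w - v)))" for w
      by (rule set_integrable_lebesgue[OF _ bT T_borel]) (intro continuous_intros cgfw)
    have "(LINT x:T|lebesgue. uT x * divg \<rho> x + grad uT x \<bullet> \<rho> x)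
       = (\<Sum>w\<in>?W. LINT x:T|lebesgue. norm (g v) * (grad (fw w) x \<bullet> (w - v)))"
      unfolding pt set_lebesgue_integral_def scaleR_sum_right
      by (rule Bochner_Integration.integral_sum) (use intg in \<open>simp add: set_integrable_def\<close>)
    also have "\<dots> = (\<Sum>w\<in>?W. LINT x:F|surface_measure. uT x * al w x)"
    proof (rule sum.cong[OF refl])
      fix w assume w: "w \<in> ?W"
      have "(LINT x:T|lebesgue. grad (fw w) x \<bullet> (w - v)) = (LINT x:T|lborel. grad (fw w) x \<bullet> (w - v))"
      proof -
        have "(\<lambda>x. grad (fw w) x \<bullet> (w - v)) \<in> borel_measurable borel"
          by (rule borel_measurable_continuous_onI) (intro continuous_intros cgfw)
        then have "(\<lambda>x. indicator T x *\<^sub>R (grad (fw w) x \<bullet> (w - v))) \<in> borel_measurable lborel"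
          using borel_measurable_scaleR[OF borel_measurable_indicator[OF T_borel]] by simp
        from integral_completion[OF this] show ?thesis by (simp add: set_lebesgue_integral_def)
      qed
      also have "\<dots> = (nrm v \<bullet> (w - v)) * (LINT x:F|surface_measure. fw w x)"
        unfolding F_def fw_def by (rule simplex_edge_divergence[OF d v _ _ polys_mult[OF s_pol uT]]) (use w in auto)
      also have "nrm v \<bullet> (w - v) = 1 / norm (g v)" using nrm_edge[OF v, of w] w by simp
      finally have "norm (g v) * (LINT x:T|lebesgue. grad (fw w) x \<bullet> (w - v)) = (LINT x:F|surface_measure. fw w x)"
        using gpos by simp
      moreover have "fw w x = uT x * al w x" for x by (simp add: fw_def al_def)
      ultimately show "(LINT x:T|lebesgue. norm (g v) * (grad (fw w) x \<bullet> (w - v))) = (LINT x:F|surface_measure. uT x * al w x)"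
        by simp
    qed
    also have "\<dots> = (LINT x:F|surface_measure. \<Sum>w\<in>?W. uT x * al w x)"
    proof -
      have "set_integrable surface_measure F (\<lambda>x. uT x * al w x)" for w
        unfolding F_def by (rule facet_integrable[OF v]) (intro continuous_intros cuT cal)
      then show ?thesis unfolding set_lebesgue_integral_def set_integrable_def scaleR_sum_right
        by (intro Bochner_Integration.integral_sum[symmetric])
    qed
    also have "\<dots> = (LINT x:F|surface_measure. uT x * \<mu> x)"
      unfolding set_lebesgue_integral_def
      by (rule Bochner_Integration.integral_cong) (auto simp: indicator_def al_sum simp flip: sum_distrib_left)
    finally show ?thesis .
  qed
  define N where "N = L2_norm lebesgue T (\<lambda>x. (1 / \<epsilon>) *\<^sub>R qT x + grad uT x)"
  have N0: "N \<ge> 0" by (simp add: N_def L2_norm_nonneg)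
  have "Y = (LINT x:T|lebesgue. ((1 / \<epsilon>) *\<^sub>R qT x + grad uT x) \<bullet> \<rho> x)"
  proof -
    have i1: "set_integrable lebesgue T (\<lambda>x. (1 / \<epsilon>) *\<^sub>R qT x \<bullet> \<rho> x)"
      by (rule set_integrable_lebesgue[OF _ bT T_borel]) (intro continuous_intros cqT crho)
    have i2: "set_integrable lebesgue T (\<lambda>x. grad uT x \<bullet> \<rho> x)"
      by (rule set_integrable_lebesgue[OF _ bT T_borel]) (intro continuous_intros cuT crho)
    have i3: "set_integrable lebesgue T (\<lambda>x. uT x * divg \<rho> x)"
      by (rule set_integrable_lebesgue[OF _ bT T_borel]) (intro continuous_intros cuT cdiv)
    have f1: "set_integrable surface_measure F (\<lambda>x. uT x * \<mu> x)" "set_integrable surface_measure F (\<lambda>x. uhat F x * \<mu> x)"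
      unfolding F_def by (rule facet_integrable[OF v]; intro continuous_intros cuT cmu cuh[unfolded F_def])+
    have "Y = (LINT x:F|surface_measure. uT x * \<mu> x - uhat F x * \<mu> x)"
      unfolding Ym by (simp add: \<mu>_def power2_eq_square algebra_simps)
    also have "\<dots> = (LINT x:F|surface_measure. uT x * \<mu> x) - (LINT x:F|surface_measure. uhat F x * \<mu> x)"
      by (rule set_integral_diff(2)[OF f1])
    also have "\<dots> = (LINT x:T|lebesgue. uT x * divg \<rho> x) + (LINT x:T|lebesgue. grad uT x \<bullet> \<rho> x)
        + ((LINT x:T|lebesgue. (1 / \<epsilon>) *\<^sub>R qT x \<bullet> \<rho> x) - (LINT x:T|lebesgue. uT x * divg \<rho> x))"
      using parts eq[OF rho_pol] unfolding bterms set_integral_add(2)[OF i3 i2] by linarith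
    also have "\<dots> = (LINT x:T|lebesgue. (1 / \<epsilon>) *\<^sub>R qT x \<bullet> \<rho> x) + (LINT x:T|lebesgue. grad uT x \<bullet> \<rho> x)" by simp
    also have "\<dots> = (LINT x:T|lebesgue. ((1 / \<epsilon>) *\<^sub>R qT x + grad uT x) \<bullet> \<rho> x)"
      unfolding inner_add_left by (rule set_integral_add(2)[OF i1 i2, symmetric])
    finally show ?thesis .
  qed
  also have "\<dots> \<le> N * L2_norm lebesgue T \<rho>"
  proof -
    have "L2 lebesgue T (\<lambda>x. (1 / \<epsilon>) *\<^sub>R qT x + grad uT x)"
      by (rule L2_continuous[OF _ bT T_borel]) (intro continuous_intros cqT cuT)
    from L2_Cauchy_Schwarz[OF this Lrho] show ?thesis unfolding N_def by linarith
  qed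
  finally have Y1: "Y \<le> N * L2_norm lebesgue T \<rho>" .
  define k where "k = S\<^sup>2 * \<omega> * 2 ^ CARD('n)"
  have k0: "k \<ge> 0" using w0 by (simp add: k_def)
  have Y0: "Y \<ge> 0" by (simp add: Y_def)
  have "Y\<^sup>2 \<le> N\<^sup>2 * (k * (r * Y))"
  proof -
    have "Y\<^sup>2 \<le> (N * L2_norm lebesgue T \<rho>)\<^sup>2" using Y1 Y0 by (intro power_mono)
    also have "\<dots> = N\<^sup>2 * (L2_norm lebesgue T \<rho>)\<^sup>2" by (simp add: power_mult_distrib)
    also have "\<dots> \<le> N\<^sup>2 * (k * (r * Y))" using rho_norm by (intro mult_left_mono) (auto simp: k_def)
    finally show ?thesis .
  qed
  then have "Y * Y \<le> Y * (k * r * N\<^sup>2)" by (simp add: power2_eq_square mult_ac)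
  then have "Y \<le> k * r * N\<^sup>2"
    using Y0 k0 r by (cases "Y = 0") auto
  then show ?thesis unfolding Y_def k_def S_def b_def \<omega>_def N_def \<mu>_def F_def .
qed

end

section \<open>Geometry of the mesh\<close>

lemma mesh_element:
  fixes T :: "(real^'n) set"
  assumes "mesh \<Omega> \<T>" "T \<in> \<T>"
  obtains V c g where "bary_simplex V c g T"
  using assms bary_simplex_exists[of T] unfolding mesh_def by blast

text \<open>
  Some ball has at least half of the supremal diameter; the maximum with 1 spares a case distinction on the
  sign of \<open>\<sigma>\<close>.
\<close>

lemma inscribed_ball:
  fixes T :: "(real^'n) set"
  assumes reg: "diameter T \<le> \<sigma> * inball_diameter T" and pos: "0 < diameter T" and T: "compact T"
  obtains x \<rho> where "0 < \<rho>" "cball x \<rho> \<subseteq> T" "diameter T \<le> 4 * max 1 \<sigma> * \<rho>"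
proof -
  define A where "A = {2 * r | r. 0 \<le> r \<and> (\<exists>x. cball x r \<subseteq> T)}"
  have prod: "0 < \<sigma> * Sup A" using reg pos by (simp add: inball_diameter_def A_def)
  obtain B where B: "\<forall>x\<in>T. norm x \<le> B" using compact_imp_bounded[OF T] by (auto simp: bounded_iff)
  have "A \<noteq> {}"
  proof -
    have "T \<noteq> {}" using pos by auto
    then obtain x where "x \<in> T" by blast
    then have "2 * 0 \<in> A" unfolding A_def by (intro CollectI exI[of _ 0] conjI exI[of _ x]) auto
    then show ?thesis by blast
  qed
  have ub: "y \<le> 4 * \<bar>B\<bar>" if "y \<in> A" for y
  proof -
    obtain r x where r: "y = 2 * r" "0 \<le> r" "cball x r \<subseteq> T" using \<open>y \<in> A\<close> unfolding A_def by blast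
    obtain e :: "real^'n" where e: "norm e = 1" by (metis norm_axis_1)
    have "x + r *\<^sub>R e \<in> cball x r" "x \<in> cball x r" using r e by (auto simp: dist_norm)
    then have "norm (x + r *\<^sub>R e) \<le> B" "norm x \<le> B" using r(3) B by blast+
    moreover have "norm (r *\<^sub>R e) \<le> norm (x + r *\<^sub>R e) + norm x" using norm_triangle_ineq4[of "x + r *\<^sub>R e" x] by simp
    ultimately show ?thesis using r e by simp
  qed
  have bdd: "bdd_above A" using ub by (auto simp: bdd_above_def)
  have S0: "0 < Sup A"
  proof (rule ccontr)
    assume "\<not> 0 < Sup A"
    moreover have "0 \<le> Sup A"
    proof -
      obtain y where "y \<in> A" using \<open>A \<noteq> {}\<close> by blast
      moreover have "0 \<le> y" using \<open>y \<in> A\<close> by (auto simp: A_def)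
      ultimately show ?thesis using cSup_upper[OF _ bdd] by fastforce
    qed
    ultimately have "Sup A = 0" by simp
    then show False using prod by simp
  qed
  then have "Sup A / 2 < Sup A" by simp
  then obtain y where y: "y \<in> A" "Sup A / 2 < y" using less_cSup_iff[OF \<open>A \<noteq> {}\<close> bdd] by blast
  then obtain r x where r: "y = 2 * r" "0 \<le> r" "cball x r \<subseteq> T" unfolding A_def by blast
  have "0 < r" using y S0 r by simp
  moreover have "diameter T \<le> 4 * max 1 \<sigma> * r"
  proof -
    have "diameter T \<le> max 1 \<sigma> * Sup A"
      using reg S0 by (auto simp: inball_diameter_def A_def[symmetric] intro: order_trans[OF _ mult_right_mono])
    also have "\<dots> \<le> max 1 \<sigma> * (4 * r)" using y r by (intro mult_left_mono) auto
    finally show ?thesis by simp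
  qed
  ultimately show thesis using that r(3) by blast
qed

lemma sub_cball_diameter:
  fixes T :: "(real^'n) set"
  assumes "bounded T" "x \<in> T" "diameter T \<le> R" shows "T \<subseteq> cball x R"
  using diameter_bounded_bound[OF assms(1,2)] assms(3) by fastforce

context bary_simplex
begin

lemma diameter_pos: "0 < diameter T"
proof -
  have "V \<noteq> {}" using card_V by auto
  then obtain v where v: "v \<in> V" by blast
  obtain w where w: "w \<in> V" "w \<noteq> v" using other_vertex[OF v] .
  have "dist v w \<le> diameter T"
    using v w V_sub_T by (intro diameter_bounded_bound compact_imp_bounded[OF compact_T]) auto
  moreover have "0 < dist v w" using w by simp
  ultimately show ?thesis by linarith
qed

lemma vertices_of_facet: assumes "v \<in> V" shows "V - {v} = {x. x extreme_point_of facet v}"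
proof -
  have "\<not> affine_dependent (V - {v})" using indep affine_dependent_subset by blast
  then show ?thesis unfolding facet_eq_hull[OF assms] using extreme_point_of_convex_hull_affine_independent by blast
qed

text \<open>
  Expresses the centre by the facet alone, so that two elements with a common facet have the same centre.
\<close>

lemma centre_eq: assumes "v \<in> V" shows "centre v = (1 / real CARD('n)) *\<^sub>R \<Sum>{x. x extreme_point_of facet v}"
  unfolding centre_def vertices_of_facet[OF assms] ..

text \<open>
  An affine function that is constant on the facet is that constant plus a multiple of the coordinate of \<open>v\<close>.
\<close>

lemma normal_unique:
  assumes v: "v \<in> V" and n: "norm n = 1" and plane: "\<And>x. x \<in> facet v \<Longrightarrow> n \<bullet> x = a"
  shows "n = nrm v \<or> n = - nrm v"
proof -
  define t where "t = n \<bullet> v - a"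
  have "n \<bullet> x = a + t * lam v x" for x
  proof -
    have "n \<bullet> x = (\<Sum>w\<in>V. lam w x * (n \<bullet> w))"
      using repr'[of x] by (metis (no_types, lifting) inner_scaleR_right inner_sum_right sum.cong)
    also have "\<dots> = (\<Sum>w\<in>V. lam w x * a + (if w = v then lam w x * t else 0))"
      by (rule sum.cong) (use plane vertex_in_facet[OF v] in \<open>auto simp: t_def algebra_simps\<close>)
    also have "\<dots> = (\<Sum>w\<in>V. lam w x) * a + lam v x * t"
      unfolding sum.distrib sum_distrib_right[symmetric] using v fin_V by simp
    finally show ?thesis by (simp add: sum_lam' mult.commute)
  qed
  then have "n \<bullet> x = a + t * c v + (t *\<^sub>R g v) \<bullet> x" for x by (simp add: lam_def algebra_simps)
  from this[of 0] this have "n \<bullet> x = (t *\<^sub>R g v) \<bullet> x" for x by simp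
  then have ng: "n = t *\<^sub>R g v" by (metis vector_eq_rdot)
  then have tg: "\<bar>t\<bar> * norm (g v) = 1" using n by simp
  have g0: "norm (g v) > 0" using g_nonzero[OF v] by simp
  have "\<bar>t\<bar> = 1 / norm (g v)" using tg g0 by (simp add: field_simps)
  then have "t = 1 / norm (g v) \<or> t = - (1 / norm (g v))" by (auto simp: abs_if split: if_splits)
  then show ?thesis unfolding ng nrm_def by auto
qed

end

text \<open>
  Two elements of a conforming mesh that share a facet lie on different sides of it: on the same side their
  intersection would have interior points and could not be a proper face.
\<close>

lemma opposite_sides:
  fixes T1 T2 :: "(real^'n) set"
  assumes b1: "bary_simplex V1 c1 g1 T1" and b2: "bary_simplex V2 c2 g2 T2"
    and face: "T1 \<inter> T2 face_of T1" "T2 \<inter> T1 face_of T2" and ne: "T1 \<noteq> T2"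
    and v: "v1 \<in> V1" "v2 \<in> V2" and F: "bary_simplex.facet c1 g1 T1 v1 = bary_simplex.facet c2 g2 T2 v2"
    and r: "r > 0"
    and ball1: "\<And>y. dist m y \<le> r \<Longrightarrow> 0 \<le> bary_simplex.lam c1 g1 v1 y \<Longrightarrow> y \<in> T1"
    and ball2: "\<And>y. dist m y \<le> r \<Longrightarrow> 0 \<le> bary_simplex.lam c2 g2 v2 y \<Longrightarrow> y \<in> T2"
    and m: "m \<in> bary_simplex.facet c1 g1 T1 v1"
  shows "bary_simplex.nrm g2 v2 = - bary_simplex.nrm g1 v1" "bary_simplex.off c2 g2 v2 = - bary_simplex.off c1 g1 v1"
proof -
  interpret S1: bary_simplex V1 c1 g1 T1 by (rule b1)
  interpret S2: bary_simplex V2 c2 g2 T2 by (rule b2)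
  let ?n = "S1.nrm v1" and ?a = "S1.off v1"
  have m1: "?n \<bullet> m = ?a" using m S1.facet_plane[OF v(1)] by auto
  have m2: "S2.nrm v2 \<bullet> m = S2.off v2" using m F S2.facet_plane[OF v(2)] by auto
  have "S2.nrm v2 = ?n \<or> S2.nrm v2 = - ?n"
  proof (rule S1.normal_unique[OF v(1) S2.norm_nrm[OF v(2)]])
    show "S2.nrm v2 \<bullet> x = S2.off v2" if "x \<in> S1.facet v1" for x
      using that F S2.facet_plane[OF v(2)] by auto
  qed
  moreover have "S2.nrm v2 \<noteq> ?n"
  proof
    assume eq: "S2.nrm v2 = ?n"
    define z where "z = m - (r / 2) *\<^sub>R ?n"
    have nn: "?n \<bullet> ?n = 1" using S1.norm_nrm[OF v(1)] by (simp add: dot_square_norm)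
    have sub: "ball z (r / 2) \<subseteq> T1 \<inter> T2"
    proof
      fix y assume y: "y \<in> ball z (r / 2)"
      have "dist m y \<le> dist m z + dist z y" by (rule dist_triangle)
      moreover have "dist m z = r / 2" using r S1.norm_nrm[OF v(1)] by (simp add: z_def dist_norm)
      ultimately have my: "dist m y \<le> r" using y by simp
      have "\<bar>?n \<bullet> (y - z)\<bar> \<le> norm ?n * norm (y - z)" by (rule Cauchy_Schwarz_ineq2)
      then have "\<bar>?n \<bullet> (y - z)\<bar> < r / 2" using y S1.norm_nrm[OF v(1)] by (simp add: dist_norm norm_minus_commute)
      moreover have "?n \<bullet> z = ?a - r / 2" using m1 nn by (simp add: z_def inner_diff_right)
      ultimately have "?n \<bullet> y \<le> ?a" unfolding inner_diff_right abs_less_iff by linarith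
      then have "0 \<le> S1.lam v1 y" "0 \<le> S2.lam v2 y"
        using S1.half_space_iff[OF v(1), of y] S2.half_space_iff[OF v(2), of y] m1 m2 unfolding eq by auto
      then show "y \<in> T1 \<inter> T2" using ball1[OF my] ball2[OF my] by blast
    qed
    then have zint: "z \<in> interior T1" "z \<in> interior T2"
      using r interior_maximal[of "ball z (r / 2)" T1] interior_maximal[of "ball z (r / 2)" T2] by auto
    have zin: "z \<in> T1 \<inter> T2" using sub r by auto
    have "T1 \<inter> T2 = T1"
    proof (rule ccontr)
      assume "T1 \<inter> T2 \<noteq> T1"
      from face_of_disjoint_interior[OF face(1) this] show False using zint zin by blast
    qed
    moreover have "T2 \<inter> T1 = T2"
    proof (rule ccontr)
      assume "T2 \<inter> T1 \<noteq> T2"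
      from face_of_disjoint_interior[OF face(2) this] show False using zint zin by blast
    qed
    ultimately show False using ne by blast
  qed
  ultimately show n: "S2.nrm v2 = - ?n" by blast
  show "S2.off v2 = - S1.off v1" using m1 m2 n by simp
qed


section \<open>The projection and the norms on faces\<close>

text \<open>
  The choice in the definition of the projection has a witness: on each element solve for the polynomial whose
  difference to \<open>R\<close> is orthogonal to the monomials.
\<close>

lemma P_W_polys:
  fixes \<T> :: "(real^'n) set set"
  assumes fin: "finite \<T>" and cpt: "\<And>T. T \<in> \<T> \<Longrightarrow> compact T" and R: "\<And>T. T \<in> \<T> \<Longrightarrow> L2 lebesgue T (R T)" and T: "T \<in> \<T>"
  shows "P_W p \<T> R T \<in> polys p"
proof -
  let ?I = "midx p :: ('n \<Rightarrow> nat) set"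
  have cm: "continuous_on UNIV (monom_fun \<alpha> :: real^'n \<Rightarrow> real)" for \<alpha>
    unfolding monom_fun_def by (intro continuous_intros)
  have L2m: "L2 lebesgue T (monom_fun \<alpha> :: real^'n \<Rightarrow> real)" if "T \<in> \<T>" for T \<alpha>
    by (rule L2_continuous[OF cm compact_imp_bounded[OF cpt[OF that]] borel_closed[OF compact_imp_closed[OF cpt[OF that]]]])
  have "\<exists>a. \<forall>\<alpha>\<in>?I. (LINT x:T|lebesgue. (R T x - (\<Sum>\<beta>\<in>?I. a \<beta> * monom_fun \<beta> x)) * monom_fun \<alpha> x) = 0" if "T \<in> \<T>" for T
    by (rule L2_projection_exists[OF finite_multi_indices L2m[OF that] R[OF that]])
  then have "\<forall>T\<in>\<T>. \<exists>a. \<forall>\<alpha>\<in>?I. (LINT x:T|lebesgue. (R T x - (\<Sum>\<beta>\<in>?I. a \<beta> * monom_fun \<beta> x)) * monom_fun \<alpha> x) = 0" by blast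
  then obtain a where a: "\<forall>T\<in>\<T>. \<forall>\<alpha>\<in>?I. (LINT x:T|lebesgue. (R T x - (\<Sum>\<beta>\<in>?I. a T \<beta> * monom_fun \<beta> x)) * monom_fun \<alpha> x) = 0"
    by (rule bchoice[THEN exE])
  define P where "P T = poly_of p (a T)" for T
  have orth: "(LINT x:T|lebesgue. (R T x - P T x) * monom_fun \<alpha> x) = 0" if "T \<in> \<T>" "\<alpha> \<in> ?I" for T \<alpha>
    using bspec[OF bspec[OF a that(1)] that(2)] by (simp add: P_def poly_of_def)
  have "(LINT x:T|lebesgue. P T x * w T x) = (LINT x:T|lebesgue. R T x * w T x)" if T: "T \<in> \<T>" and w: "w \<in> W_h p \<T>" for T w
  proof -
    have LP: "L2 lebesgue T (h :: real^'n \<Rightarrow> real)" if "h \<in> polys p" for h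
      by (rule L2_continuous[OF polys_continuous[OF that] compact_imp_bounded[OF cpt[OF T]] borel_closed[OF compact_imp_closed[OF cpt[OF T]]]])
    have wT: "w T \<in> polys p" using w T by (simp add: W_h_def)
    then obtain \<beta> where \<beta>: "w T = poly_of p \<beta>" by (rule polysE)
    have LRP: "L2 lebesgue T (\<lambda>x. R T x - P T x)" by (rule L2_diff[OF R[OF T] LP]) (simp add: P_def)
    have int: "integrable lebesgue (\<lambda>x. indicator T x *\<^sub>R ((R T x - P T x) * monom_fun \<alpha> x))" for \<alpha>
      using L2_inner_integrable[OF LRP L2m[OF T, of \<alpha>]] by (simp add: set_integrable_def)
    have "(LINT x:T|lebesgue. (R T x - P T x) * w T x)
       = (\<integral>x. (\<Sum>\<alpha>\<in>?I. \<beta> \<alpha> * (indicator T x *\<^sub>R ((R T x - P T x) * monom_fun \<alpha> x))) \<partial>lebesgue)"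
      unfolding set_lebesgue_integral_def \<beta> poly_of_def by (simp add: sum_distrib_left mult_ac)
    also have "\<dots> = (\<Sum>\<alpha>\<in>?I. \<integral>x. \<beta> \<alpha> * (indicator T x *\<^sub>R ((R T x - P T x) * monom_fun \<alpha> x)) \<partial>lebesgue)"
      by (rule Bochner_Integration.integral_sum) (rule integrable_mult_right[OF int])
    also have "\<dots> = 0"
      using orth[OF T] by (intro sum.neutral ballI) (simp add: set_lebesgue_integral_def)
    finally have z: "(LINT x:T|lebesgue. (R T x - P T x) * w T x) = 0" .
    have i: "set_integrable lebesgue T (\<lambda>x. R T x * w T x)" "set_integrable lebesgue T (\<lambda>x. P T x * w T x)"
      using L2_inner_integrable[OF R[OF T] LP[OF wT]] L2_inner_integrable[OF LP LP[OF wT], of "P T"] by (simp_all add: P_def)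
    show ?thesis using z unfolding left_diff_distrib set_integral_diff(2)[OF i] by simp
  qed
  then have "P \<in> W_h p \<T> \<and> (\<forall>w\<in>W_h p \<T>. vol_ip \<T> P w = vol_ip \<T> R w)"
    by (auto simp: W_h_def P_def vol_ip_def intro!: sum.cong)
  from someI[where P = "\<lambda>P. P \<in> W_h p \<T> \<and> (\<forall>w\<in>W_h p \<T>. vol_ip \<T> P w = vol_ip \<T> R w)", OF this]
  have "P_W p \<T> R \<in> W_h p \<T>" unfolding P_W_def by (rule conjunct1)
  then show ?thesis using T by (simp add: W_h_def)
qed

lemma (in bary_simplex) facet_L2:
  assumes v: "v \<in> V" and f: "continuous_on UNIV f"
  shows "L2 surface_measure (facet v) (f :: real^'n \<Rightarrow> real)"
  unfolding L2_def
proof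
  show "set_borel_measurable surface_measure (facet v) f"
    using facet_integrable[OF v f] by (auto simp: set_integrable_def set_borel_measurable_def)
  show "set_integrable surface_measure (facet v) (\<lambda>x. (norm (f x))\<^sup>2)"
    by (rule facet_integrable[OF v]) (intro continuous_intros f)
qed

lemma Linf_norm_le:
  assumes "\<And>x. x \<in> D \<Longrightarrow> norm (f x) \<le> B" "0 \<le> B" shows "Linf_norm M D f \<le> B"
  unfolding Linf_norm_def by (rule cInf_lower) (use assms in \<open>auto intro!: bdd_belowI[of _ 0]\<close>)

text \<open>The discrete spaces do not couple the elements, so the test field may be extended by zero.\<close>

lemma HDG_local_equation:
  fixes \<T> :: "(real^'n) set set"
  assumes sol: "HDG_solution p \<rho>0 \<T> \<epsilon> b Db c f g qh uh uhat" and fin: "finite \<T>" and T: "T \<in> \<T>"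
    and \<rho>: "\<And>i. (\<lambda>x. \<rho> x $ i) \<in> polys p"
  shows "(LINT x:T|lebesgue. (1 / \<epsilon>) *\<^sub>R qh T x \<bullet> \<rho> x) - (LINT x:T|lebesgue. uh T x * divg \<rho> x)
       + (\<Sum>F | F facet_of T. LINT x:F|surface_measure. uhat F x * (\<rho> x \<bullet> outer_normal T F)) = 0"
proof -
  define R where "R T' = (if T' = T then \<rho> else (\<lambda>_. 0))" for T'
  have z: "divg (\<lambda>_. 0 :: real^'n) x = 0" for x by (simp add: divg_def)
  have "R \<in> V_h p \<T>" using \<rho> by (simp add: V_h_def R_def)
  then have eq: "vol_ip \<T> (\<lambda>T x. (1 / \<epsilon>) *\<^sub>R qh T x) R - vol_ip \<T> uh (\<lambda>T. divg (R T))
        + bdry_ip \<T> (\<lambda>T F. uhat F) (\<lambda>T F x. R T x \<bullet> outer_normal T F) = 0"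
    using sol unfolding HDG_solution_def by blast
  have 1: "vol_ip \<T> (\<lambda>T x. (1 / \<epsilon>) *\<^sub>R qh T x) R = (\<Sum>T'\<in>\<T>. if T' = T then LINT x:T|lebesgue. (1 / \<epsilon>) *\<^sub>R qh T x \<bullet> \<rho> x else 0)"
    unfolding vol_ip_def by (rule sum.cong) (auto simp: R_def)
  have 2: "vol_ip \<T> uh (\<lambda>T. divg (R T)) = (\<Sum>T'\<in>\<T>. if T' = T then LINT x:T|lebesgue. uh T x * divg \<rho> x else 0)"
    unfolding vol_ip_def by (rule sum.cong) (auto simp: R_def z)
  have 3: "bdry_ip \<T> (\<lambda>T F. uhat F) (\<lambda>T F x. R T x \<bullet> outer_normal T F)
     = (\<Sum>T'\<in>\<T>. if T' = T then \<Sum>F | F facet_of T. LINT x:F|surface_measure. uhat F x * (\<rho> x \<bullet> outer_normal T F) else 0)"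
    unfolding bdry_ip_def by (rule sum.cong) (auto simp: R_def)
  show ?thesis using eq fin T unfolding 1 2 3 by simp
qed

section \<open>Local efficiency\<close>

lemma sum_sq2: "(x + y)\<^sup>2 \<le> 2 * (x\<^sup>2 + (y::real)\<^sup>2)"
  using zero_le_power2[of "x - y"] by (simp add: power2_eq_square algebra_simps)

lemma sum_sq4: "(x + y + z + w)\<^sup>2 \<le> 4 * (x\<^sup>2 + y\<^sup>2 + z\<^sup>2 + (w::real)\<^sup>2)"
  using sum_sq2[of "x + y" "z + w"] sum_sq2[of x y] sum_sq2[of z w] by (simp add: add.assoc)

text \<open>
  The weights: \<open>a / r \<le> K / sqrt \<epsilon>\<close> for the flux error, \<open>a \<le> \<kappa> sqrt \<epsilon>\<close> for the convection term, and \<open>a \<le> 1\<close> for the reaction term.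
\<close>

lemma residual_scaling:
  fixes \<epsilon> h r :: real
  assumes \<epsilon>: "0 < \<epsilon>" and r: "0 < r" and h: "0 \<le> h" "h \<le> K * r" "h \<le> \<kappa> * \<epsilon>"
    and nn: "0 \<le> \<kappa>" "0 \<le> B" "0 \<le> Kc" "0 \<le> k" "0 \<le> K" "0 \<le> N" "0 \<le> e1" "0 \<le> e2" "0 \<le> e3" "0 \<le> e4"
    and N: "N \<le> k * (e1 / r + (B * e2 + Kc * e3) + e4)"
    and a: "a = min (h / sqrt \<epsilon>) 1"
  shows "a\<^sup>2 * N\<^sup>2 \<le> 4 * k\<^sup>2 * (K\<^sup>2 + \<kappa>\<^sup>2 * B\<^sup>2 + Kc\<^sup>2 + 1) * (1 / \<epsilon> * e1\<^sup>2 + \<epsilon> * e2\<^sup>2 + e3\<^sup>2 + a\<^sup>2 * e4\<^sup>2)"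
proof -
  define s where "s = sqrt \<epsilon>"
  have s: "0 < s" "s\<^sup>2 = \<epsilon>" using \<epsilon> by (auto simp: s_def)
  have a0: "0 \<le> a" "a \<le> 1" "a \<le> h / s" using h s by (auto simp: a s_def)
  have ar: "a / r \<le> K / s"
  proof -
    have "a / r \<le> (h / s) / r" using a0 r by (intro divide_right_mono) auto
    also have "\<dots> \<le> ((K * r) / s) / r" using h r s by (intro divide_right_mono) auto
    finally show ?thesis using r by simp
  qed
  have as: "a \<le> \<kappa> * s"
  proof -
    have "h / s \<le> (\<kappa> * \<epsilon>) / s" using h s by (intro divide_right_mono) auto
    also have "\<dots> = \<kappa> * s" using s by (simp add: s(2)[symmetric] power2_eq_square)
    finally show ?thesis using a0 by simp
  qed
  have "a * N \<le> a * (k * (e1 / r + (B * e2 + Kc * e3) + e4))" using N a0 by (intro mult_left_mono)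
  also have "\<dots> = k * ((a / r) * e1 + a * (B * e2) + a * (Kc * e3) + a * e4)" by (simp add: algebra_simps)
  also have "\<dots> \<le> k * ((K / s) * e1 + (\<kappa> * s) * (B * e2) + 1 * (Kc * e3) + a * e4)"
    using nn a0 by (intro mult_left_mono add_mono mult_right_mono ar as) auto
  finally have "(a * N)\<^sup>2 \<le> (k * ((K / s) * e1 + (\<kappa> * s) * (B * e2) + 1 * (Kc * e3) + a * e4))\<^sup>2"
    using nn a0 by (intro power_mono) auto
  also have "\<dots> \<le> k\<^sup>2 * (4 * (((K / s) * e1)\<^sup>2 + ((\<kappa> * s) * (B * e2))\<^sup>2 + (1 * (Kc * e3))\<^sup>2 + (a * e4)\<^sup>2))"
    unfolding power_mult_distrib[of k] by (intro mult_left_mono sum_sq4) simp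
  also have "\<dots> = k\<^sup>2 * (4 * (K\<^sup>2 * (1 / \<epsilon> * e1\<^sup>2) + (\<kappa>\<^sup>2 * B\<^sup>2) * (\<epsilon> * e2\<^sup>2) + Kc\<^sup>2 * e3\<^sup>2 + 1 * (a\<^sup>2 * e4\<^sup>2)))"
    by (simp add: power_mult_distrib power_divide s(2))
  also have "\<dots> \<le> k\<^sup>2 * (4 * ((K\<^sup>2 + \<kappa>\<^sup>2 * B\<^sup>2 + Kc\<^sup>2 + 1) * (1 / \<epsilon> * e1\<^sup>2) + (K\<^sup>2 + \<kappa>\<^sup>2 * B\<^sup>2 + Kc\<^sup>2 + 1) * (\<epsilon> * e2\<^sup>2)
      + (K\<^sup>2 + \<kappa>\<^sup>2 * B\<^sup>2 + Kc\<^sup>2 + 1) * e3\<^sup>2 + (K\<^sup>2 + \<kappa>\<^sup>2 * B\<^sup>2 + Kc\<^sup>2 + 1) * (a\<^sup>2 * e4\<^sup>2)))"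
    using \<epsilon> by (intro mult_left_mono add_mono mult_right_mono) auto
  also have "\<dots> = 4 * k\<^sup>2 * (K\<^sup>2 + \<kappa>\<^sup>2 * B\<^sup>2 + Kc\<^sup>2 + 1) * (1 / \<epsilon> * e1\<^sup>2 + \<epsilon> * e2\<^sup>2 + e3\<^sup>2 + a\<^sup>2 * e4\<^sup>2)"
    by (simp only: distrib_left mult_ac)
  finally show ?thesis by (simp add: power_mult_distrib)
qed

text \<open>
  The factor \<open>h / \<epsilon>\<close> dominates the weight of the flux jump.  Since \<open>h r / \<epsilon> \<le> h\<^sup>2 / \<epsilon>\<close>, it is at most \<open>\<kappa>\<^sup>2 \<epsilon>\<close>, which serves for the lower order
  terms, and at most \<open>(1 + \<kappa>\<^sup>2) a\<^sup>2\<close>, which serves for the residual.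
\<close>

lemma face_scaling:
  fixes \<epsilon> h r :: real
  assumes \<epsilon>: "0 < \<epsilon>" "\<epsilon> \<le> 1" and r: "0 < r" and h: "h = L * r" "1 \<le> L" "h \<le> \<kappa> * \<epsilon>" "h \<le> hT"
    and nn: "0 \<le> \<kappa>" "0 \<le> e1" "0 \<le> e2" "0 \<le> e3" "0 \<le> N"
    and a: "a = min (hT / sqrt \<epsilon>) 1" and N: "a\<^sup>2 * N\<^sup>2 \<le> M * \<Lambda>"
    and \<Lambda>: "1 / \<epsilon> * e1\<^sup>2 + \<epsilon> * e2\<^sup>2 + e3\<^sup>2 \<le> \<Lambda>"
  shows "h / \<epsilon> * (r * (e1 / r + (B * e2 + Kc * e3) + N)\<^sup>2) \<le> 4 * (L + \<kappa>\<^sup>2 * B\<^sup>2 + \<kappa>\<^sup>2 * Kc\<^sup>2 + (1 + \<kappa>\<^sup>2) * M) * \<Lambda>"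
proof -
  have h0: "0 < h" using h r by simp
  have rh: "r \<le> h" using h r by simp
  have hh: "h\<^sup>2 \<le> \<kappa>\<^sup>2 * \<epsilon>\<^sup>2" using power_mono[OF h(3), of 2] h0 by (simp add: power_mult_distrib)
  have h2: "h\<^sup>2 / \<epsilon> \<le> \<kappa>\<^sup>2 * \<epsilon>"
    using divide_right_mono[OF hh, of \<epsilon>] \<epsilon> by (simp add: power2_eq_square)
  have hr2: "h * r / \<epsilon> \<le> h\<^sup>2 / \<epsilon>" using rh h0 \<epsilon> by (intro divide_right_mono) (auto simp: power2_eq_square)
  have ha: "h\<^sup>2 / \<epsilon> \<le> (1 + \<kappa>\<^sup>2) * a\<^sup>2"
  proof (cases "hT / sqrt \<epsilon> \<le> 1")
    case True
    then have "a = hT / sqrt \<epsilon>" by (simp add: a)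
    then have "a\<^sup>2 = hT\<^sup>2 / \<epsilon>" using \<epsilon> by (simp add: power_divide)
    moreover have "h\<^sup>2 / \<epsilon> \<le> hT\<^sup>2 / \<epsilon>" using h h0 \<epsilon> by (intro divide_right_mono power_mono) auto
    moreover have "0 \<le> \<kappa>\<^sup>2 * a\<^sup>2" by simp
    ultimately show ?thesis unfolding distrib_right by linarith
  next
    case False
    then have "a = 1" by (simp add: a)
    moreover have "\<kappa>\<^sup>2 * \<epsilon> \<le> \<kappa>\<^sup>2 * 1" using \<epsilon> by (intro mult_left_mono) auto
    ultimately show ?thesis using h2 by simp
  qed
  have L0: "0 \<le> \<Lambda>" using \<Lambda> \<epsilon> by (smt (verit) zero_le_power2 mult_nonneg_nonneg divide_nonneg_nonneg)
  have t: "1 / \<epsilon> * e1\<^sup>2 \<le> \<Lambda>" "\<epsilon> * e2\<^sup>2 \<le> \<Lambda>" "e3\<^sup>2 \<le> \<Lambda>"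
  proof -
    have "0 \<le> 1 / \<epsilon> * e1\<^sup>2" "0 \<le> \<epsilon> * e2\<^sup>2" "0 \<le> e3\<^sup>2" using \<epsilon> by simp_all
    then show "1 / \<epsilon> * e1\<^sup>2 \<le> \<Lambda>" "\<epsilon> * e2\<^sup>2 \<le> \<Lambda>" "e3\<^sup>2 \<le> \<Lambda>" using \<Lambda> by linarith+
  qed
  have c: "0 \<le> h * r / \<epsilon>" using h0 r \<epsilon> by simp
  have "h / \<epsilon> * (r * (e1 / r + (B * e2 + Kc * e3) + N)\<^sup>2) = (h * r / \<epsilon>) * (e1 / r + B * e2 + Kc * e3 + N)\<^sup>2"
    by (simp add: add.assoc)
  also have "\<dots> \<le> (h * r / \<epsilon>) * (4 * ((e1 / r)\<^sup>2 + (B * e2)\<^sup>2 + (Kc * e3)\<^sup>2 + N\<^sup>2))"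
    by (rule mult_left_mono[OF sum_sq4 c])
  also have "\<dots> = 4 * ((h * r / \<epsilon>) * (e1 / r)\<^sup>2 + (h * r / \<epsilon>) * (B * e2)\<^sup>2 + (h * r / \<epsilon>) * (Kc * e3)\<^sup>2 + (h * r / \<epsilon>) * N\<^sup>2)"
    by (simp only: distrib_left mult_ac)
  also have "\<dots> \<le> 4 * (L * \<Lambda> + (\<kappa>\<^sup>2 * B\<^sup>2) * \<Lambda> + (\<kappa>\<^sup>2 * Kc\<^sup>2) * \<Lambda> + (1 + \<kappa>\<^sup>2) * (M * \<Lambda>))"
  proof (intro mult_left_mono add_mono)
    have "(h * r / \<epsilon>) * (e1 / r)\<^sup>2 = L * (1 / \<epsilon> * e1\<^sup>2)" using r \<epsilon> by (simp add: h(1) power2_eq_square)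
    also have "\<dots> \<le> L * \<Lambda>" using h(2) by (intro mult_left_mono t) auto
    finally show "(h * r / \<epsilon>) * (e1 / r)\<^sup>2 \<le> L * \<Lambda>" .
    have "(h * r / \<epsilon>) * (B * e2)\<^sup>2 \<le> (\<kappa>\<^sup>2 * \<epsilon>) * (B * e2)\<^sup>2" using hr2 h2 by (intro mult_right_mono) auto
    also have "\<dots> = (\<kappa>\<^sup>2 * B\<^sup>2) * (\<epsilon> * e2\<^sup>2)" by (simp add: power_mult_distrib)
    also have "\<dots> \<le> (\<kappa>\<^sup>2 * B\<^sup>2) * \<Lambda>" by (intro mult_left_mono t) auto
    finally show "(h * r / \<epsilon>) * (B * e2)\<^sup>2 \<le> (\<kappa>\<^sup>2 * B\<^sup>2) * \<Lambda>" .
    have "\<kappa>\<^sup>2 * \<epsilon> \<le> \<kappa>\<^sup>2 * 1" using \<epsilon> by (intro mult_left_mono) auto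
    then have "(h * r / \<epsilon>) * (Kc * e3)\<^sup>2 \<le> \<kappa>\<^sup>2 * (Kc * e3)\<^sup>2" using hr2 h2 by (intro mult_right_mono) auto
    also have "\<dots> = (\<kappa>\<^sup>2 * Kc\<^sup>2) * e3\<^sup>2" by (simp add: power_mult_distrib)
    also have "\<dots> \<le> (\<kappa>\<^sup>2 * Kc\<^sup>2) * \<Lambda>" by (intro mult_left_mono t) auto
    finally show "(h * r / \<epsilon>) * (Kc * e3)\<^sup>2 \<le> (\<kappa>\<^sup>2 * Kc\<^sup>2) * \<Lambda>" .
    have "(h * r / \<epsilon>) * N\<^sup>2 \<le> ((1 + \<kappa>\<^sup>2) * a\<^sup>2) * N\<^sup>2" using hr2 ha by (intro mult_right_mono) auto
    also have "\<dots> = (1 + \<kappa>\<^sup>2) * (a\<^sup>2 * N\<^sup>2)" by simp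
    also have "\<dots> \<le> (1 + \<kappa>\<^sup>2) * (M * \<Lambda>)" by (intro mult_left_mono N) auto
    finally show "(h * r / \<epsilon>) * N\<^sup>2 \<le> (1 + \<kappa>\<^sup>2) * (M * \<Lambda>)" .
  qed simp
  also have "\<dots> = 4 * (L + \<kappa>\<^sup>2 * B\<^sup>2 + \<kappa>\<^sup>2 * Kc\<^sup>2 + (1 + \<kappa>\<^sup>2) * M) * \<Lambda>" by (simp add: algebra_simps)
  finally show ?thesis .
qed

lemma alpha_div_sqrt_le: assumes "0 < \<epsilon>" shows "alpha \<epsilon> F / sqrt \<epsilon> \<le> diameter F / \<epsilon>" "0 \<le> diameter F \<Longrightarrow> 0 \<le> alpha \<epsilon> F / sqrt \<epsilon>"
proof -
  have "alpha \<epsilon> F / sqrt \<epsilon> \<le> (diameter F / sqrt \<epsilon>) / sqrt \<epsilon>"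
    using assms by (intro divide_right_mono) (auto simp: alpha_def)
  also have "\<dots> = diameter F / \<epsilon>" using assms by simp
  finally show "alpha \<epsilon> F / sqrt \<epsilon> \<le> diameter F / \<epsilon>" .
  show "0 \<le> diameter F \<Longrightarrow> 0 \<le> alpha \<epsilon> F / sqrt \<epsilon>" using assms by (auto simp: alpha_def)
qed

text \<open>
  From \<open>h \<le> \<kappa> \<epsilon>\<close> and \<open>\<epsilon> \<le> 1\<close> both \<open>h / \<epsilon>\<close> and \<open>h\<close> are at most \<open>\<kappa>\<^sup>2 \<epsilon> / h\<close>, so the first term in the minimum suffices.
\<close>

lemma gamma_face_le:
  assumes \<epsilon>: "0 < \<epsilon>" "\<epsilon> \<le> 1" and h: "0 < diameter F" "diameter F \<le> \<kappa> * \<epsilon>"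
    and B: "0 \<le> B" "Linf_norm surface_measure F b \<le> B"
  shows "gamma_face \<epsilon> b F \<le> (1 + 2 * \<kappa>\<^sup>2 * B + \<kappa>\<^sup>2) * (\<epsilon> / diameter F)"
proof -
  define h where "h = diameter F"
  have h0: "0 < h" "h \<le> \<kappa> * \<epsilon>" using h by (auto simp: h_def)
  have hh: "h * h \<le> \<kappa>\<^sup>2 * \<epsilon>\<^sup>2" using power_mono[OF h0(2), of 2] h0(1) unfolding power_mult_distrib by (simp add: power2_eq_square[of h])
  have h1: "h \<le> \<kappa>\<^sup>2 * \<epsilon>\<^sup>2 / h" using hh h0(1) by (simp add: pos_le_divide_eq)
  have he: "h / \<epsilon> \<le> \<kappa>\<^sup>2 * (\<epsilon> / h)"
    using divide_right_mono[OF h1, of \<epsilon>] \<epsilon> by (simp add: power2_eq_square mult_ac)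
  have h2: "h \<le> \<kappa>\<^sup>2 * (\<epsilon> / h)"
  proof -
    have "h \<le> h / \<epsilon>" using \<epsilon> h0 by (simp add: pos_le_divide_eq)
    then show ?thesis using he by simp
  qed
  have al: "h / \<epsilon> + alpha \<epsilon> F / sqrt \<epsilon> \<le> 2 * (h / \<epsilon>)" "0 \<le> h / \<epsilon> + alpha \<epsilon> F / sqrt \<epsilon>"
    using alpha_div_sqrt_le[OF \<epsilon>(1), of F] h0 \<epsilon> by (auto simp: h_def)
  have "gamma_face \<epsilon> b F \<le> \<epsilon> / h + (h / \<epsilon> + alpha \<epsilon> F / sqrt \<epsilon>) * Linf_norm surface_measure F b + h"
    unfolding gamma_face_def Let_def h_def by (rule min.cobounded1)
  also have "\<dots> \<le> \<epsilon> / h + (2 * (\<kappa>\<^sup>2 * (\<epsilon> / h))) * B + \<kappa>\<^sup>2 * (\<epsilon> / h)"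
  proof (intro add_mono order_refl h2)
    have "(h / \<epsilon> + alpha \<epsilon> F / sqrt \<epsilon>) * Linf_norm surface_measure F b \<le> (h / \<epsilon> + alpha \<epsilon> F / sqrt \<epsilon>) * B"
      by (rule mult_left_mono[OF B(2) al(2)])
    also have "\<dots> \<le> (2 * (\<kappa>\<^sup>2 * (\<epsilon> / h))) * B" using al(1) he by (intro mult_right_mono B) auto
    finally show "(h / \<epsilon> + alpha \<epsilon> F / sqrt \<epsilon>) * Linf_norm surface_measure F b \<le> (2 * (\<kappa>\<^sup>2 * (\<epsilon> / h))) * B" .
  qed
  also have "\<dots> = (1 + 2 * \<kappa>\<^sup>2 * B + \<kappa>\<^sup>2) * (\<epsilon> / h)" by (simp add: algebra_simps)
  finally show ?thesis by (simp add: h_def)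
qed

text \<open>
  The discrete problem on one mesh.  The constants \<open>\<sigma>\<close>, \<open>C\<close> and \<open>D\<close> express shape regularity and the inverse
  estimates; none of them depends on \<open>\<epsilon>\<close> or on the mesh size, and the other constants are given by them explicitly.
  The ball around the centre of a face of diameter \<open>h\<close> has radius \<open>h / L\<close>, and \<open>K\<close> times that radius covers the adjacent
  elements.  \<open>M\<close> belongs to the residual, \<open>X\<close> to the mismatch of the trace, \<open>J\<close> to the flux jump.
\<close>

locale hdg_error = conv_diff \<Omega> \<epsilon> b c f u Du B Kc
  for \<Omega> :: "(real^'n) set" and \<epsilon> :: real and b :: "real^'n \<Rightarrow> real^'n" and c f u :: "real^'n \<Rightarrow> real"
    and Du :: "real^'n \<Rightarrow> real^'n" and B Kc :: real +
  fixes \<T> :: "(real^'n) set set" and qh :: "(real^'n) set \<Rightarrow> real^'n \<Rightarrow> real^'n"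
    and uh uhat :: "(real^'n) set \<Rightarrow> real^'n \<Rightarrow> real" and p :: nat and \<sigma> \<kappa> C D L K M X J Cface :: real
  assumes dim: "CARD('n) \<ge> 2" and eps1: "\<epsilon> \<le> 1" and \<sigma>: "1 \<le> \<sigma>" and \<kappa>: "0 \<le> \<kappa>"
    and L: "L = 2 * \<sigma> * real CARD('n)" and K: "K = \<sigma> * L"
    and mesh: "mesh \<Omega> \<T>"
    and inball: "\<And>T. T \<in> \<T> \<Longrightarrow> \<exists>x \<rho>. 0 < \<rho> \<and> cball x \<rho> \<subseteq> T \<and> diameter T \<le> \<sigma> * \<rho>"
    and qh: "\<And>T i. T \<in> \<T> \<Longrightarrow> (\<lambda>x. qh T x $ i) \<in> polys (Suc p)" and uh: "\<And>T. T \<in> \<T> \<Longrightarrow> uh T \<in> polys (Suc p)"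
    and uhat: "\<And>F. F \<in> faces \<T> \<Longrightarrow> uhat F \<in> polys (Suc p)"
    and local_eq: "\<And>T \<rho>. T \<in> \<T> \<Longrightarrow> (\<And>i. (\<lambda>x. \<rho> x $ i) \<in> polys (Suc p)) \<Longrightarrow>
       (LINT x:T|lebesgue. (1 / \<epsilon>) *\<^sub>R qh T x \<bullet> \<rho> x) - (LINT x:T|lebesgue. uh T x * divg \<rho> x)
       + (\<Sum>F | F facet_of T. LINT x:F|surface_measure. uhat F x * (\<rho> x \<bullet> outer_normal T F)) = 0"
    and C0: "0 \<le> C"
    and Cb: "\<And>f (m::real^'n) r E. f \<in> polys (Suc p) \<Longrightarrow> r > 0 \<Longrightarrow> E \<in> sets borel \<Longrightarrow> E \<subseteq> cball m (K * r) \<Longrightarrow>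
     (\<forall>x\<in>cball m (K * r). (f x)\<^sup>2 \<le> C * mean_sq f m (r / 2)) \<and>
     (L2_norm lebesgue E f)\<^sup>2 \<le> C * (r ^ CARD('n) * mean_sq f m (r / 2)) \<and>
     (L2_norm lebesgue E (\<lambda>x. f x * bump m r x))\<^sup>2 \<le> C * (r ^ CARD('n) * mean_sq f m (r / 2)) \<and>
     (r * L2_norm lebesgue E (grad (\<lambda>x. f x * bump m r x)))\<^sup>2 \<le> C * (r ^ CARD('n) * mean_sq f m (r / 2))"
    and D0: "0 \<le> D"
    and Db: "\<And>f m r. f \<in> polys (Suc p) \<Longrightarrow> r > 0 \<Longrightarrow> \<exists>c q. (\<forall>i. q i \<in> polys p) \<and>
       (\<forall>x::real^'n. f x = c + (\<Sum>i\<in>UNIV. (x - m) $ i / (r / 2) * q i x)) \<and> \<bar>c\<bar> \<le> D * sqrt (mean_sq f m (r / 2)) \<and>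
       (\<forall>i. \<forall>x\<in>cball m (K * r). \<bar>q i x\<bar> \<le> D * sqrt (mean_sq f m (r / 2)))"
    and M_def: "M = 4 * (C * (2 ^ CARD('n) * exp 2) + 1)\<^sup>2 * (K\<^sup>2 + (\<sigma> * \<kappa>)\<^sup>2 * B\<^sup>2 + Kc\<^sup>2 + 1)"
    and X_def: "X = (real CARD('n) * (D * (1 + real CARD('n) * (2 * K))) * (2 * K))\<^sup>2 * (K ^ CARD('n) * unit_ball_vol (real CARD('n))) * 2 ^ CARD('n)"
    and J_def: "J = (C * ((K + 1) ^ CARD('n) * unit_ball_vol (real CARD('n))) * (2 ^ CARD('n) * exp 2)) * (C * (2 ^ CARD('n) * exp 2))"
    and Cface_def: "Cface = 8 * J * (L + \<kappa>\<^sup>2 * B\<^sup>2 + \<kappa>\<^sup>2 * Kc\<^sup>2 + (1 + \<kappa>\<^sup>2) * M) + 4 * X * (1 + 2 * \<kappa>\<^sup>2 * B + \<kappa>\<^sup>2)"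
begin

abbreviation "R \<equiv> residual b c f qh uh"
abbreviation "err \<equiv> local_error_sq (Suc p) \<T> \<epsilon> b c f u Du qh uh"
abbreviation "eq T \<equiv> L2_norm lebesgue T (\<lambda>x. - \<epsilon> *\<^sub>R Du x - qh T x)"
abbreviation "eg T \<equiv> L2_norm lebesgue T (\<lambda>x. Du x - grad (uh T) x)"
abbreviation "eu T \<equiv> L2_norm lebesgue T (\<lambda>x. u x - uh T x)"

lemma L_ge: "2 * \<sigma> \<le> L" "1 \<le> L" "1 \<le> K" "2 * \<sigma> \<le> K"
proof -
  have "2 * \<sigma> * 2 \<le> L" unfolding L using \<sigma> dim by (intro mult_left_mono) auto
  then show "2 * \<sigma> \<le> L" "1 \<le> L" using \<sigma> by auto
  then have "1 * L \<le> K" unfolding K using \<sigma> by (intro mult_right_mono) auto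
  then show "1 \<le> K" "2 * \<sigma> \<le> K" using \<open>2 * \<sigma> \<le> L\<close> \<open>1 \<le> L\<close> by auto
qed

lemma mesh_facts: "finite \<T>" "\<And>T. T \<in> \<T> \<Longrightarrow> T \<subseteq> closure \<Omega>" "\<And>T T'. T \<in> \<T> \<Longrightarrow> T' \<in> \<T> \<Longrightarrow> T \<inter> T' face_of T"
  using mesh unfolding mesh_def triangulation_def by auto

lemma elem_mesh: assumes T: "T \<in> \<T>" shows "elem T" "compact T"
proof -
  obtain V c' g where "bary_simplex V c' g T" using mesh_element[OF mesh T] .
  then interpret S: bary_simplex V c' g T .
  show "elem T" by (rule elemI[OF S.compact_T S.convex_T mesh_facts(2)[OF T]])
  show "compact T" by (rule S.compact_T)
qed

lemma L2_poly:
  assumes T: "T \<in> \<T>"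
  shows "L2 lebesgue T (grad (uh T))" "L2 lebesgue T (qh T)" "L2 lebesgue T (uh T)" "L2 lebesgue T Du"
proof -
  note e = elemD[OF elem_mesh(1)[OF T]]
  show "L2 lebesgue T (grad (uh T))" by (rule L2_cont[OF e polys_continuous_grad[OF uh[OF T]]])
  show "L2 lebesgue T (qh T)" by (rule L2_cont[OF e polys_vec_continuous]) (rule qh[OF T])
  show "L2 lebesgue T (uh T)" by (rule L2_cont[OF e polys_continuous[OF uh[OF T]]])
  show "L2 lebesgue T Du" by (rule L2_D(3)[OF e])
qed

lemma residual_L2: "T \<in> \<T> \<Longrightarrow> L2 lebesgue T (R T)"
  by (rule residual_tested(1)[OF elemD[OF elem_mesh(1)] qh uh polys_continuous[OF uh] polys_continuous_grad[OF uh]])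

lemma err_split: "err T = 1 / \<epsilon> * (eq T)\<^sup>2 + \<epsilon> * (eg T)\<^sup>2 + (eu T)\<^sup>2
    + (alpha \<epsilon> T)\<^sup>2 * (L2_norm lebesgue T (\<lambda>x. R T x - P_W (Suc p) \<T> R T x))\<^sup>2"
  by (simp add: local_error_sq_def osc_sq_def)

lemma err_nonneg: "0 \<le> err T" unfolding err_split using eps by simp

lemma err_parts: "1 / \<epsilon> * (eq T)\<^sup>2 + \<epsilon> * (eg T)\<^sup>2 + (eu T)\<^sup>2 \<le> err T" "1 / \<epsilon> * (eq T)\<^sup>2 + \<epsilon> * (eg T)\<^sup>2 \<le> err T"
proof -
  show 1: "1 / \<epsilon> * (eq T)\<^sup>2 + \<epsilon> * (eg T)\<^sup>2 + (eu T)\<^sup>2 \<le> err T" unfolding err_split by simp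
  have "0 \<le> (eu T)\<^sup>2" by simp
  then show "1 / \<epsilon> * (eq T)\<^sup>2 + \<epsilon> * (eg T)\<^sup>2 \<le> err T" using 1 by linarith
qed

lemma M_nonneg: "0 \<le> M" by (simp add: M_def)

text \<open>
  The condition allows \<open>\<sigma> \<kappa>\<close> instead of \<open>\<kappa>\<close> so that the estimate applies to the neighbours of a face with
  \<open>diameter F \<le> \<kappa> \<epsilon>\<close>.
\<close>

lemma residual_bound:
  assumes T: "T \<in> \<T>" and h: "diameter T \<le> (\<sigma> * \<kappa>) * \<epsilon>"
  shows "(alpha \<epsilon> T)\<^sup>2 * (L2_norm lebesgue T (R T))\<^sup>2 \<le> M * err T"
proof -
  obtain x \<rho> where \<rho>: "0 < \<rho>" "cball x \<rho> \<subseteq> T" "diameter T \<le> \<sigma> * \<rho>" using inball[OF T] by blast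
  define r where "r = \<rho> / 2"
  have r: "r > 0" using \<rho> by (simp add: r_def)
  have bd: "bounded T" by (rule compact_imp_bounded[OF elem_mesh(2)[OF T]])
  have ball: "cball x r \<subseteq> T" using \<rho> by (auto simp: r_def)
  have ballO: "cball x r \<subseteq> \<Omega>"
    by (rule cball_in_domain[OF dom order_trans[OF \<rho>(2) mesh_facts(2)[OF T]]]) (use \<rho> in \<open>simp add: r_def\<close>)
  have "\<sigma> * \<rho> = 2 * \<sigma> * r" by (simp add: r_def)
  also have "\<dots> \<le> K * r" using L_ge(4) r by (intro mult_right_mono) auto
  finally have hK: "diameter T \<le> K * r" using \<rho>(3) by simp
  have TK: "T \<subseteq> cball x (K * r)"
    by (rule sub_cball_diameter[OF bd _ hK]) (use \<rho> in auto)
  have P: "P_W (Suc p) \<T> R T \<in> polys (Suc p)"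
    by (rule P_W_polys[OF mesh_facts(1) elem_mesh(2) residual_L2 T])
  note cb = Cb[OF P r elemD(1)[OF elem_mesh(1)[OF T]] TK]
  note est = element_residual_estimate[where T = T and qh = qh and uh = uh and p = "Suc p" and P = "P_W (Suc p) \<T> R T" and C = C and m = x and r = r and K = K, OF elem_mesh(1)[OF T] r ball ballO TK qh[OF T] uh[OF T] P C0 cb[THEN conjunct2, THEN conjunct1]
      cb[THEN conjunct2, THEN conjunct2, THEN conjunct1] cb[THEN conjunct2, THEN conjunct2, THEN conjunct2]]
  show ?thesis unfolding err_split M_def
    by (rule residual_scaling[OF eps r diameter_ge_0[OF bd] hK h _ nonneg _ _ L2_norm_nonneg L2_norm_nonneg L2_norm_nonneg L2_norm_nonneg L2_norm_nonneg est])
      (use \<sigma> \<kappa> C0 L_ge in \<open>auto simp: alpha_def\<close>)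
qed

text \<open>
  \<open>q_h + \<epsilon> \<nabla>u_h\<close> is minus the flux error minus \<open>\<epsilon>\<close> times the gradient error, since \<open>q + \<epsilon> \<nabla>u = 0\<close>.
\<close>

lemma flux_bound:
  assumes T: "T \<in> \<T>"
  shows "1 / \<epsilon> * (L2_norm lebesgue T (\<lambda>x. qh T x + \<epsilon> *\<^sub>R grad (uh T) x))\<^sup>2 \<le> 2 * err T"
proof -
  note l = L2_poly[OF T]
  have a: "L2 lebesgue T (\<lambda>x. - \<epsilon> *\<^sub>R Du x - qh T x)" "L2 lebesgue T (\<lambda>x. Du x - grad (uh T) x)"
    by (intro L2_diff L2_scale l)+
  have "(\<lambda>x. qh T x + \<epsilon> *\<^sub>R grad (uh T) x) = (\<lambda>x. (-1) *\<^sub>R (- \<epsilon> *\<^sub>R Du x - qh T x) + (- \<epsilon>) *\<^sub>R (Du x - grad (uh T) x))"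
    by (auto simp: algebra_simps)
  then have "L2_norm lebesgue T (\<lambda>x. qh T x + \<epsilon> *\<^sub>R grad (uh T) x) \<le> eq T + \<epsilon> * eg T"
    using L2_norm_triangle[OF L2_scale[OF a(1), of "-1"] L2_scale[OF a(2), of "- \<epsilon>"]] eps unfolding L2_norm_scale by simp
  then have "(L2_norm lebesgue T (\<lambda>x. qh T x + \<epsilon> *\<^sub>R grad (uh T) x))\<^sup>2 \<le> (eq T + \<epsilon> * eg T)\<^sup>2"
    by (rule power_mono[OF _ L2_norm_nonneg])
  also have "\<dots> \<le> 2 * ((eq T)\<^sup>2 + (\<epsilon> * eg T)\<^sup>2)" by (rule sum_sq2)
  finally have "1 / \<epsilon> * (L2_norm lebesgue T (\<lambda>x. qh T x + \<epsilon> *\<^sub>R grad (uh T) x))\<^sup>2 \<le> 1 / \<epsilon> * (2 * ((eq T)\<^sup>2 + (\<epsilon> * eg T)\<^sup>2))"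
    using eps by (intro mult_left_mono) auto
  also have "\<dots> = 2 * (1 / \<epsilon> * (eq T)\<^sup>2 + \<epsilon> * (eg T)\<^sup>2)" using eps by (simp add: field_simps power2_eq_square)
  also have "\<dots> \<le> 2 * err T" using err_parts(2)[of T] by simp
  finally show ?thesis .
qed

lemma element_estimate:
  assumes T: "T \<in> \<T>" and h: "diameter T \<le> \<kappa> * \<epsilon>"
  shows "eta_elem_sq \<epsilon> b c f qh uh T \<le> (M + 2) * err T"
proof -
  have "\<kappa> * \<epsilon> \<le> (\<sigma> * \<kappa>) * \<epsilon>" using \<sigma> \<kappa> eps by (simp add: mult_right_mono mult_le_cancel_right1)
  then have "diameter T \<le> (\<sigma> * \<kappa>) * \<epsilon>" using h by simp
  from residual_bound[OF T this] flux_bound[OF T] show ?thesis unfolding eta_elem_sq_def distrib_right by linarith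
qed

text \<open>
  By shape regularity element, face and inscribed ball have comparable sizes.  Twice the radius \<open>h / L\<close> is at most the
  one admitted by \<open>half_ball_sub_T\<close>; the factor 2 leaves room for \<open>cball_in_domain\<close>.
\<close>

lemma facet_geometry:
  fixes V c' g v
  assumes T: "T \<in> \<T>" and S: "bary_simplex V c' g T" and v: "v \<in> V"
  defines "h \<equiv> diameter (bary_simplex.facet c' g T v)" and "m \<equiv> bary_simplex.centre V v"
  shows "0 < h" "h \<le> diameter T" "diameter T \<le> \<sigma> * h" "T \<subseteq> cball m (K * (h / L))" "norm (g v) * (h / L) \<le> 1"
    and "\<And>y. dist m y \<le> 2 * (h / L) \<Longrightarrow> 0 \<le> bary_simplex.lam c' g v y \<Longrightarrow> y \<in> T"
proof -
  interpret S: bary_simplex V c' g T by (rule S)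
  obtain x \<rho> where \<rho>: "0 < \<rho>" "cball x \<rho> \<subseteq> T" "diameter T \<le> \<sigma> * \<rho>" using inball[OF T] by blast
  have bd: "bounded T" by (rule compact_imp_bounded[OF S.compact_T])
  have \<rho>h: "\<rho> \<le> h" unfolding h_def by (rule S.inball_le_diameter_facet[OF dim v \<rho>(1,2)])
  then show h0: "0 < h" using \<rho> by simp
  show hT: "h \<le> diameter T" unfolding h_def by (rule diameter_subset[OF _ bd]) (auto simp: S.facet_def)
  have "\<sigma> * \<rho> \<le> \<sigma> * h" using \<sigma> \<rho>h by (intro mult_left_mono) auto
  then show Th: "diameter T \<le> \<sigma> * h" using \<rho> by simp
  have "K * (h / L) = \<sigma> * h" using L_ge by (simp add: K)
  then show "T \<subseteq> cball m (K * (h / L))"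
    using S.centre_in_facet[OF v] Th by (intro sub_cball_diameter[OF bd]) (auto simp: m_def S.facet_def)
  have d0: "real CARD('n) > 0" by simp
  have h\<rho>: "h \<le> \<sigma> * \<rho>" using hT \<rho> by simp
  have "2 * (h / L) = (h / \<sigma>) / real CARD('n)" by (simp add: L)
  also have "\<dots> \<le> \<rho> / real CARD('n)" using h\<rho> \<sigma> by (intro divide_right_mono) (auto simp: pos_divide_le_eq mult.commute)
  finally have r2: "2 * (h / L) \<le> \<rho> / real CARD('n)" .
  show "y \<in> T" if "dist m y \<le> 2 * (h / L)" "0 \<le> S.lam v y" for y
    by (rule S.half_ball_sub_T[OF v \<rho>(1,2) _ that(2)]) (use that(1) r2 in \<open>simp add: m_def\<close>)
  have "\<rho> / real CARD('n) \<le> \<rho>" using \<rho> dim by (simp add: pos_divide_le_eq)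
  then have "h / L \<le> 2 * \<rho>" using r2 \<rho> by linarith
  then have "norm (g v) * (h / L) \<le> norm (g v) * (2 * \<rho>)" by (intro mult_left_mono) auto
  then show "norm (g v) * (h / L) \<le> 1" using S.grad_bound_by_inball[OF v \<rho>(1,2)] by linarith
qed

lemma XJ_nonneg: "0 \<le> X" "0 \<le> J"
  using C0 L_ge unfolding X_def J_def by auto

text \<open>
  Combines \<open>trace_mismatch_estimate\<close> and \<open>flux_bound\<close>; the radius of the ball is at most the diameter of the face.
\<close>

lemma mismatch_bound:
  fixes V c' g v
  assumes T: "T \<in> \<T>" and S: "bary_simplex V c' g T" and v: "v \<in> V"
  defines "F \<equiv> bary_simplex.facet c' g T v"
  shows "\<epsilon> / diameter F * (L2_norm surface_measure F (\<lambda>x. uh T x - uhat F x))\<^sup>2 \<le> 2 * X * err T"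
proof -
  interpret S: bary_simplex V c' g T by (rule S)
  define r where "r = diameter F / L"
  define m where "m = S.centre v"
  note geo = facet_geometry[OF T S v, folded F_def m_def, folded r_def]
  have r: "r > 0" using geo(1) L_ge by (simp add: r_def)
  have rh: "r \<le> diameter F" using geo(1) L_ge by (simp add: r_def pos_divide_le_eq)
  have m: "S.nrm v \<bullet> m = S.off v" using S.centre_in_facet[OF v] S.facet_plane[OF v] by (auto simp: m_def)
  have ball: "cball m r \<inter> {x. S.nrm v \<bullet> x = S.off v} \<subseteq> S.facet v"
  proof
    fix x assume x: "x \<in> cball m r \<inter> {x. S.nrm v \<bullet> x = S.off v}"
    then have "S.lam v x = 0" using S.plane_iff[OF v] by simp
    moreover have "x \<in> T" using geo(6)[of x] x r \<open>S.lam v x = 0\<close> by simp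
    ultimately show "x \<in> S.facet v" by (simp add: S.facet_def)
  qed
  have uf: "uhat (S.facet w) \<in> polys (Suc p)" if "w \<in> V" for w
    by (rule uhat) (use T that S.facet_of_iff in \<open>auto simp: faces_def\<close>)
  have est: "(L2_norm surface_measure F (\<lambda>x. uh T x - uhat F x))\<^sup>2 \<le> X * r * (L2_norm lebesgue T (\<lambda>x. (1 / \<epsilon>) *\<^sub>R qh T x + grad (uh T) x))\<^sup>2"
    unfolding F_def X_def
    by (rule S.trace_mismatch_estimate[where qT = "qh T" and uT = "uh T" and uhat = uhat and p = p and D = D and m = m and r = r and K = K and \<epsilon> = \<epsilon>, OF dim v r L_ge(3) geo(4) m ball geo(5) qh[OF T] uh[OF T] uf D0 Db[OF _ r] local_eq[OF T]])
  have "(\<lambda>x. (1 / \<epsilon>) *\<^sub>R qh T x + grad (uh T) x) = (\<lambda>x. (1 / \<epsilon>) *\<^sub>R (qh T x + \<epsilon> *\<^sub>R grad (uh T) x))"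
    using eps by (auto simp: scaleR_right_distrib)
  then have "L2_norm lebesgue T (\<lambda>x. (1 / \<epsilon>) *\<^sub>R qh T x + grad (uh T) x) = 1 / \<epsilon> * L2_norm lebesgue T (\<lambda>x. qh T x + \<epsilon> *\<^sub>R grad (uh T) x)"
    using eps by (simp only: L2_norm_scale) simp
  then have N: "\<epsilon> * (L2_norm lebesgue T (\<lambda>x. (1 / \<epsilon>) *\<^sub>R qh T x + grad (uh T) x))\<^sup>2 \<le> 2 * err T"
    using flux_bound[OF T] eps by (simp add: power2_eq_square)
  have "\<epsilon> / diameter F * (L2_norm surface_measure F (\<lambda>x. uh T x - uhat F x))\<^sup>2
     \<le> \<epsilon> / diameter F * (X * r * (L2_norm lebesgue T (\<lambda>x. (1 / \<epsilon>) *\<^sub>R qh T x + grad (uh T) x))\<^sup>2)"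
    using eps geo(1) by (intro mult_left_mono est) auto
  also have "\<dots> = (r / diameter F) * (X * (\<epsilon> * (L2_norm lebesgue T (\<lambda>x. (1 / \<epsilon>) *\<^sub>R qh T x + grad (uh T) x))\<^sup>2))" by simp
  also have "\<dots> \<le> 1 * (X * (2 * err T))"
    using rh r geo(1) XJ_nonneg err_nonneg eps by (intro mult_mono mult_left_mono N mult_nonneg_nonneg) auto
  finally show ?thesis by simp
qed

text \<open>
  The jump of \<open>u_h\<close> is the difference of the two mismatches with the common numerical trace.
\<close>

lemma face_estimate:
  assumes T: "T1 \<in> face_patch \<T> F" "T2 \<in> face_patch \<T> F" "T1 \<noteq> T2" and hF: "diameter F \<le> \<kappa> * \<epsilon>"
  shows "eta_face_sq \<epsilon> b qh uh T1 T2 F \<le> Cface * (err T1 + err T2)"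
proof -
  have Tm: "T1 \<in> \<T>" "T2 \<in> \<T>" and Ff: "F facet_of T1" "F facet_of T2" using T by (auto simp: face_patch_def)
  obtain V1 c1 g1 where b1: "bary_simplex V1 c1 g1 T1" using mesh_element[OF mesh Tm(1)] .
  obtain V2 c2 g2 where b2: "bary_simplex V2 c2 g2 T2" using mesh_element[OF mesh Tm(2)] .
  interpret S1: bary_simplex V1 c1 g1 T1 by (rule b1)
  interpret S2: bary_simplex V2 c2 g2 T2 by (rule b2)
  obtain v1 where v1: "v1 \<in> V1" "F = S1.facet v1" using Ff(1) S1.facet_of_iff by blast
  obtain v2 where v2: "v2 \<in> V2" "F = S2.facet v2" using Ff(2) S2.facet_of_iff by blast
  define h where "h = diameter F"
  define r where "r = h / L"
  define m where "m = S1.centre v1"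
  have m2: "S2.centre v2 = m" unfolding m_def S1.centre_eq[OF v1(1)] S2.centre_eq[OF v2(1)] v1(2)[symmetric] v2(2)[symmetric] ..
  note geo1 = facet_geometry[OF Tm(1) b1 v1(1), folded v1(2) m_def, folded h_def, folded r_def]
  note geo2 = facet_geometry[OF Tm(2) b2 v2(1), folded v2(2), unfolded m2, folded h_def, folded r_def]
  have r: "r > 0" using geo1(1) L_ge by (simp add: r_def)
  have hL: "h = L * r" using L_ge by (simp add: r_def)
  define n where "n = S1.nrm v1"
  define a where "a = S1.off v1"
  have mF: "m \<in> F" using S1.centre_in_facet[OF v1(1)] by (simp add: m_def v1(2))
  have opp: "S2.nrm v2 = - n" "S2.off v2 = - a"
    unfolding n_def a_def
    by (rule opposite_sides[OF b1 b2 mesh_facts(3)[OF Tm] mesh_facts(3)[OF Tm(2,1)] T(3) v1(1) v2(1) _ r];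
        use v1(2) v2(2) mF geo1(6) geo2(6) r in auto)+
  have lam1: "n \<bullet> x \<le> a \<longleftrightarrow> 0 \<le> S1.lam v1 x" for x unfolding n_def a_def by (rule S1.half_space_iff[OF v1(1)])
  have lam2: "a \<le> n \<bullet> x \<longleftrightarrow> 0 \<le> S2.lam v2 x" for x using S2.half_space_iff[OF v2(1), of x] unfolding opp by simp
  have n1: "norm n = 1" unfolding n_def by (rule S1.norm_nrm[OF v1(1)])
  have Fpl: "F \<subseteq> {x. n \<bullet> x = a}" using S1.facet_plane[OF v1(1)] by (simp add: v1(2) n_def a_def)
  have ma: "n \<bullet> m = a" using mF Fpl by auto
  have side: "T1 \<subseteq> {x. n \<bullet> x \<le> a}" "T2 \<subseteq> {x. a \<le> n \<bullet> x}"
    unfolding lam1 lam2 using v1 v2 by (auto simp: S1.T_iff S2.T_iff)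
  have ballT: "cball m r \<inter> {x. n \<bullet> x \<le> a} \<subseteq> T1" "cball m r \<inter> {x. a \<le> n \<bullet> x} \<subseteq> T2"
    unfolding lam1 lam2 using geo1(6) geo2(6) r by auto
  have "cball m (2 * r) \<subseteq> T1 \<union> T2"
  proof
    fix x assume x: "x \<in> cball m (2 * r)"
    have "n \<bullet> x \<le> a \<or> a \<le> n \<bullet> x" by linarith
    then show "x \<in> T1 \<union> T2" unfolding lam1 lam2 using geo1(6)[of x] geo2(6)[of x] x by auto
  qed
  then have "cball m (2 * r) \<subseteq> closure \<Omega>" using mesh_facts(2)[OF Tm(1)] mesh_facts(2)[OF Tm(2)] by blast
  then have ballO: "cball m r \<subseteq> \<Omega>" by (rule cball_in_domain[OF dom]) (use r in simp)
  have Fb: "F \<in> sets borel" unfolding v1(2) by (rule S1.facet_borel)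
  have FT: "F \<subseteq> T1" unfolding v1(2) by (auto simp: S1.facet_def)
  have FK: "F \<subseteq> cball m (K * r)" using FT geo1(4) by blast
  have ballF: "cball m r \<inter> {x. n \<bullet> x = a} \<subseteq> F"
  proof
    fix x assume x: "x \<in> cball m r \<inter> {x. n \<bullet> x = a}"
    then have "x \<in> T1" using ballT(1) by auto
    moreover have "S1.lam v1 x = 0" using x S1.plane_iff[OF v1(1), of x] by (simp add: n_def a_def)
    ultimately show "x \<in> F" by (simp add: v1(2) S1.facet_def)
  qed
  define E where "E T = eq T / r + (B * eg T + Kc * eu T) + L2_norm lebesgue T (R T)" for T
  have TKb: "T \<in> sets borel \<and> T \<subseteq> cball m (K * r)" if "T = T1 \<or> T = T2" for T
    using that geo1(4) geo2(4) elemD(1)[OF elem_mesh(1)] Tm by auto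
  have jump_q: "(L2_norm surface_measure F (\<lambda>x. qh T1 x \<bullet> n + qh T2 x \<bullet> (- n)))\<^sup>2 \<le> J * r * (E T1 + E T2)\<^sup>2"
    unfolding J_def E_def
  proof (rule face_jump_estimate[where ?T1.0 = T1 and ?T2.0 = T2 and F = F and n = n and a = a and m = m and r = r and K = K and qh = qh and uh = uh and p = "Suc p" and C = C, OF elem_mesh(1)[OF Tm(1)] elem_mesh(1)[OF Tm(2)] r _ n1 ma side ballT ballO Fb Fpl FK ballF
      qh[OF Tm(1)] qh[OF Tm(2)] uh[OF Tm(1)] uh[OF Tm(2)] C0])
    show "0 \<le> K" using L_ge by simp
    show "(f x)\<^sup>2 \<le> C * mean_sq f m (r / 2)" if "f \<in> polys (Suc p)" "x \<in> cball m (K * r)" for f x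
      using Cb[OF that(1) r Fb FK] that(2) by blast
    show "(L2_norm lebesgue T (\<lambda>x. f x * bump m r x))\<^sup>2 \<le> C * (r ^ CARD('n) * mean_sq f m (r / 2))"
      if "f \<in> polys (Suc p)" "T = T1 \<or> T = T2" for f T
      using Cb[OF that(1) r TKb[OF that(2), THEN conjunct1] TKb[OF that(2), THEN conjunct2]] by blast
    show "(r * L2_norm lebesgue T (grad (\<lambda>x. f x * bump m r x)))\<^sup>2 \<le> C * (r ^ CARD('n) * mean_sq f m (r / 2))"
      if "f \<in> polys (Suc p)" "T = T1 \<or> T = T2" for f T
      using Cb[OF that(1) r TKb[OF that(2), THEN conjunct1] TKb[OF that(2), THEN conjunct2]] by blast
  qed
  define S where "S = L + \<kappa>\<^sup>2 * B\<^sup>2 + \<kappa>\<^sup>2 * Kc\<^sup>2 + (1 + \<kappa>\<^sup>2) * M"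
  have ET: "h / \<epsilon> * (r * (E T)\<^sup>2) \<le> 4 * S * err T" if T: "T \<in> \<T>" and hT: "h \<le> diameter T" "diameter T \<le> \<sigma> * h" for T
  proof -
    have "\<sigma> * h \<le> \<sigma> * (\<kappa> * \<epsilon>)" using hF \<sigma> by (intro mult_left_mono) (auto simp: h_def)
    then have "diameter T \<le> (\<sigma> * \<kappa>) * \<epsilon>" using hT(2) by (simp add: mult.assoc)
    note Rb = residual_bound[OF T this]
    show ?thesis unfolding E_def S_def
      by (rule face_scaling[OF eps eps1 r hL L_ge(2) hF[folded h_def] hT(1) \<kappa> L2_norm_nonneg L2_norm_nonneg L2_norm_nonneg L2_norm_nonneg
          alpha_def Rb err_parts(1)])
  qed
  have on: "outer_normal T1 F = n" "outer_normal T2 F = - n"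
    using S1.outer_normal_facet[OF v1(1)] S2.outer_normal_facet[OF v2(1)] opp(1) unfolding v1(2)[symmetric] v2(2)[symmetric] n_def by simp_all
  have h0: "0 < h" by (rule geo1(1))
  have part_q: "alpha \<epsilon> F / sqrt \<epsilon> * (L2_norm surface_measure F (\<lambda>x. qh T1 x \<bullet> outer_normal T1 F + qh T2 x \<bullet> outer_normal T2 F))\<^sup>2
     \<le> 8 * J * S * (err T1 + err T2)"
  proof -
    have "alpha \<epsilon> F / sqrt \<epsilon> * (L2_norm surface_measure F (\<lambda>x. qh T1 x \<bullet> outer_normal T1 F + qh T2 x \<bullet> outer_normal T2 F))\<^sup>2
      \<le> h / \<epsilon> * (J * r * (E T1 + E T2)\<^sup>2)"
      unfolding on h_def using h0 eps alpha_div_sqrt_le(1)[OF eps, of F]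
      by (intro mult_mono jump_q) (auto simp: h_def)
    also have "\<dots> \<le> h / \<epsilon> * (J * r * (2 * ((E T1)\<^sup>2 + (E T2)\<^sup>2)))"
      using h0 eps r XJ_nonneg by (intro mult_left_mono sum_sq2) auto
    also have "\<dots> = 2 * J * (h / \<epsilon> * (r * (E T1)\<^sup>2) + h / \<epsilon> * (r * (E T2)\<^sup>2))" by (simp add: algebra_simps)
    also have "\<dots> \<le> 2 * J * (4 * S * err T1 + 4 * S * err T2)"
      using XJ_nonneg by (intro mult_left_mono add_mono ET Tm geo1(2,3) geo2(2,3)) auto
    finally show ?thesis by (simp add: algebra_simps)
  qed
  define G where "G = 1 + 2 * \<kappa>\<^sup>2 * B + \<kappa>\<^sup>2"
  have part_u: "gamma_face \<epsilon> b F * (L2_norm surface_measure F (\<lambda>x. uh T1 x - uh T2 x))\<^sup>2 \<le> 4 * X * G * (err T1 + err T2)"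
  proof -
    have "norm (b x) \<le> B" if "x \<in> F" for x using that FT mesh_facts(2)[OF Tm(1)] by (intro b_bound) auto
    then have "Linf_norm surface_measure F b \<le> B" using nonneg by (intro Linf_norm_le) auto
    then have \<gamma>: "gamma_face \<epsilon> b F \<le> G * (\<epsilon> / h)"
      unfolding G_def h_def using h0 hF by (intro gamma_face_le[OF eps eps1]) (auto simp: h_def nonneg)
    have G0: "0 \<le> G" using nonneg by (simp add: G_def)
    have "F \<in> faces \<T>" using Tm(1) Ff(1) by (auto simp: faces_def)
    then have cont: "continuous_on UNIV (uhat F)" by (rule polys_continuous[OF uhat])
    let ?w = "\<lambda>T x. uh T x - uhat F x"
    have l: "L2 surface_measure F (?w T)" if "T \<in> \<T>" for T
      unfolding v1(2) by (rule S1.facet_L2[OF v1(1)])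
        (intro continuous_intros polys_continuous[OF uh[OF that]] cont[unfolded v1(2)])
    have "(\<lambda>x. uh T1 x - uh T2 x) = (\<lambda>x. ?w T1 x - ?w T2 x)" by auto
    then have "L2_norm surface_measure F (\<lambda>x. uh T1 x - uh T2 x) \<le> L2_norm surface_measure F (?w T1) + L2_norm surface_measure F (?w T2)"
      using L2_norm_diff_le[OF l[OF Tm(1)] l[OF Tm(2)]] by simp
    then have "(L2_norm surface_measure F (\<lambda>x. uh T1 x - uh T2 x))\<^sup>2 \<le> (L2_norm surface_measure F (?w T1) + L2_norm surface_measure F (?w T2))\<^sup>2"
      by (rule power_mono[OF _ L2_norm_nonneg])
    also have "\<dots> \<le> 2 * ((L2_norm surface_measure F (?w T1))\<^sup>2 + (L2_norm surface_measure F (?w T2))\<^sup>2)" by (rule sum_sq2)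
    finally have "gamma_face \<epsilon> b F * (L2_norm surface_measure F (\<lambda>x. uh T1 x - uh T2 x))\<^sup>2
       \<le> (G * (\<epsilon> / h)) * (2 * ((L2_norm surface_measure F (?w T1))\<^sup>2 + (L2_norm surface_measure F (?w T2))\<^sup>2))"
      using \<gamma> G0 h0 eps by (intro mult_mono) auto
    also have "\<dots> = 2 * G * (\<epsilon> / h * (L2_norm surface_measure F (?w T1))\<^sup>2 + \<epsilon> / h * (L2_norm surface_measure F (?w T2))\<^sup>2)"
      by (simp add: algebra_simps)
    also have "\<dots> \<le> 2 * G * (2 * X * err T1 + 2 * X * err T2)"
      using G0 mismatch_bound[OF Tm(1) b1 v1(1), folded v1(2), folded h_def] mismatch_bound[OF Tm(2) b2 v2(1), folded v2(2), folded h_def]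
      by (intro mult_left_mono add_mono) auto
    finally show ?thesis by (simp add: algebra_simps)
  qed
  show ?thesis using part_q part_u unfolding eta_face_sq_def Cface_def S_def G_def distrib_right by linarith
qed

end

theorem theorem2p4:
  fixes \<Omega> :: "(real^'n) set"
    and b :: "real^'n \<Rightarrow> real^'n" and Db :: "real^'n \<Rightarrow> real^'n^'n"
    and c \<psi> :: "real^'n \<Rightarrow> real" and D\<psi> :: "real^'n \<Rightarrow> real^'n"
    and b0 \<rho>0 \<sigma> \<kappa> :: real and p :: nat
  assumes dim: "CARD('n) = 2 \<or> CARD('n) = 3"
    and domain: "polyhedral_domain \<Omega>"
    and b: "in_W1inf_vec \<Omega> b Db"
    and c: "Linf lebesgue \<Omega> c"
    and coercive: "AE x in lebesgue. x \<in> \<Omega> \<longrightarrow> c x - 1/2 * trace (Db x) \<ge> 0"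
    and \<psi>: "in_W1inf \<Omega> \<psi> D\<psi>"
    and b0: "b0 > 0" "AE x in lebesgue. x \<in> \<Omega> \<longrightarrow> b x \<bullet> D\<psi> x \<ge> b0"
    and p: "p \<ge> 1"
    and \<rho>0: "0 < \<rho>0" "\<rho>0 \<le> 1"
    and \<kappa>: "\<kappa> > 0"
  shows "\<exists>C2>0. \<forall>\<epsilon> f g u Du \<T> qh uh uhat.
    0 < \<epsilon> \<longrightarrow> \<epsilon> \<le> 1 \<longrightarrow>
    L2 lebesgue \<Omega> f \<longrightarrow> in_Hhalf \<Omega> g \<longrightarrow>
    weak_solution \<Omega> \<epsilon> b c f g u Du \<longrightarrow>
    mesh \<Omega> \<T> \<longrightarrow> shape_regular \<sigma> \<T> \<longrightarrow>
    HDG_solution p \<rho>0 \<T> \<epsilon> b Db c f g qh uh uhat \<longrightarrow>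
      (\<forall>F\<in>interior_faces \<T>. diameter F \<le> \<kappa> * \<epsilon> \<longrightarrow>
         (\<forall>Tp\<in>face_patch \<T> F. \<forall>Tm\<in>face_patch \<T> F. Tp \<noteq> Tm \<longrightarrow>
            eta_face_sq \<epsilon> b qh uh Tp Tm F
            \<le> C2 * (\<Sum>T\<in>face_patch \<T> F. local_error_sq p \<T> \<epsilon> b c f u Du qh uh T))) \<and>
      (\<forall>T\<in>\<T>. diameter T \<le> \<kappa> * \<epsilon> \<longrightarrow>
         eta_elem_sq \<epsilon> b c f qh uh T
         \<le> C2 * local_error_sq p \<T> \<epsilon> b c f u Du qh uh T)"
proof -
  have d2: "CARD('n) \<ge> 2" using dim by auto
  obtain p' where p': "p = Suc p'" using p by (cases p) auto
  have bc: "continuous_on (closure \<Omega>) b" using b by (simp add: in_W1inf_vec_def)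
  have "compact (closure \<Omega>)" using polyhedral_domainD(2)[OF domain] by simp
  then have "bounded (b ` closure \<Omega>)" using bc compact_continuous_image compact_imp_bounded by blast
  then obtain B where B: "0 < B" "\<forall>y\<in>b ` closure \<Omega>. norm y \<le> B" unfolding bounded_pos by blast
  obtain Kc0 where "AE x in lebesgue. x \<in> \<Omega> \<longrightarrow> norm (c x) \<le> Kc0" using c unfolding Linf_def by blast
  then have Kc: "AE x in lebesgue. x \<in> \<Omega> \<longrightarrow> norm (c x) \<le> \<bar>Kc0\<bar>" by (rule AE_mp) (auto intro!: AE_I2)
  \<comment> \<open>the constant of the inscribed ball\<close>
  define s where "s = 4 * max 1 \<sigma>"
  define L where "L = 2 * s * real CARD('n)"
  define K where "K = s * L"
  have s: "1 \<le> s" by (simp add: s_def)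
  have "1 * 1 \<le> 2 * s * real CARD('n)" using s d2 by (intro mult_mono) auto
  then have L1: "1 \<le> L" by (simp add: L_def)
  then have "1 * 1 \<le> s * L" using s by (intro mult_mono) auto
  then have K1: "1 \<le> K" by (simp add: K_def)
  obtain C where C: "C > 0" "\<forall>f\<in>polys (Suc p'). \<forall>(m::real^'n) r E. r > 0 \<longrightarrow> E \<in> sets borel \<longrightarrow> E \<subseteq> cball m (K * r) \<longrightarrow>
     (\<forall>x\<in>cball m (K * r). (f x)\<^sup>2 \<le> C * mean_sq f m (r / 2)) \<and>
     (L2_norm lebesgue E f)\<^sup>2 \<le> C * (r ^ CARD('n) * mean_sq f m (r / 2)) \<and>
     (L2_norm lebesgue E (\<lambda>x. f x * bump m r x))\<^sup>2 \<le> C * (r ^ CARD('n) * mean_sq f m (r / 2)) \<and>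
     (r * L2_norm lebesgue E (grad (\<lambda>x. f x * bump m r x)))\<^sup>2 \<le> C * (r ^ CARD('n) * mean_sq f m (r / 2))"
    using bubble_bounds[OF K1, where p = "Suc p'" and ?'n = 'n] by (elim exE conjE)
  have K2: "1 \<le> 2 * K" using K1 by simp
  obtain D where D: "D > 0" "\<forall>f\<in>polys (Suc p'). \<forall>x0 r. r > 0 \<longrightarrow> (\<exists>c q. (\<forall>i. q i \<in> polys p') \<and>
     (\<forall>x::real^'n. f x = c + (\<Sum>i\<in>UNIV. (x - x0) $ i / r * q i x)) \<and> \<bar>c\<bar> \<le> D * sqrt (mean_sq f x0 r) \<and>
     (\<forall>i. \<forall>x\<in>cball x0 (2 * K * r). \<bar>q i x\<bar> \<le> D * sqrt (mean_sq f x0 r)))"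
    using polys_decomposition[OF K2, where p = p' and ?'n = 'n] by (elim exE conjE)
  have D': "\<exists>c q. (\<forall>i. q i \<in> polys p') \<and>
       (\<forall>x::real^'n. f x = c + (\<Sum>i\<in>UNIV. (x - m) $ i / (r / 2) * q i x)) \<and> \<bar>c\<bar> \<le> D * sqrt (mean_sq f m (r / 2)) \<and>
       (\<forall>i. \<forall>x\<in>cball m (K * r). \<bar>q i x\<bar> \<le> D * sqrt (mean_sq f m (r / 2)))" if "f \<in> polys (Suc p')" "r > 0" for f m r
  proof -
    have r2: "r / 2 > 0" and e: "2 * K * (r / 2) = K * r" using that(2) by auto
    show ?thesis using D(2)[rule_format, OF that(1) r2, of m] unfolding e .
  qed
  define M where "M = 4 * (C * (2 ^ CARD('n) * exp 2) + 1)\<^sup>2 * (K\<^sup>2 + (s * \<kappa>)\<^sup>2 * B\<^sup>2 + \<bar>Kc0\<bar>\<^sup>2 + 1)"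
  define X where "X = (real CARD('n) * (D * (1 + real CARD('n) * (2 * K))) * (2 * K))\<^sup>2 * (K ^ CARD('n) * unit_ball_vol (real CARD('n))) * 2 ^ CARD('n)"
  define J where "J = (C * ((K + 1) ^ CARD('n) * unit_ball_vol (real CARD('n))) * (2 ^ CARD('n) * exp 2)) * (C * (2 ^ CARD('n) * exp 2))"
  define Cface where "Cface = 8 * J * (L + \<kappa>\<^sup>2 * B\<^sup>2 + \<kappa>\<^sup>2 * \<bar>Kc0\<bar>\<^sup>2 + (1 + \<kappa>\<^sup>2) * M) + 4 * X * (1 + 2 * \<kappa>\<^sup>2 * B + \<kappa>\<^sup>2)"
  define C2 where "C2 = max (M + 2) Cface"
  have C2: "0 < C2" "M + 2 \<le> C2" "Cface \<le> C2" by (auto simp: C2_def M_def less_max_iff_disj add_nonneg_pos)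
  show ?thesis
  proof (intro exI[of _ C2] conjI C2(1) allI impI)
    fix \<epsilon> f g u Du \<T> qh uh uhat
    assume \<epsilon>: "0 < \<epsilon>" "\<epsilon> \<le> 1" and f: "L2 lebesgue \<Omega> f" and ws: "weak_solution \<Omega> \<epsilon> b c f g u Du"
      and mesh: "mesh \<Omega> \<T>" and reg: "shape_regular \<sigma> \<T>" and sol: "HDG_solution p \<rho>0 \<T> \<epsilon> b Db c f g qh uh uhat"
    note dom = polyhedral_domainD[OF domain]
    have fin: "finite \<T>" using mesh by (simp add: mesh_def triangulation_def)
    interpret hdg_error \<Omega> \<epsilon> b c f u Du B "\<bar>Kc0\<bar>" \<T> qh uh uhat p' s \<kappa> C D L K M X J Cface
    proof
      show "L2 lebesgue \<Omega> u" "L2 lebesgue \<Omega> Du" using ws by (auto simp: weak_solution_def in_H1_def)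
      show "(LINT x:\<Omega>|lebesgue. \<epsilon> * (Du x \<bullet> grad v x) + (b x \<bullet> Du x) * v x + c x * u x * v x) = (LINT x:\<Omega>|lebesgue. f x * v x)"
        if "test_function \<Omega> v" for v
        using ws test_function_in_H10[OF that dom(1,2)] unfolding weak_solution_def by blast
      show "\<exists>x \<rho>. 0 < \<rho> \<and> cball x \<rho> \<subseteq> T \<and> diameter T \<le> s * \<rho>" if T: "T \<in> \<T>" for T
      proof -
        obtain V c' g' where "bary_simplex V c' g' T" using mesh_element[OF mesh T] .
        then interpret S: bary_simplex V c' g' T .
        have "diameter T \<le> \<sigma> * inball_diameter T" using reg T by (simp add: shape_regular_def)
        from inscribed_ball[OF this S.diameter_pos S.compact_T] show ?thesis unfolding s_def by metis
      qed
      show "(\<lambda>x. qh T x $ i) \<in> polys (Suc p')" "uh T \<in> polys (Suc p')" if "T \<in> \<T>" for T i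
        using sol that by (auto simp: HDG_solution_def V_h_def W_h_def p')
      show "uhat F \<in> polys (Suc p')" if "F \<in> faces \<T>" for F
        using sol that by (auto simp: HDG_solution_def M_h_def p')
      show "(LINT x:T|lebesgue. (1 / \<epsilon>) *\<^sub>R qh T x \<bullet> \<rho> x) - (LINT x:T|lebesgue. uh T x * divg \<rho> x)
         + (\<Sum>F | F facet_of T. LINT x:F|surface_measure. uhat F x * (\<rho> x \<bullet> outer_normal T F)) = 0"
        if "T \<in> \<T>" "\<And>i. (\<lambda>x. \<rho> x $ i) \<in> polys (Suc p')" for T \<rho>
        by (rule HDG_local_equation[OF sol fin that(1)]) (use that(2) p' in simp)
      show "(\<forall>x\<in>cball m (K * r). (f x)\<^sup>2 \<le> C * mean_sq f m (r / 2)) \<and>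
       (L2_norm lebesgue E f)\<^sup>2 \<le> C * (r ^ CARD('n) * mean_sq f m (r / 2)) \<and>
       (L2_norm lebesgue E (\<lambda>x. f x * bump m r x))\<^sup>2 \<le> C * (r ^ CARD('n) * mean_sq f m (r / 2)) \<and>
       (r * L2_norm lebesgue E (grad (\<lambda>x. f x * bump m r x)))\<^sup>2 \<le> C * (r ^ CARD('n) * mean_sq f m (r / 2))"
        if "f \<in> polys (Suc p')" "r > 0" "E \<in> sets borel" "E \<subseteq> cball m (K * r)" for f and m :: "real^'n" and r E
        by (rule C(2)[rule_format, OF that])
      show "\<exists>c q. (\<forall>i. q i \<in> polys p') \<and>
         (\<forall>x::real^'n. f x = c + (\<Sum>i\<in>UNIV. (x - m) $ i / (r / 2) * q i x)) \<and> \<bar>c\<bar> \<le> D * sqrt (mean_sq f m (r / 2)) \<and>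
         (\<forall>i. \<forall>x\<in>cball m (K * r). \<bar>q i x\<bar> \<le> D * sqrt (mean_sq f m (r / 2)))" if "f \<in> polys (Suc p')" "r > 0" for f m r
        by (rule D'[OF that])
      show "set_borel_measurable lebesgue \<Omega> c" using c by (simp add: Linf_def)
      show "norm (b x) \<le> B" if "x \<in> closure \<Omega>" for x using B(2) that by blast
      show "AE x in lebesgue. x \<in> \<Omega> \<longrightarrow> norm (c x) \<le> \<bar>Kc0\<bar>" by (rule Kc)
    qed (rule M_def X_def J_def Cface_def
        | (use domain \<epsilon> bc f mesh d2 s \<kappa> B C(1) D(1) L_def K_def in \<open>auto\<close>)[1])+
    show "\<forall>F\<in>interior_faces \<T>. diameter F \<le> \<kappa> * \<epsilon> \<longrightarrow>
         (\<forall>Tp\<in>face_patch \<T> F. \<forall>Tm\<in>face_patch \<T> F. Tp \<noteq> Tm \<longrightarrow>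
            eta_face_sq \<epsilon> b qh uh Tp Tm F
            \<le> C2 * (\<Sum>T\<in>face_patch \<T> F. local_error_sq p \<T> \<epsilon> b c f u Du qh uh T))"
    proof (intro ballI impI)
      fix F Tp Tm assume hF: "diameter F \<le> \<kappa> * \<epsilon>" and T: "Tp \<in> face_patch \<T> F" "Tm \<in> face_patch \<T> F" "Tp \<noteq> Tm"
      have finp: "finite (face_patch \<T> F)" using fin by (simp add: face_patch_def)
      have "err Tp + err Tm = (\<Sum>T\<in>{Tp, Tm}. err T)" using T(3) by simp
      also have "\<dots> \<le> (\<Sum>T\<in>face_patch \<T> F. err T)"
        by (rule sum_mono2[OF finp]) (use T err_nonneg in auto)
      finally have "C2 * (err Tp + err Tm) \<le> C2 * (\<Sum>T\<in>face_patch \<T> F. err T)" using C2(1) by simp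
      moreover have "Cface * (err Tp + err Tm) \<le> C2 * (err Tp + err Tm)"
        using C2(3) err_nonneg[of Tp] err_nonneg[of Tm] by (intro mult_right_mono) auto
      ultimately show "eta_face_sq \<epsilon> b qh uh Tp Tm F
            \<le> C2 * (\<Sum>T\<in>face_patch \<T> F. local_error_sq p \<T> \<epsilon> b c f u Du qh uh T)"
        using face_estimate[OF T hF] unfolding p' by linarith
    qed
    show "\<forall>T\<in>\<T>. diameter T \<le> \<kappa> * \<epsilon> \<longrightarrow>
         eta_elem_sq \<epsilon> b c f qh uh T \<le> C2 * local_error_sq p \<T> \<epsilon> b c f u Du qh uh T"
    proof (intro ballI impI)
      fix T assume T: "T \<in> \<T>" "diameter T \<le> \<kappa> * \<epsilon>"
      have "(M + 2) * err T \<le> C2 * err T" using C2(2) err_nonneg by (intro mult_right_mono)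
      then show "eta_elem_sq \<epsilon> b c f qh uh T \<le> C2 * local_error_sq p \<T> \<epsilon> b c f u Du qh uh T"
        using element_estimate[OF T] unfolding p' by linarith
    qed
  qed
qed

end
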